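(* Let $X$ be the $16$-dimensional half-spinor representation of $\mathrm{Spin}(10)$ whose weights are the vectors $(\pm\tfrac12,\pm\tfrac12,\pm\tfrac12,\pm\tfrac12,\pm\tfrac12)$ with an even number of negative coordinates, considered with the action of $G_0=\mathrm{Spin}(10)\times\mathbb C^*$ (with $\mathbb C^*$ acting by scalars); this is $\mathfrak g_1$ for $\mathfrak g$ of type $E_6$ and the simple root $\alpha_1$. For $I\subset\{1,\dots,5\}$ of even cardinality let $[I]$ be a nonzero weight vector whose weight is negative exactly in the coordinates in $I$. Then $X$ has exactly three $G_0$-orbits: $\mathcal O_0=\{0\}$, of dimension $0$; $\mathcal O_1$, with support of type $A_1$, dimension $11$, representative $[\emptyset]$; $\mathcal O_2$, with support of type $2A_1$, dimension $16$, representative $[\emptyset]+[\{1,2,3,4\}]$. The orbit closures satisfy $\overline{\mathcal O_0}\subset\overline{\mathcal O_1}\subset\overline{\mathcal O_2}=X$.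
   Context: Everything is over $\mathbb C$. The $\mathbb Z$-grading of $\mathfrak g$ of type $E_6$ attached to $\alpha_1$ (Bourbaki numbering; $\mathfrak g_i$ is spanned by root spaces of roots in which $\alpha_1$ has coefficient $i$, plus the Cartan subalgebra for $i=0$) is $\mathfrak g=\mathfrak g_{-1}\oplus\mathfrak g_0\oplus\mathfrak g_1$ with $\mathfrak g_0=\mathbb C\oplus\mathfrak{so}(10)$ and $\mathfrak g_1=X$. The support of a nonzero $e\in\mathfrak g_1$ is the following graded semisimple Lie subalgebra of $\mathfrak g$: let $H$ be a maximal torus in the normalizer of the line $\mathbb Ce$ in $G_0$, $\mathfrak t$ its Lie algebra, $\varphi$ the character of $\mathfrak t$ with $[u,e]=\varphi(u)e$; put $\mathfrak g(\mathfrak t,\varphi)_i=\{x\in\mathfrak g_i: [u,x]=i\varphi(u)x\ \forall u\in\mathfrak t\}$; the support is the derived algebra of $\bigoplus_i\mathfrak g(\mathfrak t,\varphi)_i$. Its type is its Dynkin type. *)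

theory Defs
  imports "HOL-Analysis.Analysis" "HOL-Library.Numeral_Type"
begin

section \<open>Complex Lie algebras and Dynkin types\<close>

text \<open>
  A Lie algebra is carried by a set \<open>L\<close> inside a complex vector space, so that subalgebras are
  Lie algebras in the same sense. All algebras considered below are finite-dimensional.
\<close>

locale lie_algebra = vector_space scale
  for scale :: "complex \<Rightarrow> 'a \<Rightarrow> 'a::ab_group_add" +
  fixes L :: "'a set" and br :: "'a \<Rightarrow> 'a \<Rightarrow> 'a"
  assumes subspace_L: "subspace L"
    and br_closed: "x \<in> L \<Longrightarrow> y \<in> L \<Longrightarrow> br x y \<in> L"
    and br_add_left: "x \<in> L \<Longrightarrow> y \<in> L \<Longrightarrow> z \<in> L \<Longrightarrow> br (x + y) z = br x z + br y z"
    and br_add_right: "x \<in> L \<Longrightarrow> y \<in> L \<Longrightarrow> z \<in> L \<Longrightarrow> br x (y + z) = br x y + br x z"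
    and br_scale_left: "x \<in> L \<Longrightarrow> y \<in> L \<Longrightarrow> br (scale c x) y = scale c (br x y)"
    and br_scale_right: "x \<in> L \<Longrightarrow> y \<in> L \<Longrightarrow> br x (scale c y) = scale c (br x y)"
    and br_self: "x \<in> L \<Longrightarrow> br x x = 0"
    and jacobi: "x \<in> L \<Longrightarrow> y \<in> L \<Longrightarrow> z \<in> L \<Longrightarrow>
                   br x (br y z) + br y (br z x) + br z (br x y) = 0"
begin

definition bracket_span :: "'a set \<Rightarrow> 'a set \<Rightarrow> 'a set" where
  "bracket_span A B = span {br x y | x y. x \<in> A \<and> y \<in> B}"

definition lie_ideal :: "'a set \<Rightarrow> bool" where
  "lie_ideal J \<longleftrightarrow> J \<subseteq> L \<and> subspace J \<and> (\<forall>x\<in>L. \<forall>y\<in>J. br x y \<in> J)"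

primrec derived_series :: "'a set \<Rightarrow> nat \<Rightarrow> 'a set" where
  "derived_series A 0 = A"
| "derived_series A (Suc k) = bracket_span (derived_series A k) (derived_series A k)"

primrec lower_central_series :: "'a set \<Rightarrow> nat \<Rightarrow> 'a set" where
  "lower_central_series A 0 = A"
| "lower_central_series A (Suc k) = bracket_span A (lower_central_series A k)"

definition semisimple :: bool where
  "semisimple \<longleftrightarrow> (\<forall>J. lie_ideal J \<and> (\<exists>k. derived_series J k = {0}) \<longrightarrow> J = {0})"

definition cartan_subalgebra :: "'a set \<Rightarrow> bool" where
  "cartan_subalgebra \<hh> \<longleftrightarrow>
     \<hh> \<subseteq> L \<and> subspace \<hh> \<and> (\<forall>x\<in>\<hh>. \<forall>y\<in>\<hh>. br x y \<in> \<hh>) \<and>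
     (\<exists>k. lower_central_series \<hh> k = {0}) \<and>
     {x \<in> L. \<forall>y\<in>\<hh>. br x y \<in> \<hh>} = \<hh>"

definition root_space :: "'a set \<Rightarrow> ('a \<Rightarrow> complex) \<Rightarrow> 'a set" where
  "root_space \<hh> \<alpha> = {x \<in> L. \<forall>h\<in>\<hh>. br h x = scale (\<alpha> h) x}"

text \<open>A linear form on \<open>\<hh>\<close> is represented by the function that extends it by \<open>0\<close> outside \<open>\<hh>\<close>.\<close>

definition linear_form_on :: "'a set \<Rightarrow> ('a \<Rightarrow> complex) \<Rightarrow> bool" where
  "linear_form_on \<hh> \<alpha> \<longleftrightarrow>
     (\<forall>x\<in>\<hh>. \<forall>y\<in>\<hh>. \<alpha> (x + y) = \<alpha> x + \<alpha> y) \<and>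
     (\<forall>c. \<forall>x\<in>\<hh>. \<alpha> (scale c x) = c * \<alpha> x) \<and>
     (\<forall>x. x \<notin> \<hh> \<longrightarrow> \<alpha> x = 0)"

definition roots :: "'a set \<Rightarrow> ('a \<Rightarrow> complex) set" where
  "roots \<hh> = {\<alpha>. linear_form_on \<hh> \<alpha> \<and> \<alpha> \<noteq> (\<lambda>x. 0) \<and> root_space \<hh> \<alpha> \<noteq> {0}}"

definition int_comb :: "nat \<Rightarrow> (nat \<Rightarrow> 'a \<Rightarrow> complex) \<Rightarrow> (nat \<Rightarrow> int) \<Rightarrow> 'a \<Rightarrow> complex" where
  "int_comb n \<alpha> m = (\<lambda>x. \<Sum>i=1..n. of_int (m i) * \<alpha> i x)"

definition root_base :: "'a set \<Rightarrow> nat \<Rightarrow> (nat \<Rightarrow> 'a \<Rightarrow> complex) \<Rightarrow> bool" where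
  "root_base \<hh> n \<alpha> \<longleftrightarrow>
     (\<forall>i\<in>{1..n}. \<alpha> i \<in> roots \<hh>) \<and>
     (\<forall>c. (\<forall>x\<in>\<hh>. (\<Sum>i=1..n. c i * \<alpha> i x) = 0) \<longrightarrow> (\<forall>i\<in>{1..n}. c i = 0)) \<and>
     (\<forall>\<beta>\<in>roots \<hh>. \<exists>m. \<beta> = int_comb n \<alpha> m \<and>
        ((\<forall>i\<in>{1..n}. m i \<ge> 0) \<or> (\<forall>i\<in>{1..n}. m i \<le> 0)))"

definition is_coroot :: "'a set \<Rightarrow> ('a \<Rightarrow> complex) \<Rightarrow> 'a \<Rightarrow> bool" where
  "is_coroot \<hh> \<alpha> h \<longleftrightarrow>
     h \<in> bracket_span (root_space \<hh> \<alpha>) (root_space \<hh> (\<lambda>x. - \<alpha> x)) \<and> \<alpha> h = 2"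

text \<open>
  All Dynkin diagrams needed are simply laced. Such a diagram on the nodes \<open>1..n\<close> is given by its
  set of edges; this also covers disconnected diagrams.
\<close>

definition dynkin_base :: "'a set \<Rightarrow> nat \<Rightarrow> (nat \<Rightarrow> 'a \<Rightarrow> complex) \<Rightarrow> nat set set \<Rightarrow> bool" where
  "dynkin_base \<hh> n \<alpha> E \<longleftrightarrow>
     cartan_subalgebra \<hh> \<and> root_base \<hh> n \<alpha> \<and>
     (\<forall>j\<in>{1..n}. \<exists>h. is_coroot \<hh> (\<alpha> j) h \<and>
        (\<forall>i\<in>{1..n}. \<alpha> i h = (if i = j then 2 else if {i, j} \<in> E then -1 else 0)))"

definition dynkin_type :: "nat \<Rightarrow> nat set set \<Rightarrow> bool" where
  "dynkin_type n E \<longleftrightarrow> semisimple \<and> (\<exists>\<hh> \<alpha>. dynkin_base \<hh> n \<alpha> E)"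

text \<open>
  Degree \<open>d\<close> part of the grading attached to the simple root \<open>\<alpha> k\<close>.
\<close>

definition simple_root_grading ::
  "'a set \<Rightarrow> nat \<Rightarrow> (nat \<Rightarrow> 'a \<Rightarrow> complex) \<Rightarrow> nat \<Rightarrow> int \<Rightarrow> 'a set" where
  "simple_root_grading \<hh> n \<alpha> k d =
     span ((if d = 0 then \<hh> else {}) \<union>
           \<Union>{root_space \<hh> (int_comb n \<alpha> m) | m. int_comb n \<alpha> m \<in> roots \<hh> \<and> m k = d})"

end

definition A1_edges :: "nat set set" where "A1_edges = {}"

definition twoA1_edges :: "nat set set" where "twoA1_edges = {}"

text \<open>Bourbaki numbering of the diagram of type \<open>E\<^sub>6\<close>.\<close>

definition E6_edges :: "nat set set" where
  "E6_edges = {{1, 3}, {3, 4}, {4, 5}, {5, 6}, {2, 4}}"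


section \<open>Spin(10) and the half-spinor representation\<close>

text \<open>
  The spinor space is the exterior algebra of \<open>\<complex>\<^sup>5\<close>, with coordinates indexed by the subsets of
  \<open>{1,\<dots>,5}\<close>. These are sets over the numeral type \<open>5\<close>, in which the numeral \<open>5\<close> equals \<open>0\<close> and
  is the least element; the signs below may be taken with respect to any linear order.
\<close>

type_synonym spinor = "complex ^ (5 set)"
type_synonym spinor_mat = "complex ^ (5 set) ^ (5 set)"

definition X :: "spinor set" where
  "X = {x. \<forall>I. odd (card I) \<longrightarrow> x $ I = 0}"

definition wedge :: "5 \<Rightarrow> spinor_mat" where
  "wedge i = (\<chi> I J. if i \<notin> J \<and> I = insert i J then (-1) ^ card {j \<in> J. j < i} else 0)"

definition contr :: "5 \<Rightarrow> spinor_mat" where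
  "contr i = transpose (wedge i)"

text \<open>
  \<open>\<complex>\<^sup>1\<^sup>0\<close> carries the split quadratic form \<open>quad\<close>, and \<open>gamma v ** gamma v = quad v\<close>. Hence \<open>gamma\<close>
  identifies the Clifford algebra with the algebra of all endomorphisms of the spinor space, and
  the spin group is taken inside the latter. The basis vector with index \<open>Inl i\<close> has weight
  \<open>\<epsilon>\<^sub>i\<close>, the one with index \<open>Inr i\<close> has weight \<open>-\<epsilon>\<^sub>i\<close>.
\<close>

definition quad :: "complex ^ (5 + 5) \<Rightarrow> complex" where
  "quad v = (\<Sum>i\<in>UNIV. v $ Inl i * v $ Inr i)"

definition gamma :: "complex ^ (5 + 5) \<Rightarrow> spinor_mat" where
  "gamma v = (\<chi> I J. \<Sum>i\<in>UNIV. v $ Inl i * contr i $ I $ J + v $ Inr i * wedge i $ I $ J)"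

definition Spin10 :: "spinor_mat set" where
  "Spin10 = {foldr (\<lambda>v M. gamma v ** M) vs (mat 1) | vs.
               even (length vs) \<and> (\<forall>v\<in>set vs. quad v = 1)}"

definition G0 :: "(spinor_mat \<times> complex) set" where
  "G0 = Spin10 \<times> (UNIV - {0})"

fun G0_mult :: "spinor_mat \<times> complex \<Rightarrow> spinor_mat \<times> complex \<Rightarrow> spinor_mat \<times> complex" where
  "G0_mult (s, c) (s', c') = (s ** s', c * c')"

fun G0_act :: "spinor_mat \<times> complex \<Rightarrow> spinor \<Rightarrow> spinor" where
  "G0_act (s, c) x = c *s (s *v x)"

definition orbit :: "spinor \<Rightarrow> spinor set" where
  "orbit x = {G0_act g x | g. g \<in> G0}"

text \<open>The Lie algebra of \<open>Spin(10)\<close> is spanned by the \<open>spin_gen v w\<close>.\<close>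

definition spin_gen :: "complex ^ (5 + 5) \<Rightarrow> complex ^ (5 + 5) \<Rightarrow> spinor_mat" where
  "spin_gen v w = (\<chi> I J. (gamma v ** gamma w - gamma w ** gamma v) $ I $ J / 2)"

text \<open>
  The elements \<open>spin_cartan i\<close> form the basis of a Cartan subalgebra of \<open>\<ss>\<oo>(10)\<close> dual to
  \<open>\<epsilon>\<^sub>1, \<dots>, \<epsilon>\<^sub>5\<close>: the \<open>i\<close>-th coordinate of a weight is its value on \<open>spin_cartan i\<close>.
\<close>

definition spin_cartan :: "5 \<Rightarrow> spinor_mat" where
  "spin_cartan i = spin_gen (axis (Inl i) 1) (axis (Inr i) 1)"

definition weight_vector :: "5 set \<Rightarrow> spinor \<Rightarrow> bool" where
  "weight_vector I x \<longleftrightarrow>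
     x \<in> X \<and> x \<noteq> 0 \<and> (\<forall>i. spin_cartan i *v x = (if i \<in> I then - 1 / 2 else 1 / 2) *s x)"


section \<open>The graded Lie algebra of type E6\<close>

text \<open>
  A triple \<open>(\<xi>, u, x)\<close> has components in degrees \<open>-1\<close>, \<open>0\<close>, \<open>1\<close>. The degree \<open>-1\<close> part is the dual of
  \<open>X\<close>, where \<open>\<xi>\<close> stands for the linear form \<open>pairing \<xi>\<close>; the degree \<open>0\<close> part consists of the pairs
  \<open>(A, c)\<close> with \<open>A\<close> in \<open>\<ss>\<oo>(10)\<close>, acting on \<open>X\<close> as \<open>A + c\<close>.
\<close>

type_synonym e6_vec = "spinor \<times> (spinor_mat \<times> complex) \<times> spinor"

fun e6_scale :: "complex \<Rightarrow> e6_vec \<Rightarrow> e6_vec" where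
  "e6_scale k (\<xi>, (A, c), x) = (k *s \<xi>, (\<chi> I. k *s A $ I, k * c), k *s x)"

definition pairing :: "spinor \<Rightarrow> spinor \<Rightarrow> complex" where
  "pairing \<xi> x = (\<Sum>I\<in>UNIV. \<xi> $ I * x $ I)"

text \<open>
  The bracket of \<open>x\<close> in degree \<open>1\<close> and \<open>\<xi>\<close> in degree \<open>-1\<close> is, up to a common factor, the only
  element \<open>[x, \<xi>]\<close> of degree \<open>0\<close> with \<open>\<kappa>([x, \<xi>], u) = \<xi>(u x)\<close> for all \<open>u\<close> of degree \<open>0\<close>, where
  \<open>\<kappa>((A, c), (B, d)) = 3 tr\<^sub>X(A B) + 16 c d\<close> is proportional to the Killing form of \<open>E\<^sub>6\<close>.
  In \<open>moment\<close> it is written out in the basis vectors \<open>axis p 1\<close> of \<open>\<complex>\<^sup>1\<^sup>0\<close>, where \<open>dual_index\<close>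
  gives the dual basis up to the factor \<open>2\<close>. The common factor is chosen such that the bracket of
  \<open>axis I 1\<close> with its dual basis vector is a coroot.
\<close>

definition dual_index :: "5 + 5 \<Rightarrow> 5 + 5" where
  "dual_index = case_sum Inr Inl"

definition moment :: "spinor \<Rightarrow> spinor \<Rightarrow> spinor_mat \<times> complex" where
  "moment x \<xi> =
     (\<chi> I J. - (\<Sum>p\<in>UNIV. \<Sum>q\<in>UNIV.
         pairing \<xi> (spin_gen (axis p 1) (axis q 1) *v x) *
         spin_gen (axis (dual_index p) 1) (axis (dual_index q) 1) $ I $ J) / 2,
      3 / 4 * pairing \<xi> x)"

fun e6_br :: "e6_vec \<Rightarrow> e6_vec \<Rightarrow> e6_vec" where
  "e6_br (\<xi>, (A, c), x) (\<eta>, (B, d), y) =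
     ((transpose B *v \<xi> + d *s \<xi>) - (transpose A *v \<eta> + c *s \<eta>),
      (A ** B - B ** A, 0) + moment x \<eta> - moment y \<xi>,
      (A *v y + c *s y) - (B *v x + d *s x))"

definition deg0 :: "spinor_mat \<times> complex \<Rightarrow> e6_vec" where
  "deg0 u = (0, u, 0)"

definition deg1 :: "spinor \<Rightarrow> e6_vec" where
  "deg1 x = (0, 0, x)"

definition e6_deg :: "int \<Rightarrow> e6_vec set" where
  "e6_deg i =
     (if i = -1 then {(\<xi>, 0, 0) | \<xi>. \<xi> \<in> X}
      else if i = 0 then
        module.span e6_scale ({deg0 (spin_gen v w, 0) | v w. True} \<union> {deg0 (0, 1)})
      else if i = 1 then deg1 ` X
      else {0})"

definition e6 :: "e6_vec set" where
  "e6 = module.span e6_scale (\<Union>i. e6_deg i)"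


section \<open>Tori and supports\<close>

text \<open>
  \<open>torus_points r\<close> is the group \<open>(\<complex>\<^sup>*)\<^sup>r\<close> under pointwise multiplication; the coordinates from \<open>r\<close>
  on are fixed to \<open>1\<close>. Its regular functions are the Laurent polynomials.
\<close>

definition torus_points :: "nat \<Rightarrow> (nat \<Rightarrow> complex) set" where
  "torus_points r = {s. (\<forall>i<r. s i \<noteq> 0) \<and> (\<forall>i\<ge>r. s i = 1)}"

definition laurent_on_torus :: "nat \<Rightarrow> ((nat \<Rightarrow> complex) \<Rightarrow> complex) \<Rightarrow> bool" where
  "laurent_on_torus r f \<longleftrightarrow>
     (\<exists>(M :: (nat \<Rightarrow> int) set) a. finite M \<and>
        (\<forall>s\<in>torus_points r. f s = (\<Sum>m\<in>M. a m * (\<Prod>i<r. s i powi m i))))"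

text \<open>
  An algebraic torus is an algebraic group isomorphic to some \<open>(\<complex>\<^sup>*)\<^sup>r\<close>; in characteristic \<open>0\<close> a
  bijective homomorphism of algebraic groups is an isomorphism.
\<close>

definition algebraic_torus :: "(spinor_mat \<times> complex) set \<Rightarrow> bool" where
  "algebraic_torus H \<longleftrightarrow>
     (\<exists>r \<rho>. bij_betw \<rho> (torus_points r) H \<and>
        (\<forall>s\<in>torus_points r. \<forall>t\<in>torus_points r.
           \<rho> (\<lambda>i. s i * t i) = G0_mult (\<rho> s) (\<rho> t)) \<and>
        \<rho> (\<lambda>i. 1) = (mat 1, 1) \<and>
        (\<forall>I J. laurent_on_torus r (\<lambda>s. fst (\<rho> s) $ I $ J)) \<and>
        laurent_on_torus r (\<lambda>s. snd (\<rho> s)))"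

definition maximal_torus_in ::
  "(spinor_mat \<times> complex) set \<Rightarrow> (spinor_mat \<times> complex) set \<Rightarrow> bool" where
  "maximal_torus_in H N \<longleftrightarrow>
     algebraic_torus H \<and> H \<subseteq> N \<and> (\<forall>H'. algebraic_torus H' \<and> H \<subseteq> H' \<and> H' \<subseteq> N \<longrightarrow> H' = H)"

definition line_normalizer :: "spinor \<Rightarrow> (spinor_mat \<times> complex) set" where
  "line_normalizer e = {g \<in> G0. G0_act g ` range (\<lambda>k. k *s e) = range (\<lambda>k. k *s e)}"

text \<open>The Lie algebra of a closed subgroup is its tangent space at the identity.\<close>

definition lie_of_group :: "(spinor_mat \<times> complex) set \<Rightarrow> (spinor_mat \<times> complex) set" where
  "lie_of_group H = {u. \<exists>c :: real \<Rightarrow> spinor_mat \<times> complex.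
      (\<forall>\<tau>. c \<tau> \<in> H) \<and> c 0 = (mat 1, 1) \<and> (c has_vector_derivative u) (at 0)}"

definition e6_centralizer_deg ::
  "(spinor_mat \<times> complex) set \<Rightarrow> (spinor_mat \<times> complex \<Rightarrow> complex) \<Rightarrow> int \<Rightarrow> e6_vec set" where
  "e6_centralizer_deg \<tt> \<phi> i =
     {x \<in> e6_deg i. \<forall>u\<in>\<tt>. e6_br (deg0 u) x = e6_scale (of_int i * \<phi> u) x}"

definition e6_centralizer ::
  "(spinor_mat \<times> complex) set \<Rightarrow> (spinor_mat \<times> complex \<Rightarrow> complex) \<Rightarrow> e6_vec set" where
  "e6_centralizer \<tt> \<phi> = module.span e6_scale (\<Union>i. e6_centralizer_deg \<tt> \<phi> i)"

definition is_support :: "spinor \<Rightarrow> e6_vec set \<Rightarrow> bool" where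
  "is_support e S \<longleftrightarrow>
     (\<exists>H \<phi>. maximal_torus_in H (line_normalizer e) \<and>
        (\<forall>u\<in>lie_of_group H. e6_br (deg0 u) (deg1 e) = e6_scale (\<phi> u) (deg1 e)) \<and>
        S = lie_algebra.bracket_span e6_scale e6_br
              (e6_centralizer (lie_of_group H) \<phi>) (e6_centralizer (lie_of_group H) \<phi>))"

text \<open>The type does not depend on the choice of the maximal torus.\<close>

definition support_type :: "spinor \<Rightarrow> nat \<Rightarrow> nat set set \<Rightarrow> bool" where
  "support_type e n E \<longleftrightarrow>
     (\<exists>S. is_support e S) \<and>
     (\<forall>S. is_support e S \<longrightarrow>
        lie_algebra e6_scale S e6_br \<and> lie_algebra.dynkin_type e6_scale S e6_br n E)"


section \<open>Dimension and closure\<close>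

definition holomorphic_map_on :: "(complex ^ 'n \<Rightarrow> complex ^ 'n) \<Rightarrow> (complex ^ 'n) set \<Rightarrow> bool" where
  "holomorphic_map_on f U \<longleftrightarrow>
     (\<forall>x\<in>U. \<exists>D. (f has_derivative D) (at x) \<and> (\<forall>k v. D (k *s v) = k *s D v))"

text \<open>
  An orbit of an algebraic group is a smooth, locally closed subvariety; its dimension is the
  dimension of the underlying (embedded) complex submanifold.
\<close>

definition complex_submanifold_of_dim :: "nat \<Rightarrow> (complex ^ 'n) set \<Rightarrow> bool" where
  "complex_submanifold_of_dim d M \<longleftrightarrow>
     (\<forall>p\<in>M. \<exists>U f g K. open U \<and> p \<in> U \<and> open (f ` U) \<and>
        holomorphic_map_on f U \<and> holomorphic_map_on g (f ` U) \<and> (\<forall>x\<in>U. g (f x) = x) \<and>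
        vec.subspace K \<and> vec.dim K = d \<and> f ` (M \<inter> U) = f ` U \<inter> K)"

inductive polynomial_fun :: "(complex ^ 'n \<Rightarrow> complex) \<Rightarrow> bool" where
  const: "polynomial_fun (\<lambda>x. k)"
| coord: "polynomial_fun (\<lambda>x. x $ i)"
| add: "polynomial_fun p \<Longrightarrow> polynomial_fun q \<Longrightarrow> polynomial_fun (\<lambda>x. p x + q x)"
| mult: "polynomial_fun p \<Longrightarrow> polynomial_fun q \<Longrightarrow> polynomial_fun (\<lambda>x. p x * q x)"

definition zariski_closure :: "(complex ^ 'n) set \<Rightarrow> (complex ^ 'n) set" where
  "zariski_closure S = {x. \<forall>p. polynomial_fun p \<and> (\<forall>y\<in>S. p y = 0) \<longrightarrow> p x = 0}"

end

theory Submission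
  imports Defs
begin

text \<open>The action of reflections and of
  products of two isotropic vectors brings a nonzero spinor, together with any set of diagonal
  elements for which it is an eigenvector, to \<open>k [\<emptyset>]\<close> or \<open>k [\<emptyset>] + l [I]\<close> with \<open>I\<close> of size \<open>4\<close>. The
  two forms are separated by the quadrics \<open>x \<mapsto> \<langle>x, \<gamma>(v) x\<rangle>\<close>, which vanish exactly on the smaller
  orbit and \<open>0\<close>; solving them for five of the coordinates gives the chart of dimension \<open>11\<close>, while
  the other orbit contains all points of \<open>X\<close> near its representative.

  A torus acts on the vector representation through characters. A weight vector of nontrivial
  character is isotropic and pairs with one of the inverse character, so hyperbolic pairs of weight
  vectors can be split off one at a time, each being moved to a standard pair; thus every torus is conjugate
  to a diagonal one. Hence a maximal torus of the normalizer of a line is conjugate to the group of all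
  diagonal elements that normalize one of the two standard lines. The centralizer of its Lie algebra
  is the Cartan subalgebra together with the root vectors of \<open>\<plusminus>\<close> the weights of the normal form; these
  weights are orthogonal as roots, so the derived algebra is a sum of copies of \<open>\<ss>\<ll>(2)\<close>.

  The Jacobi identity of \<open>E\<^sub>6\<close> reduces to a quadratic relation for the Casimir operator of \<open>\<ss>\<oo>(10)\<close> on
  \<open>X \<otimes> X\<close>.\<close>

section \<open>Clifford operators on spinors\<close>

text \<open>For two elements of degree 1 and one of degree -1 the Jacobi identity says that
  \<open>[x, \<xi>] y\<close> is symmetric in \<open>x\<close> and \<open>y\<close>. In terms of the
  operator \<open>Om\<close> on tensors, the antisymmetric part is \<open>2 - Om^2 / 2\<close>
  applied to an alternating tensor, where 2 = 5/4 + 3/4 uses the scalar part of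
  \<open>moment\<close>; so \<open>Om^2 = 4\<close> is needed there. It can be checked by hand,
  because \<open>Om^2\<close> couples only entries whose two indices have a given symmetric
  difference, of size 0, 2 or 4.

  The type of a support is asserted for every maximal torus, while the group is only a set of
  products of Clifford vectors. Conjugacy is therefore made explicit. A diagonalised torus ends up
  inside a standard torus, which itself normalizes the line, so maximality turns inclusion into
  equality. Conversely, a standard torus is maximal because it contains an element with ten distinct
  weights on the vector representation.

  One interpolation argument, \<open>weight_multiplier\<close>, yields the eigenspace decompositions
  for Lie algebras and tori alike.\<close>

lemma exhaust_5: "(x::5) = 0 \<or> x = 1 \<or> x = 2 \<or> x = 3 \<or> x = 4"
proof (induct x)
  case (of_int z)
  then have "z = 0 \<or> z = 1 \<or> z = 2 \<or> z = 3 \<or> z = 4" by fastforce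
  then show ?case by auto
qed

lemma UNIV_5: "(UNIV :: 5 set) = {0, 1, 2, 3, 4}"
  using exhaust_5 by auto

lemma sum_5: "sum f (UNIV :: 5 set) = f 0 + f 1 + f 2 + f 3 + f 4"
  unfolding UNIV_5 by (simp add: add.assoc)

lemma prod_5: "prod f (UNIV :: 5 set) = f 0 * f 1 * f 2 * f 3 * f 4"
  unfolding UNIV_5 by (simp add: mult.assoc)

lemma sum_UNIV_Plus:
  "(\<Sum>p\<in>(UNIV :: ('m::finite + 'n::finite) set). f p) = (\<Sum>i\<in>UNIV. f (Inl i)) + (\<Sum>i\<in>UNIV. f (Inr i))"
  by (subst UNIV_Plus_UNIV[symmetric], subst sum.Plus) simp_all

text \<open>The sign carried by \<open>wedge i\<close> and \<open>contr i\<close>. Only elements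
  below \<open>i\<close> are counted, so it does not change when \<open>i\<close> itself is added or
  removed, and it may be read off at the row or at the column index.\<close>

definition sg :: "5 \<Rightarrow> 5 set \<Rightarrow> complex" where
  "sg i I = (- 1) ^ card {j \<in> I. j < i}"

lemma sg_sq [simp]: "sg i I * sg i I = 1"
  by (cases "even (card {j \<in> I. j < i})") (simp_all add: sg_def)

lemma sg_sq' [simp]: "sg i I * (sg i I * z) = z"
  by (metis sg_sq mult.assoc mult_1)

lemma sg_nz [simp]: "sg i I \<noteq> 0"
  by (simp add: sg_def)

lemma sg_insert: "j \<notin> I \<Longrightarrow> sg i (insert j I) = (if j < i then - sg i I else sg i I)"
proof -
  assume "j \<notin> I"
  then have "{k \<in> insert j I. k < i} = (if j < i then insert j {k \<in> I. k < i} else {k \<in> I. k < i})"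
    by auto
  then show ?thesis using \<open>j \<notin> I\<close> by (simp add: sg_def)
qed

lemma sg_remove: "j \<in> I \<Longrightarrow> sg i (I - {j}) = (if j < i then - sg i I else sg i I)"
  using sg_insert[of j "I - {j}" i] by (auto simp: insert_absorb)

lemma wedge_mv: "wedge i *v x = (\<chi> I. if i \<in> I then sg i I * x $ (I - {i}) else 0)"
proof (subst vec_eq_iff, intro allI)
  fix I
  have "(wedge i *v x) $ I = (\<Sum>J\<in>UNIV. if J = I - {i} then (if i \<in> I then sg i I * x $ J else 0) else 0)"
    unfolding matrix_vector_mult_def wedge_def vec_lambda_beta
  proof (rule sum.cong)
    fix J
    have "{j. (j = i \<or> j \<in> J) \<and> j < i} = {j \<in> J. j < i}" by auto
    then show "(if i \<notin> J \<and> I = insert i J then (- 1) ^ card {j \<in> J. j < i} else 0) * x $ J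
       = (if J = I - {i} then if i \<in> I then sg i I * x $ J else 0 else 0)"
      by (auto simp: sg_def)
  qed (rule refl)
  then show "(wedge i *v x) $ I = (\<chi> I. if i \<in> I then sg i I * x $ (I - {i}) else 0) $ I"
    by simp
qed

lemma contr_mv: "contr i *v x = (\<chi> I. if i \<notin> I then sg i I * x $ (insert i I) else 0)"
proof (subst vec_eq_iff, intro allI)
  fix I
  have "(contr i *v x) $ I = (\<Sum>J\<in>UNIV. if J = insert i I then (if i \<notin> I then sg i I * x $ J else 0) else 0)"
    unfolding matrix_vector_mult_def wedge_def contr_def transpose_def vec_lambda_beta
    by (rule sum.cong) (auto simp: sg_def)
  then show "(contr i *v x) $ I = (\<chi> I. if i \<notin> I then sg i I * x $ (insert i I) else 0) $ I"
    by simp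
qed

lemma wedge_anticomm: "wedge i *v (wedge j *v x) + wedge j *v (wedge i *v x) = 0"
proof (cases "i = j")
  case True then show ?thesis by (simp add: wedge_mv vec_eq_iff)
next
  case False
  have D: "I - {j} - {i} = I - {i} - {j}" for I by blast
  have N: "(j < i) = (\<not> i < j)" using False by auto
  have "(wedge i *v (wedge j *v x) + wedge j *v (wedge i *v x)) $ I = 0" for I
    using False by (cases "i \<in> I"; cases "j \<in> I") (simp_all add: wedge_mv sg_remove D N)
  then show ?thesis by (simp add: vec_eq_iff)
qed

lemma contr_anticomm: "contr i *v (contr j *v x) + contr j *v (contr i *v x) = 0"
proof (cases "i = j")
  case True then show ?thesis by (simp add: contr_mv vec_eq_iff)
next
  case False
  have D: "insert j (insert i I) = insert i (insert j I)" for I by blast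
  have N: "(j < i) = (\<not> i < j)" using False by auto
  have "(contr i *v (contr j *v x) + contr j *v (contr i *v x)) $ I = 0" for I
    using False by (cases "i \<in> I"; cases "j \<in> I") (simp_all add: contr_mv sg_insert D N)
  then show ?thesis by (simp add: vec_eq_iff)
qed

lemma contr_wedge_anticomm:
  "contr i *v (wedge j *v x) + wedge j *v (contr i *v x) = (if i = j then x else 0)"
proof (cases "i = j")
  case True then show ?thesis
    by (auto simp: wedge_mv contr_mv vec_eq_iff sg_insert sg_remove insert_absorb)
next
  case False
  have D: "insert i (I - {j}) = insert i I - {j}" for I using False by auto
  have N: "(j < i) = (\<not> i < j)" using False by auto
  have "(contr i *v (wedge j *v x) + wedge j *v (contr i *v x)) $ I = 0" for I
    using False by (cases "i \<in> I"; cases "j \<in> I") (simp_all add: wedge_mv contr_mv sg_insert sg_remove D N)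
  then show ?thesis using False by (simp add: vec_eq_iff)
qed

subsection \<open>The Clifford relation\<close>

text \<open>Multiplication by a complex scalar, in the form in which it occurs in
  \<open>e6_scale\<close>.\<close>

definition cmat :: "complex \<Rightarrow> complex ^ 'n ^ 'm \<Rightarrow> complex ^ 'n ^ 'm" where
  "cmat k A = (\<chi> I. k *s A $ I)"

lemma cmat_mv [simp]: "cmat k A *v x = k *s (A *v x)"
  by (simp add: cmat_def matrix_vector_mult_def vec_eq_iff sum_distrib_left mult.assoc)

lemma sum_mv: "(\<Sum>i\<in>S. A i) *v x = (\<Sum>i\<in>S. A i *v (x :: complex ^ 'n))"
  by (induction S rule: infinite_finite_induct) (simp_all add: matrix_vector_mult_add_rdistrib)

lemma mv_sum: "(A :: complex ^ 'n ^ 'm) *v (\<Sum>i\<in>S. x i) = (\<Sum>i\<in>S. A *v x i)"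
  by (induction S rule: infinite_finite_induct) (simp_all add: matrix_vector_right_distrib)

lemma gamma_mv:
  "gamma v *v x = (\<Sum>i\<in>UNIV. v $ Inl i *s (contr i *v x) + v $ Inr i *s (wedge i *v x))"
proof -
  have "gamma v = (\<Sum>i\<in>UNIV. cmat (v $ Inl i) (contr i) + cmat (v $ Inr i) (wedge i))"
    by (simp add: gamma_def cmat_def vec_eq_iff)
  then show ?thesis by (simp add: sum_mv matrix_vector_mult_add_rdistrib)
qed

text \<open>The polar form without a factor 1/2: it is exactly the anticommutator of two Clifford
  vectors, and \<open>polar v v\<close> is twice \<open>quad v\<close>.\<close>

definition polar :: "complex ^ (5 + 5) \<Rightarrow> complex ^ (5 + 5) \<Rightarrow> complex" where
  "polar v w = (\<Sum>i\<in>UNIV. v $ Inl i * w $ Inr i + v $ Inr i * w $ Inl i)"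

lemma polar_add_left: "polar (u + v) w = polar u w + polar v w"
  by (simp add: polar_def algebra_simps sum.distrib)
lemma polar_add_right: "polar u (v + w) = polar u v + polar u w"
  by (simp add: polar_def algebra_simps sum.distrib)
lemma polar_scale_left: "polar (c *s v) w = c * polar v w"
  by (simp add: polar_def algebra_simps sum_distrib_left)
lemma polar_scale_right: "polar v (c *s w) = c * polar v w"
  by (simp add: polar_def algebra_simps sum_distrib_left)
lemma polar_commute: "polar v w = polar w v"
  by (simp add: polar_def algebra_simps)
lemma polar_diff_left: "polar (u - v) w = polar u w - polar v w"
  by (simp add: polar_def algebra_simps sum.distrib sum_subtractf)
lemma polar_diff_right: "polar u (v - w) = polar u v - polar u w"
  by (simp add: polar_def algebra_simps sum.distrib sum_subtractf)
lemma polar_minus_left: "polar (- v) w = - polar v w"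
  using polar_diff_left[of 0 v w] by (simp add: polar_def)
lemma polar_minus_right: "polar v (- w) = - polar v w"
  using polar_diff_right[of v 0 w] by (simp add: polar_def)
lemma polar_zero [simp]: "polar 0 w = 0" "polar w 0 = 0"
  by (simp_all add: polar_def)

lemmas polar_simps = polar_add_left polar_add_right polar_scale_left polar_scale_right
  polar_diff_left polar_diff_right polar_minus_left polar_minus_right

lemma polar_self: "polar v v = 2 * quad v"
  by (simp add: polar_def quad_def sum_distrib_left algebra_simps)

lemma quad_add: "quad (v + w) = quad v + quad w + polar v w"
  by (simp add: polar_def quad_def sum.distrib algebra_simps)
lemma quad_scale: "quad (c *s v) = c\<^sup>2 * quad v"
  by (simp add: quad_def sum_distrib_left algebra_simps power2_eq_square)
lemma quad_minus [simp]: "quad (- v) = quad v"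
  by (simp add: quad_def)
lemma quad_diff: "quad (v - w) = quad v + quad w - polar v w"
  using quad_add[of v "- w"] by (simp add: polar_simps)

lemma polar_axis: "polar v (axis p 1) = v $ dual_index p"
  unfolding polar_def dual_index_def
  by (cases p) (simp_all add: axis_def if_distrib[of "\<lambda>z. _ * z"] sum.distrib cong: if_cong)

lemma dual_index_simps [simp]: "dual_index (Inl i) = Inr i" "dual_index (Inr i) = Inl i"
  "dual_index (dual_index p) = p"
  by (auto simp: dual_index_def split: sum.split)

lemma dual_index_eq [simp]: "dual_index p = dual_index q \<longleftrightarrow> p = q"
  by (metis dual_index_simps(3))

lemma dual_index_neq [simp]: "dual_index p \<noteq> p"
  by (cases p) auto

lemma bij_dual_index: "bij dual_index"
  by (metis bijI' dual_index_simps(3) dual_index_eq)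

lemma quad_axis [simp]: "quad (axis p 1) = 0"
  by (cases p) (auto simp: quad_def axis_def intro!: sum.neutral)

lemma polar_axis_axis: "polar (axis p 1) (axis q 1) = (if q = dual_index p then 1 else 0)"
proof -
  have "dual_index q = p \<longleftrightarrow> q = dual_index p" by (metis dual_index_simps(3))
  then show ?thesis unfolding polar_axis by (simp add: axis_def)
qed

text \<open>Both products are expanded over the same pairs of indices; within a pair the three
  anticommutation rules cancel everything except the mixed terms with \<open>i = j\<close>.\<close>

lemma gamma_anticomm:
  "gamma v *v (gamma w *v x) + gamma w *v (gamma v *v x) = polar v w *s x"
proof -
  have C: "contr i *v (contr j *v x) = - (contr j *v (contr i *v x))"
    and W: "wedge i *v (wedge j *v x) = - (wedge j *v (wedge i *v x))"
    and CW: "contr i *v (wedge j *v x) = (if i = j then x else 0) - wedge j *v (contr i *v x)" for i j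
    using contr_anticomm[of i j x] wedge_anticomm[of i j x] contr_wedge_anticomm[of i j x]
    by (auto simp: add_eq_0_iff2 algebra_simps)
  have E: "gamma v *v (gamma w *v x) = (\<Sum>i\<in>UNIV. \<Sum>j\<in>UNIV.
      (v $ Inl i * w $ Inl j) *s (contr i *v (contr j *v x)) + (v $ Inl i * w $ Inr j) *s (contr i *v (wedge j *v x))
    + (v $ Inr i * w $ Inl j) *s (wedge i *v (contr j *v x)) + (v $ Inr i * w $ Inr j) *s (wedge i *v (wedge j *v x)))"
    for v w
    unfolding gamma_mv by (simp add: mv_sum matrix_vector_right_distrib vector_scalar_commute
        sum.distrib vec.scale_sum_right vec.scale_right_distrib vec.scale_scale algebra_simps)
  \<comment> \<open>The two summations are exchanged so that each term meets its counterpart in the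
    first product under the same \<open>i\<close> and \<open>j\<close>.\<close>
  have E2: "gamma w *v (gamma v *v x) = (\<Sum>i\<in>UNIV. \<Sum>j\<in>UNIV.
      (w $ Inl j * v $ Inl i) *s (contr j *v (contr i *v x)) + (w $ Inl j * v $ Inr i) *s (contr j *v (wedge i *v x))
    + (w $ Inr j * v $ Inl i) *s (wedge j *v (contr i *v x)) + (w $ Inr j * v $ Inr i) *s (wedge j *v (wedge i *v x)))"
    unfolding E by (rule sum.swap)
  have "gamma v *v (gamma w *v x) + gamma w *v (gamma v *v x) =
     (\<Sum>i\<in>UNIV. \<Sum>j\<in>UNIV. (if i = j then (v $ Inl i * w $ Inr j + v $ Inr i * w $ Inl j) *s x else 0))"
    unfolding E[of v w] E2 sum.distrib[symmetric]
  proof (intro sum.cong refl)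
    fix i j
    show "(v $ Inl i * w $ Inl j) *s (contr i *v (contr j *v x)) + (v $ Inl i * w $ Inr j) *s (contr i *v (wedge j *v x))
    + (v $ Inr i * w $ Inl j) *s (wedge i *v (contr j *v x)) + (v $ Inr i * w $ Inr j) *s (wedge i *v (wedge j *v x))
    + ((w $ Inl j * v $ Inl i) *s (contr j *v (contr i *v x)) + (w $ Inl j * v $ Inr i) *s (contr j *v (wedge i *v x))
    + (w $ Inr j * v $ Inl i) *s (wedge j *v (contr i *v x)) + (w $ Inr j * v $ Inr i) *s (wedge j *v (wedge i *v x)))
    = (if i = j then (v $ Inl i * w $ Inr j + v $ Inr i * w $ Inl j) *s x else 0)"
      unfolding C[of i j] W[of i j] CW[of i j] CW[of j i]
      by (simp add: vec_eq_iff algebra_simps)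
  qed
  also have "\<dots> = polar v w *s x"
    by (simp add: polar_def vec.scale_sum_left)
  finally show ?thesis .
qed

lemma gamma_sq: "gamma v *v (gamma v *v x) = quad v *s x"
proof -
  have "2 *s (gamma v *v (gamma v *v x)) = 2 *s (quad v *s x)"
    using gamma_anticomm[of v v x] by (simp add: polar_self vec_eq_iff)
  then show ?thesis by (simp add: vec_eq_iff)
qed

lemma gamma_add: "gamma (v + w) = gamma v + gamma w"
  by (simp add: gamma_def vec_eq_iff sum.distrib algebra_simps)
lemma gamma_scale: "gamma (c *s v) = cmat c (gamma v)"
  by (simp add: gamma_def vec_eq_iff cmat_def sum.distrib algebra_simps sum_distrib_left)
lemma gamma_zero [simp]: "gamma 0 = 0"
  by (simp add: gamma_def vec_eq_iff)
lemma gamma_minus: "gamma (- v) = - gamma v"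
  by (simp add: gamma_def vec_eq_iff sum_negf[symmetric])
lemma gamma_diff: "gamma (v - w) = gamma v - gamma w"
  using gamma_add[of v "- w"] by (simp add: gamma_minus)
lemma gamma_sum: "gamma (\<Sum>i\<in>S. f i) = (\<Sum>i\<in>S. gamma (f i))"
  by (induction S rule: infinite_finite_induct) (simp_all add: gamma_add)

lemmas gamma_linear = gamma_add gamma_scale gamma_minus gamma_diff

lemma gamma_axis: "gamma (axis (Inl i) 1) = contr i" "gamma (axis (Inr i) 1) = wedge i"
  by (auto simp: matrix_eq gamma_mv axis_def if_distrib[of "\<lambda>z. z *s _"] cong: if_cong)

text \<open>Exchange of the two isotropic halves. Under \<open>gamma\<close> it becomes
  transposition, so it governs the action on dual spinors.\<close>

definition dualv :: "complex ^ (5 + 5) \<Rightarrow> complex ^ (5 + 5)" where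
  "dualv v = (\<chi> p. v $ dual_index p)"

lemma quad_dualv [simp]: "quad (dualv v) = quad v"
  by (simp add: dualv_def quad_def mult.commute)
lemma dualv_axis [simp]: "dualv (axis p 1) = axis (dual_index p) 1"
  by (simp add: dualv_def vec_eq_iff axis_def) (metis dual_index_simps(3))

lemma transpose_gamma: "transpose (gamma v) = gamma (dualv v)"
  by (simp add: gamma_def transpose_def vec_eq_iff dualv_def contr_def add.commute)

text \<open>The entries joining \<open>{}\<close> and the singletons already determine
  \<open>v\<close>; this makes \<open>gamma\<close> injective.\<close>

lemma gamma_coords: "v $ Inl i = gamma v $ {} $ {i}" "v $ Inr i = gamma v $ {i} $ {}"
proof -
  have "contr j $ {} $ {i} = (if j = i then 1 else 0)" "wedge j $ {} $ {i} = 0"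
    "wedge j $ {i} $ {} = (if j = i then 1 else 0)" "contr j $ {i} $ {} = 0" for j
    by (auto simp: contr_def wedge_def transpose_def)
  then show "v $ Inl i = gamma v $ {} $ {i}" "v $ Inr i = gamma v $ {i} $ {}"
    by (simp_all add: gamma_def if_distrib[of "\<lambda>z. _ * z"] cong: if_cong del: if_split)
qed

lemma gamma_eq_iff [simp]: "gamma v = gamma w \<longleftrightarrow> v = w"
  by (metis gamma_coords vec_eq_iff sum.exhaust)

lemma gamma_vector_expand: "gamma v = (\<Sum>p\<in>UNIV. cmat (v $ p) (gamma (axis p 1)))"
proof -
  have "gamma v *v x = (\<Sum>p\<in>UNIV. cmat (v $ p) (gamma (axis p 1))) *v x" for x
    by (simp add: sum_UNIV_Plus sum_mv matrix_vector_mult_add_rdistrib gamma_axis gamma_mv sum.distrib)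
  then show ?thesis by (simp add: matrix_eq)
qed

declare transpose_matrix_vector [simp del]

lemma vec_scale_cancel: "c *s (x :: complex ^ 'n) = c *s y \<Longrightarrow> c \<noteq> 0 \<Longrightarrow> x = y"
  by (simp add: vec_eq_iff)

section \<open>The bilinear pairing of spinors\<close>

lemma pairing_add_left: "pairing (\<xi> + \<eta>) x = pairing \<xi> x + pairing \<eta> x"
  by (simp add: pairing_def algebra_simps sum.distrib)
lemma pairing_add_right: "pairing \<xi> (x + y) = pairing \<xi> x + pairing \<xi> y"
  by (simp add: pairing_def algebra_simps sum.distrib)
lemma pairing_scale_left: "pairing (c *s \<xi>) x = c * pairing \<xi> x"
  by (simp add: pairing_def algebra_simps sum_distrib_left)
lemma pairing_scale_right: "pairing \<xi> (c *s x) = c * pairing \<xi> x"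
  by (simp add: pairing_def algebra_simps sum_distrib_left)
lemma pairing_diff_left: "pairing (\<xi> - \<eta>) x = pairing \<xi> x - pairing \<eta> x"
  by (simp add: pairing_def algebra_simps sum_subtractf)
lemma pairing_diff_right: "pairing \<xi> (x - y) = pairing \<xi> x - pairing \<xi> y"
  by (simp add: pairing_def algebra_simps sum_subtractf)
lemma pairing_zero [simp]: "pairing 0 x = 0" "pairing \<xi> 0 = 0"
  by (simp_all add: pairing_def)
lemma pairing_commute: "pairing x y = pairing y x"
  by (simp add: pairing_def mult.commute)
lemma pairing_sum_right: "pairing x (\<Sum>i\<in>S. f i) = (\<Sum>i\<in>S. pairing x (f i))"
  by (induction S rule: infinite_finite_induct) (simp_all add: pairing_add_right)
lemma pairing_axis [simp]: "pairing (axis I 1) x = x $ I" "pairing x (axis I 1) = x $ I"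
  by (simp_all add: pairing_def axis_def if_distrib[of "\<lambda>z. z * _"] if_distrib[of "\<lambda>z. _ * z"] cong: if_cong)

lemmas pairing_simps = pairing_add_left pairing_add_right pairing_scale_left pairing_scale_right
  pairing_diff_left pairing_diff_right

lemma pairing_mv: "pairing \<xi> (A *v x) = pairing (transpose A *v \<xi>) x"
proof -
  have "pairing \<xi> (A *v x) = (\<Sum>I\<in>UNIV. \<Sum>J\<in>UNIV. \<xi> $ I * A $ I $ J * x $ J)"
    by (simp add: pairing_def matrix_vector_mult_def sum_distrib_left mult.assoc)
  also have "\<dots> = (\<Sum>J\<in>UNIV. \<Sum>I\<in>UNIV. \<xi> $ I * A $ I $ J * x $ J)"
    by (rule sum.swap)
  also have "\<dots> = pairing (transpose A *v \<xi>) x"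
    by (simp add: pairing_def matrix_vector_mult_def transpose_def sum_distrib_right sum_distrib_left mult_ac)
  finally show ?thesis .
qed

subsection \<open>Parity\<close>

text \<open>The other half-spinor space, which every \<open>gamma v\<close> exchanges with
  \<open>X\<close>.\<close>

definition XO :: "spinor set" where
  "XO = {x. \<forall>I. even (card I) \<longrightarrow> x $ I = 0}"

lemma X_zero [simp]: "0 \<in> X" by (simp add: X_def)
lemma X_add: "x \<in> X \<Longrightarrow> y \<in> X \<Longrightarrow> x + y \<in> X" by (simp add: X_def)
lemma X_diff: "x \<in> X \<Longrightarrow> y \<in> X \<Longrightarrow> x - y \<in> X" by (simp add: X_def)
lemma X_scale: "x \<in> X \<Longrightarrow> c *s x \<in> X" by (simp add: X_def)
lemma X_sum: "(\<And>i. i \<in> S \<Longrightarrow> f i \<in> X) \<Longrightarrow> (\<Sum>i\<in>S. f i) \<in> X"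
  by (induction S rule: infinite_finite_induct) (simp_all add: X_add)
lemma X_axis: "axis I 1 \<in> X \<longleftrightarrow> even (card I)"
  by (auto simp: X_def axis_def)

lemma even_card_insert: "i \<notin> I \<Longrightarrow> even (card (insert i (I :: 5 set))) = odd (card I)"
  by simp
lemma even_card_remove: "i \<in> I \<Longrightarrow> even (card ((I :: 5 set) - {i})) = odd (card I)"
  using card.remove[of I i] by (metis even_Suc finite)

lemma gamma_component:
  "(gamma v *v x) $ I = (\<Sum>i\<in>UNIV. if i \<in> I then v $ Inr i * sg i I * x $ (I - {i}) else v $ Inl i * sg i I * x $ insert i I)"
  unfolding gamma_mv sum_component by (intro sum.cong) (simp_all add: wedge_mv contr_mv)

lemma gamma_X: "x \<in> X \<Longrightarrow> gamma v *v x \<in> XO"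
  unfolding XO_def
proof (intro CollectI allI impI)
  fix I :: "5 set" assume x: "x \<in> X" and I: "even (card I)"
  have "x $ (I - {i}) = 0" if "i \<in> I" for i using x I even_card_remove[OF that] unfolding X_def by blast
  moreover have "x $ insert i I = 0" if "i \<notin> I" for i using x I even_card_insert[OF that] unfolding X_def by blast
  ultimately show "(gamma v *v x) $ I = 0" unfolding gamma_component by (intro sum.neutral) auto
qed

lemma gamma_XO: "x \<in> XO \<Longrightarrow> gamma v *v x \<in> X"
  unfolding X_def
proof (intro CollectI allI impI)
  fix I :: "5 set" assume x: "x \<in> XO" and I: "odd (card I)"
  have "x $ (I - {i}) = 0" if "i \<in> I" for i using x I even_card_remove[OF that] unfolding XO_def by blast
  moreover have "x $ insert i I = 0" if "i \<notin> I" for i using x I even_card_insert[OF that] unfolding XO_def by blast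
  ultimately show "(gamma v *v x) $ I = 0" unfolding gamma_component by (intro sum.neutral) auto
qed

lemma gamma_gamma_X: "x \<in> X \<Longrightarrow> gamma v *v (gamma w *v x) \<in> X"
  by (simp add: gamma_X gamma_XO)

lemma spin_gen_mv: "spin_gen v w *v x = gamma v *v (gamma w *v x) - (polar v w / 2) *s x"
proof -
  have "spin_gen v w = cmat (1/2) (gamma v ** gamma w - gamma w ** gamma v)"
    by (simp add: spin_gen_def cmat_def vec_eq_iff)
  then have "2 *s (spin_gen v w *v x) = gamma v *v (gamma w *v x) - gamma w *v (gamma v *v x)"
    by (simp add: matrix_vector_mult_diff_rdistrib matrix_vector_mul_assoc)
  also have "gamma w *v (gamma v *v x) = polar v w *s x - gamma v *v (gamma w *v x)"
    using gamma_anticomm[of v w x] by (simp add: algebra_simps)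
  finally have "2 *s (spin_gen v w *v x) = 2 *s (gamma v *v (gamma w *v x) - (polar v w / 2) *s x)"
    by (simp add: vec_eq_iff)
  then show ?thesis by (rule vec_scale_cancel) simp
qed

lemma spin_gen_X: "x \<in> X \<Longrightarrow> spin_gen v w *v x \<in> X"
  by (simp add: spin_gen_mv X_diff X_scale gamma_gamma_X)

subsection \<open>The quadratic Casimir on pairs of spinors\<close>

definition outer :: "spinor \<Rightarrow> spinor \<Rightarrow> spinor_mat" where
  "outer x y = (\<chi> I J. x $ I * y $ J)"

text \<open>A matrix stands for a tensor of two spinors, as in \<open>outer\<close>. The transpose
  of \<open>gamma (axis p 1)\<close> belongs to the dual index, so this is Clifford multiplication
  by the invariant tensor of the quadratic form, one vector on each factor. It exchanges tensors
  over \<open>X\<close> with tensors over \<open>XO\<close>; its square is the Casimir operator up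
  to an affine change.\<close>

definition Om :: "spinor_mat \<Rightarrow> spinor_mat" where
  "Om M = (\<Sum>p\<in>UNIV. gamma (axis p 1) ** M ** gamma (axis p 1))"

lemma Om_mv: "Om M *v z = (\<Sum>p\<in>UNIV. gamma (axis p 1) *v (M *v (gamma (axis p 1) *v z)))"
  by (simp add: Om_def sum_mv matrix_vector_mul_assoc matrix_mul_assoc)

lemma mm_left: "(A ** M) $ I $ J = (A *v (\<chi> K. M $ K $ J)) $ I"
  by (simp add: matrix_matrix_mult_def matrix_vector_mult_def)
lemma mm_right: "((M :: complex ^ 'n ^ 'm) ** B) $ I $ J = (transpose B *v (M $ I)) $ J"
  by (simp add: matrix_matrix_mult_def matrix_vector_mult_def transpose_def mult.commute)

lemma mm_both: "((A ** M ** B) :: spinor_mat) $ I $ J = (A *v (\<chi> K. (transpose B *v (M $ K)) $ J)) $ I"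
  by (subst matrix_mul_assoc[symmetric], subst mm_left) (simp only: mm_right)

definition fl :: "5 \<Rightarrow> 5 set \<Rightarrow> 5 set" where
  "fl i I = (if i \<in> I then I - {i} else insert i I)"

lemma mem_fl: "j \<in> fl i I \<longleftrightarrow> (j \<in> I) \<noteq> (j = i)"
  by (auto simp: fl_def)

lemma even_card_fl: "even (card (fl i I)) = odd (card I)"
  unfolding fl_def using even_card_insert[of i I] even_card_remove[of i I] by presburger

text \<open>If the left factor removes \<open>i\<close> from the row index, the transposed right
  factor adds \<open>i\<close> to the column index, and vice versa. So only elements of exactly one
  of the two indices contribute, and they are toggled in both.\<close>

lemma Om_component:
  "Om M $ I $ J = (\<Sum>i\<in>UNIV. if (i \<in> I) \<noteq> (i \<in> J) then sg i I * sg i J * M $ (fl i I) $ (fl i J) else 0)"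
proof -
  have T: "transpose (contr i) = wedge i" "transpose (wedge i) = contr i" for i
    by (simp_all add: contr_def)
  show ?thesis
    unfolding Om_def sum_component sum_UNIV_Plus gamma_axis sum.distrib[symmetric]
    by (intro sum.cong refl) (simp add: mm_both T wedge_mv contr_mv fl_def)
qed

text \<open>Counting elements below \<open>i\<close> in the two sets gives the count for the
  symmetric difference plus twice that for the intersection.\<close>

lemma sg_sg: "sg i I * sg i J = sg i {j. (j \<in> I) \<noteq> (j \<in> J)}"
proof -
  let ?A = "{j \<in> I. j < i}" and ?B = "{j \<in> J. j < i}"
  let ?D = "{j \<in> {j. (j \<in> I) \<noteq> (j \<in> J)}. j < i}"
  have "card (?A \<union> ?B) + card (?A \<inter> ?B) = card ?A + card ?B"
    using card_Un_Int[of ?A ?B] by simp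
  moreover have "card (?A \<union> ?B) = card ?D + card (?A \<inter> ?B)"
  proof -
    have u: "?A \<union> ?B = ?D \<union> (?A \<inter> ?B)" and d: "?D \<inter> (?A \<inter> ?B) = {}" by auto
    from arg_cong[OF u, of card] card_Un_disjoint[OF finite finite d] show ?thesis by (rule trans)
  qed
  ultimately have "card ?A + card ?B = card ?D + 2 * card (?A \<inter> ?B)" by simp
  then have "(-1::complex) ^ (card ?A + card ?B) = (-1) ^ card ?D" by (simp add: power_add)
  then show ?thesis unfolding sg_def by (simp add: power_add)
qed

text \<open>Toggling an element in both indices keeps their symmetric difference \<open>D\<close>,
  so the second application of \<open>Om\<close> meets the same \<open>D\<close> and the same
  signs.\<close>

lemma Om_Om_component:
  fixes M :: spinor_mat and I J :: "5 set"
  defines "D \<equiv> {j. (j \<in> I) \<noteq> (j \<in> J)}"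
  shows "Om (Om M) $ I $ J = (\<Sum>i\<in>D. \<Sum>j\<in>D. sg i D * sg j D * M $ (fl j (fl i I)) $ (fl j (fl i J)))"
proof -
  have Om: "Om M $ I' $ J' = (\<Sum>i\<in>D. sg i D * M $ (fl i I') $ (fl i J'))"
    if "{j. (j \<in> I') \<noteq> (j \<in> J')} = D" for M and I' J' :: "5 set"
  proof -
    have "Om M $ I' $ J' = (\<Sum>i\<in>UNIV. if i \<in> D then sg i D * M $ (fl i I') $ (fl i J') else 0)"
      unfolding Om_component sg_sg that using that by (intro sum.cong) auto
    then show ?thesis by (simp add: sum.If_cases)
  qed
  have d: "{j. (j \<in> fl i I) \<noteq> (j \<in> fl i J)} = D" for i
    by (auto simp: mem_fl D_def)
  have "Om (Om M) $ I $ J = (\<Sum>i\<in>D. sg i D * Om M $ fl i I $ fl i J)"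
    by (rule Om) (simp add: D_def)
  also have "\<dots> = (\<Sum>i\<in>D. \<Sum>j\<in>D. sg i D * sg j D * M $ (fl j (fl i I)) $ (fl j (fl i J)))"
    by (intro sum.cong refl) (simp add: Om[OF d] sum_distrib_left mult.assoc)
  finally show ?thesis .
qed

lemma card_4_sorted:
  fixes D :: "'a::linorder set"
  assumes "card D = 4"
  obtains a b c d where "D = {a, b, c, d}" "a < b" "b < c" "c < d"
proof -
  have f: "finite D" using assms card.infinite by fastforce
  let ?l = "sorted_list_of_set D"
  have l: "length ?l = 4" "sorted_wrt (<) ?l" "set ?l = D" using assms f by auto
  have "length l = 4 \<Longrightarrow> \<exists>a b c d. l = [a, b, c, d]" for l :: "'a list"
    by (auto simp: length_Suc_conv eval_nat_numeral)
  with l(1) obtain a b c d where "?l = [a, b, c, d]" by blast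
  with l show ?thesis by (intro that[of a b c d]) auto
qed

text \<open>On alternating tensors, \<open>Om\<close> squares to \<open>4\<close>: \<open>\<Lambda>\<^sup>2 X\<close> is the third exterior power of the
  vector representation, on which \<open>Om\<close> acts by \<open>\<plusminus>(10 - 2 \<cdot> 3)/2\<close>.\<close>

lemma Om_Om_alternating:
  assumes alt: "\<And>I J. T $ I $ J = - T $ J $ I"
    and ev: "\<And>I J. odd (card J) \<Longrightarrow> T $ I $ J = 0"
    and I: "even (card I)"
  shows "Om (Om T) $ I $ J = 4 * T $ I $ J"
proof (cases "even (card J)")
  case False
  then show ?thesis by (simp add: Om_Om_component ev even_card_fl)
next
  case J: True
  define D where "D = {j. (j \<in> I) \<noteq> (j \<in> J)}"
  define F where "F i j = T $ (fl j (fl i I)) $ (fl j (fl i J))" for i j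
  have O: "Om (Om T) $ I $ J = (\<Sum>i\<in>D. \<Sum>j\<in>D. sg i D * sg j D * F i j)"
    unfolding D_def F_def by (rule Om_Om_component)
  have Fii: "F i i = T $ I $ J" for i
  proof -
    have "fl i (fl i I) = I" "fl i (fl i J) = J" by (auto simp: mem_fl)
    then show ?thesis by (simp add: F_def)
  qed
  have Fsym: "F i j = F j i" for i j
  proof -
    have "fl i (fl j K) = fl j (fl i K)" for K by (auto simp: mem_fl)
    then show ?thesis by (simp add: F_def)
  qed
  have "D \<union> (I \<inter> J) = I \<union> J" "D \<inter> (I \<inter> J) = {}" by (auto simp: D_def)
  then have "card D + card (I \<inter> J) = card (I \<union> J)" by (metis card_Un_disjoint finite)
  moreover have "card (I \<union> J) + card (I \<inter> J) = card I + card J" by (metis card_Un_Int finite)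
  ultimately have "card D + 2 * card (I \<inter> J) = card I + card J" by simp
  then have "even (card D)" using I J by (metis even_add even_mult_iff even_numeral)
  moreover have "card D \<le> 5" using card_mono[of "UNIV :: 5 set" D] by simp
  ultimately have "card D = 0 \<or> card D = 2 \<or> card D = 4"
    by presburger
  then show ?thesis
  proof (elim disjE)
    assume "card D = 0"
    then have "D = {}" by simp
    then have "I = J" by (auto simp: D_def)
    then have "T $ I $ J = 0" using alt[of I J] by simp
    then show ?thesis using O \<open>D = {}\<close> by simp
  next
    assume "card D = 2"
    then obtain a b where D: "D = {a, b}" "a < b" by (metis card_2_iff doubleton_eq_iff linorder_neq_iff)
    have s: "sg a D = 1" "sg b D = -1"
    proof -
      have "{j \<in> D. j < a} = {}" "{j \<in> D. j < b} = {a}" using D by auto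
      then show "sg a D = 1" "sg b D = -1" by (simp_all only: sg_def) simp_all
    qed
    have mD: "(j \<in> I) \<noteq> (j \<in> J) \<longleftrightarrow> j = a \<or> j = b" for j
      using D(1) unfolding D_def by blast
    \<comment> \<open>Toggling both elements of \<open>D\<close> exchanges \<open>I\<close> and
      \<open>J\<close>. The two diagonal terms give \<open>2 * T $ I $ J\<close>, and the two mixed
      terms, with sign -1 and alternation, give the same again.\<close>
    have "fl b (fl a I) = J" "fl b (fl a J) = I"
      by (rule set_eqI, use mD D(2) in \<open>unfold mem_fl, metis less_irrefl\<close>)+
    then have "F a b = - T $ I $ J" using alt[of J I] by (simp add: F_def)
    then show ?thesis unfolding O using D s Fsym[of b a] Fii by simp
  next
    assume "card D = 4"
    then obtain a b c d where D: "D = {a, b, c, d}" "a < b" "b < c" "c < d" by (rule card_4_sorted)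
    have s: "sg a D = 1" "sg b D = -1" "sg c D = 1" "sg d D = -1"
    proof -
      have "{j \<in> D. j < a} = {}" "{j \<in> D. j < b} = {a}" "{j \<in> D. j < c} = {a, b}" "{j \<in> D. j < d} = {a, b, c}"
        using D by auto
      moreover have "a \<noteq> b" "a \<noteq> c" "b \<noteq> c" using D by auto
      then have "card {a, b} = 2" "card {a, b, c} = 3" by simp_all
      ultimately show "sg a D = 1" "sg b D = -1" "sg c D = 1" "sg d D = -1"
        by (simp_all only: sg_def) simp_all
    qed
    have mD: "(j \<in> I) \<noteq> (j \<in> J) \<longleftrightarrow> j = a \<or> j = b \<or> j = c \<or> j = d" for j
      using D(1) unfolding D_def by blast
    \<comment> \<open>Toggling \<open>i\<close> and \<open>j\<close> in \<open>I\<close> gives the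
      same set as toggling \<open>k\<close> and \<open>l\<close> in \<open>J\<close>. Since
      complementary pairs carry equal signs, alternation cancels all mixed terms, and the four
      diagonal ones remain.\<close>
    have opp: "F i j = - F k l" if "{i, j, k, l} = D" "i \<noteq> j" "k \<noteq> l" "i \<noteq> k" "i \<noteq> l" "j \<noteq> k" "j \<noteq> l" for i j k l
    proof -
      have m: "(m \<in> I) \<noteq> (m \<in> J) \<longleftrightarrow> m = i \<or> m = j \<or> m = k \<or> m = l" for m
        using that(1) unfolding D_def by blast
      have "fl l (fl k I) = fl j (fl i J)" "fl l (fl k J) = fl j (fl i I)"
        by (rule set_eqI, unfold mem_fl, use m that(2-) in metis)+
      then show ?thesis using alt[of "fl j (fl i I)" "fl j (fl i J)"] by (simp add: F_def)
    qed
    have "F a b = - F c d" "F a c = - F b d" "F a d = - F b c"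
      by (rule opp, use D in auto)+
    moreover have "F b a = F a b" "F c a = F a c" "F d a = F a d" "F c b = F b c" "F d b = F b d" "F d c = F c d"
      by (rule Fsym)+
    moreover have "Om (Om T) $ I $ J = (\<Sum>i\<in>{a, b, c, d}. \<Sum>j\<in>{a, b, c, d}. sg i D * sg j D * F i j)"
      using O D(1) by simp
    moreover have "a \<notin> {b, c, d}" "b \<notin> {c, d}" "c \<noteq> d" using D by auto
    ultimately show ?thesis using s Fii by simp
  qed
qed

lemma Om_add: "Om (M + N) = Om M + Om N"
  by (simp add: Om_component vec_eq_iff sum.distrib[symmetric] distrib_left if_distrib[of "\<lambda>z. z + _"] cong: if_cong)
lemma Om_diff: "Om (M - N) = Om M - Om N"
  using Om_add[of "M - N" N] by (simp add: algebra_simps)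

lemma sum_gamma_axis_mv: "(\<Sum>p\<in>UNIV. v $ p *s (gamma (axis p 1) *v x)) = gamma v *v x"
  "(\<Sum>p\<in>UNIV. v $ dual_index p *s (gamma (axis p 1) *v x)) = gamma (dualv v) *v x"
proof -
  show A: "(\<Sum>p\<in>UNIV. v $ p *s (gamma (axis p 1) *v x)) = gamma v *v x" for v
    by (subst (2) gamma_vector_expand) (simp add: sum_mv)
  show "(\<Sum>p\<in>UNIV. v $ dual_index p *s (gamma (axis p 1) *v x)) = gamma (dualv v) *v x"
    using A[of "dualv v"] by (simp add: dualv_def)
qed

lemma sum_dual_coords: "(\<Sum>p\<in>UNIV. v $ dual_index p * w $ p) = polar v w"
  by (simp add: sum_UNIV_Plus polar_def sum.distrib algebra_simps)

lemma gamma_swap: "gamma v *v (gamma w *v x) = polar v w *s x - gamma w *v (gamma v *v x)"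
  using gamma_anticomm[of v w x] by (simp add: algebra_simps)

text \<open>Moving the two inner Clifford vectors past \<open>gamma u\<close> leaves corrections
  \<open>2 * quad u\<close>, \<open>- quad u\<close> and \<open>- quad u\<close> times
  \<open>M\<close>, which cancel.\<close>

lemma Om_gamma: "Om (gamma u ** M ** transpose (gamma u)) = gamma u ** Om M ** transpose (gamma u)"
proof -
  have "Om (gamma u ** M ** transpose (gamma u)) *v z = (gamma u ** Om M ** transpose (gamma u)) *v z" for z
  proof -
    let ?g = "\<lambda>p. gamma (axis p 1)" and ?u = "gamma u" and ?d = "gamma (dualv u)"
    have "?g p *v (?u *v (M *v (?d *v (?g p *v z)))) =
       (u $ dual_index p * u $ p) *s (M *v z) - (u $ dual_index p) *s (M *v (?g p *v (?d *v z)))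
       - u $ p *s (?u *v (?g p *v (M *v z))) + ?u *v (?g p *v (M *v (?g p *v (?d *v z))))" for p
    proof -
      have 1: "?d *v (?g p *v z) = u $ p *s z - ?g p *v (?d *v z)"
        by (subst gamma_swap) (simp add: polar_axis dualv_def)
      have 2: "?g p *v (?u *v y) = u $ dual_index p *s y - ?u *v (?g p *v y)" for y
        by (subst gamma_swap) (simp add: polar_axis polar_commute[of _ u])
      show ?thesis unfolding 1 2
        by (simp add: matrix_vector_mult_diff_distrib vector_scalar_commute vec_eq_iff algebra_simps)
    qed
    then have "Om (?u ** M ** transpose ?u) *v z =
       (\<Sum>p\<in>UNIV. (u $ dual_index p * u $ p) *s (M *v z)) - M *v (\<Sum>p\<in>UNIV. (u $ dual_index p) *s (?g p *v (?d *v z)))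
       - ?u *v (\<Sum>p\<in>UNIV. u $ p *s (?g p *v (M *v z))) + ?u *v (\<Sum>p\<in>UNIV. ?g p *v (M *v (?g p *v (?d *v z))))"
      by (simp add: Om_mv transpose_gamma matrix_vector_mul_assoc[symmetric] sum.distrib sum_subtractf mv_sum vector_scalar_commute)
    also have "(\<Sum>p\<in>UNIV. (u $ dual_index p * u $ p) *s (M *v z)) = (2 * quad u) *s (M *v z)"
      by (simp add: vec.scale_sum_left[symmetric] sum_dual_coords polar_self)
    finally show ?thesis unfolding sum_gamma_axis_mv gamma_sq
      by (simp add: Om_mv transpose_gamma matrix_vector_mul_assoc[symmetric] vector_scalar_commute vec_eq_iff algebra_simps)
  qed
  then show ?thesis by (simp add: matrix_eq)
qed

definition Om_derivation :: "spinor_mat \<Rightarrow> bool" where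
  "Om_derivation B \<longleftrightarrow> (\<forall>M. Om (B ** M + M ** transpose B) = B ** Om M + Om M ** transpose B)"

lemma transpose_diff: "transpose (A - B) = transpose A - transpose (B :: complex ^ 'n ^ 'm)"
  by (simp add: transpose_def vec_eq_iff)
lemma transpose_add: "transpose (A + B) = transpose A + transpose (B :: complex ^ 'n ^ 'm)"
  by (simp add: transpose_def vec_eq_iff)
lemma transpose_cmat: "transpose (cmat k A) = cmat k (transpose A)"
  by (simp add: transpose_def vec_eq_iff cmat_def)
lemma transpose_zero [simp]: "transpose (0 :: complex ^ 'n ^ 'm) = 0"
  by (simp add: transpose_def vec_eq_iff)

lemma spin_gen_eq: "spin_gen v w = gamma v ** gamma w - cmat (polar v w / 2) (mat 1)"
  by (simp add: matrix_eq spin_gen_mv matrix_vector_mult_diff_rdistrib matrix_vector_mul_assoc[symmetric])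

text \<open>The commutators on the left and on the right each leave two terms after summation over
  \<open>p\<close>. They contain the same Clifford vectors on both sides of \<open>M\<close>, with
  opposite signs.\<close>

lemma Om_derivation_spin_gen: "Om_derivation (spin_gen v w)"
  unfolding Om_derivation_def
proof (intro allI)
  fix M
  let ?B = "spin_gen v w" and ?g = "\<lambda>p. gamma (axis p 1)"
  let ?v = "gamma v" and ?w = "gamma w" and ?v' = "gamma (dualv v)" and ?w' = "gamma (dualv w)"
  have Bt: "transpose ?B *v z = ?w' *v (?v' *v z) - (polar v w / 2) *s z" for z
    by (simp add: spin_gen_eq transpose_diff transpose_cmat matrix_transpose_mul transpose_gamma
        matrix_vector_mult_diff_rdistrib matrix_vector_mul_assoc[symmetric])
  have "Om (?B ** M + M ** transpose ?B) *v z = (?B ** Om M + Om M ** transpose ?B) *v z" for z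
  proof -
    have 1: "?g p *v (?v *v (?w *v y)) = v $ dual_index p *s (?w *v y) - w $ dual_index p *s (?v *v y) + ?v *v (?w *v (?g p *v y))" for p y
      by (subst gamma_swap, subst gamma_swap[of "axis p 1" w])
         (simp add: polar_axis polar_commute[of "axis p 1"] matrix_vector_mult_diff_distrib vector_scalar_commute)
    have 2: "?w' *v (?v' *v (?g p *v z)) = v $ p *s (?w' *v z) - w $ p *s (?v' *v z) + ?g p *v (?w' *v (?v' *v z))" for p
      by (subst gamma_swap[of "dualv v" "axis p 1"], simp add: matrix_vector_mult_diff_distrib vector_scalar_commute,
          subst gamma_swap[of "dualv w" "axis p 1"])
         (simp add: polar_axis matrix_vector_mult_diff_distrib vector_scalar_commute dualv_def)
    have "?g p *v (?B *v (M *v (?g p *v z))) + ?g p *v (M *v (transpose ?B *v (?g p *v z))) =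
       ?w *v (M *v (v $ dual_index p *s (?g p *v z))) - ?v *v (M *v (w $ dual_index p *s (?g p *v z)))
     + v $ p *s (?g p *v (M *v (?w' *v z))) - w $ p *s (?g p *v (M *v (?v' *v z)))
     + ?B *v (?g p *v (M *v (?g p *v z))) + ?g p *v (M *v (?g p *v (transpose ?B *v z)))" for p
      unfolding Bt spin_gen_mv matrix_vector_mult_diff_distrib 1 2
      by (simp add: matrix_vector_mult_diff_distrib matrix_vector_right_distrib vector_scalar_commute vec_eq_iff algebra_simps)
    then have "Om (?B ** M + M ** transpose ?B) *v z =
       ?w *v (M *v (\<Sum>p\<in>UNIV. v $ dual_index p *s (?g p *v z))) - ?v *v (M *v (\<Sum>p\<in>UNIV. w $ dual_index p *s (?g p *v z)))
     + (\<Sum>p\<in>UNIV. v $ p *s (?g p *v (M *v (?w' *v z)))) - (\<Sum>p\<in>UNIV. w $ p *s (?g p *v (M *v (?v' *v z))))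
     + ?B *v (\<Sum>p\<in>UNIV. ?g p *v (M *v (?g p *v z))) + (\<Sum>p\<in>UNIV. ?g p *v (M *v (?g p *v (transpose ?B *v z))))"
      by (simp add: Om_mv Om_add matrix_vector_mult_add_rdistrib matrix_vector_mul_assoc[symmetric]
          sum.distrib[symmetric] sum_subtractf[symmetric] mv_sum)
    then show ?thesis unfolding sum_gamma_axis_mv
      by (simp add: Om_mv matrix_vector_mult_add_rdistrib matrix_vector_mul_assoc[symmetric])
  qed
  then show "Om (?B ** M + M ** transpose ?B) = ?B ** Om M + Om M ** transpose ?B"
    by (simp add: matrix_eq)
qed

subsection \<open>The moment map\<close>

lemma outer_mm: "A ** outer x y = outer (A *v x) y" "outer x y ** A = outer x (transpose A *v y)"
  by (simp_all add: outer_def vec_eq_iff matrix_matrix_mult_def matrix_vector_mult_def transpose_def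
      sum_distrib_left sum_distrib_right mult_ac)

lemma transpose_outer_mv: "transpose (outer x y) *v z = pairing z x *s y"
  by (simp add: outer_def vec_eq_iff transpose_def matrix_vector_mult_def pairing_def sum_distrib_left mult_ac)

lemma transpose_gamma_axis: "transpose (gamma (axis p 1)) = gamma (axis (dual_index p) 1)"
  by (simp add: transpose_gamma)

lemma transpose_sum: "transpose (\<Sum>i\<in>S. A i) = (\<Sum>i\<in>S. transpose (A i :: complex ^ 'n ^ 'm))"
  by (induction S rule: infinite_finite_induct) (simp_all add: transpose_add)

lemma Om_sum: "Om (\<Sum>i\<in>S. A i) = (\<Sum>i\<in>S. Om (A i))"
proof -
  have "Om 0 = 0" using Om_diff[of 0 0] by simp
  then show ?thesis by (induction S rule: infinite_finite_induct) (simp_all add: Om_add)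
qed

lemma Om_Om_outer:
  "transpose (Om (Om (outer x y))) *v \<xi> = (\<Sum>p\<in>UNIV. \<Sum>q\<in>UNIV.
     pairing \<xi> (gamma (axis p 1) *v (gamma (axis q 1) *v x)) *s
       (gamma (axis (dual_index p) 1) *v (gamma (axis (dual_index q) 1) *v y)))"
proof -
  let ?g = "\<lambda>p. gamma (axis p 1)"
  have "Om (outer a c) = (\<Sum>p\<in>UNIV. outer (?g p *v a) (?g (dual_index p) *v c))" for a c
    by (simp add: Om_def outer_mm transpose_gamma_axis)
  then have "Om (Om (outer x y)) = (\<Sum>q\<in>UNIV. \<Sum>p\<in>UNIV. outer (?g p *v (?g q *v x)) (?g (dual_index p) *v (?g (dual_index q) *v y)))"
    by (simp add: Om_sum)
  also have "\<dots> = (\<Sum>p\<in>UNIV. \<Sum>q\<in>UNIV. outer (?g p *v (?g q *v x)) (?g (dual_index p) *v (?g (dual_index q) *v y)))"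
    by (rule sum.swap)
  finally show ?thesis by (simp add: transpose_sum sum_mv transpose_outer_mv)
qed

text \<open>Each of the five hyperbolic pairs contributes the anticommutator of
  \<open>contr i\<close> and \<open>wedge i\<close>, which is the identity.\<close>

lemma sum_gamma_dual: "(\<Sum>p\<in>UNIV. gamma (axis p 1) *v (gamma (axis (dual_index p) 1) *v x)) = 5 *s x"
proof -
  have "(\<Sum>p\<in>UNIV. gamma (axis p 1) *v (gamma (axis (dual_index p) 1) *v x)) = (\<Sum>i\<in>(UNIV :: 5 set). x)"
    unfolding sum_UNIV_Plus sum.distrib[symmetric]
    by (intro sum.cong refl) (simp add: gamma_axis contr_wedge_anticomm)
  also have "\<dots> = 5 *s x" by (simp add: vec_eq_iff)
  finally show ?thesis .
qed

lemma sum_gamma_dual': "(\<Sum>p\<in>UNIV. gamma (axis (dual_index p) 1) *v (gamma (axis p 1) *v x)) = 5 *s x"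
  using sum.reindex_bij_betw[OF bij_dual_index, of "\<lambda>p. gamma (axis p 1) *v (gamma (axis (dual_index p) 1) *v x)"]
  by (simp add: sum_gamma_dual)

text \<open>\<open>spin_gen\<close> differs from a product of Clifford vectors by a scalar, and only
  for dual basis vectors. The resulting corrections to the double sum are 10/4, -5/2 and -5/2, so
  the sum is \<open>Om^2\<close> minus 5/2; the factor -1/2 in \<open>moment\<close> then produces
  5/4.\<close>

lemma moment_mv:
  "fst (moment x \<xi>) *v y = (5/4 * pairing \<xi> x) *s y - (1/2) *s (transpose (Om (Om (outer x y))) *v \<xi>)"
proof -
  let ?g = "\<lambda>p. gamma (axis p 1)" and ?d = dual_index
  let ?s = "\<lambda>p q. spin_gen (axis p 1) (axis q 1)"
  have "fst (moment x \<xi>) = cmat (-1/2) (\<Sum>p\<in>UNIV. \<Sum>q\<in>UNIV. cmat (pairing \<xi> (?s p q *v x)) (?s (?d p) (?d q)))"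
    by (simp add: moment_def vec_eq_iff cmat_def sum_component)
  then have "fst (moment x \<xi>) *v y = (-1/2) *s (\<Sum>p\<in>UNIV. \<Sum>q\<in>UNIV. pairing \<xi> (?s p q *v x) *s (?s (?d p) (?d q) *v y))"
    by (simp add: sum_mv)
  also have "(\<Sum>p\<in>UNIV. \<Sum>q\<in>UNIV. pairing \<xi> (?s p q *v x) *s (?s (?d p) (?d q) *v y))
    = (\<Sum>p\<in>UNIV. \<Sum>q\<in>UNIV. pairing \<xi> (?g p *v (?g q *v x)) *s (?g (?d p) *v (?g (?d q) *v y))
       + (if q = ?d p then (pairing \<xi> x / 4) *s y - (pairing \<xi> (?g p *v (?g q *v x)) / 2) *s y
           - (pairing \<xi> x / 2) *s (?g (?d p) *v (?g (?d q) *v y)) else 0))"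
  proof (intro sum.cong refl)
    fix p q
    have "?d q = p \<longleftrightarrow> q = ?d p" by (metis dual_index_simps(3))
    then have "polar (axis p 1) (axis q 1) = (if q = ?d p then 1 else 0)"
      "polar (axis (?d p) 1) (axis (?d q) 1) = (if q = ?d p then 1 else 0)"
      by (auto simp: polar_axis_axis)
    then show "pairing \<xi> (?s p q *v x) *s (?s (?d p) (?d q) *v y) =
      pairing \<xi> (?g p *v (?g q *v x)) *s (?g (?d p) *v (?g (?d q) *v y))
       + (if q = ?d p then (pairing \<xi> x / 4) *s y - (pairing \<xi> (?g p *v (?g q *v x)) / 2) *s y
           - (pairing \<xi> x / 2) *s (?g (?d p) *v (?g (?d q) *v y)) else 0)"
      by (simp add: spin_gen_mv pairing_simps vec_eq_iff algebra_simps)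
  qed
  also have "\<dots> = transpose (Om (Om (outer x y))) *v \<xi> + (\<Sum>p\<in>UNIV. (pairing \<xi> x / 4) *s y - (pairing \<xi> (?g p *v (?g (?d p) *v x)) / 2) *s y
           - (pairing \<xi> x / 2) *s (?g (?d p) *v (?g p *v y)))"
    by (simp add: sum.distrib Om_Om_outer)
  also have "(\<Sum>p\<in>UNIV. (pairing \<xi> x / 4) *s y - (pairing \<xi> (?g p *v (?g (?d p) *v x)) / 2) *s y
           - (pairing \<xi> x / 2) *s (?g (?d p) *v (?g p *v y)))
     = (10 * pairing \<xi> x / 4) *s y - (pairing \<xi> (\<Sum>p\<in>UNIV. ?g p *v (?g (?d p) *v x)) / 2) *s y
       - (pairing \<xi> x / 2) *s (\<Sum>p\<in>UNIV. ?g (?d p) *v (?g p *v y))"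
    by (simp add: sum_subtractf pairing_sum_right vec.scale_sum_right sum_divide_distrib vec.scale_sum_left)
       (simp add: vec_eq_iff)
  finally show ?thesis unfolding sum_gamma_dual sum_gamma_dual'
    by (simp add: vec_eq_iff pairing_simps algebra_simps)
qed

lemma snd_moment [simp]: "snd (moment x \<xi>) = 3/4 * pairing \<xi> x"
  by (simp add: moment_def)

text \<open>Together with the scalar part 3/4, the left side is \<open>2 * pairing \<xi> x\<close>
  times \<open>y\<close> minus half of \<open>Om^2\<close> of \<open>outer x y\<close>, contracted
  with \<open>\<xi>\<close>. On the alternating tensor \<open>T\<close> the operator
  \<open>Om^2\<close> is 4, so the difference of the two sides vanishes.\<close>

lemma moment_swap:
  assumes "x \<in> X" "y \<in> X" "\<xi> \<in> X"
  shows "fst (moment x \<xi>) *v y + snd (moment x \<xi>) *s y = fst (moment y \<xi>) *v x + snd (moment y \<xi>) *s x"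
proof -
  define T where "T = outer x y - outer y x"
  have "(transpose (Om (Om T)) *v \<xi>) $ J = (4 *s (transpose T *v \<xi>)) $ J" for J
  proof -
    \<comment> \<open>The relation for \<open>Om^2\<close> needs a row index of even size; the other
      rows are multiplied by vanishing coordinates of \<open>\<xi>\<close>.\<close>
    have "\<xi> $ I = 0 \<or> Om (Om T) $ I $ J = 4 * T $ I $ J" for I
    proof (cases "even (card I)")
      case True
      have "Om (Om T) $ I $ J = 4 * T $ I $ J"
        by (rule Om_Om_alternating) (use assms True in \<open>auto simp: T_def outer_def X_def\<close>)
      then show ?thesis ..
    qed (use assms in \<open>auto simp: X_def\<close>)
    from this have *: "Om (Om T) $ I $ J * \<xi> $ I = 4 * (T $ I $ J * \<xi> $ I)" for I
    proof (rule disjE)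
      show "\<xi> $ I = 0 \<Longrightarrow> ?thesis" "Om (Om T) $ I $ J = 4 * T $ I $ J \<Longrightarrow> ?thesis"
        by simp_all
    qed
    show ?thesis
      by (simp add: matrix_vector_mult_def transpose_def sum_distrib_left *)
  qed
  then have "transpose (Om (Om T)) *v \<xi> = 4 *s (transpose T *v \<xi>)" by (simp add: vec_eq_iff)
  then have "transpose (Om (Om (outer x y))) *v \<xi> - transpose (Om (Om (outer y x))) *v \<xi>
     = 4 *s (pairing \<xi> x *s y - pairing \<xi> y *s x)"
    by (simp add: T_def Om_diff transpose_diff matrix_vector_mult_diff_rdistrib transpose_outer_mv)
  then have E: "transpose (Om (Om (outer x y))) *v \<xi>
     = 4 *s (pairing \<xi> x *s y - pairing \<xi> y *s x) + transpose (Om (Om (outer y x))) *v \<xi>"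
    by (simp add: algebra_simps)
  show ?thesis unfolding moment_mv E by (simp add: vec_eq_iff algebra_simps)
qed

lemma moment_derivation:
  assumes "Om_derivation B"
  shows "fst (moment (B *v x) \<xi>) - fst (moment x (transpose B *v \<xi>))
       = B ** fst (moment x \<xi>) - fst (moment x \<xi>) ** B"
proof -
  have "(fst (moment (B *v x) \<xi>) - fst (moment x (transpose B *v \<xi>))) *v y
       = (B ** fst (moment x \<xi>) - fst (moment x \<xi>) ** B) *v y" for y
  proof -
    let ?M = "outer x y"
    have "Om (Om (B ** ?M + ?M ** transpose B)) = B ** Om (Om ?M) + Om (Om ?M) ** transpose B"
      using assms unfolding Om_derivation_def by simp
    then have "Om (Om (outer (B *v x) y)) + Om (Om (outer x (B *v y))) = B ** Om (Om ?M) + Om (Om ?M) ** transpose B"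
      by (simp add: outer_mm Om_add)
    then have "transpose (Om (Om (outer (B *v x) y)) + Om (Om (outer x (B *v y)))) *v \<xi>
      = transpose (B ** Om (Om ?M) + Om (Om ?M) ** transpose B) *v \<xi>" by simp
    then have E: "transpose (Om (Om (outer (B *v x) y))) *v \<xi> = transpose (Om (Om ?M)) *v (transpose B *v \<xi>)
        + B *v (transpose (Om (Om ?M)) *v \<xi>) - transpose (Om (Om (outer x (B *v y)))) *v \<xi>"
      by (simp add: transpose_add matrix_vector_mult_add_rdistrib matrix_transpose_mul matrix_vector_mul_assoc algebra_simps)
    show ?thesis
      unfolding matrix_vector_mult_diff_rdistrib matrix_vector_mul_assoc[symmetric] moment_mv
      by (simp add: E pairing_mv matrix_vector_mult_diff_distrib matrix_vector_right_distrib vector_scalar_commute vec_eq_iff algebra_simps)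
  qed
  then show ?thesis by (simp add: matrix_eq)
qed

text \<open>The equivariance of \<open>Om\<close> is applied twice and contracted with
  \<open>\<xi>\<close>. Here \<open>s'\<close> is the inverse of \<open>s\<close>, so
  \<open>transpose s'\<close> is the contragredient action on the dual.\<close>

lemma moment_equivariant:
  assumes Om: "\<And>M. Om (s ** M ** transpose s) = s ** Om M ** transpose s"
    and s: "s ** s' = mat 1" "s' ** s = mat 1"
  shows "fst (moment (s *v x) (transpose s' *v \<xi>)) = s ** fst (moment x \<xi>) ** s'"
    "pairing (transpose s' *v \<xi>) (s *v x) = pairing \<xi> x"
proof -
  show P: "pairing (transpose s' *v \<xi>) (s *v x) = pairing \<xi> x"
    by (simp add: pairing_mv[symmetric] matrix_vector_mul_assoc s)
  have "fst (moment (s *v x) (transpose s' *v \<xi>)) *v y = (s ** fst (moment x \<xi>) ** s') *v y" for y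
  proof -
    define z where "z = s' *v y"
    have y: "y = s *v z" by (simp add: z_def matrix_vector_mul_assoc s)
    have "outer (s *v x) (s *v z) = s ** outer x z ** transpose s" by (simp add: outer_mm)
    then have "Om (Om (outer (s *v x) (s *v z))) = s ** Om (Om (outer x z)) ** transpose s" by (simp add: Om)
    then have "transpose (Om (Om (outer (s *v x) (s *v z)))) *v (transpose s' *v \<xi>)
        = s *v (transpose (Om (Om (outer x z))) *v (transpose s *v (transpose s' *v \<xi>)))"
      by (simp add: matrix_transpose_mul matrix_vector_mul_assoc matrix_mul_assoc)
    also have "transpose s *v (transpose s' *v \<xi>) = \<xi>"
      by (simp add: matrix_vector_mul_assoc matrix_transpose_mul[symmetric] s)
    finally show ?thesis unfolding y matrix_vector_mul_assoc[symmetric] moment_mv P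
      by (simp add: matrix_vector_mul_assoc s matrix_vector_mult_diff_distrib vector_scalar_commute)
  qed
  then show "fst (moment (s *v x) (transpose s' *v \<xi>)) = s ** fst (moment x \<xi>) ** s'"
    by (simp add: matrix_eq)
qed

section \<open>The graded Lie algebra\<close>

lemma cmat_zero [simp]: "cmat 0 A = 0" "cmat k 0 = 0"
  by (simp_all add: cmat_def vec_eq_iff)
lemma cmat_one [simp]: "cmat 1 A = A"
  by (simp add: cmat_def vec_eq_iff)
lemma cmat_component [simp]: "cmat k A $ I $ J = k * A $ I $ J"
  by (simp add: cmat_def)
lemma cmat_mm [simp]: "cmat k A ** B = cmat k (A ** B)" "A ** cmat k B = cmat k (A ** B)"
  by (simp_all add: matrix_eq matrix_vector_mul_assoc[symmetric] vector_scalar_commute)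
lemma cmat_cmat [simp]: "cmat k (cmat l A) = cmat (k * l) A"
  by (simp add: vec_eq_iff)

interpretation mat: vector_space "cmat :: complex \<Rightarrow> spinor_mat \<Rightarrow> spinor_mat"
  by unfold_locales (simp_all add: cmat_def vec_eq_iff algebra_simps)

lemma e6_scale_eq: "e6_scale k (\<xi>, (A, c), x) = (k *s \<xi>, (cmat k A, k * c), k *s x)"
  by (simp add: cmat_def)

lemma e6_scale_pair: "e6_scale k a = (k *s fst a, (cmat k (fst (fst (snd a))), k * snd (fst (snd a))), k *s snd (snd a))"
  by (cases a rule: prod.exhaust; simp add: cmat_def) (metis cmat_def e6_scale_eq prod.collapse)

interpretation e6: vector_space e6_scale
  by unfold_locales (simp_all add: e6_scale_pair prod_eq_iff mat.scale_right_distrib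
      mat.scale_left_distrib vec.scale_right_distrib vec.scale_left_distrib algebra_simps)

section \<open>The matrices of so(10) and the equivariance of the bracket\<close>

definition soA :: "spinor_mat set" where
  "soA = mat.span {spin_gen v w | v w. True}"

lemma soA_induct [consumes 1, case_names zero gen add]:
  assumes "A \<in> soA" "P 0" "\<And>v w k. P (cmat k (spin_gen v w))" "\<And>A B. P A \<Longrightarrow> P B \<Longrightarrow> P (A + B)"
  shows "P A"
  using assms(1) unfolding soA_def
proof (induction rule: mat.span_induct_alt)
  case base show ?case by fact
next
  case (step c x y)
  then show ?case using assms(3,4) by auto
qed

lemma soA_zero [simp]: "0 \<in> soA" and soA_add: "A \<in> soA \<Longrightarrow> B \<in> soA \<Longrightarrow> A + B \<in> soA"
  and soA_diff: "A \<in> soA \<Longrightarrow> B \<in> soA \<Longrightarrow> A - B \<in> soA"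
  and soA_scale: "A \<in> soA \<Longrightarrow> cmat k A \<in> soA"
  and soA_sum: "(\<And>i. i \<in> S \<Longrightarrow> f i \<in> soA) \<Longrightarrow> (\<Sum>i\<in>S. f i) \<in> soA"
  and soA_gen: "spin_gen v w \<in> soA"
  unfolding soA_def by (auto intro: mat.span_zero mat.span_add mat.span_diff mat.span_scale mat.span_sum mat.span_base)

lemma soA_X: "A \<in> soA \<Longrightarrow> x \<in> X \<Longrightarrow> A *v x \<in> X"
  by (induction A rule: soA_induct) (simp_all add: spin_gen_X X_scale X_add matrix_vector_mult_add_rdistrib)

lemma transpose_spin_gen: "transpose (spin_gen v w) = spin_gen (dualv w) (dualv v)"
proof -
  have "polar (dualv w) (dualv v) = polar v w"
    by (simp add: polar_def dualv_def algebra_simps)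
  then show ?thesis
    by (simp add: spin_gen_eq transpose_diff transpose_cmat matrix_transpose_mul transpose_gamma)
qed

lemma soA_transpose: "A \<in> soA \<Longrightarrow> transpose A \<in> soA"
  by (induction A rule: soA_induct) (simp_all add: transpose_cmat transpose_spin_gen soA_scale soA_gen transpose_add soA_add)

lemma Om_cmat: "Om (cmat k M) = cmat k (Om M)"
  by (simp add: matrix_eq Om_mv vec.scale_sum_right vector_scalar_commute)

lemma matrix_add_rdistrib': "(A + B) ** C = A ** C + B ** (C :: complex ^ 'n ^ 'm)"
  by (simp add: matrix_eq matrix_vector_mul_assoc[symmetric] matrix_vector_mult_add_rdistrib)

lemma soA_Om_derivation: "A \<in> soA \<Longrightarrow> Om_derivation A"
proof (induction A rule: soA_induct)
  case zero then show ?case using Om_diff[of 0 0] by (simp add: Om_derivation_def)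
next
  case (gen v w k)
  have "cmat k B ** M + M ** transpose (cmat k B) = cmat k (B ** M + M ** transpose B)" for B M :: spinor_mat
    by (simp add: transpose_cmat mat.scale_right_distrib)
  then show ?case using Om_derivation_spin_gen[of v w]
    unfolding Om_derivation_def by (simp add: Om_cmat transpose_cmat flip: mat.scale_right_distrib)
next
  case (add A B)
  have "(A + B) ** M + M ** transpose (A + B) = (A ** M + M ** transpose A) + (B ** M + M ** transpose B)" for M :: spinor_mat
    by (simp add: transpose_add matrix_add_ldistrib matrix_add_rdistrib')
  with add show ?case unfolding Om_derivation_def
    by (simp add: Om_add)
qed

lemma fst_moment_eq:
  "fst (moment x \<xi>) = cmat (-1/2) (\<Sum>p\<in>UNIV. \<Sum>q\<in>UNIV. cmat (pairing \<xi> (spin_gen (axis p 1) (axis q 1) *v x))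
     (spin_gen (axis (dual_index p) 1) (axis (dual_index q) 1)))"
  by (simp add: moment_def vec_eq_iff cmat_def sum_component)

lemma moment_soA: "fst (moment x \<xi>) \<in> soA"
  unfolding fst_moment_eq by (intro soA_scale soA_sum soA_gen)

lemma moment_add_left: "moment (x + y) \<xi> = moment x \<xi> + moment y \<xi>"
  by (simp add: prod_eq_iff fst_moment_eq matrix_vector_right_distrib pairing_simps mat.scale_left_distrib
      sum.distrib mat.scale_right_distrib algebra_simps)
lemma moment_add_right: "moment x (\<xi> + \<eta>) = moment x \<xi> + moment x \<eta>"
  by (simp add: prod_eq_iff fst_moment_eq pairing_simps mat.scale_left_distrib
      sum.distrib mat.scale_right_distrib algebra_simps)
lemma fst_moment_scale: "fst (moment (k *s x) \<xi>) = cmat k (fst (moment x \<xi>))"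
   "fst (moment x (k *s \<xi>)) = cmat k (fst (moment x \<xi>))"
  by (simp_all add: fst_moment_eq vector_scalar_commute pairing_simps mat.scale_sum_right algebra_simps)
lemma moment_diff_left: "moment (x - y) \<xi> = moment x \<xi> - moment y \<xi>"
  using moment_add_left[of "x - y" y] by (simp add: algebra_simps)
lemma moment_diff_right: "moment x (\<xi> - \<eta>) = moment x \<xi> - moment x \<eta>"
  using moment_add_right[of x "\<xi> - \<eta>" \<eta>] by (simp add: algebra_simps)
lemma moment_zero [simp]: "moment 0 \<xi> = 0" "moment x 0 = 0"
  using moment_diff_left[of 0 0] moment_diff_right[of x 0 0] by simp_all

lemma Om_transpose: "Om (transpose M) = transpose (Om M)"
  by (auto simp: vec_eq_iff Om_component transpose_def intro!: sum.cong)

lemma pairing_transpose: "pairing \<eta> (transpose N *v \<xi>) = pairing \<xi> (N *v \<eta>)"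
  by (metis pairing_mv pairing_commute transpose_transpose)

text \<open>The number \<open>C x \<xi> y \<eta>\<close>, the pairing of \<open>\<eta>\<close> with
  \<open>[x, \<xi>] y\<close>, is symmetric under exchanging \<open>x\<close> and \<open>y\<close>
  by \<open>moment_swap\<close>, and under exchanging both pairs at once because \<open>Om\<close>
  commutes with transposition. Together these allow the exchange of \<open>\<xi>\<close> and
  \<open>\<eta>\<close>.\<close>

lemma moment_swap_transpose:
  assumes "x \<in> X" "\<xi> \<in> X" "\<eta> \<in> X"
  shows "transpose (fst (moment x \<xi>)) *v \<eta> + snd (moment x \<xi>) *s \<eta>
       = transpose (fst (moment x \<eta>)) *v \<xi> + snd (moment x \<eta>) *s \<xi>" (is "?l = ?r")
proof -
  define C where "C x \<xi> y \<eta> = pairing \<eta> (fst (moment x \<xi>) *v y + snd (moment x \<xi>) *s y)" for x \<xi> y \<eta>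
  have C: "C x \<xi> y \<eta> = 2 * pairing \<xi> x * pairing \<eta> y - 1/2 * pairing \<xi> (Om (Om (outer x y)) *v \<eta>)" for x \<xi> y \<eta>
    by (simp add: C_def moment_mv pairing_simps pairing_transpose)
  have Csym: "C x \<xi> y \<eta> = C y \<eta> x \<xi>" for x \<xi> y \<eta>
  proof -
    have "outer y x = transpose (outer x y)" by (simp add: outer_def transpose_def vec_eq_iff)
    then have "Om (Om (outer y x)) = transpose (Om (Om (outer x y)))" by (simp only: Om_transpose)
    then show ?thesis unfolding C by (simp add: pairing_transpose)
  qed
  have Csw: "C x \<xi> y \<eta> = C y \<xi> x \<eta>" if "x \<in> X" "y \<in> X" "\<xi> \<in> X" for x \<xi> y \<eta>
    unfolding C_def moment_swap[OF that] ..
  have l: "pairing y (transpose (fst (moment x \<xi>)) *v \<eta> + snd (moment x \<xi>) *s \<eta>) = C x \<xi> y \<eta>" for y \<xi> \<eta>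
    by (simp add: C_def pairing_simps pairing_transpose pairing_commute[of \<eta> y])
  have lX: "?l \<in> X" "?r \<in> X" using assms by (auto intro!: X_add X_scale soA_X soA_transpose moment_soA)
  have "?l $ I = ?r $ I" for I
  proof (cases "even (card I)")
    case False then show ?thesis using lX by (simp add: X_def)
  next
    case True
    let ?y = "axis I 1 :: spinor"
    have y: "?y \<in> X" using True by (simp add: X_axis)
    have "C x \<xi> ?y \<eta> = C x \<eta> ?y \<xi>"
      using Csym[of x \<xi> ?y \<eta>] Csw[OF y assms(1,3)] by simp
    then show ?thesis unfolding l[symmetric] pairing_axis .
  qed
  then show ?thesis by (simp add: vec_eq_iff)
qed

text \<open>Commutation with \<open>spin_gen a b\<close> acts on Clifford vectors as an
  infinitesimal rotation in the plane of \<open>a\<close> and \<open>b\<close>; this is the vector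
  representation of so(10).\<close>

lemma spin_gen_gamma:
  "spin_gen a b *v (gamma v *v z) = gamma (polar b v *s a - polar a v *s b) *v z + gamma v *v (spin_gen a b *v z)"
proof -
  have "gamma a *v (gamma b *v (gamma v *v z)) = polar b v *s (gamma a *v z) - (polar a v *s (gamma b *v z) - gamma v *v (gamma a *v (gamma b *v z)))"
    by (subst gamma_swap[of b v], simp add: matrix_vector_mult_diff_distrib vector_scalar_commute, subst gamma_swap[of a v]) simp
  then show ?thesis
    by (simp add: spin_gen_mv gamma_linear matrix_vector_mult_diff_distrib matrix_vector_mult_diff_rdistrib vector_scalar_commute)
qed

lemma spin_gen_commutator:
  fixes a b v w
  defines "ad \<equiv> \<lambda>v. polar b v *s a - polar a v *s b"
  shows "spin_gen a b ** spin_gen v w - spin_gen v w ** spin_gen a b = spin_gen (ad v) w + spin_gen v (ad w)"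
proof -
  have "polar (ad v) w + polar v (ad w) = 0"
    by (simp add: ad_def polar_simps polar_commute)
  then have p: "polar (ad v) w = - polar v (ad w)" by (simp add: add_eq_0_iff2)
  have g: "spin_gen a b *v (gamma v *v z) = gamma (ad v) *v z + gamma v *v (spin_gen a b *v z)" for v z
    unfolding ad_def by (rule spin_gen_gamma)
  show ?thesis
    unfolding matrix_eq matrix_vector_mult_diff_rdistrib matrix_vector_mult_add_rdistrib matrix_vector_mul_assoc[symmetric]
    by (simp add: spin_gen_mv[of v] spin_gen_mv[of _ w] spin_gen_mv[of v "ad w"] g matrix_vector_mult_diff_distrib
       matrix_vector_right_distrib vector_scalar_commute p)
qed

lemma matrix_diff_distrib: "(A - B) ** C = A ** C - B ** (C :: complex ^ 'n ^ 'm)"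
  "A ** (C - D) = A ** C - A ** (D :: complex ^ 'n ^ 'm)"
  by (simp_all add: matrix_eq matrix_vector_mul_assoc[symmetric] matrix_vector_mult_diff_rdistrib matrix_vector_mult_diff_distrib)

lemma soA_commutator: "A \<in> soA \<Longrightarrow> B \<in> soA \<Longrightarrow> A ** B - B ** A \<in> soA"
proof (induction A rule: soA_induct)
  case zero then show ?case by simp
next
  case (gen v w k)
  then show ?case
  proof (induction B rule: soA_induct)
    case zero then show ?case by simp
  next
    case (gen v' w' k')
    have "cmat k (spin_gen v w) ** cmat k' (spin_gen v' w') - cmat k' (spin_gen v' w') ** cmat k (spin_gen v w)
      = cmat (k * k') (spin_gen v w ** spin_gen v' w' - spin_gen v' w' ** spin_gen v w)"
      by (simp add: mat.scale_right_diff_distrib mult.commute)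
    then show ?case unfolding spin_gen_commutator by (simp add: soA_scale soA_add soA_gen)
  next
    case (add A B)
    have "cmat k (spin_gen v w) ** (A + B) - (A + B) ** cmat k (spin_gen v w)
     = (cmat k (spin_gen v w) ** A - A ** cmat k (spin_gen v w)) + (cmat k (spin_gen v w) ** B - B ** cmat k (spin_gen v w))"
      by (simp only: matrix_add_ldistrib matrix_add_rdistrib') simp
    then show ?case using add by (simp only: soA_add)
  qed
next
  case (add A C)
  have "(A + C) ** B - B ** (A + C) = (A ** B - B ** A) + (C ** B - B ** C)"
    by (simp only: matrix_add_ldistrib matrix_add_rdistrib') simp
  then show ?case using add by (simp only: soA_add)
qed

section \<open>The graded pieces and the bracket of E6\<close>

lemma e6_deg_0: "e6_deg 0 = {deg0 (A, c) | A c. A \<in> soA}"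
proof -
  have e: "e6_deg 0 = e6.span ({deg0 (spin_gen v w, 0) | v w. True} \<union> {deg0 (0, 1)})"
    by (simp add: e6_deg_def)
  have sub: "e6.subspace {deg0 (A, c) | A c. A \<in> soA}"
    unfolding e6.subspace_def
  proof (intro conjI ballI allI)
    show "0 \<in> {deg0 (A, c) | A c. A \<in> soA}"
      by (intro CollectI exI[of _ 0]) (simp add: deg0_def zero_prod_def)
  next
    fix x y assume "x \<in> {deg0 (A, c) | A c. A \<in> soA}" "y \<in> {deg0 (A, c) | A c. A \<in> soA}"
    then obtain A c B d where "x = deg0 (A, c)" "y = deg0 (B, d)" "A \<in> soA" "B \<in> soA" by blast
    then show "x + y \<in> {deg0 (A, c) | A c. A \<in> soA}"
      by (intro CollectI exI[of _ "A + B"] exI[of _ "c + d"]) (simp add: deg0_def soA_add)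
  next
    fix k x assume "x \<in> {deg0 (A, c) | A c. A \<in> soA}"
    then obtain A c where "x = deg0 (A, c)" "A \<in> soA" by blast
    then show "e6_scale k x \<in> {deg0 (A, c) | A c. A \<in> soA}"
      by (intro CollectI exI[of _ "cmat k A"] exI[of _ "k * c"]) (simp add: deg0_def soA_scale e6_scale_pair)
  qed
  have "{deg0 (spin_gen v w, 0) | v w. True} \<union> {deg0 (0, 1)} \<subseteq> {deg0 (A, c) | A c. A \<in> soA}"
    using soA_gen soA_zero by blast
  then have "e6_deg 0 \<subseteq> {deg0 (A, c) | A c. A \<in> soA}"
    unfolding e by (rule e6.span_minimal[OF _ sub])
  moreover have "deg0 (A, c) \<in> e6_deg 0" if "A \<in> soA" for A c
  proof -
    have "deg0 (A, 0) \<in> e6_deg 0" using that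
    proof (induction A rule: soA_induct)
      case zero then show ?case unfolding e using e6.span_zero by (simp add: deg0_def zero_prod_def)
    next
      case (gen v w k)
      have "e6_scale k (deg0 (spin_gen v w, 0)) \<in> e6_deg 0" unfolding e
        by (intro e6.span_scale e6.span_base) blast
      then show ?case by (simp add: deg0_def e6_scale_pair)
    next
      case (add A B)
      then have "deg0 (A, 0) + deg0 (B, 0) \<in> e6_deg 0" unfolding e by (intro e6.span_add)
      then show ?case by (simp add: deg0_def)
    qed
    moreover have "e6_scale c (deg0 (0, 1)) \<in> e6_deg 0" unfolding e
      by (intro e6.span_scale e6.span_base) blast
    ultimately have "deg0 (A, 0) + e6_scale c (deg0 (0, 1)) \<in> e6_deg 0" unfolding e by (rule e6.span_add)
    then show ?thesis by (simp add: deg0_def e6_scale_pair)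
  qed
  ultimately show ?thesis by blast
qed

lemma e6_deg_1: "e6_deg 1 = {(0, 0, x) | x. x \<in> X}"
  by (auto simp: e6_deg_def deg1_def)
lemma e6_deg_m1: "e6_deg (- 1) = {(\<xi>, 0, 0) | \<xi>. \<xi> \<in> X}"
  by (simp add: e6_deg_def)
lemma e6_deg_other: "i \<noteq> -1 \<Longrightarrow> i \<noteq> 0 \<Longrightarrow> i \<noteq> 1 \<Longrightarrow> e6_deg i = {0}"
  by (simp add: e6_deg_def)

lemma e6_iff: "(\<xi>, (A, c), x) \<in> e6 \<longleftrightarrow> \<xi> \<in> X \<and> A \<in> soA \<and> x \<in> X"
proof
  let ?E = "{(\<xi>, (A, c :: complex), x) | \<xi> A c x. \<xi> \<in> X \<and> A \<in> soA \<and> x \<in> X}"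
  have sub: "e6.subspace ?E"
    unfolding e6.subspace_def
    by (auto simp: zero_prod_def X_add soA_add e6_scale_pair X_scale soA_scale)
  have "e6_deg i \<subseteq> ?E" for i
  proof -
    consider "i = -1" | "i = 0" | "i = 1" | "i \<noteq> -1" "i \<noteq> 0" "i \<noteq> 1" by blast
    then show ?thesis
      by cases (auto simp: e6_deg_0 e6_deg_1 e6_deg_m1 e6_deg_other deg0_def zero_prod_def)
  qed
  then have "e6 \<subseteq> ?E" unfolding e6_def by (intro e6.span_minimal sub) blast
  then show "(\<xi>, (A, c), x) \<in> e6 \<Longrightarrow> \<xi> \<in> X \<and> A \<in> soA \<and> x \<in> X" by blast
next
  assume a: "\<xi> \<in> X \<and> A \<in> soA \<and> x \<in> X"
  have "(\<xi>, 0, 0) \<in> e6_deg (-1)" "deg0 (A, c) \<in> e6_deg 0" "(0, 0, x) \<in> e6_deg 1"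
    using a by (auto simp: e6_deg_0 e6_deg_1 e6_deg_m1)
  then have "(\<xi>, 0, 0) + deg0 (A, c) + (0, 0, x) \<in> e6"
    unfolding e6_def by (intro e6.span_add e6.span_base) blast+
  then show "(\<xi>, (A, c), x) \<in> e6" by (simp add: deg0_def)
qed

lemma e6_br_pair: "e6_br a b =
   ((transpose (fst (fst (snd b))) *v fst a + snd (fst (snd b)) *s fst a) - (transpose (fst (fst (snd a))) *v fst b + snd (fst (snd a)) *s fst b),
    (fst (fst (snd a)) ** fst (fst (snd b)) - fst (fst (snd b)) ** fst (fst (snd a)), 0) + moment (snd (snd a)) (fst b) - moment (snd (snd b)) (fst a),
    (fst (fst (snd a)) *v snd (snd b) + snd (fst (snd a)) *s snd (snd b)) - (fst (fst (snd b)) *v snd (snd a) + snd (fst (snd b)) *s snd (snd a)))"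
proof -
  obtain \<xi> A c x \<eta> B d y where "a = (\<xi>, (A, c), x)" "b = (\<eta>, (B, d), y)" by (metis prod.exhaust)
  then show ?thesis by simp
qed

lemma e6_br_add_left: "e6_br (a + a') b = e6_br a b + e6_br a' b"
  by (simp add: e6_br_pair prod_eq_iff transpose_add matrix_vector_mult_add_rdistrib matrix_vector_right_distrib
      matrix_add_ldistrib matrix_add_rdistrib' moment_add_left moment_add_right vec.scale_left_distrib vec.scale_right_distrib algebra_simps pairing_simps)

lemma e6_br_antisym: "e6_br a b = - e6_br b a"
  by (simp add: e6_br_pair prod_eq_iff)

lemma e6_br_add_right: "e6_br a (b + b') = e6_br a b + e6_br a b'"
  using e6_br_antisym[of a] e6_br_add_left[of b b' a] by simp

lemma e6_br_scale_left: "e6_br (e6_scale k a) b = e6_scale k (e6_br a b)"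
  by (simp add: e6_br_pair prod_eq_iff e6_scale_pair transpose_cmat vector_scalar_commute
      fst_moment_scale vec.scale_right_diff_distrib vec.scale_right_distrib mat.scale_right_diff_distrib mat.scale_right_distrib
      pairing_simps) (simp add: algebra_simps vec_eq_iff)

lemma e6_br_scale_right: "e6_br a (e6_scale k b) = e6_scale k (e6_br a b)"
  using e6_br_antisym[of a] e6_br_scale_left[of k b a] by (simp add: e6.scale_minus_right)

lemma e6_br_zero [simp]: "e6_br 0 b = 0" "e6_br a 0 = 0"
  using e6_br_scale_left[of 0 0 b] e6_br_scale_right[of a 0 0] by simp_all

lemma e6_br_closed: "a \<in> e6 \<Longrightarrow> b \<in> e6 \<Longrightarrow> e6_br a b \<in> e6"
proof -
  obtain \<xi> A c x \<eta> B d y where ab: "a = (\<xi>, (A, c), x)" "b = (\<eta>, (B, d), y)" by (metis prod.exhaust)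
  assume "a \<in> e6" "b \<in> e6"
  then have h: "\<xi> \<in> X" "A \<in> soA" "x \<in> X" "\<eta> \<in> X" "B \<in> soA" "y \<in> X" by (auto simp: ab e6_iff)
  have "(\<xi>', u, x') \<in> e6 \<longleftrightarrow> \<xi>' \<in> X \<and> fst u \<in> soA \<and> x' \<in> X" for \<xi>' u x'
    by (cases u) (simp add: e6_iff)
  then show ?thesis using h
    by (simp add: ab) (intro conjI X_add X_diff X_scale soA_X soA_transpose soA_add soA_diff soA_commutator moment_soA; assumption)
qed

text \<open>The identity is split by the component of the result. Degrees 1 and -1 need the two
  exchange lemmas for \<open>moment\<close>, the matrix part of degree 0 needs its infinitesimal
  equivariance, and the scalar part needs only the adjointness of \<open>transpose\<close> under
  \<open>pairing\<close>.\<close>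

lemma e6_jacobi:
  assumes "a \<in> e6" "b \<in> e6" "c \<in> e6"
  shows "e6_br a (e6_br b c) + e6_br b (e6_br c a) + e6_br c (e6_br a b) = 0"
proof -
  obtain \<xi> A k x \<eta> B l y \<zeta> C m z where abc: "a = (\<xi>, (A, k), x)" "b = (\<eta>, (B, l), y)" "c = (\<zeta>, (C, m), z)"
    by (metis prod.exhaust)
  have h: "\<xi> \<in> X" "A \<in> soA" "x \<in> X" "\<eta> \<in> X" "B \<in> soA" "y \<in> X" "\<zeta> \<in> X" "C \<in> soA" "z \<in> X"
    using assms by (auto simp: abc e6_iff)
  let ?M = "\<lambda>x \<xi>. fst (moment x \<xi>)"
  have D: "?M (S *v u) \<omega> = S ** ?M u \<omega> - ?M u \<omega> ** S + ?M u (transpose S *v \<omega>)" if "S \<in> soA" for S u \<omega>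
    using moment_derivation[OF soA_Om_derivation[OF that], of u \<omega>] by (simp add: algebra_simps)
  have S: "?M u \<omega> *v v = ?M v \<omega> *v u + snd (moment v \<omega>) *s u - snd (moment u \<omega>) *s v"
    if "u \<in> X" "v \<in> X" "\<omega> \<in> X" for u v \<omega>
    using moment_swap[OF that] by (simp add: algebra_simps)
  have St: "transpose (?M u \<omega>) *v \<psi> = transpose (?M u \<psi>) *v \<omega> + snd (moment u \<psi>) *s \<omega> - snd (moment u \<omega>) *s \<psi>"
    if "u \<in> X" "\<omega> \<in> X" "\<psi> \<in> X" for u \<psi> \<omega>
    using moment_swap_transpose[OF that] by (simp add: algebra_simps)
  note ms = matrix_vector_mult_diff_rdistrib matrix_vector_mult_add_rdistrib matrix_vector_mul_assoc[symmetric]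
      matrix_vector_mult_diff_distrib matrix_vector_right_distrib vector_scalar_commute
      transpose_add transpose_diff matrix_transpose_mul
  have 3: "snd (snd (e6_br a (e6_br b c) + e6_br b (e6_br c a) + e6_br c (e6_br a b))) = 0"
    unfolding abc e6_br_pair fst_conv snd_conv fst_add snd_add fst_diff snd_diff ms
    unfolding S[OF h(3,6,7)] S[OF h(9,3,4)] S[OF h(6,9,1)]
    by (simp add: vec_eq_iff algebra_simps)
  have 1: "fst (e6_br a (e6_br b c) + e6_br b (e6_br c a) + e6_br c (e6_br a b)) = 0"
    unfolding abc e6_br_pair fst_conv snd_conv fst_add snd_add fst_diff snd_diff ms
    unfolding St[OF h(3,4,7)] St[OF h(9,1,4)] St[OF h(6,1,7)]
    by (simp add: vec_eq_iff algebra_simps)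
  have 22: "snd (fst (snd (e6_br a (e6_br b c) + e6_br b (e6_br c a) + e6_br c (e6_br a b)))) = 0"
    unfolding abc e6_br_pair fst_conv snd_conv fst_add snd_add fst_diff snd_diff ms
    by (simp add: pairing_simps pairing_mv algebra_simps)
  have 21: "fst (fst (snd (e6_br a (e6_br b c) + e6_br b (e6_br c a) + e6_br c (e6_br a b)))) = 0"
  proof -
    have "fst (fst (snd (e6_br a (e6_br b c) + e6_br b (e6_br c a) + e6_br c (e6_br a b)))) *v v = 0" for v
      unfolding abc e6_br_pair fst_conv snd_conv fst_add snd_add fst_diff snd_diff moment_add_left moment_add_right
        moment_diff_left moment_diff_right fst_moment_scale
      unfolding D[OF h(2)] D[OF h(5)] D[OF h(8)] ms
      by (simp add: vec_eq_iff algebra_simps)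
    then show ?thesis by (simp add: matrix_eq)
  qed
  from 1 3 21 22 show ?thesis by (simp add: prod_eq_iff)
qed

interpretation e6: lie_algebra e6_scale e6 e6_br
proof
  show "e6.subspace e6" unfolding e6_def by (rule e6.subspace_span)
  show "e6_br x x = 0" for x
    using e6_br_antisym[of x x] e6.scale_cancel_left[of 2 "e6_br x x" 0]
    by (simp add: e6_br_pair prod_eq_iff)
qed (simp_all add: e6_br_closed e6_br_add_left e6_br_add_right e6_br_scale_left e6_br_scale_right e6_jacobi)

text \<open>The adjoint action of \<open>(s, c)\<close> on the graded algebra, where
  \<open>s'\<close> is meant to be the inverse of \<open>s\<close>; the dual piece carries the
  contragredient action.\<close>

fun e6_Ad :: "spinor_mat \<Rightarrow> spinor_mat \<Rightarrow> complex \<Rightarrow> e6_vec \<Rightarrow> e6_vec" where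
  "e6_Ad s s' c (\<xi>, (A, d), x) = ((1 / c) *s (transpose s' *v \<xi>), (s ** A ** s', d), c *s (s *v x))"

lemma e6_Ad_pair: "e6_Ad s s' c a = ((1 / c) *s (transpose s' *v fst a),
   (s ** fst (fst (snd a)) ** s', snd (fst (snd a))), c *s (s *v snd (snd a)))"
  by (metis e6_Ad.simps prod.collapse)

lemma e6_Ad_br:
  assumes Om: "\<And>M. Om (s ** M ** transpose s) = s ** Om M ** transpose s"
    and s: "s ** s' = mat 1" "s' ** s = mat 1" and c: "c \<noteq> 0"
  shows "e6_br (e6_Ad s s' c a) (e6_Ad s s' c b) = e6_Ad s s' c (e6_br a b)"
proof -
  have ss: "s' *v (s *v x) = x" "transpose s *v (transpose s' *v x) = x" for x
    by (simp_all add: matrix_vector_mul_assoc s matrix_transpose_mul[symmetric])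
  note M = moment_equivariant[OF Om s]
  have mm: "s ** A ** s' ** (s ** B ** s') = s ** (A ** B) ** s'" for A B
  proof -
    have "s ** A ** s' ** (s ** B ** s') = s ** A ** (s' ** s) ** B ** s'" by (simp only: matrix_mul_assoc)
    then show ?thesis by (simp add: s matrix_mul_assoc)
  qed
  show ?thesis unfolding e6_br_pair e6_Ad_pair fst_conv snd_conv prod_eq_iff fst_add snd_add fst_diff snd_diff
    by (simp add: fst_moment_scale pairing_simps M c mm ss matrix_transpose_mul
       matrix_vector_mul_assoc[symmetric] matrix_diff_distrib matrix_add_ldistrib matrix_add_rdistrib'
       vector_scalar_commute matrix_vector_mult_diff_distrib matrix_vector_right_distrib)
       (simp add: vec_eq_iff algebra_simps c)
qed

lemma e6_Ad_add: "e6_Ad s s' c (a + b) = e6_Ad s s' c a + e6_Ad s s' c b"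
  by (simp add: e6_Ad_pair prod_eq_iff matrix_vector_right_distrib vec.scale_right_distrib matrix_add_ldistrib matrix_add_rdistrib')

lemma e6_Ad_scale: "e6_Ad s s' c (e6_scale k a) = e6_scale k (e6_Ad s s' c a)"
  by (simp add: e6_Ad_pair e6_scale_pair prod_eq_iff vector_scalar_commute)

section \<open>Weight decompositions and root data\<close>

text \<open>Lagrange interpolation on joint eigenvalues: a property stable under linear combinations
  and under multiplication by each \<open>\<theta> T\<close> survives multiplication by a polynomial
  in them that is 1 at the joint eigenvalue of \<open>l\<close> and 0 at the finitely many others.
  \<open>P\<close> is kept abstract because it will mean membership in a subspace in one place and
  the vanishing of a sum of characters in another.\<close>

lemma weight_multiplier:
  fixes P :: "('k \<Rightarrow> complex) \<Rightarrow> bool" and \<theta> :: "'t \<Rightarrow> 'k \<Rightarrow> complex"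
  assumes add: "\<And>c d. P c \<Longrightarrow> P d \<Longrightarrow> P (\<lambda>k. c k + d k)"
    and scale: "\<And>a c. P c \<Longrightarrow> P (\<lambda>k. a * c k)"
    and mult: "\<And>T c. T \<in> F \<Longrightarrow> P c \<Longrightarrow> P (\<lambda>k. \<theta> T k * c k)"
    and "finite K" and c: "P c"
  shows "\<exists>m. P (\<lambda>k. m k * c k) \<and> (\<forall>k. (\<forall>T\<in>F. \<theta> T k = \<theta> T l) \<longrightarrow> m k = 1)
          \<and> (\<forall>k\<in>K. \<not> (\<forall>T\<in>F. \<theta> T k = \<theta> T l) \<longrightarrow> m k = 0)"
  using \<open>finite K\<close>
proof (induction K)
  case empty
  show ?case using c by (intro exI[of _ "\<lambda>_. 1"]) simp
next
  case (insert j K)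
  then obtain m where m: "P (\<lambda>k. m k * c k)" "\<And>k. (\<forall>T\<in>F. \<theta> T k = \<theta> T l) \<Longrightarrow> m k = 1"
     "\<And>k. k \<in> K \<Longrightarrow> \<not> (\<forall>T\<in>F. \<theta> T k = \<theta> T l) \<Longrightarrow> m k = 0" by blast
  show ?case
  proof (cases "\<forall>T\<in>F. \<theta> T j = \<theta> T l")
    case True
    then show ?thesis using m by (intro exI[of _ m]) auto
  next
    case False
    then obtain T where T: "T \<in> F" "\<theta> T j \<noteq> \<theta> T l" by blast
    \<comment> \<open>The linear factor in \<open>\<theta> T\<close> that vanishes at
      \<open>j\<close> and equals 1 wherever \<open>\<theta> T\<close> takes its value at
      \<open>l\<close>.\<close>
    let ?a = "1 / (\<theta> T l - \<theta> T j)"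
    let ?m = "\<lambda>k. ?a * (\<theta> T k - \<theta> T j) * m k"
    have "P (\<lambda>k. ?a * (\<theta> T k * (m k * c k)) + (- ?a * \<theta> T j) * (m k * c k))"
      by (intro add scale mult T(1) m(1))
    moreover have "(\<lambda>k. ?a * (\<theta> T k * (m k * c k)) + (- ?a * \<theta> T j) * (m k * c k)) = (\<lambda>k. ?m k * c k)"
      by (simp add: algebra_simps diff_divide_distrib)
    ultimately have "P (\<lambda>k. ?m k * c k)" by simp
    moreover have "?m k = 1" if "\<forall>T\<in>F. \<theta> T k = \<theta> T l" for k
      using that T m(2)[OF that] by simp
    moreover have "?m k = 0" if "k \<in> insert j K" "\<not> (\<forall>T\<in>F. \<theta> T k = \<theta> T l)" for k
      using that m(3) by auto
    ultimately show ?thesis by (intro exI[of _ ?m]) blast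
  qed
qed

lemma (in vector_space) subspace_mem_sum_scale:
  assumes "subspace J" shows "(\<Sum>k\<in>K. scale (c k) (z k)) \<in> J \<Longrightarrow> (\<Sum>k\<in>K. scale (d k) (z k)) \<in> J
     \<Longrightarrow> (\<Sum>k\<in>K. scale (c k + d k) (z k)) \<in> J"
    "(\<Sum>k\<in>K. scale (c k) (z k)) \<in> J \<Longrightarrow> (\<Sum>k\<in>K. scale (a * c k) (z k)) \<in> J"
  using assms by (auto simp: scale_left_distrib sum.distrib scale_sum_right[symmetric] scale_scale[symmetric]
      simp del: scale_scale intro: subspace_add subspace_scale)

text \<open>A stable subspace contains the joint eigencomponents of its elements. Stability is
  expressed through coefficients, so the family \<open>F\<close> need not consist of operators on
  the space.\<close>

lemma weight_component_mem:
  fixes scale :: "complex \<Rightarrow> 'a \<Rightarrow> 'a::ab_group_add" and \<theta> :: "'t \<Rightarrow> 'k \<Rightarrow> complex"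
  assumes "vector_space scale" and J: "module.subspace scale J" and K: "finite K"
    and stable: "\<And>T c. T \<in> F \<Longrightarrow> (\<Sum>k\<in>K. scale (c k) (z k)) \<in> J \<Longrightarrow> (\<Sum>k\<in>K. scale (\<theta> T k * c k) (z k)) \<in> J"
    and mem: "(\<Sum>k\<in>K. z k) \<in> J"
  shows "(\<Sum>k | k \<in> K \<and> (\<forall>T\<in>F. \<theta> T k = \<theta> T l). z k) \<in> J"
proof -
  interpret vector_space scale by fact
  let ?P = "\<lambda>c. (\<Sum>k\<in>K. scale (c k) (z k)) \<in> J"
  have "\<exists>m. ?P (\<lambda>k. m k * 1) \<and> (\<forall>k. (\<forall>T\<in>F. \<theta> T k = \<theta> T l) \<longrightarrow> m k = 1)
          \<and> (\<forall>k\<in>K. \<not> (\<forall>T\<in>F. \<theta> T k = \<theta> T l) \<longrightarrow> m k = 0)"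
    by (rule weight_multiplier[where F = F and P = ?P and \<theta> = \<theta>])
       (use subspace_mem_sum_scale[OF J] stable K mem in auto)
  then obtain m where m: "?P m" "\<And>k. (\<forall>T\<in>F. \<theta> T k = \<theta> T l) \<Longrightarrow> m k = 1"
     "\<And>k. k \<in> K \<Longrightarrow> \<not> (\<forall>T\<in>F. \<theta> T k = \<theta> T l) \<Longrightarrow> m k = 0" by auto
  have "(\<Sum>k\<in>K. scale (m k) (z k)) = (\<Sum>k\<in>K. if \<forall>T\<in>F. \<theta> T k = \<theta> T l then z k else 0)"
    using m(2,3) by (intro sum.cong) auto
  also have "\<dots> = (\<Sum>k | k \<in> K \<and> (\<forall>T\<in>F. \<theta> T k = \<theta> T l). z k)"
    by (simp add: sum.If_cases[OF K] Collect_conj_eq)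
  finally show ?thesis using m(1) by simp
qed

section \<open>General facts on Lie algebras and semisimplicity\<close>

context lie_algebra
begin

lemma br_antisym: "x \<in> L \<Longrightarrow> y \<in> L \<Longrightarrow> br x y = - br y x"
proof -
  assume xy: "x \<in> L" "y \<in> L"
  then have "x + y \<in> L" using subspace_L subspace_add by blast
  then have "br x (x + y) + br y (x + y) = 0" using br_self br_add_left[OF xy] by metis
  then have "br x y + br y x = 0" using xy by (simp add: br_add_right br_self)
  then show ?thesis by (simp add: add_eq_0_iff2)
qed

lemma L_zero: "0 \<in> L" and L_add: "x \<in> L \<Longrightarrow> y \<in> L \<Longrightarrow> x + y \<in> L" and L_scale: "x \<in> L \<Longrightarrow> scale c x \<in> L"
  and L_sum: "(\<And>i. i \<in> S \<Longrightarrow> f i \<in> L) \<Longrightarrow> (\<Sum>i\<in>S. f i) \<in> L"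
  using subspace_L by (auto intro: subspace_0 subspace_add subspace_scale subspace_diff subspace_sum)

lemma br_zero_left: "y \<in> L \<Longrightarrow> br 0 y = 0" and br_zero_right: "y \<in> L \<Longrightarrow> br y 0 = 0"
  using br_scale_left[of 0 y 0] br_scale_right[of y 0 0] L_zero by simp_all

lemma br_sum_right: "x \<in> L \<Longrightarrow> (\<And>i. i \<in> S \<Longrightarrow> f i \<in> L) \<Longrightarrow> br x (\<Sum>i\<in>S. f i) = (\<Sum>i\<in>S. br x (f i))"
  by (induction S rule: infinite_finite_induct) (simp_all add: br_zero_right br_add_right L_sum)

lemma br_br: "x \<in> L \<Longrightarrow> a \<in> L \<Longrightarrow> b \<in> L \<Longrightarrow> br x (br a b) = br (br x a) b + br a (br x b)"
proof -
  assume h: "x \<in> L" "a \<in> L" "b \<in> L"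
  have "br x (br a b) + br a (br b x) + br b (br x a) = 0" using h by (rule jacobi)
  moreover have "br b (br x a) = - br (br x a) b" using h by (intro br_antisym br_closed)
  moreover have "br a (br b x) = - br a (br x b)"
    using h br_antisym[of b x] br_scale_right[of a "br x b" "-1"] by (simp add: br_closed)
  ultimately show ?thesis by (simp add: algebra_simps)
qed

lemma bracket_span_ideal: "lie_ideal A \<Longrightarrow> lie_ideal (bracket_span A A)"
proof -
  assume A: "lie_ideal A"
  then have AL: "A \<subseteq> L" "\<And>x y. x \<in> L \<Longrightarrow> y \<in> A \<Longrightarrow> br x y \<in> A" unfolding lie_ideal_def by auto
  let ?S = "{br x y | x y. x \<in> A \<and> y \<in> A}"
  have SL: "?S \<subseteq> L" using AL br_closed by blast
  have sp: "span ?S \<subseteq> L" by (rule span_minimal[OF SL subspace_L])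
  have "y \<in> L \<and> br x y \<in> span ?S" if x: "x \<in> L" and y: "y \<in> span ?S" for x y
    using y
  proof (induction rule: span_induct_alt)
    case base show ?case by (simp add: br_zero_right x span_zero L_zero)
  next
    case (step c s y)
    then obtain a b where s: "s = br a b" "a \<in> A" "b \<in> A" by blast
    then have sL: "s \<in> L" using SL by blast
    have "br x s = br (br x a) b + br a (br x b)" using x AL s by (auto intro: br_br)
    moreover have "br (br x a) b \<in> span ?S" "br a (br x b) \<in> span ?S"
      using s AL(2)[OF x] by (intro span_base; blast)+
    ultimately have "br x s \<in> span ?S" by (simp add: span_add)
    moreover have "br x (scale c s + y) = scale c (br x s) + br x y"
      using step sL x by (subst br_add_right) (auto simp: br_scale_right L_scale)
    ultimately show ?case using step sL by (auto intro: span_add span_scale L_add L_scale)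
  qed
  then show ?thesis using sp unfolding lie_ideal_def bracket_span_def by auto
qed

lemma derived_series_ideal: "lie_ideal J \<Longrightarrow> lie_ideal (derived_series J k)"
  by (induction k) (auto intro: bracket_span_ideal)

text \<open>The last nonzero term of the derived series of a solvable ideal is an abelian ideal, so
  it is enough to exclude the abelian ones.\<close>

lemma semisimpleI:
  assumes "\<And>J. lie_ideal J \<Longrightarrow> (\<And>x y. x \<in> J \<Longrightarrow> y \<in> J \<Longrightarrow> br x y = 0) \<Longrightarrow> J = {0}"
  shows semisimple
  unfolding semisimple_def
proof (intro allI impI, elim conjE exE)
  fix J k assume J: "lie_ideal J" "derived_series J k = {0}"
  then show "J = {0}"
  proof (induction k)
    case (Suc k)
    let ?D = "derived_series J k"
    have D: "lie_ideal ?D" using Suc.prems by (intro derived_series_ideal)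
    have "?D = {0}"
    proof (rule assms[OF D])
      fix x y assume "x \<in> ?D" "y \<in> ?D"
      then have "br x y \<in> bracket_span ?D ?D" unfolding bracket_span_def by (intro span_base) blast
      then show "br x y = 0" using Suc.prems(2) by simp
    qed
    then show ?case using Suc by blast
  qed simp
qed

end

text \<open>An abelian subalgebra together with finitely many root vectors of distinct nonzero
  weights that span the algebra with it. This is enough to identify the Cartan subalgebra, the roots
  and the root spaces; it is instantiated for E6 and for the sums of copies of sl(2).\<close>

locale root_datum = lie_algebra scale L br
  for scale :: "complex \<Rightarrow> 'a \<Rightarrow> 'a::ab_group_add" and L br +
  fixes hh :: "'a set" and K :: "'k set" and wt :: "'k \<Rightarrow> 'a \<Rightarrow> complex" and e :: "'k \<Rightarrow> 'a"
  assumes hh_sub: "hh \<subseteq> L" and hh_subspace: "subspace hh"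
    and hh_abelian: "x \<in> hh \<Longrightarrow> y \<in> hh \<Longrightarrow> br x y = 0"
    and K_finite: "finite K"
    and wt_linear: "k \<in> K \<Longrightarrow> linear_form_on hh (wt k)"
    and wt_nz: "k \<in> K \<Longrightarrow> wt k \<noteq> (\<lambda>x. 0)"
    and wt_inj: "inj_on wt K"
    and e_root: "k \<in> K \<Longrightarrow> e k \<in> root_space hh (wt k)"
    and e_nz: "k \<in> K \<Longrightarrow> e k \<noteq> 0"
    and L_span: "L \<subseteq> span (hh \<union> e ` K)"
begin

lemma eL: "k \<in> K \<Longrightarrow> e k \<in> L"
  using e_root unfolding root_space_def by auto

lemma br_e: "k \<in> K \<Longrightarrow> h \<in> hh \<Longrightarrow> br h (e k) = scale (wt k h) (e k)"
  using e_root unfolding root_space_def by auto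

lemma decomp:
  assumes "x \<in> L"
  obtains h c where "h \<in> hh" "x = h + (\<Sum>k\<in>K. scale (c k) (e k))"
proof -
  have "x \<in> span (hh \<union> e ` K)" using assms L_span by blast
  then have "\<exists>h c. h \<in> hh \<and> x = h + (\<Sum>k\<in>K. scale (c k) (e k))"
  proof (induction rule: span_induct_alt)
    case base show ?case using subspace_0[OF hh_subspace]
      by (intro exI[of _ 0] exI[of _ "\<lambda>_. 0"]) simp
  next
    case (step a s y)
    then obtain h c where hc: "h \<in> hh" "y = h + (\<Sum>k\<in>K. scale (c k) (e k))" by blast
    from step(1) show ?case
    proof
      assume "s \<in> hh"
      then have "scale a s + h \<in> hh" using hc hh_subspace by (intro subspace_add subspace_scale)
      then show ?case using hc by (intro exI[of _ "scale a s + h"] exI[of _ c]) simp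
    next
      assume "s \<in> e ` K"
      then obtain j where j: "j \<in> K" "s = e j" by blast
      have "(\<Sum>k\<in>K. scale (c k + (if k = j then a else 0)) (e k))
         = (\<Sum>k\<in>K. scale (c k) (e k)) + (\<Sum>k\<in>K. if k = j then scale a (e k) else 0)"
        by (simp add: scale_left_distrib sum.distrib if_distrib[of "\<lambda>z. scale z _"] cong: if_cong)
      also have "\<dots> = (\<Sum>k\<in>K. scale (c k) (e k)) + scale a s" using j K_finite by simp
      finally show ?case using hc
        by (intro exI[of _ h] exI[of _ "\<lambda>k. c k + (if k = j then a else 0)"]) (simp add: algebra_simps)
    qed
  qed
  then show thesis using that by blast
qed

lemma br_decomp: "h \<in> hh \<Longrightarrow> h' \<in> hh \<Longrightarrow>
    br h (h' + (\<Sum>k\<in>K. scale (c k) (e k))) = (\<Sum>k\<in>K. scale (wt k h * c k) (e k))"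
  using hh_sub by (subst br_add_right) (auto intro!: L_sum L_scale eL sum.cong
     simp: hh_abelian br_sum_right br_scale_right L_scale eL br_e mult.commute)

lemma wt_eqI: "k \<in> K \<Longrightarrow> linear_form_on hh \<beta> \<Longrightarrow> (\<And>h. h \<in> hh \<Longrightarrow> wt k h = \<beta> h) \<Longrightarrow> wt k = \<beta>"
  using wt_linear[of k] unfolding linear_form_on_def by (metis ext)

lemma wt_nz': "k \<in> K \<Longrightarrow> \<exists>h\<in>hh. wt k h \<noteq> 0"
  using wt_linear[of k] wt_nz[of k] unfolding linear_form_on_def by (metis ext)

lemma stable_components:
  assumes J: "subspace J" and st: "\<And>h x. h \<in> hh \<Longrightarrow> x \<in> J \<Longrightarrow> br h x \<in> J"
    and h: "h \<in> hh" and x: "h + (\<Sum>k\<in>K. scale (c k) (e k)) \<in> J"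
  shows "h \<in> J" "k \<in> K \<Longrightarrow> scale (c k) (e k) \<in> J"
proof -
  \<comment> \<open>The index \<open>None\<close> stands for the component in \<open>hh\<close>,
    whose weight is zero.\<close>
  let ?K = "insert None (Some ` K)"
  define z where "z = (\<lambda>k. case k of None \<Rightarrow> h | Some k \<Rightarrow> scale (c k) (e k))"
  define \<theta> where "\<theta> = (\<lambda>T k. case k of None \<Rightarrow> 0 | Some k \<Rightarrow> wt k T)"
  have S: "(\<Sum>k\<in>?K. scale (d k) (z k)) = scale (d None) h + (\<Sum>k\<in>K. scale (d (Some k) * c k) (e k))" for d
    using K_finite by (simp add: z_def sum.reindex)
  have vs: "vector_space scale" by unfold_locales
  have m: "(\<Sum>k | k \<in> ?K \<and> (\<forall>T\<in>hh. \<theta> T k = \<theta> T l). z k) \<in> J" for l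
  proof (rule weight_component_mem[OF vs J])
    show "finite ?K" using K_finite by simp
    show "sum z ?K \<in> J" using S[of "\<lambda>_. 1"] x by simp
  next
    fix T d assume T: "T \<in> hh" and d: "(\<Sum>k\<in>?K. scale (d k) (z k)) \<in> J"
    have "br T (scale (d None) h + (\<Sum>k\<in>K. scale (d (Some k) * c k) (e k))) \<in> J"
      using st[OF T d] unfolding S .
    also have "br T (scale (d None) h + (\<Sum>k\<in>K. scale (d (Some k) * c k) (e k)))
        = (\<Sum>k\<in>K. scale (wt k T * (d (Some k) * c k)) (e k))"
      using T h hh_subspace by (intro br_decomp) (auto intro: subspace_scale)
    also have "\<dots> = (\<Sum>k\<in>?K. scale (\<theta> T k * d k) (z k))"
      unfolding S by (simp add: \<theta>_def mult.assoc)
    finally show "(\<Sum>k\<in>?K. scale (\<theta> T k * d k) (z k)) \<in> J" .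
  qed
  have "{k. k \<in> ?K \<and> (\<forall>T\<in>hh. \<theta> T k = \<theta> T None)} = {None}"
    using wt_nz' by (fastforce simp: \<theta>_def)
  then show "h \<in> J" using m[of None] by (simp add: z_def)
  assume k: "k \<in> K"
  have "{j. j \<in> ?K \<and> (\<forall>T\<in>hh. \<theta> T j = \<theta> T (Some k))} = {Some k}"
  proof -
    have "j = k" if "j \<in> K" "\<forall>T\<in>hh. wt j T = wt k T" for j
      using wt_eqI[OF that(1) wt_linear[OF k]] that(2) wt_inj k that(1) by (auto dest: inj_onD)
    then show ?thesis using wt_nz'[OF k] k by (auto simp: \<theta>_def)
  qed
  then show "scale (c k) (e k) \<in> J" using m[of "Some k"] by (simp add: z_def)
qed

text \<open>Directness of the decomposition is the stability of components applied to the zero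
  subspace.\<close>

lemma decomp_zero:
  assumes "h \<in> hh" "h + (\<Sum>k\<in>K. scale (c k) (e k)) = 0"
  shows "h = 0" "k \<in> K \<Longrightarrow> c k = 0"
proof -
  have J: "subspace {0}" by (rule subspace_single_0)
  have st: "\<And>h x. h \<in> hh \<Longrightarrow> x \<in> {0} \<Longrightarrow> br h x \<in> {0}" using hh_sub by (auto simp: br_zero_right)
  show "h = 0" using stable_components(1)[OF J st assms(1), of c] assms(2) by simp
  show "k \<in> K \<Longrightarrow> c k = 0" using stable_components(2)[OF J st assms(1), of c k] assms(2) e_nz[of k] by simp
qed

lemma eigen_decomp:
  assumes h': "h' \<in> hh" and h: "h \<in> hh"
    and eq: "br h (h' + (\<Sum>k\<in>K. scale (c k) (e k))) = scale l (h' + (\<Sum>k\<in>K. scale (c k) (e k)))"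
  shows "scale l h' = 0" "k \<in> K \<Longrightarrow> wt k h * c k = l * c k"
proof -
  have "(\<Sum>k\<in>K. scale (wt k h * c k) (e k)) = scale l h' + (\<Sum>k\<in>K. scale (l * c k) (e k))"
    using eq h h' by (simp add: br_decomp scale_right_distrib scale_sum_right)
  then have z: "scale l h' + (\<Sum>k\<in>K. scale (l * c k - wt k h * c k) (e k)) = 0"
    by (simp add: scale_left_diff_distrib sum_subtractf)
  have hh': "scale l h' \<in> hh" using h' hh_subspace by (intro subspace_scale)
  show "scale l h' = 0" by (rule decomp_zero(1)[OF hh' z])
  show "k \<in> K \<Longrightarrow> wt k h * c k = l * c k" using decomp_zero(2)[OF hh' z, of k] by auto
qed

lemma root_space_decomp:
  assumes h': "h' \<in> hh" and x: "h' + (\<Sum>k\<in>K. scale (c k) (e k)) \<in> root_space hh \<beta>" and h: "h \<in> hh"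
  shows "scale (\<beta> h) h' = 0" "k \<in> K \<Longrightarrow> wt k h * c k = \<beta> h * c k"
proof -
  have "br h (h' + (\<Sum>k\<in>K. scale (c k) (e k))) = scale (\<beta> h) (h' + (\<Sum>k\<in>K. scale (c k) (e k)))"
    using x h unfolding root_space_def by blast
  note eigen_decomp[OF h' h this]
  then show "scale (\<beta> h) h' = 0" "k \<in> K \<Longrightarrow> wt k h * c k = \<beta> h * c k" by blast+
qed

lemma root_space_wt:
  assumes k: "k \<in> K" shows "root_space hh (wt k) = range (\<lambda>c. scale c (e k))"
proof
  show "range (\<lambda>c. scale c (e k)) \<subseteq> root_space hh (wt k)"
    using k hh_sub by (auto simp: root_space_def L_scale eL br_scale_right br_e mult.commute)
  show "root_space hh (wt k) \<subseteq> range (\<lambda>c. scale c (e k))"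
  proof
    fix x assume x: "x \<in> root_space hh (wt k)"
    then have "x \<in> L" unfolding root_space_def by blast
    then obtain h' c where hc: "h' \<in> hh" "x = h' + (\<Sum>k\<in>K. scale (c k) (e k))" by (rule decomp)
    obtain h where "h \<in> hh" "wt k h \<noteq> 0" using wt_nz'[OF k] by blast
    then have h0: "h' = 0" using root_space_decomp(1)[OF hc(1) x[unfolded hc(2)], of h] by simp
    have "c j = 0" if j: "j \<in> K" "j \<noteq> k" for j
    proof (rule ccontr)
      assume "c j \<noteq> 0"
      then have "wt j h = wt k h" if "h \<in> hh" for h
        using root_space_decomp(2)[OF hc(1) x[unfolded hc(2)] that j(1)] by simp
      then have "wt j = wt k" using wt_eqI[OF j(1) wt_linear[OF k]] by blast
      then show False using j k wt_inj by (auto dest: inj_onD)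
    qed
    then have "(\<Sum>j\<in>K. scale (c j) (e j)) = (\<Sum>j\<in>K. if j = k then scale (c k) (e k) else 0)"
      by (intro sum.cong) auto
    also have "\<dots> = scale (c k) (e k)" using k K_finite by simp
    finally show "x \<in> range (\<lambda>c. scale c (e k))" using hc h0 by auto
  qed
qed

lemma roots_eq: "roots hh = wt ` K"
proof
  show "wt ` K \<subseteq> roots hh"
  proof
    fix \<alpha> assume "\<alpha> \<in> wt ` K"
    then obtain k where k: "k \<in> K" "\<alpha> = wt k" by blast
    then have "root_space hh \<alpha> \<noteq> {0}" using e_root e_nz by blast
    then show "\<alpha> \<in> roots hh" using k wt_linear wt_nz unfolding roots_def by auto
  qed
  show "roots hh \<subseteq> wt ` K"
  proof
    fix \<beta> assume b: "\<beta> \<in> roots hh"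
    then have lin: "linear_form_on hh \<beta>" and nz: "\<beta> \<noteq> (\<lambda>x. 0)" and "root_space hh \<beta> \<noteq> {0}"
      unfolding roots_def by auto
    moreover have "0 \<in> root_space hh \<beta>" using hh_sub by (auto simp: root_space_def L_zero br_zero_right)
    ultimately obtain x where x: "x \<in> root_space hh \<beta>" "x \<noteq> 0" by blast
    then have "x \<in> L" unfolding root_space_def by blast
    then obtain h' c where hc: "h' \<in> hh" "x = h' + (\<Sum>k\<in>K. scale (c k) (e k))" by (rule decomp)
    obtain h where "h \<in> hh" "\<beta> h \<noteq> 0" using lin nz unfolding linear_form_on_def by (metis ext)
    then have h0: "h' = 0" using root_space_decomp(1)[OF hc(1) x(1)[unfolded hc(2)], of h] by simp
    obtain k where k: "k \<in> K" "c k \<noteq> 0"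
    proof (rule ccontr)
      assume "\<not> thesis"
      then have "\<And>k. k \<in> K \<Longrightarrow> c k = 0" using that by blast
      then have "(\<Sum>k\<in>K. scale (c k) (e k)) = 0" by (intro sum.neutral) simp
      then show False using hc x(2) h0 by simp
    qed
    then have "wt k h = \<beta> h" if "h \<in> hh" for h
      using root_space_decomp(2)[OF hc(1) x(1)[unfolded hc(2)] that k(1)] by simp
    then have "wt k = \<beta>" using wt_eqI[OF k(1) lin] by blast
    then show "\<beta> \<in> wt ` K" using k by blast
  qed
qed

text \<open>The subalgebra \<open>hh\<close> is abelian, hence nilpotent. If \<open>x\<close>
  normalizes it, then bracketing with an \<open>h\<close> on which \<open>wt k\<close> does not
  vanish shows that the coefficient of \<open>x\<close> at \<open>e k\<close> is zero.\<close>

lemma cartan: "cartan_subalgebra hh"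
  unfolding cartan_subalgebra_def
proof (intro conjI)
  show "hh \<subseteq> L" "subspace hh" by (fact hh_sub hh_subspace)+
  show "\<forall>x\<in>hh. \<forall>y\<in>hh. br x y \<in> hh" using hh_abelian subspace_0[OF hh_subspace] by simp
  have "bracket_span hh hh = {0}"
  proof -
    have "{br x y | x y. x \<in> hh \<and> y \<in> hh} \<subseteq> {0}" using hh_abelian by auto
    then have "span {br x y | x y. x \<in> hh \<and> y \<in> hh} \<subseteq> {0}" by (rule span_minimal) (rule subspace_single_0)
    then show ?thesis unfolding bracket_span_def using span_zero by blast
  qed
  then show "\<exists>k. lower_central_series hh k = {0}" by (intro exI[of _ "Suc 0"]) simp
  show "{x \<in> L. \<forall>y\<in>hh. br x y \<in> hh} = hh"
  proof
    show "hh \<subseteq> {x \<in> L. \<forall>y\<in>hh. br x y \<in> hh}" using hh_sub hh_abelian subspace_0[OF hh_subspace] by auto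
    show "{x \<in> L. \<forall>y\<in>hh. br x y \<in> hh} \<subseteq> hh"
    proof
      fix x assume "x \<in> {x \<in> L. \<forall>y\<in>hh. br x y \<in> hh}"
      then have x: "x \<in> L" "\<And>y. y \<in> hh \<Longrightarrow> br x y \<in> hh" by auto
      obtain h' c where hc: "h' \<in> hh" "x = h' + (\<Sum>k\<in>K. scale (c k) (e k))" using x(1) by (rule decomp)
      have "c k = 0" if k: "k \<in> K" for k
      proof -
        obtain h where h: "h \<in> hh" "wt k h \<noteq> 0" using wt_nz'[OF k] by blast
        have "br h x = - br x h" using h hh_sub x by (intro br_antisym) auto
        then have bh: "br h x \<in> hh" using x(2)[OF h(1)] hh_subspace subspace_neg by metis
        then have m: "- br h x \<in> hh" using hh_subspace subspace_neg by blast
        have "- br h x + (\<Sum>k\<in>K. scale (wt k h * c k) (e k)) = 0"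
          using h hc by (simp add: br_decomp)
        from decomp_zero(2)[OF m this k] show ?thesis using h by simp
      qed
      then have "(\<Sum>k\<in>K. scale (c k) (e k)) = 0" by (intro sum.neutral) simp
      then show "x \<in> hh" using hc by simp
    qed
  qed
qed

text \<open>An abelian ideal contains the components of its elements. It contains no
  \<open>e k\<close>, since then \<open>br (e k) y\<close> would lie in it as well and commute with
  \<open>e k\<close>; a component in \<open>hh\<close> on which some root does not vanish would
  again produce this \<open>e k\<close>.\<close>

lemma semisimple_root_datum:
  assumes nondeg: "\<And>k. k \<in> K \<Longrightarrow> \<exists>y\<in>L. br (br (e k) y) (e k) \<noteq> 0"
    and sep: "\<And>h. h \<in> hh \<Longrightarrow> (\<And>k. k \<in> K \<Longrightarrow> wt k h = 0) \<Longrightarrow> h = 0"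
  shows semisimple
proof (rule semisimpleI)
  fix J assume J: "lie_ideal J" and ab: "\<And>x y. x \<in> J \<Longrightarrow> y \<in> J \<Longrightarrow> br x y = 0"
  have JL: "J \<subseteq> L" "subspace J" "\<And>x y. x \<in> L \<Longrightarrow> y \<in> J \<Longrightarrow> br x y \<in> J"
    using J unfolding lie_ideal_def by auto
  have eJ: "e k \<notin> J" if k: "k \<in> K" for k
  proof
    assume e: "e k \<in> J"
    obtain y where y: "y \<in> L" "br (br (e k) y) (e k) \<noteq> 0" using nondeg[OF k] by blast
    have "br (e k) y = - br y (e k)" using y e JL by (intro br_antisym) auto
    then have "br (e k) y \<in> J" using JL(2) JL(3)[OF y(1) e] subspace_neg by metis
    then show False using ab[OF _ e] y by blast
  qed
  have "x = 0" if x: "x \<in> J" for x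
  proof -
    obtain h c where hc: "h \<in> hh" "x = h + (\<Sum>k\<in>K. scale (c k) (e k))" using x JL by (blast elim: decomp)
    have st: "br h x \<in> J" if "h \<in> hh" "x \<in> J" for h x using that JL hh_sub by blast
    have comp1: "h \<in> J"
      by (rule stable_components(1)[OF JL(2) _ hc(1) x[unfolded hc(2)]]) (rule st)
    have comp2: "scale (c k) (e k) \<in> J" if "k \<in> K" for k
      by (rule stable_components(2)[OF JL(2) _ hc(1) x[unfolded hc(2)] that]) (rule st)
    have ck: "c k = 0" if k: "k \<in> K" for k
    proof (rule ccontr)
      assume "c k \<noteq> 0"
      then have "scale (inverse (c k)) (scale (c k) (e k)) \<in> J" using comp2[OF k] JL(2) subspace_scale by blast
      then show False using eJ[OF k] \<open>c k \<noteq> 0\<close> by simp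
    qed
    have "h = 0"
    proof (rule sep[OF hc(1)], rule ccontr)
      fix k assume k: "k \<in> K" "wt k h \<noteq> 0"
      have "br (e k) h = - br h (e k)" using k hc hh_sub eL by (intro br_antisym) auto
      moreover have "br (e k) h \<in> J" using comp1 JL eL[OF k(1)] by blast
      ultimately have "br h (e k) \<in> J" using JL(2) subspace_neg by (metis minus_minus)
      then have "scale (inverse (wt k h)) (scale (wt k h) (e k)) \<in> J"
        using br_e[OF k(1) hc(1)] JL(2) by (metis subspace_scale)
      then show False using eJ[OF k(1)] k(2) by simp
    qed
    moreover have "(\<Sum>k\<in>K. scale (c k) (e k)) = 0" using ck by (intro sum.neutral) simp
    ultimately show ?thesis using hc by simp
  qed
  then show "J = {0}" using subspace_0[OF JL(2)] by blast
qed

lemma dynkin_baseI: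
  assumes s: "\<And>i. i \<in> {1..n} \<Longrightarrow> s i \<in> K"
    and indep: "\<And>c i. (\<And>x. x \<in> hh \<Longrightarrow> (\<Sum>i=1..n. c i * wt (s i) x) = 0) \<Longrightarrow> i \<in> {1..n} \<Longrightarrow> c i = 0"
    and comb: "\<And>k. k \<in> K \<Longrightarrow> \<exists>m. (\<forall>x\<in>hh. wt k x = (\<Sum>i=1..n. of_int (m i) * wt (s i) x)) \<and>
        ((\<forall>i\<in>{1..n}. m i \<ge> 0) \<or> (\<forall>i\<in>{1..n}. m i \<le> 0))"
    and coroot: "\<And>j. j \<in> {1..n} \<Longrightarrow> \<exists>y\<in>root_space hh (\<lambda>x. - wt (s j) x). 
        br (e (s j)) y \<in> hh \<and> (\<forall>i\<in>{1..n}. wt (s i) (br (e (s j)) y) = (if i = j then 2 else if {i, j} \<in> E then -1 else 0))"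
  shows "dynkin_base hh n (\<lambda>i. wt (s i)) E"
  unfolding dynkin_base_def root_base_def roots_eq
proof (intro conjI ballI allI impI cartan)
  show "i \<in> {1..n} \<Longrightarrow> wt (s i) \<in> wt ` K" for i using s by blast
  show "\<forall>x\<in>hh. (\<Sum>i = 1..n. c i * wt (s i) x) = 0 \<Longrightarrow> i \<in> {1..n} \<Longrightarrow> c i = 0" for c i
    using indep by blast
  fix \<beta> assume "\<beta> \<in> wt ` K"
  then obtain k where k: "k \<in> K" "\<beta> = wt k" by blast
  obtain m where m: "\<forall>x\<in>hh. wt k x = (\<Sum>i=1..n. of_int (m i) * wt (s i) x)"
        "(\<forall>i\<in>{1..n}. m i \<ge> 0) \<or> (\<forall>i\<in>{1..n}. m i \<le> 0)" using comb[OF k(1)] by blast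
  have "wt k x = int_comb n (\<lambda>i. wt (s i)) m x" for x
  proof (cases "x \<in> hh")
    case True then show ?thesis using m unfolding int_comb_def by simp
  next
    case False
    then have "wt j x = 0" if "j \<in> K" for j using wt_linear[OF that] unfolding linear_form_on_def by blast
    then show ?thesis using k s unfolding int_comb_def by (simp add: sum.neutral)
  qed
  then show "\<exists>m. \<beta> = int_comb n (\<lambda>i. wt (s i)) m \<and> ((\<forall>i\<in>{1..n}. 0 \<le> m i) \<or> (\<forall>i\<in>{1..n}. m i \<le> 0))"
    using k m(2) by blast
next
  fix j assume j: "j \<in> {1..n}"
  obtain y where y: "y \<in> root_space hh (\<lambda>x. - wt (s j) x)" "br (e (s j)) y \<in> hh"
     "\<forall>i\<in>{1..n}. wt (s i) (br (e (s j)) y) = (if i = j then 2 else if {i, j} \<in> E then -1 else 0)"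
    using coroot[OF j] by blast
  have "br (e (s j)) y \<in> bracket_span (root_space hh (wt (s j))) (root_space hh (\<lambda>x. - wt (s j) x))"
    unfolding bracket_span_def using y(1) e_root[OF s[OF j]] by (intro span_base) blast
  then have "is_coroot hh (wt (s j)) (br (e (s j)) y)" unfolding is_coroot_def using y(3) j by simp
  then show "\<exists>h. is_coroot hh (wt (s j)) h \<and> (\<forall>i\<in>{1..n}. wt (s i) h = (if i = j then 2 else if {i, j} \<in> E then - 1 else 0))"
    using y(3) by blast
qed

end

section \<open>The root system of type E6\<close>

lemma mv_axis: "(A *v axis J 1) $ I = (A :: complex ^ 'n ^ 'm) $ I $ J"
  by (simp add: matrix_vector_mult_def axis_def if_distrib[of "\<lambda>z. _ * z"] cong: if_cong)

lemma mv_minus: "(- A) *v x = - (A *v (x :: complex ^ 'n))" "(A :: complex ^ 'n ^ 'm) *v (- x) = - (A *v x)"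
  by (simp_all add: matrix_vector_mult_def vec_eq_iff sum_negf)

definition sgn_in :: "5 set \<Rightarrow> 5 \<Rightarrow> complex" where
  "sgn_in I i = (if i \<in> I then - 1/2 else 1/2)"

lemma sgn_in_eq_iff: "sgn_in I j = sgn_in J j \<longleftrightarrow> (j \<in> I \<longleftrightarrow> j \<in> J)"
  by (simp add: sgn_in_def)

text \<open>The inner product of two weights. With 3/4 added for the center it becomes 2, 1 or 0
  when the indices differ in 0, 2 or 4 elements, that is, the Cartan integer.\<close>

lemma sgn_in_product: "(\<Sum>i\<in>UNIV. sgn_in J i * sgn_in I i) = 5/4 - of_nat (card {j. (j \<in> I) \<noteq> (j \<in> J)}) / 2"
proof -
  have "(\<Sum>i\<in>UNIV. sgn_in J i * sgn_in I i) = (\<Sum>i\<in>UNIV. 1/4 - (if i \<in> {j. (j \<in> I) \<noteq> (j \<in> J)} then 1/2 else 0))"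
    by (intro sum.cong) (auto simp: sgn_in_def)
  then show ?thesis by (simp add: sum_subtractf sum.If_cases)
qed

lemma spin_cartan_component: "(spin_cartan i *v x) $ I = sgn_in I i * x $ I"
  unfolding spin_cartan_def spin_gen_mv gamma_axis polar_axis_axis
  by (auto simp: wedge_mv contr_mv sgn_in_def sg_insert sg_remove insert_absorb)

section \<open>The Cartan subalgebra and the root vectors\<close>

definition cart :: "(5 \<Rightarrow> complex) \<Rightarrow> spinor_mat" where
  "cart a = (\<Sum>i\<in>UNIV. cmat (a i) (spin_cartan i))"

lemma cart_mv: "(cart a *v x) $ I = (\<Sum>i\<in>UNIV. sgn_in I i * a i) * x $ I"
  by (simp add: cart_def sum_mv spin_cartan_component sum_distrib_left mult_ac)

lemma cart_component: "cart a $ I $ J = (if I = J then \<Sum>i\<in>UNIV. sgn_in I i * a i else 0)"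
proof -
  have "(cart a *v axis J 1) $ I = cart a $ I $ J" by (rule mv_axis)
  then show ?thesis unfolding cart_mv by (cases "I = J") (simp_all add: axis_def)
qed

lemma transpose_cart [simp]: "transpose (cart a) = cart a"
  by (auto simp: transpose_def vec_eq_iff cart_component)

lemma cart_soA: "cart a \<in> soA"
  unfolding cart_def spin_cartan_def by (intro soA_sum soA_scale soA_gen)

lemma cart_linear: "cart (\<lambda>i. a i + b i) = cart a + cart b" "cart (\<lambda>i. k * a i) = cmat k (cart a)"
  "cart (\<lambda>i. 0) = 0"
  by (auto simp: vec_eq_iff cart_component algebra_simps sum.distrib sum_distrib_left)

lemma cart_commute: "cart a ** cart b = cart b ** cart a"
proof -
  have "(cart a ** cart b) *v x = (cart b ** cart a) *v x" for x
    by (simp add: matrix_vector_mul_assoc[symmetric] vec_eq_iff cart_mv)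
  then show ?thesis by (simp add: matrix_eq)
qed

definition hel :: "(5 \<Rightarrow> complex) \<Rightarrow> complex \<Rightarrow> e6_vec" where
  "hel a c = (0, (cart a, c), 0)"

definition hE :: "e6_vec set" where "hE = {hel a c | a c. True}"

lemma hel_hE [simp]: "hel a c \<in> hE" by (auto simp: hE_def)

text \<open>The weights with indices \<open>{}\<close> and \<open>{i}\<close> differ exactly in
  coordinate \<open>i\<close>. The singleton lies outside \<open>X\<close>, but
  \<open>cart a\<close> acts on all spinors, so the coefficients can be read off there.\<close>

definition coa :: "e6_vec \<Rightarrow> 5 \<Rightarrow> complex" where
  "coa z i = fst (fst (snd z)) $ {} $ {} - fst (fst (snd z)) $ {i} $ {i}"

lemma coa_hel [simp]: "coa (hel a c) = a"
proof
  fix i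
  have "(\<Sum>j\<in>UNIV. sgn_in {} j * a j) - (\<Sum>j\<in>UNIV. sgn_in {i} j * a j) = (\<Sum>j\<in>UNIV. if j = i then a j else 0)"
    unfolding sum_subtractf[symmetric] by (intro sum.cong) (auto simp: sgn_in_def)
  then show "coa (hel a c) i = a i" by (simp add: coa_def hel_def cart_component)
qed

definition eps :: "5 + 5 \<Rightarrow> (5 \<Rightarrow> complex) \<Rightarrow> complex" where
  "eps p a = (case p of Inl i \<Rightarrow> a i | Inr i \<Rightarrow> - a i)"

lemma eps_dual [simp]: "eps (dual_index p) a = - eps p a"
  by (cases p) (simp_all add: eps_def)

text \<open>Roots are indexed by their kind: weights of \<open>X\<close>, their negatives, and the roots
  \<open>\<plusminus>\<epsilon>\<^sub>i \<plusminus> \<epsilon>\<^sub>j\<close> of \<open>\<ss>\<oo>(10)\<close>, given as pairs of indices of isotropic basis vectors.\<close>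

datatype e6_root = Pos "5 set" | Neg "5 set" | Vec "(5 + 5) set"

definition vec_pair :: "(5 + 5) set \<Rightarrow> bool" where
  "vec_pair S \<longleftrightarrow> (\<exists>p q. S = {p, q} \<and> p \<noteq> q \<and> q \<noteq> dual_index p)"

definition KE :: "e6_root set" where
  "KE = Pos ` {I. even (card I)} \<union> Neg ` {I. even (card I)} \<union> Vec ` {S. vec_pair S}"

fun lin :: "e6_root \<Rightarrow> (5 \<Rightarrow> complex) \<Rightarrow> complex \<Rightarrow> complex" where
  "lin (Pos I) a c = (\<Sum>i\<in>UNIV. sgn_in I i * a i) + c"
| "lin (Neg I) a c = - ((\<Sum>i\<in>UNIV. sgn_in I i * a i) + c)"
| "lin (Vec S) a c = (\<Sum>p\<in>S. eps p a)"

definition wtE :: "e6_root \<Rightarrow> e6_vec \<Rightarrow> complex" where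
  "wtE k z = (if z \<in> hE then lin k (coa z) (snd (fst (snd z))) else 0)"

lemma wtE_hel [simp]: "wtE k (hel a c) = lin k a c"
  unfolding wtE_def by simp (simp add: hel_def)

text \<open>The order of the two vectors is an arbitrary choice; exchanging them only changes the
  sign.\<close>

definition vec_gen :: "(5 + 5) set \<Rightarrow> spinor_mat" where
  "vec_gen S = (let pq = (SOME pq. S = {fst pq, snd pq}) in spin_gen (axis (fst pq) 1) (axis (snd pq) 1))"

lemma spin_gen_swap: "spin_gen v w = cmat (-1) (spin_gen w v)"
  by (simp add: spin_gen_def vec_eq_iff minus_divide_left)

lemma vec_gen_pair:
  obtains k where "k \<noteq> 0" "vec_gen {p, q} = cmat k (spin_gen (axis p 1) (axis q 1))"
proof -
  define pq where "pq = (SOME pq. {p, q} = {fst pq, snd pq})"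
  have "{p, q} = {fst pq, snd pq}" unfolding pq_def by (rule someI[of _ "(p, q)"]) simp
  then have "fst pq = p \<and> snd pq = q \<or> fst pq = q \<and> snd pq = p" by (auto simp: doubleton_eq_iff)
  moreover have "vec_gen {p, q} = spin_gen (axis (fst pq) 1) (axis (snd pq) 1)"
    by (simp add: vec_gen_def pq_def Let_def)
  ultimately show thesis
    using that[of 1] that[of "-1"] spin_gen_swap[of "axis q 1" "axis p 1"] by auto
qed

fun eE :: "e6_root \<Rightarrow> e6_vec" where
  "eE (Pos I) = (0, 0, axis I 1)"
| "eE (Neg I) = (axis I 1, 0, 0)"
| "eE (Vec S) = (0, (vec_gen S, 0), 0)"

lemma cart_gamma: "cart a *v (gamma (axis p 1) *v x) = eps p a *s (gamma (axis p 1) *v x) + gamma (axis p 1) *v (cart a *v x)"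
proof -
  have "spin_cartan i *v (gamma (axis p 1) *v x) = (if p = Inl i then 1 else if p = Inr i then -1 else 0) *s (gamma (axis p 1) *v x)
      + gamma (axis p 1) *v (spin_cartan i *v x)" for i
    unfolding spin_cartan_def spin_gen_gamma polar_axis_axis
    by (cases p) (auto simp: gamma_linear mv_minus)
  then have "a i *s (spin_cartan i *v (gamma (axis p 1) *v x)) = (if p = Inl i then a i else if p = Inr i then - a i else 0) *s (gamma (axis p 1) *v x)
      + a i *s (gamma (axis p 1) *v (spin_cartan i *v x))" for i
    by (simp add: vec.scale_right_distrib)
  then have "cart a *v (gamma (axis p 1) *v x) = (\<Sum>i\<in>UNIV. (if p = Inl i then a i else if p = Inr i then - a i else 0) *s (gamma (axis p 1) *v x)
      + a i *s (gamma (axis p 1) *v (spin_cartan i *v x)))"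
    by (simp add: cart_def sum_mv)
  also have "\<dots> = (\<Sum>i\<in>UNIV. (if p = Inl i then a i else if p = Inr i then - a i else 0) *s (gamma (axis p 1) *v x))
    + gamma (axis p 1) *v (cart a *v x)"
    by (simp add: cart_def sum_mv mv_sum sum.distrib vector_scalar_commute)
  also have "(\<Sum>i\<in>UNIV. (if p = Inl i then a i else if p = Inr i then - a i else 0) *s (gamma (axis p 1) *v x)) = eps p a *s (gamma (axis p 1) *v x)"
  proof -
    have "(\<Sum>i\<in>UNIV. if p = Inl i then a i else if p = Inr i then - a i else 0) = eps p a"
      by (cases p) (simp_all add: eps_def cong: if_cong)
    then show ?thesis unfolding vec.scale_sum_left[symmetric] by simp
  qed
  finally show ?thesis .
qed

lemma cart_spin_gen: "cart a ** spin_gen (axis p 1) (axis q 1) - spin_gen (axis p 1) (axis q 1) ** cart a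
   = cmat (eps p a + eps q a) (spin_gen (axis p 1) (axis q 1))"
proof -
  have "q = dual_index p \<Longrightarrow> eps p a + eps q a = 0" by simp
  then have z: "(eps p a + eps q a) * polar (axis p 1) (axis q 1) = 0" by (auto simp: polar_axis_axis)
  have "(cart a ** spin_gen (axis p 1) (axis q 1) - spin_gen (axis p 1) (axis q 1) ** cart a) *v x
   = cmat (eps p a + eps q a) (spin_gen (axis p 1) (axis q 1)) *v x" for x
  proof -
    have "(cart a ** spin_gen (axis p 1) (axis q 1) - spin_gen (axis p 1) (axis q 1) ** cart a) *v x
       = (eps p a + eps q a) *s (gamma (axis p 1) *v (gamma (axis q 1) *v x))"
      unfolding matrix_vector_mult_diff_rdistrib matrix_vector_mul_assoc[symmetric] spin_gen_mv
      by (simp add: matrix_vector_mult_diff_distrib cart_gamma matrix_vector_right_distrib vector_scalar_commute vec.scale_left_distrib)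
    also have "\<dots> = (eps p a + eps q a) *s (spin_gen (axis p 1) (axis q 1) *v x) + ((eps p a + eps q a) * polar (axis p 1) (axis q 1) / 2) *s x"
      by (simp add: spin_gen_mv vec_eq_iff algebra_simps)
    finally show ?thesis unfolding z by simp
  qed
  then show ?thesis by (simp add: matrix_eq)
qed

lemma br_hel:
  "e6_br (hel a c) (\<xi>, (A, d), x) = (- (cart a *v \<xi> + c *s \<xi>), (cart a ** A - A ** cart a, 0), cart a *v x + c *s x)"
  by (simp add: hel_def)

lemma br_hel_eE: "k \<in> KE \<Longrightarrow> e6_br (hel a c) (eE k) = e6_scale (lin k a c) (eE k)"
proof (cases k)
  case (Pos I)
  have "cart a *v axis I 1 + c *s axis I 1 = lin k a c *s axis I 1"
    using Pos by (auto simp: vec_eq_iff cart_mv axis_def)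
  then show ?thesis using Pos by (simp add: br_hel zero_prod_def e6_scale_pair)
next
  case (Neg I)
  have "- (cart a *v axis I 1 + c *s axis I 1) = lin k a c *s axis I 1"
    using Neg by (auto simp: vec_eq_iff cart_mv axis_def)
  then show ?thesis using Neg by (simp add: br_hel zero_prod_def e6_scale_pair)
next
  case (Vec S)
  assume "k \<in> KE"
  then obtain p q where S: "S = {p, q}" "p \<noteq> q" using Vec by (auto simp: KE_def vec_pair_def)
  obtain l where l: "vec_gen S = cmat l (spin_gen (axis p 1) (axis q 1))" using vec_gen_pair S by metis
  have "cart a ** vec_gen S - vec_gen S ** cart a = cmat (lin k a c) (vec_gen S)"
    unfolding l cmat_mm mat.scale_right_diff_distrib[symmetric] cart_spin_gen using Vec S by (simp add: mult.commute)
  then show ?thesis using Vec by (simp add: br_hel e6_scale_pair)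
qed

lemma hE_subspace: "e6.subspace hE"
  unfolding e6.subspace_def
proof (intro conjI ballI allI)
  show "0 \<in> hE" unfolding hE_def hel_def
    by (intro CollectI exI[of _ "\<lambda>i. 0"] exI[of _ 0]) (simp add: cart_linear zero_prod_def)
next
  fix x y assume "x \<in> hE" "y \<in> hE"
  then obtain a c b d where "x = hel a c" "y = hel b d" by (auto simp: hE_def)
  then have "x + y = hel (\<lambda>i. a i + b i) (c + d)" by (simp add: hel_def cart_linear)
  then show "x + y \<in> hE" by simp
next
  fix k x assume "x \<in> hE"
  then obtain a c where "x = hel a c" by (auto simp: hE_def)
  then have "e6_scale k x = hel (\<lambda>i. k * a i) (k * c)" by (simp add: hel_def cart_linear e6_scale_pair)
  then show "e6_scale k x \<in> hE" by simp
qed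

lemma hel_add: "hel a c + hel b d = hel (\<lambda>i. a i + b i) (c + d)"
  by (simp add: hel_def cart_linear)
lemma hel_scale: "e6_scale k (hel a c) = hel (\<lambda>i. k * a i) (k * c)"
  by (simp add: hel_def cart_linear e6_scale_pair)

lemma eps_linear: "eps p (\<lambda>i. a i + b i) = eps p a + eps p b" "eps p (\<lambda>i. k * a i) = k * eps p a"
  by (cases p; simp add: eps_def)+

lemma lin_linear: "lin k (\<lambda>i. a i + b i) (c + d) = lin k a c + lin k b d" "lin k (\<lambda>i. l * a i) (l * c) = l * lin k a c"
  by (cases k; simp add: algebra_simps sum.distrib sum_distrib_left eps_linear)+

lemma lin_center: "lin k (\<lambda>_. 0) 1 = (case k of Pos _ \<Rightarrow> 1 | Neg _ \<Rightarrow> -1 | Vec _ \<Rightarrow> 0)"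
proof -
  have "eps p (\<lambda>_. 0) = 0" for p by (cases p) (simp_all add: eps_def)
  then show ?thesis by (cases k) simp_all
qed

abbreviation ind :: "5 \<Rightarrow> 5 \<Rightarrow> complex" where "ind j \<equiv> (\<lambda>i. if i = j then 1 else 0)"

lemma sum_sgn_ind: "(\<Sum>i\<in>UNIV. sgn_in I i * ind j i) = sgn_in I j"
  by (simp add: if_distrib[of "\<lambda>z. _ * z"] cong: if_cong)

lemma eps_ind: "eps p (ind j) = (if p = Inl j then 1 else if p = Inr j then -1 else 0)"
  by (cases p) (auto simp: eps_def)

lemma lin_Vec_ind: "vec_pair S \<Longrightarrow> lin (Vec S) (ind j) c = (if Inl j \<in> S then 1 else if Inr j \<in> S then -1 else 0)"
proof -
  assume "vec_pair S"
  then obtain p q where "S = {p, q}" "p \<noteq> q" "q \<noteq> dual_index p" unfolding vec_pair_def by blast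
  then show ?thesis
    by (cases p; cases q) (auto simp: eps_ind)
qed

text \<open>The central direction separates the three kinds of roots, and within a kind the basis
  elements \<open>ind j\<close> read off the coordinates.\<close>

lemma lin_inj:
  assumes k: "k \<in> KE" "k' \<in> KE" and eq: "\<And>a c. lin k a c = lin k' a c"
  shows "k = k'"
proof -
  have "lin k (\<lambda>_. 0) 1 = lin k' (\<lambda>_. 0) 1" by (rule eq)
  then consider I J where "k = Pos I" "k' = Pos J" | I J where "k = Neg I" "k' = Neg J" | S T where "k = Vec S" "k' = Vec T"
    unfolding lin_center by (cases k; cases k') auto
  then show ?thesis
  proof cases
    case 1
    then have "sgn_in I j = sgn_in J j" for j using eq[of "ind j" 0] by (simp add: sum_sgn_ind)
    then have "j \<in> I \<longleftrightarrow> j \<in> J" for j unfolding sgn_in_eq_iff .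
    then show ?thesis using 1 by blast
  next
    case 2
    then have "sgn_in I j = sgn_in J j" for j using eq[of "ind j" 0] by (simp add: sum_sgn_ind)
    then have "j \<in> I \<longleftrightarrow> j \<in> J" for j unfolding sgn_in_eq_iff .
    then show ?thesis using 2 by blast
  next
    case 3
    then have S: "vec_pair S" "vec_pair T" using k by (auto simp: KE_def)
    have n: "\<not> (Inl j \<in> S \<and> Inr j \<in> S)" if "vec_pair S" for S j
      using that unfolding vec_pair_def by auto
    have e: "(if Inl j \<in> S then 1 else if Inr j \<in> S then -1 else 0::complex) = (if Inl j \<in> T then 1 else if Inr j \<in> T then -1 else 0)" for j
      using eq[of "ind j" 0] unfolding 3 lin_Vec_ind[OF S(1)] lin_Vec_ind[OF S(2)] .
    have t: "(a \<longleftrightarrow> c) \<and> (\<not> a \<and> b \<longleftrightarrow> \<not> c \<and> d)"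
      if "(if a then 1 else if b then -1 else 0::complex) = (if c then 1 else if d then -1 else 0)" for a b c d
      using that by (cases a; cases b; cases c; cases d; simp)
    have "p \<in> S \<longleftrightarrow> p \<in> T" for p
      by (cases p) (use t[OF e] n[OF S(1)] n[OF S(2)] in blast)+
    then show ?thesis using 3 by blast
  qed
qed

lemma lin_nz: "k \<in> KE \<Longrightarrow> \<exists>a c. lin k a c \<noteq> 0"
proof (cases k)
  case (Vec S)
  assume "k \<in> KE"
  then have S: "vec_pair S" using Vec by (auto simp: KE_def)
  then obtain p where p: "p \<in> S" unfolding vec_pair_def by blast
  have "lin k (ind (case p of Inl j \<Rightarrow> j | Inr j \<Rightarrow> j)) 0 \<noteq> 0"
    using p Vec by (cases p) (simp_all add: lin_Vec_ind[OF S] del: lin.simps)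
  then show ?thesis by blast
next
  case (Pos I) then show ?thesis using lin_center[of k] by (intro exI[of _ "\<lambda>_. 0"] exI[of _ 1]) simp
next
  case (Neg I) then show ?thesis using lin_center[of k] by (intro exI[of _ "\<lambda>_. 0"] exI[of _ 1]) simp
qed

lemma spinor_expand: "(x :: spinor) = (\<Sum>I\<in>UNIV. x $ I *s axis I 1)"
  by (simp add: vec_eq_iff axis_def if_distrib[of "\<lambda>z. _ * z"] cong: if_cong)

lemma X_pos_span: "x \<in> X \<Longrightarrow> (0, 0, x) \<in> e6.span (eE ` Pos ` {I. even (card I)})"
proof -
  assume x: "x \<in> X"
  have "(0, 0, x) = (\<Sum>I\<in>UNIV. e6_scale (x $ I) (eE (Pos I)))"
    by (simp add: prod_eq_iff fst_sum snd_sum e6_scale_pair) (rule spinor_expand)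
  also have "\<dots> \<in> e6.span (eE ` Pos ` {I. even (card I)})"
  proof (rule e6.span_sum)
    fix I show "e6_scale (x $ I) (eE (Pos I)) \<in> e6.span (eE ` Pos ` {I. even (card I)})"
    proof (cases "even (card I)")
      case True then show ?thesis by (intro e6.span_scale e6.span_base imageI CollectI)
    next
      case False then show ?thesis using x by (simp add: X_def e6.span_zero)
    qed
  qed
  finally show ?thesis .
qed

lemma X_neg_span: "x \<in> X \<Longrightarrow> (x, 0, 0) \<in> e6.span (eE ` Neg ` {I. even (card I)})"
proof -
  assume x: "x \<in> X"
  have "(x, 0, 0) = (\<Sum>I\<in>UNIV. e6_scale (x $ I) (eE (Neg I)))"
    by (simp add: prod_eq_iff fst_sum snd_sum e6_scale_pair) (rule spinor_expand)
  also have "\<dots> \<in> e6.span (eE ` Neg ` {I. even (card I)})"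
  proof (rule e6.span_sum)
    fix I show "e6_scale (x $ I) (eE (Neg I)) \<in> e6.span (eE ` Neg ` {I. even (card I)})"
    proof (cases "even (card I)")
      case True then show ?thesis by (intro e6.span_scale e6.span_base imageI CollectI)
    next
      case False then show ?thesis using x by (simp add: X_def e6.span_zero)
    qed
  qed
  finally show ?thesis .
qed

lemma spin_gen_self: "spin_gen v v = 0"
  by (simp add: spin_gen_def vec_eq_iff)

lemma spin_gen_dual:
  "spin_gen (axis (Inl i) 1) (axis (Inr i) 1) = cart (ind i)"
  "spin_gen (axis (Inr i) 1) (axis (Inl i) 1) = cart (\<lambda>j. - ind i j)"
proof -
  show 1: "spin_gen (axis (Inl i) 1) (axis (Inr i) 1) = cart (ind i)" for i
    by (simp add: cart_def spin_cartan_def if_distrib[of "\<lambda>z. cmat z _"] cong: if_cong)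
  show "spin_gen (axis (Inr i) 1) (axis (Inl i) 1) = cart (\<lambda>j. - ind i j)"
    using cart_linear(2)[of "-1" "ind i"] by (subst spin_gen_swap) (simp add: 1)
qed

lemma spin_gen_axis_span: "(0, (spin_gen (axis p 1) (axis q 1), 0), 0) \<in> e6.span (hE \<union> eE ` Vec ` {S. vec_pair S})"
proof -
  consider "p = q" | "q = dual_index p" | "p \<noteq> q" "q \<noteq> dual_index p" by blast
  then show ?thesis
  proof cases
    case 1 then show ?thesis using e6.span_zero by (simp add: spin_gen_self zero_prod_def)
  next
    case 2
    then have "(0, (spin_gen (axis p 1) (axis q 1), 0), 0) \<in> hE"
      by (cases p) (auto simp: spin_gen_dual hE_def hel_def)
    then show ?thesis by (intro e6.span_base) simp
  next
    case 3
    obtain k where k: "k \<noteq> 0" "vec_gen {p, q} = cmat k (spin_gen (axis p 1) (axis q 1))" by (rule vec_gen_pair)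
    have "vec_pair {p, q}" using 3 unfolding vec_pair_def by blast
    then have "e6_scale (1 / k) (eE (Vec {p, q})) \<in> e6.span (hE \<union> eE ` Vec ` {S. vec_pair S})"
      by (intro e6.span_scale e6.span_base) blast
    then show ?thesis using k by (simp add: e6_scale_pair)
  qed
qed

lemma spin_gen_expand: "spin_gen v w = (\<Sum>p\<in>UNIV. \<Sum>q\<in>UNIV. cmat (v $ p * w $ q) (spin_gen (axis p 1) (axis q 1)))"
proof -
  have l: "spin_gen (u + v) w = spin_gen u w + spin_gen v w" "spin_gen (k *s v) w = cmat k (spin_gen v w)" "spin_gen 0 w = 0"
    "spin_gen w (u + v) = spin_gen w u + spin_gen w v" "spin_gen w (k *s v) = cmat k (spin_gen w v)" "spin_gen w 0 = 0" for u v w k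
    by (simp_all add: matrix_eq spin_gen_mv gamma_linear matrix_vector_mult_add_rdistrib polar_simps vec_eq_iff
       vector_scalar_commute matrix_vector_right_distrib field_simps)
  have s: "spin_gen (\<Sum>p\<in>S. f p) w = (\<Sum>p\<in>S. spin_gen (f p) w)" "spin_gen w (\<Sum>p\<in>S. f p) = (\<Sum>p\<in>S. spin_gen w (f p))" for f and S :: "(5 + 5) set" and w
    by (induction S rule: infinite_finite_induct) (simp_all add: l)
  have e: "v = (\<Sum>p\<in>UNIV. v $ p *s axis p 1)" for v :: "complex ^ (5 + 5)"
    by (simp add: vec_eq_iff axis_def if_distrib[of "\<lambda>z. _ * z"] cong: if_cong)
  have "spin_gen v w = spin_gen (\<Sum>p\<in>UNIV. v $ p *s axis p 1) (\<Sum>q\<in>UNIV. w $ q *s axis q 1)" using e by metis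
  then show ?thesis by (simp add: s l mat.scale_sum_right mult.commute) (rule sum.swap)
qed

lemma soA_span: "A \<in> soA \<Longrightarrow> (0, (A, c), 0) \<in> e6.span (hE \<union> eE ` Vec ` {S. vec_pair S})" (is "_ \<Longrightarrow> _ \<in> ?V")
proof -
  assume "A \<in> soA"
  then have "(0, (A, 0), 0) \<in> ?V"
  proof (induction A rule: soA_induct)
    case zero then show ?case using e6.span_zero by (simp add: zero_prod_def)
  next
    case (gen v w k)
    have "(\<Sum>p\<in>UNIV. \<Sum>q\<in>UNIV. e6_scale (k * (v $ p * w $ q)) (0, (spin_gen (axis p 1) (axis q 1), 0), 0)) \<in> ?V"
      by (intro e6.span_sum e6.span_scale spin_gen_axis_span)
    also have "(\<Sum>p\<in>UNIV. \<Sum>q\<in>UNIV. e6_scale (k * (v $ p * w $ q)) (0, (spin_gen (axis p 1) (axis q 1), 0), 0)) = (0, (cmat k (spin_gen v w), 0), 0)"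
      by (subst spin_gen_expand[of v w]) (simp add: prod_eq_iff fst_sum snd_sum e6_scale_pair mat.scale_sum_right)
    finally show ?case .
  next
    case (add A B)
    then have "(0, (A, 0), 0) + (0, (B, 0), 0) \<in> ?V" by (intro e6.span_add)
    then show ?case by simp
  qed
  moreover have "hel (\<lambda>_. 0) c \<in> ?V" by (intro e6.span_base) simp
  ultimately have "(0, (A, 0), 0) + hel (\<lambda>_. 0) c \<in> ?V" by (rule e6.span_add)
  then show ?thesis by (simp add: hel_def cart_linear)
qed

lemma e6_span: "e6 \<subseteq> e6.span (hE \<union> eE ` KE)"
proof
  fix z assume z: "z \<in> e6"
  obtain \<xi> A c x where zz: "z = (\<xi>, (A, c), x)" by (metis prod.exhaust)
  have h: "\<xi> \<in> X" "A \<in> soA" "x \<in> X" using z by (auto simp: zz e6_iff)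
  have "(\<xi>, 0, 0) \<in> e6.span (hE \<union> eE ` KE)" using X_neg_span[OF h(1)] by (rule e6.span_mono[THEN subsetD, rotated]) (auto simp: KE_def)
  moreover have "(0, 0, x) \<in> e6.span (hE \<union> eE ` KE)" using X_pos_span[OF h(3)] by (rule e6.span_mono[THEN subsetD, rotated]) (auto simp: KE_def)
  moreover have "(0, (A, c), 0) \<in> e6.span (hE \<union> eE ` KE)" using soA_span[OF h(2)] by (rule e6.span_mono[THEN subsetD, rotated]) (auto simp: KE_def)
  ultimately have "(\<xi>, 0, 0) + (0, 0, x) + (0, (A, c), 0) \<in> e6.span (hE \<union> eE ` KE)" by (intro e6.span_add)
  then show "z \<in> e6.span (hE \<union> eE ` KE)" by (simp add: zz)
qed

lemma hE_e6: "hE \<subseteq> e6"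
  by (auto simp: hE_def hel_def e6_iff cart_soA)

lemma eE_e6: "k \<in> KE \<Longrightarrow> eE k \<in> e6"
proof (cases k)
  case (Vec S)
  assume "k \<in> KE"
  then obtain p q where "S = {p, q}" using Vec by (auto simp: KE_def vec_pair_def)
  then have "vec_gen S \<in> soA" using vec_gen_pair soA_scale soA_gen by metis
  then show ?thesis using Vec by (simp add: e6_iff)
qed (auto simp: KE_def e6_iff X_axis zero_prod_def)

section \<open>Brackets of opposite root vectors and coroots\<close>

lemma axis_component: "axis I (1 :: complex) $ J = (if J = I then 1 else 0)"
  by (simp add: axis_def)

lemma outer_axis: "outer (axis I 1) y $ J $ L = (if J = I then y $ L else 0)"
  by (simp add: outer_def axis_component)

lemma moment_axis_component:
  "(fst (moment (axis I 1) (axis J 1)) *v y) $ L = (if I = J then 5/4 * y $ L else 0)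
     - (\<Sum>i\<in>{j. (j \<in> J) \<noteq> (j \<in> L)}. \<Sum>j\<in>{j. (j \<in> J) \<noteq> (j \<in> L)}.
         sg i {j. (j \<in> J) \<noteq> (j \<in> L)} * sg j {j. (j \<in> J) \<noteq> (j \<in> L)} * (if fl j (fl i J) = I then y $ (fl j (fl i L)) else 0)) / 2"
proof -
  have "(transpose (Om (Om (outer (axis I 1) y))) *v axis J 1) $ L = Om (Om (outer (axis I 1) y)) $ J $ L"
    unfolding mv_axis by (simp add: transpose_def)
  then show ?thesis
    unfolding moment_mv by (simp add: Om_Om_component outer_axis axis_component)
qed

lemma fl_fl [simp]: "fl i (fl i J) = J"
  by (auto simp: mem_fl)
lemma fl_fl_eq_iff: "fl j (fl i J) = J \<longleftrightarrow> i = j"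
proof
  assume "fl j (fl i J) = J"
  then have "i \<in> fl j (fl i J) \<longleftrightarrow> i \<in> J" by simp
  then show "i = j" by (simp add: mem_fl) blast
qed simp

text \<open>Two toggles lead from \<open>I\<close> back to \<open>I\<close> only if they are equal.
  So the operator is diagonal, with entry \<open>5/4 - d/2\<close> at an index differing from
  \<open>I\<close> in \<open>d\<close> elements, which is the inner product of the two
  weights.\<close>

lemma moment_axis_same: "moment (axis I 1) (axis I 1) = (cart (sgn_in I), 3/4)"
proof -
  have "(fst (moment (axis I 1) (axis I 1)) *v y) $ L = (cart (sgn_in I) *v y) $ L" for y L
  proof -
    let ?D = "{j. (j \<in> I) \<noteq> (j \<in> L)}"
    have "(\<Sum>i\<in>?D. \<Sum>j\<in>?D. sg i ?D * sg j ?D * (if fl j (fl i I) = I then y $ (fl j (fl i L)) else 0))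
      = (\<Sum>i\<in>?D. \<Sum>j\<in>?D. if i = j then y $ L else 0)"
      by (intro sum.cong refl) (auto simp: fl_fl_eq_iff)
    also have "\<dots> = of_nat (card ?D) * y $ L" by simp
    finally have "(fst (moment (axis I 1) (axis I 1)) *v y) $ L = (5/4 - of_nat (card ?D) / 2) * y $ L"
      unfolding moment_axis_component by (simp add: algebra_simps)
    then show ?thesis unfolding cart_mv sgn_in_product .
  qed
  then have "fst (moment (axis I 1) (axis I 1)) = cart (sgn_in I)" by (simp add: matrix_eq vec_eq_iff)
  then show ?thesis by (simp add: prod_eq_iff)
qed

text \<open>Each application of \<open>Om\<close> toggles one element, so \<open>Om^2\<close> cannot
  connect indices that are more than two toggles apart.\<close>

lemma moment_axis_far:
  assumes "I \<noteq> J" "\<And>i j. fl j (fl i J) \<noteq> I"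
  shows "moment (axis I 1) (axis J 1) = 0"
proof -
  have "fst (moment (axis I 1) (axis J 1)) = 0"
    using assms by (simp add: matrix_eq vec_eq_iff moment_axis_component)
  moreover have "pairing (axis J 1) (axis I 1) = 0"
    unfolding pairing_axis using assms(1) by (simp add: axis_component)
  ultimately show ?thesis by (simp add: prod_eq_iff del: pairing_axis)
qed

definition vsign :: "5 + 5 \<Rightarrow> 5 \<Rightarrow> complex" where
  "vsign p i = eps p (ind i)"

text \<open>The 3/4 is the central part of the bracket of a weight vector with its dual; added to
  the square length 5/4 of a weight it gives the value 2 of a root on its coroot.\<close>

fun corE :: "e6_root \<Rightarrow> e6_vec" where
  "corE (Pos I) = hel (sgn_in I) (3/4)"
| "corE (Neg I) = hel (\<lambda>i. - sgn_in I i) (- 3/4)"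
| "corE (Vec S) = hel (\<lambda>i. \<Sum>p\<in>S. vsign p i) 0"

fun negE :: "e6_root \<Rightarrow> e6_root" where
  "negE (Pos I) = Neg I" | "negE (Neg I) = Pos I" | "negE (Vec S) = Vec (dual_index ` S)"

lemma spin_gen_opposite:
  assumes "p \<noteq> q" "q \<noteq> dual_index p"
  defines "p' \<equiv> dual_index p" and "q' \<equiv> dual_index q"
  shows "spin_gen (axis p 1) (axis q 1) ** spin_gen (axis q' 1) (axis p' 1) - spin_gen (axis q' 1) (axis p' 1) ** spin_gen (axis p 1) (axis q 1)
    = cart (\<lambda>i. vsign p i + vsign q i)"
proof -
  have "dual_index q \<noteq> p" using assms(2) by (metis dual_index_simps(3))
  then have P: "polar (axis q 1) (axis q' 1) = 1" "polar (axis p 1) (axis q' 1) = 0" "polar (axis q 1) (axis p' 1) = 0" "polar (axis p 1) (axis p' 1) = 1"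
    using assms by (auto simp: polar_axis_axis p'_def q'_def)
  have d: "spin_gen (axis r 1) (axis (dual_index r) 1) = cart (vsign r)" for r
  proof (cases r)
    case (Inl i)
    then have "vsign r = ind i" by (auto simp: vsign_def eps_ind)
    then show ?thesis using Inl by (simp add: spin_gen_dual)
  next
    case (Inr i)
    then have "vsign r = (\<lambda>j. - ind i j)" by (auto simp: vsign_def eps_ind)
    then show ?thesis using Inr by (simp add: spin_gen_dual)
  qed
  have "spin_gen (axis q' 1) (- axis q 1) = spin_gen (axis q 1) (axis q' 1)"
    by (simp add: matrix_eq spin_gen_mv[of _ "- axis q 1"] gamma_linear spin_gen_mv[of "axis q 1"] gamma_swap[of "axis q 1" "axis q' 1"] polar_simps polar_commute)
       (simp add: vec_eq_iff mv_minus)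
  then show ?thesis
    unfolding spin_gen_commutator P by (simp add: d q'_def p'_def cart_linear)
qed

lemma coroot_exists:
  assumes k: "k \<in> KE"
  shows "\<exists>y. y \<in> e6 \<and> (\<forall>a c. e6_br (hel a c) y = e6_scale (- lin k a c) y) \<and> e6_br (eE k) y = corE k"
proof (cases k)
  case (Pos I)
  then have "Neg I \<in> KE" using k by (auto simp: KE_def)
  then show ?thesis using br_hel_eE[of "Neg I"] eE_e6[of "Neg I"] Pos
    by (intro exI[of _ "eE (Neg I)"]) (simp add: moment_axis_same hel_def zero_prod_def)
next
  case (Neg I)
  then have "Pos I \<in> KE" using k by (auto simp: KE_def)
  moreover have "- cart (sgn_in I) = cart (\<lambda>i. - sgn_in I i)"
    by (simp add: vec_eq_iff cart_component sum_negf)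
  ultimately show ?thesis using br_hel_eE[of "Pos I"] eE_e6[of "Pos I"] Neg
    by (intro exI[of _ "eE (Pos I)"]) (simp add: moment_axis_same hel_def zero_prod_def)
next
  case (Vec S)
  then obtain p q where S: "S = {p, q}" "p \<noteq> q" "q \<noteq> dual_index p" using k by (auto simp: KE_def vec_pair_def)
  obtain l where l: "l \<noteq> 0" "vec_gen S = cmat l (spin_gen (axis p 1) (axis q 1))" using vec_gen_pair S by metis
  let ?B = "spin_gen (axis (dual_index q) 1) (axis (dual_index p) 1)"
  \<comment> \<open>The factor \<open>1/l\<close> undoes the sign hidden in the choice made by
    \<open>vec_gen\<close>.\<close>
  let ?y = "(0, (cmat (1/l) ?B, 0), 0) :: e6_vec"
  have "?y \<in> e6" by (simp add: e6_iff soA_scale soA_gen)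
  moreover have "e6_br (hel a c) ?y = e6_scale (- lin k a c) ?y" for a c
  proof -
    have "cart a ** cmat (1/l) ?B - cmat (1/l) ?B ** cart a = cmat (1/l) (cart a ** ?B - ?B ** cart a)"
      by (simp add: mat.scale_right_diff_distrib)
    then show ?thesis using Vec S by (simp add: br_hel cart_spin_gen e6_scale_pair mult.commute)
  qed
  moreover have "e6_br (eE k) ?y = corE k"
  proof -
    have "vec_gen S ** cmat (1/l) ?B - cmat (1/l) ?B ** vec_gen S
       = spin_gen (axis p 1) (axis q 1) ** ?B - ?B ** spin_gen (axis p 1) (axis q 1)"
      using l by simp
    then show ?thesis using Vec S(1) spin_gen_opposite[OF S(2,3)] S(2) by (simp add: hel_def)
  qed
  ultimately show ?thesis by blast
qed

lemma lin_corE: "k \<in> KE \<Longrightarrow> wtE k (corE k) = 2"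
proof (cases k)
  case (Pos I)
  have "(\<Sum>i\<in>UNIV. sgn_in I i * sgn_in I i) = (\<Sum>i\<in>(UNIV :: 5 set). 1/4)" by (intro sum.cong) (auto simp: sgn_in_def)
  also have "\<dots> = 5/4" by simp
  finally have s: "(\<Sum>i\<in>UNIV. sgn_in I i * sgn_in I i) = 5/4" .
  show ?thesis using Pos by (simp add: s)
next
  case (Neg I)
  have "(\<Sum>i\<in>UNIV. sgn_in I i * sgn_in I i) = (\<Sum>i\<in>(UNIV :: 5 set). 1/4)" by (intro sum.cong) (auto simp: sgn_in_def)
  also have "\<dots> = 5/4" by simp
  finally have s: "(\<Sum>i\<in>UNIV. sgn_in I i * sgn_in I i) = 5/4" .
  show ?thesis using Neg by (simp add: sum_negf s)
next
  case (Vec S)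
  assume "k \<in> KE"
  then obtain p q where S: "S = {p, q}" "p \<noteq> q" "q \<noteq> dual_index p" using Vec by (auto simp: KE_def vec_pair_def)
  have "wtE k (corE k) = eps p (\<lambda>i. vsign p i + vsign q i) + eps q (\<lambda>i. vsign p i + vsign q i)"
    using S Vec by simp
  also have "\<dots> = 2" using S(2,3) by (cases p; cases q) (auto simp: eps_def vsign_def)
  finally show ?thesis .
qed

lemma wtE_linear: "e6.linear_form_on hE (wtE k)"
  unfolding e6.linear_form_on_def
proof (intro conjI ballI allI impI)
  fix x y assume "x \<in> hE" "y \<in> hE"
  then obtain a c b d where "x = hel a c" "y = hel b d" by (auto simp: hE_def)
  then show "wtE k (x + y) = wtE k x + wtE k y" by (simp add: hel_add lin_linear)
next
  fix l x assume "x \<in> hE"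
  then obtain a c where "x = hel a c" by (auto simp: hE_def)
  then show "wtE k (e6_scale l x) = l * wtE k x" by (simp add: hel_scale lin_linear)
qed (simp add: wtE_def)

interpretation E6: root_datum e6_scale e6 e6_br hE KE wtE eE
proof
  show "hE \<subseteq> e6" by (rule hE_e6)
  show "e6.subspace hE" by (rule hE_subspace)
  show "finite KE" by (simp add: KE_def)
  show "inj_on wtE KE"
  proof (rule inj_onI)
    fix k k' assume k: "k \<in> KE" "k' \<in> KE" "wtE k = wtE k'"
    then have "lin k a c = lin k' a c" for a c using wtE_hel by metis
    then show "k = k'" using lin_inj k by blast
  qed
  show "e6 \<subseteq> e6.span (hE \<union> eE ` KE)" by (rule e6_span)
next
  fix x y assume "x \<in> hE" "y \<in> hE"
  then obtain a c b d where "x = hel a c" "y = hel b d" by (auto simp: hE_def)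
  then show "e6_br x y = 0" by (simp add: hel_def cart_commute zero_prod_def)
next
  fix k assume k: "k \<in> KE"
  show "e6.linear_form_on hE (wtE k)" by (rule wtE_linear)
  show "wtE k \<noteq> (\<lambda>x. 0)" using lin_nz[OF k] wtE_hel by metis
  show "eE k \<in> e6.root_space hE (wtE k)"
    using k eE_e6[OF k] br_hel_eE[OF k] by (auto simp: e6.root_space_def hE_def)
  show "eE k \<noteq> 0"
  proof
    assume z: "eE k = 0"
    obtain y where y: "e6_br (eE k) y = corE k" using coroot_exists[OF k] by blast
    then have "corE k = 0" using z by simp
    also have "0 = hel (\<lambda>_. 0) 0" by (simp add: hel_def cart_linear zero_prod_def)
    finally have "wtE k (corE k) = lin k (\<lambda>_. 0) 0" by simp
    also have "\<dots> = 0" using lin_linear(2)[of k 0 "\<lambda>_. 0" 0] by simp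
    finally show False using lin_corE[OF k] by simp
  qed
qed

text \<open>The coordinates are ordered 1, 2, 3, 4, 0, the last one playing the part of 5. The roots
  \<open>sE 6\<close>, \<open>sE 5\<close>, \<open>sE 4\<close> form the chain of D5, and
  \<open>sE 3\<close>, \<open>sE 2\<close> its fork. \<open>sE 1\<close> is the lowest weight of
  \<open>X\<close> for these simple roots, which attaches it to \<open>sE 3\<close>.\<close>

definition sE :: "nat \<Rightarrow> e6_root" where
  "sE i = (if i = 1 then Pos {1, 2, 3, 4} else if i = 2 then Vec {Inl 4, Inl 0}
     else if i = 3 then Vec {Inl 4, Inr 0} else if i = 4 then Vec {Inl 3, Inr 4}
     else if i = 5 then Vec {Inl 2, Inr 3} else Vec {Inl 1, Inr 2})"

lemma atLeast1_atMost6: "{1..6} = {1, 2, 3, 4, 5, 6 :: nat}"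
  by auto

lemma sum_1_6: "(\<Sum>i=1..6. f i) = f 1 + f 2 + f 3 + f 4 + f 5 + f (6 :: nat)" for f :: "nat \<Rightarrow> complex"
  unfolding atLeast1_atMost6 by (simp add: add.assoc)

lemma lin_sE:
  "lin (sE 1) a c = (a 0 - a 1 - a 2 - a 3 - a 4) / 2 + c"
  "lin (sE 2) a c = a 4 + a 0" "lin (sE 3) a c = a 4 - a 0" "lin (sE 4) a c = a 3 - a 4"
  "lin (sE 5) a c = a 2 - a 3" "lin (sE 6) a c = a 1 - a 2"
  by (simp_all add: sE_def sum_5 sgn_in_def eps_def diff_divide_distrib)

lemma sE_KE: "i \<in> {1..6} \<Longrightarrow> sE i \<in> KE"
proof -
  have "vec_pair {p, q}" if "p \<noteq> q" "q \<noteq> dual_index p" for p q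
    using that unfolding vec_pair_def by blast
  then show "i \<in> {1..6} \<Longrightarrow> sE i \<in> KE"
    unfolding atLeast1_atMost6 by (auto simp: sE_def KE_def)
qed

lemma vsign_simps: "vsign (Inl i) = ind i" "vsign (Inr i) = (\<lambda>j. - ind i j)"
  by (auto simp: vsign_def eps_ind)

lemma cartan_matrix:
  assumes "i \<in> {1..6}" "j \<in> {1..6}"
  shows "wtE (sE i) (corE (sE j)) = (if i = j then 2 else if {i, j} \<in> E6_edges then -1 else 0)"
proof -
  have cor: "corE (sE 1) = hel (sgn_in {1, 2, 3, 4}) (3/4)"
    "corE (sE 2) = hel (\<lambda>i. ind 4 i + ind 0 i) 0" "corE (sE 3) = hel (\<lambda>i. ind 4 i - ind 0 i) 0"
    "corE (sE 4) = hel (\<lambda>i. ind 3 i - ind 4 i) 0" "corE (sE 5) = hel (\<lambda>i. ind 2 i - ind 3 i) 0"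
    "corE (sE 6) = hel (\<lambda>i. ind 1 i - ind 2 i) 0"
    by (simp_all add: sE_def vsign_simps)
  have E: "{i, j} \<in> E6_edges \<longleftrightarrow> (i, j) \<in> {(1,3),(3,1),(3,4),(4,3),(4,5),(5,4),(5,6),(6,5),(2,4),(4,2)}"
    unfolding E6_edges_def by (simp add: doubleton_eq_iff)
  have "i = 1 \<or> i = 2 \<or> i = 3 \<or> i = 4 \<or> i = 5 \<or> i = 6" "j = 1 \<or> j = 2 \<or> j = 3 \<or> j = 4 \<or> j = 5 \<or> j = 6"
    using assms unfolding atLeast1_atMost6 by blast+
  then show ?thesis unfolding E
    by (elim disjE; simp only: cor wtE_hel lin_sE; simp add: sgn_in_def)
qed

text \<open>Coefficients in the simple roots of \<open>d\<close> times \<open>sE 1\<close> plus the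
  vector \<open>w\<close>: partial sums along the chain, and two halves at the fork. The division is
  exact when the coordinate sum of \<open>w\<close> is even, that is, on the root lattice of
  D5.\<close>

definition mE :: "int \<Rightarrow> (5 \<Rightarrow> int) \<Rightarrow> nat \<Rightarrow> int" where
  "mE d w i = (if i = 1 then d else if i = 6 then w 1 else if i = 5 then w 1 + w 2
     else if i = 4 then w 1 + w 2 + w 3 else if i = 3 then (w 1 + w 2 + w 3 + w 4 - w 0) div 2
     else (w 1 + w 2 + w 3 + w 4 + w 0) div 2)"

lemma mE_lin:
  assumes "even (w 1 + w 2 + w 3 + w 4 + w 0)"
  shows "(\<Sum>i=1..6. of_int (mE d w i) * lin (sE i) a c)
    = of_int d * ((a 0 - a 1 - a 2 - a 3 - a 4) / 2 + c) + (\<Sum>i\<in>UNIV. of_int (w i) * a i)"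
proof -
  obtain k where k: "w 1 + w 2 + w 3 + w 4 + w 0 = 2 * k" using assms by (elim evenE)
  then have w: "w 0 = 2 * k - w 1 - w 2 - w 3 - w 4" by simp
  have d: "(w 1 + w 2 + w 3 + w 4 - w 0) div 2 = w 1 + w 2 + w 3 + w 4 - k" "(w 1 + w 2 + w 3 + w 4 + w 0) div 2 = k"
    using k by linarith+
  show ?thesis unfolding sum_1_6 lin_sE mE_def d sum_5 by (simp add: w algebra_simps)
qed

lemma card_5_parity: "even (card (I :: 5 set)) \<longleftrightarrow>
  even ((if 0 \<in> I then 1 else 0 :: int) + (if 1 \<in> I then 1 else 0) + (if 2 \<in> I then 1 else 0) + (if 3 \<in> I then 1 else 0) + (if 4 \<in> I then 1 else 0))"
proof -
  have "int (card I) = (\<Sum>i\<in>UNIV. if i \<in> I then 1 else 0)" by (simp add: sum.If_cases)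
  then show ?thesis unfolding sum_5 by (metis even_of_nat)
qed

text \<open>The weight of index \<open>I\<close> minus the lowest weight, whose only positive
  coordinate is the one at 0.\<close>

definition posw :: "5 set \<Rightarrow> 5 \<Rightarrow> int" where
  "posw I i = (if i = 0 then (if i \<in> I then -1 else 0) else if i \<in> I then 0 else 1)"

lemma posw_even: "even (card I) \<Longrightarrow> even (posw I 1 + posw I 2 + posw I 3 + posw I 4 + posw I 0)"
  unfolding card_5_parity posw_def
  by (cases "0 \<in> I"; cases "1 \<in> I"; cases "2 \<in> I"; cases "3 \<in> I"; cases "4 \<in> I"; simp)

lemma lin_Pos_posw: "lin (Pos I) a c = (a 0 - a 1 - a 2 - a 3 - a 4) / 2 + c + (\<Sum>i\<in>UNIV. of_int (posw I i) * a i)"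
  unfolding lin.simps sum_5 posw_def sgn_in_def
  by (cases "0 \<in> I"; cases "1 \<in> I"; cases "2 \<in> I"; cases "3 \<in> I"; cases "4 \<in> I"; simp; simp add: field_simps)

lemma mE_posw_nonneg: "even (card I) \<Longrightarrow> i \<in> {1..6} \<Longrightarrow> 0 \<le> mE 1 (posw I) i"
  unfolding card_5_parity posw_def mE_def atLeast1_atMost6
  by (cases "0 \<in> I"; cases "1 \<in> I"; cases "2 \<in> I"; cases "3 \<in> I"; cases "4 \<in> I"; simp)

definition ieps :: "5 + 5 \<Rightarrow> 5 \<Rightarrow> int" where
  "ieps p i = (if p = Inl i then 1 else if p = Inr i then -1 else 0)"

lemma eps_ieps: "eps p a = (\<Sum>i\<in>UNIV. of_int (ieps p i) * a i)"
proof (cases p)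
  case (Inl j)
  have "(\<Sum>i\<in>UNIV. of_int (ieps p i) * a i) = (\<Sum>i\<in>UNIV. if i = j then a i else 0)"
    using Inl by (intro sum.cong) (auto simp: ieps_def)
  then show ?thesis using Inl by (simp add: eps_def)
next
  case (Inr j)
  have "(\<Sum>i\<in>UNIV. of_int (ieps p i) * a i) = (\<Sum>i\<in>UNIV. if i = j then - a i else 0)"
    using Inr by (intro sum.cong) (auto simp: ieps_def)
  then show ?thesis using Inr by (simp add: eps_def)
qed

lemma exhaust_55: "p \<in> {Inl 0, Inl 1, Inl 2, Inl 3, Inl (4 :: 5), Inr 0, Inr 1, Inr 2, Inr 3, Inr (4 :: 5)}"
  using exhaust_5 by (cases p) auto

lemma ieps_even: "even (ieps p 1 + ieps q 1 + (ieps p 2 + ieps q 2) + (ieps p 3 + ieps q 3) + (ieps p 4 + ieps q 4) + (ieps p 0 + ieps q 0))"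
proof -
  have "odd (ieps p 1 + ieps p 2 + ieps p 3 + ieps p 4 + ieps p 0)" for p
    using exhaust_55[of p] by (elim insertE emptyE; simp add: ieps_def)
  from this[of p] this[of q] show ?thesis by presburger
qed

lemma mE_ieps_sign:
  assumes "q \<noteq> p" "q \<noteq> dual_index p"
  shows "(\<forall>i\<in>{1..6}. 0 \<le> mE 0 (\<lambda>i. ieps p i + ieps q i) i) \<or> (\<forall>i\<in>{1..6}. mE 0 (\<lambda>i. ieps p i + ieps q i) i \<le> 0)"
  using assms exhaust_55[of p] exhaust_55[of q] unfolding atLeast1_atMost6 mE_def
  by (elim insertE emptyE; simp add: ieps_def)

lemma root_combination:
  assumes k: "k \<in> KE"
  shows "\<exists>m. (\<forall>a c. lin k a c = (\<Sum>i=1..6. of_int (m i) * lin (sE i) a c)) \<and>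
    ((\<forall>i\<in>{1..6}. m i \<ge> 0) \<or> (\<forall>i\<in>{1..6}. m i \<le> 0))"
proof (cases k)
  case (Pos I)
  then have I: "even (card I)" using k by (auto simp: KE_def)
  show ?thesis
    using mE_lin[OF posw_even[OF I], of 1] mE_posw_nonneg[OF I] Pos
    by (intro exI[of _ "mE 1 (posw I)"]) (simp del: lin.simps add: lin_Pos_posw)
next
  case (Neg I)
  then have I: "even (card I)" using k by (auto simp: KE_def)
  have "lin k a c = (\<Sum>i=1..6. of_int (- mE 1 (posw I) i) * lin (sE i) a c)" for a c
  proof -
    have "lin k a c = - lin (Pos I) a c" using Neg by simp
    also have "\<dots> = - (\<Sum>i=1..6. of_int (mE 1 (posw I) i) * lin (sE i) a c)"
      unfolding mE_lin[OF posw_even[OF I]] lin_Pos_posw by simp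
    finally show ?thesis by (simp add: sum_negf)
  qed
  then show ?thesis using mE_posw_nonneg[OF I]
    by (intro exI[of _ "\<lambda>i. - mE 1 (posw I) i"]) simp
next
  case (Vec S)
  then obtain p q where S: "S = {p, q}" "p \<noteq> q" "q \<noteq> dual_index p" using k by (auto simp: KE_def vec_pair_def)
  have "lin k a c = (\<Sum>i=1..6. of_int (mE 0 (\<lambda>i. ieps p i + ieps q i) i) * lin (sE i) a c)" for a c
    using S(2) by (subst mE_lin[OF ieps_even]) (simp add: Vec S(1) eps_ieps sum.distrib algebra_simps)
  then show ?thesis using mE_ieps_sign[of q p] S by blast
qed

lemma E6_indep:
  assumes "\<And>x. x \<in> hE \<Longrightarrow> (\<Sum>i=1..6. c i * wtE (sE i) x) = 0" "i \<in> {1..6}"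
  shows "c i = 0"
proof -
  have e: "(\<Sum>i=1..6. c i * lin (sE i) a d) = 0" for a d using assms(1)[of "hel a d"] by simp
  have c1: "c 1 = 0" using e[of "\<lambda>_. 0" 1] unfolding sum_1_6 lin_sE by simp
  have c6: "c 6 = 0" using e[of "ind 1" 0] c1 unfolding sum_1_6 lin_sE by simp
  have c5: "c 5 = 0" using e[of "ind 2" 0] c1 c6 unfolding sum_1_6 lin_sE by simp
  have c4: "c 4 = 0" using e[of "ind 3" 0] c1 c5 unfolding sum_1_6 lin_sE by simp
  have "c 2 + c 3 = 0" using e[of "ind 4" 0] c1 c4 unfolding sum_1_6 lin_sE by simp
  moreover have "c 2 - c 3 = 0" using e[of "ind 0" 0] c1 unfolding sum_1_6 lin_sE by simp
  ultimately have "c 2 = 0" "c 3 = 0" by (metis add_self_div_2 div_0 diff_eq_eq add_0 mult_2 mult_eq_0_iff zero_neq_numeral)+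
  then show ?thesis using assms(2) c1 c4 c5 c6 unfolding atLeast1_atMost6 by auto
qed

lemma corE_hE: "corE k \<in> hE" by (cases k) simp_all

lemma E6_dynkin_base: "e6.dynkin_base hE 6 (\<lambda>i. wtE (sE i)) E6_edges"
proof (rule E6.dynkin_baseI)
  show "i \<in> {1..6} \<Longrightarrow> sE i \<in> KE" for i by (rule sE_KE)
  show "c i = 0" if "\<And>x. x \<in> hE \<Longrightarrow> (\<Sum>i=1..6. c i * wtE (sE i) x) = 0" "i \<in> {1..6}" for c i
    using that by (rule E6_indep)
next
  fix k assume "k \<in> KE"
  then show "\<exists>m. (\<forall>x\<in>hE. wtE k x = (\<Sum>i=1..6. of_int (m i) * wtE (sE i) x)) \<and>
        ((\<forall>i\<in>{1..6}. m i \<ge> 0) \<or> (\<forall>i\<in>{1..6}. m i \<le> 0))"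
    using root_combination[of k] by (auto simp: hE_def)
next
  fix j :: nat assume j: "j \<in> {1..6}"
  obtain y where y: "y \<in> e6" "\<And>a c. e6_br (hel a c) y = e6_scale (- lin (sE j) a c) y" "e6_br (eE (sE j)) y = corE (sE j)"
    using coroot_exists[OF sE_KE[OF j]] by blast
  have "y \<in> e6.root_space hE (\<lambda>x. - wtE (sE j) x)"
    unfolding e6.root_space_def using y by (auto simp: hE_def)
  then show "\<exists>y\<in>e6.root_space hE (\<lambda>x. - wtE (sE j) x). e6_br (eE (sE j)) y \<in> hE \<and>
     (\<forall>i\<in>{1..6}. wtE (sE i) (e6_br (eE (sE j)) y) = (if i = j then 2 else if {i, j} \<in> E6_edges then -1 else 0))"
    using y(3) corE_hE cartan_matrix[OF _ j] by (intro bexI[of _ y]) simp_all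
qed

lemma E6_semisimple: "e6.semisimple"
proof (rule E6.semisimple_root_datum)
  fix k assume k: "k \<in> KE"
  obtain y where y: "y \<in> e6" "e6_br (eE k) y = corE k" using coroot_exists[OF k] by blast
  have "e6_br (corE k) (eE k) = e6_scale (wtE k (corE k)) (eE k)" by (rule E6.br_e[OF k corE_hE])
  then have "e6_br (e6_br (eE k) y) (eE k) \<noteq> 0" using y lin_corE[OF k] E6.e_nz[OF k] by simp
  then show "\<exists>y\<in>e6. e6_br (e6_br (eE k) y) (eE k) \<noteq> 0" using y(1) by blast
next
  fix h assume h: "h \<in> hE" "\<And>k. k \<in> KE \<Longrightarrow> wtE k h = 0"
  then obtain a c where a: "h = hel a c" by (auto simp: hE_def)
  have l: "lin (sE i) a c = 0" if "i \<in> {1..6}" for i using h(2)[OF sE_KE[OF that]] a by simp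
  have "a 4 + a 0 = 0" "a 4 - a 0 = 0" "a 3 - a 4 = 0" "a 2 - a 3 = 0" "a 1 - a 2 = 0" "(a 0 - a 1 - a 2 - a 3 - a 4) / 2 + c = 0"
    using l[of 1] l[of 2] l[of 3] l[of 4] l[of 5] l[of 6] unfolding lin_sE by simp_all
  then have z: "a 4 = 0" "a 0 = 0" "a 3 = 0" "a 2 = 0" "a 1 = 0" "c = 0" by auto
  have "a i = 0" for i using exhaust_5[of i] z by auto
  then have "a = (\<lambda>_. 0)" by auto
  then show "h = 0" using a z by (simp add: hel_def cart_linear zero_prod_def)
qed

section \<open>Comparison of the two gradings\<close>

fun degE :: "e6_root \<Rightarrow> int" where
  "degE (Pos I) = 1" | "degE (Neg I) = -1" | "degE (Vec S) = 0"

lemma lin_degE: "lin k (\<lambda>_. 0) 1 = of_int (degE k)"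
  unfolding lin_center by (cases k) simp_all

text \<open>The central element \<open>hel\<close> with zero matrix part and scalar 1 takes the
  value 1 on \<open>sE 1\<close> and 0 on the other simple roots. So the coefficient of the first
  simple root in a root is the degree of its root vector.\<close>

lemma E6_grading: "e6_deg d = e6.simple_root_grading hE 6 (\<lambda>i. wtE (sE i)) 1 d"
proof -
  let ?R = "\<Union>{e6.root_space hE (e6.int_comb 6 (\<lambda>i. wtE (sE i)) m) | m.
      e6.int_comb 6 (\<lambda>i. wtE (sE i)) m \<in> e6.roots hE \<and> m 1 = d}"
  have R: "?R = (\<Union>k\<in>{k \<in> KE. degE k = d}. range (\<lambda>c. e6_scale c (eE k)))"
  proof (intro set_eqI iffI)
    fix z assume "z \<in> ?R"
    then obtain m where m: "z \<in> e6.root_space hE (e6.int_comb 6 (\<lambda>i. wtE (sE i)) m)"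
       "e6.int_comb 6 (\<lambda>i. wtE (sE i)) m \<in> e6.roots hE" "m 1 = d" by blast
    obtain k where k: "k \<in> KE" "e6.int_comb 6 (\<lambda>i. wtE (sE i)) m = wtE k" using m(2) unfolding E6.roots_eq by blast
    have "wtE k (hel (\<lambda>_. 0) 1) = (\<Sum>i=1..6. of_int (m i) * wtE (sE i) (hel (\<lambda>_. 0) 1))"
      unfolding k(2)[symmetric] e6.int_comb_def ..
    also have "\<dots> = of_int (m 1)" unfolding wtE_hel sum_1_6 lin_sE by simp
    finally have "degE k = d" using m(3) by (simp add: lin_degE)
    then show "z \<in> (\<Union>k\<in>{k \<in> KE. degE k = d}. range (\<lambda>c. e6_scale c (eE k)))"
      using m(1) k E6.root_space_wt[OF k(1)] by auto
  next
    fix z assume "z \<in> (\<Union>k\<in>{k \<in> KE. degE k = d}. range (\<lambda>c. e6_scale c (eE k)))"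
    then obtain k where k: "k \<in> KE" "degE k = d" "z \<in> range (\<lambda>c. e6_scale c (eE k))" by blast
    obtain m where m: "\<And>a c. lin k a c = (\<Sum>i=1..6. of_int (m i) * lin (sE i) a c)" using root_combination[OF k(1)] by blast
    have e: "e6.int_comb 6 (\<lambda>i. wtE (sE i)) m = wtE k"
    proof
      fix x show "e6.int_comb 6 (\<lambda>i. wtE (sE i)) m x = wtE k x"
      proof (cases "x \<in> hE")
        case True
        then obtain a c where "x = hel a c" by (auto simp: hE_def)
        then show ?thesis unfolding e6.int_comb_def by (simp add: m)
      qed (simp add: e6.int_comb_def wtE_def)
    qed
    have "lin k (\<lambda>_. 0) 1 = of_int (m 1)" unfolding m sum_1_6 lin_sE by simp
    then have "m 1 = d" using k(2) by (simp add: lin_degE)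
    moreover have "wtE k \<in> e6.roots hE" unfolding E6.roots_eq using k(1) by blast
    ultimately have "e6.root_space hE (wtE k) \<subseteq> ?R" using e by (intro Union_upper CollectI exI[of _ m]) simp
    then show "z \<in> ?R" using k(3) unfolding E6.root_space_wt[OF k(1)] by blast
  qed
  have sp: "e6.simple_root_grading hE 6 (\<lambda>i. wtE (sE i)) 1 d
     = e6.span ((if d = 0 then hE else {}) \<union> (\<Union>k\<in>{k \<in> KE. degE k = d}. range (\<lambda>c. e6_scale c (eE k))))"
    unfolding e6.simple_root_grading_def R ..
  have base: "eE k \<in> e6.simple_root_grading hE 6 (\<lambda>i. wtE (sE i)) 1 d" if "k \<in> KE" "degE k = d" for k
  proof -
    have "e6_scale 1 (eE k) \<in> range (\<lambda>c. e6_scale c (eE k))" by (rule rangeI)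
    then show ?thesis unfolding sp using that by (intro e6.span_base) auto
  qed
  consider "d = -1" | "d = 0" | "d = 1" | "d \<noteq> -1" "d \<noteq> 0" "d \<noteq> 1" by blast
  then have sub2: "e6_deg d \<subseteq> e6.simple_root_grading hE 6 (\<lambda>i. wtE (sE i)) 1 d"
  proof cases
    case 1
    have "eE ` Neg ` {I. even (card I)} \<subseteq> e6.simple_root_grading hE 6 (\<lambda>i. wtE (sE i)) 1 d"
      using base 1 by (auto simp: KE_def simp del: eE.simps)
    then have "e6.span (eE ` Neg ` {I. even (card I)}) \<subseteq> e6.simple_root_grading hE 6 (\<lambda>i. wtE (sE i)) 1 d"
      by (rule e6.span_minimal) (simp only: sp e6.subspace_span)
    then show ?thesis using X_neg_span 1 by (auto simp: e6_deg_m1)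
  next
    case 3
    have "eE ` Pos ` {I. even (card I)} \<subseteq> e6.simple_root_grading hE 6 (\<lambda>i. wtE (sE i)) 1 d"
      using base 3 by (auto simp: KE_def simp del: eE.simps)
    then have "e6.span (eE ` Pos ` {I. even (card I)}) \<subseteq> e6.simple_root_grading hE 6 (\<lambda>i. wtE (sE i)) 1 d"
      by (rule e6.span_minimal) (simp only: sp e6.subspace_span)
    then show ?thesis using X_pos_span 3 by (auto simp: e6_deg_1)
  next
    case 2
    have "eE ` Vec ` {S. vec_pair S} \<subseteq> e6.simple_root_grading hE 6 (\<lambda>i. wtE (sE i)) 1 d"
      using base 2 by (auto simp: KE_def simp del: eE.simps)
    moreover have "hE \<subseteq> e6.simple_root_grading hE 6 (\<lambda>i. wtE (sE i)) 1 d"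
      unfolding sp using 2 by (auto intro: e6.span_base)
    ultimately have "hE \<union> eE ` Vec ` {S. vec_pair S} \<subseteq> e6.simple_root_grading hE 6 (\<lambda>i. wtE (sE i)) 1 d"
      by blast
    then have "e6.span (hE \<union> eE ` Vec ` {S. vec_pair S}) \<subseteq> e6.simple_root_grading hE 6 (\<lambda>i. wtE (sE i)) 1 d"
      by (rule e6.span_minimal) (simp only: sp e6.subspace_span)
    then show ?thesis using soA_span 2 by (auto simp: e6_deg_0 deg0_def)
  next
    case 4
    then show ?thesis unfolding sp by (simp add: e6_deg_other e6.span_zero)
  qed
  have z: "(\<chi> I. 0) = (0 :: spinor_mat)" by (simp add: vec_eq_iff)
  have dsub: "e6.subspace (e6_deg d)"
  proof -
    consider "d = -1" | "d = 0" | "d = 1" | "d \<noteq> -1" "d \<noteq> 0" "d \<noteq> 1" by blast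
    then show ?thesis
    proof cases
      case 2 then show ?thesis by (simp add: e6_deg_def)
    qed (auto simp: e6_deg_m1 e6_deg_1 e6_deg_other e6.subspace_def zero_prod_def X_add X_scale z)
  qed
  have "hE \<subseteq> e6_deg 0" by (auto simp: hE_def hel_def e6_deg_0 deg0_def cart_soA)
  moreover have "eE k \<in> e6_deg (degE k)" if "k \<in> KE" for k
    using eE_e6[OF that] by (cases k) (auto simp: e6_deg_0 e6_deg_1 e6_deg_m1 deg0_def e6_iff zero_prod_def)
  then have "range (\<lambda>c. e6_scale c (eE k)) \<subseteq> e6_deg d" if "k \<in> KE" "degE k = d" for k
    using that dsub e6.subspace_scale by blast
  ultimately have "(if d = 0 then hE else {}) \<union> (\<Union>k\<in>{k \<in> KE. degE k = d}. range (\<lambda>c. e6_scale c (eE k))) \<subseteq> e6_deg d"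
    by (cases "d = 0") auto
  then have "e6.simple_root_grading hE 6 (\<lambda>i. wtE (sE i)) 1 d \<subseteq> e6_deg d"
    unfolding sp by (rule e6.span_minimal) (rule dsub)
  with sub2 show ?thesis by blast
qed

section \<open>The spin group and its orbits\<close>

abbreviation pprod :: "(complex ^ (5 + 5)) list \<Rightarrow> spinor_mat" where
  "pprod vs \<equiv> foldr (\<lambda>v M. gamma v ** M) vs (mat 1)"

lemma pprod_append: "pprod (us @ vs) = pprod us ** pprod vs"
  by (induction us) (simp_all add: matrix_mul_assoc)

lemma Spin10_iff: "s \<in> Spin10 \<longleftrightarrow> (\<exists>vs. s = pprod vs \<and> even (length vs) \<and> (\<forall>v\<in>set vs. quad v = 1))"
  unfolding Spin10_def by blast

lemma Spin10_one [simp]: "mat 1 \<in> Spin10"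
  unfolding Spin10_iff by (intro exI[of _ "[]"]) simp

lemma Spin10_mult: "s \<in> Spin10 \<Longrightarrow> t \<in> Spin10 \<Longrightarrow> s ** t \<in> Spin10"
proof -
  assume "s \<in> Spin10" "t \<in> Spin10"
  then obtain us vs where "s = pprod us" "even (length us)" "\<forall>v\<in>set us. quad v = 1"
    "t = pprod vs" "even (length vs)" "\<forall>v\<in>set vs. quad v = 1" unfolding Spin10_iff by blast
  then show ?thesis unfolding Spin10_iff by (intro exI[of _ "us @ vs"]) (auto simp: pprod_append simp del: foldr_append)
qed

lemma gamma_gamma_mm: "gamma v ** gamma v = cmat (quad v) (mat 1)"
  by (simp add: matrix_eq matrix_vector_mul_assoc[symmetric] gamma_sq)

lemma pprod_rev: "\<forall>v\<in>set vs. quad v = 1 \<Longrightarrow> pprod (rev vs) ** pprod vs = mat 1"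
proof (induction vs)
  case (Cons v vs)
  have "pprod (rev (v # vs)) ** pprod (v # vs) = pprod (rev vs) ** (gamma v ** gamma v) ** pprod vs"
    by (simp only: rev.simps pprod_append foldr.simps o_apply matrix_mul_assoc id_apply matrix_mul_rid)
  then show ?case using Cons by (simp add: gamma_gamma_mm)
qed simp

lemma Spin10_inverse:
  assumes "s \<in> Spin10" obtains s' where "s' \<in> Spin10" "s ** s' = mat 1" "s' ** s = mat 1"
proof -
  obtain vs where vs: "s = pprod vs" "even (length vs)" "\<forall>v\<in>set vs. quad v = 1" using assms unfolding Spin10_iff by blast
  have "pprod (rev vs) \<in> Spin10" unfolding Spin10_iff using vs by (intro exI[of _ "rev vs"]) simp
  moreover have "pprod (rev vs) ** s = mat 1" using pprod_rev[OF vs(3)] vs(1) by simp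
  moreover have "s ** pprod (rev vs) = mat 1" using pprod_rev[of "rev vs"] vs by simp
  ultimately show thesis using that by blast
qed

lemma pprod_induct_even:
  assumes "even (length vs)" "P []" "\<And>u v vs. P vs \<Longrightarrow> P (u # v # vs)"
  shows "P vs"
  using assms(1)
proof (induction vs rule: induct_list012)
  case (3 u v vs) then show ?case using assms(3) by simp
qed (use assms(2) in simp_all)

lemma Spin10_X: "s \<in> Spin10 \<Longrightarrow> x \<in> X \<Longrightarrow> s *v x \<in> X"
proof -
  assume "s \<in> Spin10" "x \<in> X"
  then obtain vs where vs: "s = pprod vs" "even (length vs)" unfolding Spin10_iff by blast
  have "pprod vs *v x \<in> X" using vs(2)
    by (rule pprod_induct_even) (simp_all add: \<open>x \<in> X\<close> matrix_vector_mul_assoc[symmetric] gamma_gamma_X)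
  then show ?thesis using vs by simp
qed

lemma Spin10_Om: "s \<in> Spin10 \<Longrightarrow> Om (s ** M ** transpose s) = s ** Om M ** transpose s"
proof -
  assume "s \<in> Spin10"
  then obtain vs where vs: "s = pprod vs" unfolding Spin10_iff by blast
  have "Om (pprod vs ** M ** transpose (pprod vs)) = pprod vs ** Om M ** transpose (pprod vs)"
  proof (induction vs arbitrary: M)
    case Nil then show ?case by (simp add: transpose_mat)
  next
    case (Cons v vs)
    have "pprod (v # vs) ** N ** transpose (pprod (v # vs)) = gamma v ** (pprod vs ** N ** transpose (pprod vs)) ** transpose (gamma v)" for N
      by (simp add: matrix_transpose_mul matrix_mul_assoc)
    then show ?case by (simp only: Om_gamma Cons.IH)
  qed
  then show ?thesis using vs by simp
qed

text \<open>Conjugation by \<open>gamma u\<close> with \<open>quad u = 1\<close> is minus the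
  reflection in \<open>u\<close>, hence maps Clifford vectors to Clifford vectors.\<close>

lemma pprod_gamma: "\<forall>v\<in>set vs. quad v = 1 \<Longrightarrow> \<exists>w. pprod vs ** gamma v = gamma w ** pprod vs"
proof (induction vs arbitrary: v)
  case Nil then show ?case by auto
next
  case (Cons u vs)
  then obtain w where w: "pprod vs ** gamma v = gamma w ** pprod vs" by auto
  have "gamma u ** gamma w = gamma (polar u w *s u - w) ** gamma u"
  proof -
    have "gamma u *v (gamma w *v z) = gamma (polar u w *s u - w) *v (gamma u *v z)" for z
      using Cons.prems by (simp add: gamma_linear matrix_vector_mult_diff_rdistrib gamma_sq gamma_swap[of u w])
    then show ?thesis by (simp add: matrix_eq matrix_vector_mul_assoc[symmetric])
  qed
  then have "pprod (u # vs) ** gamma v = gamma (polar u w *s u - w) ** pprod (u # vs)"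
    using w by (simp add: matrix_mul_assoc[symmetric]) (simp add: matrix_mul_assoc)
  then show ?case by blast
qed

lemma Spin10_gamma: "s \<in> Spin10 \<Longrightarrow> \<exists>w. s ** gamma v = gamma w ** s"
  unfolding Spin10_iff using pprod_gamma by blast

lemma Spin10_conj_gamma:
  assumes "s \<in> Spin10" "s ** s' = mat 1"
  obtains w where "s ** gamma v ** s' = gamma w"
proof -
  obtain w where "s ** gamma v = gamma w ** s" using Spin10_gamma[OF assms(1)] by blast
  then have "s ** gamma v ** s' = gamma w" using assms(2) by (metis matrix_mul_assoc matrix_mul_rid)
  then show thesis using that by blast
qed

lemma Spin10_conj_soA:
  assumes "s \<in> Spin10" "s ** s' = mat 1" "s' ** s = mat 1" "A \<in> soA"
  shows "s ** A ** s' \<in> soA"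
  using assms(4)
proof (induction A rule: soA_induct)
  case zero then show ?case by simp
next
  case (gen v w k)
  obtain v' where v': "s ** gamma v ** s' = gamma v'" using Spin10_conj_gamma[OF assms(1,2)] by blast
  obtain w' where w': "s ** gamma w ** s' = gamma w'" using Spin10_conj_gamma[OF assms(1,2)] by blast
  have mm: "s ** (A ** B) ** s' = s ** A ** s' ** (s ** B ** s')" for A B
  proof -
    have "s ** A ** s' ** (s ** B ** s') = s ** A ** (s' ** s) ** B ** s'" by (simp only: matrix_mul_assoc)
    then show ?thesis by (simp add: assms matrix_mul_assoc)
  qed
  have sg: "spin_gen v w = cmat (1/2) (gamma v ** gamma w - gamma w ** gamma v)" for v w
    by (simp add: spin_gen_def vec_eq_iff)
  have "s ** spin_gen v w ** s' = spin_gen v' w'"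
    unfolding sg by (simp add: matrix_diff_distrib mm v' w')
  then show ?case by (simp add: soA_scale soA_gen)
next
  case (add A B)
  then show ?case by (simp add: matrix_add_ldistrib matrix_add_rdistrib' soA_add)
qed

subsection \<open>Unipotent, diagonal and reflection elements\<close>

lemma Spin10_pair: "quad u = 1 \<Longrightarrow> quad v = 1 \<Longrightarrow> gamma u ** gamma v \<in> Spin10"
  unfolding Spin10_iff by (intro exI[of _ "[u, v]"]) simp

text \<open>The element is the product of \<open>gamma u\<close> and \<open>gamma (u + c v)\<close>,
  where \<open>c\<close> is a square root of \<open>quad w\<close> and \<open>u\<close> is
  \<open>w\<close> divided by \<open>c\<close>; both are unit vectors because \<open>v\<close> is
  isotropic and orthogonal to \<open>w\<close>.\<close>

lemma unipotent_Spin10_anisotropic: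
  assumes "quad v = 0" "polar w v = 0" "quad w \<noteq> 0"
  shows "mat 1 + gamma w ** gamma v \<in> Spin10"
proof -
  let ?c = "csqrt (quad w)"
  have c: "?c \<noteq> 0" "?c\<^sup>2 = quad w" using assms(3) by auto
  define u where "u = (1 / ?c) *s w"
  have u: "quad u = 1" using c by (simp add: u_def quad_scale power_divide)
  have v: "quad (u + ?c *s v) = 1" using u assms by (simp add: quad_add quad_scale u_def polar_simps)
  have "gamma u ** gamma (u + ?c *s v) = mat 1 + gamma w ** gamma v"
    using u c by (simp add: gamma_linear matrix_add_ldistrib gamma_gamma_mm) (simp add: u_def gamma_linear)
  then show ?thesis using Spin10_pair[OF u v] by simp
qed

text \<open>An isotropic \<open>w\<close> is written as \<open>(w + t z) - t z\<close>, where
  \<open>z\<close> is a unit vector from another hyperbolic pair; one of the signs \<open>t\<close>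
  makes \<open>w + t z\<close> anisotropic. The unipotent elements multiply by adding their vectors,
  since \<open>gamma (axis p 1)\<close> on both sides of \<open>gamma z\<close> gives zero.\<close>

lemma unipotent_Spin10:
  assumes "polar w (axis p 1) = 0"
  shows "mat 1 + gamma w ** gamma (axis p 1) \<in> Spin10"
proof (cases "quad w = 0")
  case False then show ?thesis by (intro unipotent_Spin10_anisotropic) (simp_all add: assms)
next
  case True
  obtain j where j: "p \<noteq> Inl j" "p \<noteq> Inr j"
  proof (cases p)
    case (Inl i) then show thesis using that[of "if i = 0 then 1 else 0"] by auto
  next
    case (Inr i) then show thesis using that[of "if i = 0 then 1 else 0"] by auto
  qed
  define z where "z = axis (Inl j) 1 + (axis (Inr j) 1 :: complex ^ (5 + 5))"
  have qz: "quad z = 1" by (simp add: z_def quad_add polar_axis_axis)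
  have pz: "polar z (axis p 1) = 0" using j by (cases p) (auto simp: z_def polar_simps polar_axis_axis)
  have qt: "quad (w + t *s z) = t\<^sup>2 + t * polar w z" for t
    by (simp add: quad_add quad_scale qz True polar_simps)
  have "\<exists>t\<in>{1, -1}. quad (w + t *s z) \<noteq> 0"
  proof (rule ccontr)
    assume "\<not> ?thesis"
    then have "1 + polar w z = 0" "1 - polar w z = 0" by (auto simp: qt)
    then show False by (metis add_diff_cancel_left' diff_add_cancel one_add_one zero_neq_numeral add.right_neutral)
  qed
  then obtain t where t: "t \<in> {1, -1}" "quad (w + t *s z) \<noteq> 0" by blast
  let ?p = "axis p 1"
  have 1: "mat 1 + gamma (w + t *s z) ** gamma ?p \<in> Spin10"
    by (rule unipotent_Spin10_anisotropic) (use t assms pz in \<open>simp_all add: polar_simps\<close>)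
  have 2: "mat 1 + gamma (- t *s z) ** gamma ?p \<in> Spin10"
    by (rule unipotent_Spin10_anisotropic) (use t assms pz qz in \<open>auto simp: polar_simps quad_scale\<close>)
  have "(mat 1 + gamma (w + t *s z) ** gamma ?p) ** (mat 1 + gamma (- t *s z) ** gamma ?p) *v x
      = (mat 1 + gamma w ** gamma ?p) *v x" for x
  proof -
    have "gamma ?p *v (gamma z *v (gamma ?p *v x)) = 0"
      using pz by (simp add: gamma_swap[of ?p z] polar_commute[of ?p z] gamma_sq)
    then show ?thesis
      by (simp add: matrix_vector_mult_add_rdistrib matrix_vector_mult_diff_rdistrib matrix_vector_mul_assoc[symmetric] gamma_linear mv_minus
          matrix_vector_right_distrib matrix_vector_mult_diff_distrib vector_scalar_commute)
  qed
  then show ?thesis using Spin10_mult[OF 1 2] by (metis matrix_eq)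
qed

lemma unipotent_axis_Spin10:
  assumes "q \<noteq> dual_index p"
  shows "mat 1 + cmat t (gamma (axis q 1) ** gamma (axis p 1)) \<in> Spin10"
proof -
  have "polar (t *s axis q 1) (axis p 1) = 0"
  proof -
    have "p \<noteq> dual_index q" using assms by (metis dual_index_simps(3))
    then show ?thesis by (simp add: polar_simps polar_axis_axis)
  qed
  from unipotent_Spin10[OF this] show ?thesis by (simp add: gamma_linear)
qed

text \<open>The diagonal operator with eigenvalue \<open>l\<close> at \<open>{}\<close>, where each
  element \<open>i\<close> of the index contributes a factor \<open>m i\<close>. These factors are
  the weights on the vectors \<open>axis (Inr i) 1\<close>, and their inverses those on
  \<open>axis (Inl i) 1\<close>.\<close>

definition dg :: "complex \<Rightarrow> (5 \<Rightarrow> complex) \<Rightarrow> spinor_mat" where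
  "dg l m = (\<chi> I J. if I = J then l * (\<Prod>i\<in>I. m i) else 0)"

lemma dg_mv: "(dg l m *v x) $ I = l * (\<Prod>i\<in>I. m i) * x $ I"
  by (simp add: dg_def matrix_vector_mult_def if_distrib[of "\<lambda>z. z * _"] cong: if_cong)

lemma dg_mult: "dg l m ** dg l' m' = dg (l * l') (\<lambda>i. m i * m' i)"
  by (simp add: matrix_eq matrix_vector_mul_assoc[symmetric] vec_eq_iff dg_mv prod.distrib)

lemma dg_one: "dg 1 (\<lambda>_. 1) = mat 1"
  by (simp add: matrix_eq vec_eq_iff dg_mv)

definition Diag :: "spinor_mat set" where
  "Diag = {dg l m | l m. l \<noteq> 0 \<and> (\<forall>i. m i \<noteq> 0)}"

text \<open>The unit vector of the \<open>i\<close>-th hyperbolic pair, which toggles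
  \<open>i\<close> in the index of a coordinate. It is odd, so only products of an even number of
  flips lie in \<open>Spin10\<close>.\<close>

definition flip :: "5 \<Rightarrow> spinor_mat" where
  "flip i = gamma (axis (Inl i) 1 + axis (Inr i) 1)"

lemma quad_flip: "quad (axis (Inl i) 1 + axis (Inr i) 1) = 1"
  by (simp add: quad_add polar_axis_axis)

lemma flip_mv: "(flip i *v x) $ I = sg i I * x $ (fl i I)"
  by (simp add: flip_def gamma_linear matrix_vector_mult_add_rdistrib gamma_axis wedge_mv contr_mv fl_def)

lemma flip_flip: "flip i ** flip i = mat 1"
  unfolding flip_def gamma_gamma_mm quad_flip by simp

lemma flip_Spin10: "flip i ** flip j \<in> Spin10"
  unfolding flip_def by (rule Spin10_pair) (simp_all add: quad_flip)

lemma sg_fl [simp]: "sg i (fl i I) = sg i I"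
  by (simp add: fl_def sg_insert sg_remove)

lemma flip_dg: "m i \<noteq> 0 \<Longrightarrow> flip i ** dg l m ** flip i = dg (l * m i) (m(i := 1 / m i))"
proof -
  assume m: "m i \<noteq> 0"
  have "l * prod m (fl i I) = l * m i * prod (m(i := 1 / m i)) I" for I
  proof (cases "i \<in> I")
    case True
    have "prod (m(i := 1 / m i)) I = 1 / m i * prod m (I - {i})"
      using True by (simp add: prod.remove[of I i])
    then show ?thesis using True m by (simp add: fl_def)
  next
    case False
    then have "prod (m(i := 1 / m i)) I = prod m I" by (intro prod.cong) auto
    then show ?thesis using False by (simp add: fl_def)
  qed
  moreover have "sg i I * (c * (sg i I * z)) = c * z" for I c z
    by (metis mult.left_commute sg_sq')
  ultimately show ?thesis
    by (simp only: matrix_eq matrix_vector_mul_assoc[symmetric] vec_eq_iff flip_mv dg_mv sg_fl fl_fl) blast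
qed

lemma flip_Diag: "d \<in> Diag \<Longrightarrow> flip i ** d ** flip i \<in> Diag"
proof -
  assume "d \<in> Diag"
  then obtain l m where d: "d = dg l m" "l \<noteq> 0" "\<And>i. m i \<noteq> 0" unfolding Diag_def by blast
  then show ?thesis unfolding Diag_def d(1) flip_dg[OF d(3)] 
    by (intro CollectI exI[of _ "l * m i"] exI[of _ "m(i := 1 / m i)"]) simp
qed

text \<open>Two unit vectors of the same hyperbolic plane, one of them rescaled by \<open>a\<close>
  and \<open>1 / a\<close>, multiply to a one-parameter torus element.\<close>

lemma torus_Spin10_single:
  assumes "a \<noteq> 0"
  shows "dg (1 / a) (\<lambda>j. if j = i then a\<^sup>2 else 1) \<in> Spin10"
proof -
  let ?v = "a *s axis (Inl i) 1 + (1 / a) *s axis (Inr i) 1"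
  have q: "quad ?v = 1" using assms by (simp add: quad_add quad_scale polar_simps polar_axis_axis)
  have g: "(gamma ?v *v x) $ I = sg i I * (if i \<in> I then 1 / a else a) * x $ (fl i I)" for x I
    by (simp add: gamma_linear matrix_vector_mult_add_rdistrib gamma_axis wedge_mv contr_mv fl_def)
  have "flip i ** gamma ?v = dg (1 / a) (\<lambda>j. if j = i then a\<^sup>2 else 1)"
  proof -
    have "(\<Prod>j\<in>I. if j = i then a\<^sup>2 else 1) = (if i \<in> I then a\<^sup>2 else 1)" for I :: "5 set" by simp
    then show ?thesis using assms
      by (simp add: matrix_eq matrix_vector_mul_assoc[symmetric] vec_eq_iff flip_mv dg_mv g mem_fl power2_eq_square)
  qed
  then show ?thesis using Spin10_pair[OF quad_flip q, of i] unfolding flip_def by simp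
qed

lemma torus_Spin10:
  assumes l: "l\<^sup>2 * (\<Prod>i\<in>UNIV. m i) = 1"
  shows "dg l m \<in> Spin10"
proof -
  have m: "m i \<noteq> 0" for i using l by (metis prod_zero finite UNIV_I mult_zero_right zero_neq_one)
  have l0: "l \<noteq> 0" using l by auto
  define r where "r i = csqrt (m i)" for i
  have r: "(r i)\<^sup>2 = m i" "r i \<noteq> 0" for i using m by (auto simp: r_def)
  have "(l * (\<Prod>i\<in>UNIV. r i))\<^sup>2 = 1" using l by (simp add: power_mult_distrib r prod_power_distrib)
  then have "l * (\<Prod>i\<in>UNIV. r i) = 1 \<or> l * (\<Prod>i\<in>UNIV. r i) = -1" by (simp add: power2_eq_1_iff)
  then obtain e where e: "e = 1 \<or> e = -1" "l * (\<Prod>i\<in>UNIV. r i) = e" by blast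
  \<comment> \<open>The square roots satisfy the required relation only up to the sign
    \<open>e\<close>, which is absorbed into the one at 0.\<close>
  define a where "a i = (if i = 0 then e * r i else r i)" for i
  have a: "(a i)\<^sup>2 = m i" "a i \<noteq> 0" for i using r e by (auto simp: a_def power_mult_distrib)
  have "l * (\<Prod>i\<in>UNIV. a i) = e * (l * (\<Prod>i\<in>UNIV. r i))" by (simp add: prod_5 a_def mult_ac)
  also have "\<dots> = 1" using e by auto
  finally have la: "l = 1 / (\<Prod>i\<in>UNIV. a i)" using a by (simp add: eq_divide_eq)
  let ?s = "\<lambda>i. dg (1 / a i) (\<lambda>j. if j = i then (a i)\<^sup>2 else 1)"
  have "?s 0 ** ?s 1 ** ?s 2 ** ?s 3 ** ?s 4 \<in> Spin10"
    by (intro Spin10_mult torus_Spin10_single a)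
  also have "?s 0 ** ?s 1 ** ?s 2 ** ?s 3 ** ?s 4 = dg l m"
  proof -
    have "(if i = 0 then (a 0)\<^sup>2 else 1) * (if i = 1 then (a 1)\<^sup>2 else 1) * (if i = 2 then (a 2)\<^sup>2 else 1) *
      (if i = 3 then (a 3)\<^sup>2 else 1) * (if i = 4 then (a 4)\<^sup>2 else 1) = m i" for i :: 5
      using exhaust_5[of i] by (elim disjE) (simp_all add: a)
    then show ?thesis unfolding dg_mult la by (simp add: prod_5)
  qed
  finally show ?thesis .
qed

lemma dg_wedge: "dg l m *v (wedge i *v x) = m i *s (wedge i *v (dg l m *v x))"
  by (simp add: vec_eq_iff dg_mv wedge_mv prod.remove[of _ i])

lemma dg_contr: "m i \<noteq> 0 \<Longrightarrow> dg l m *v (contr i *v x) = (1 / m i) *s (contr i *v (dg l m *v x))"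
  by (simp add: vec_eq_iff dg_mv contr_mv)

definition dwt :: "(5 \<Rightarrow> complex) \<Rightarrow> 5 + 5 \<Rightarrow> complex" where
  "dwt m p = (case p of Inl i \<Rightarrow> 1 / m i | Inr i \<Rightarrow> m i)"

lemma dg_gamma_axis: "(\<And>i. m i \<noteq> 0) \<Longrightarrow> dg l m *v (gamma (axis p 1) *v x) = dwt m p *s (gamma (axis p 1) *v (dg l m *v x))"
  by (cases p) (simp_all add: gamma_axis dg_wedge dg_contr dwt_def)

lemma dg_unipotent_commute:
  assumes "\<And>i. m i \<noteq> 0" "t = 0 \<or> dwt m q * dwt m p = 1"
  shows "dg l m ** (mat 1 + cmat t (gamma (axis q 1) ** gamma (axis p 1))) = (mat 1 + cmat t (gamma (axis q 1) ** gamma (axis p 1))) ** dg l m"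
proof -
  have "dg l m *v (gamma (axis q 1) *v (gamma (axis p 1) *v x)) = (dwt m q * dwt m p) *s (gamma (axis q 1) *v (gamma (axis p 1) *v (dg l m *v x)))" for x
    using assms(1) by (simp add: dg_gamma_axis vector_scalar_commute)
  then show ?thesis using assms(2)
    by (auto simp: matrix_eq matrix_vector_mul_assoc[symmetric] matrix_vector_mult_add_rdistrib matrix_vector_right_distrib vector_scalar_commute)
qed

subsection \<open>Reduction to normal form\<close>

text \<open>The reduction is carried out equivariantly: \<open>D\<close> is a set of diagonal elements having the
  spinor as an eigenvector, and stays diagonal. For \<open>D = {}\<close> this classifies the orbits; applied to
  a maximal torus of the normalizer of a line, it conjugates the torus to a standard one.\<close>

definition eigen :: "spinor_mat set \<Rightarrow> spinor \<Rightarrow> bool" where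
  "eigen D x \<longleftrightarrow> (\<forall>d\<in>D. \<exists>k. d *v x = k *s x)"

lemma eigen_conj:
  assumes "eigen D x" "g' ** g = mat 1"
  shows "eigen ((\<lambda>d. g ** d ** g') ` D) (g *v x)"
  unfolding eigen_def
proof safe
  fix d assume "d \<in> D"
  then obtain k where k: "d *v x = k *s x" using assms unfolding eigen_def by blast
  have "(g ** d ** g') *v (g *v x) = g *v (d *v ((g' ** g) *v x))" by (simp add: matrix_vector_mul_assoc matrix_mul_assoc)
  then show "\<exists>k. (g ** d ** g') *v (g *v x) = k *s (g *v x)" using assms(2) k
    by (intro exI[of _ k]) (simp add: vector_scalar_commute)
qed

definition reduces :: "spinor_mat set \<Rightarrow> spinor \<Rightarrow> (spinor \<Rightarrow> bool) \<Rightarrow> bool" where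
  "reduces D x P \<longleftrightarrow> (\<exists>g\<in>Spin10. \<exists>g'\<in>Spin10. g ** g' = mat 1 \<and> g' ** g = mat 1 \<and>
     (\<lambda>d. g ** d ** g') ` D \<subseteq> Diag \<and> P (g *v x))"

lemma reduces_refl: "D \<subseteq> Diag \<Longrightarrow> P x \<Longrightarrow> reduces D x P"
  unfolding reduces_def by (intro bexI[of _ "mat 1"]) auto

lemma reduces_step:
  assumes g: "g \<in> Spin10" "g' \<in> Spin10" "g ** g' = mat 1" "g' ** g = mat 1"
    and red: "reduces ((\<lambda>d. g ** d ** g') ` D) (g *v x) P"
  shows "reduces D x P"
proof -
  obtain h h' where h: "h \<in> Spin10" "h' \<in> Spin10" "h ** h' = mat 1" "h' ** h = mat 1"
     "(\<lambda>d. h ** d ** h') ` (\<lambda>d. g ** d ** g') ` D \<subseteq> Diag" "P (h *v (g *v x))"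
    using red unfolding reduces_def by blast
  have "h ** g ** (g' ** h') = h ** (g ** g') ** h'" "g' ** h' ** (h ** g) = g' ** (h' ** h) ** g"
    by (simp_all only: matrix_mul_assoc)
  then have "h ** g ** (g' ** h') = mat 1" "g' ** h' ** (h ** g) = mat 1" using g h by simp_all
  moreover have "h ** g ** d ** (g' ** h') = h ** (g ** d ** g') ** h'" for d by (simp only: matrix_mul_assoc)
  then have "(\<lambda>d. h ** g ** d ** (g' ** h')) ` D \<subseteq> Diag" using h(5) by (simp add: image_image)
  moreover have "P ((h ** g) *v x)" using h(6) by (simp add: matrix_vector_mul_assoc)
  ultimately show ?thesis unfolding reduces_def using g h by (intro bexI[of _ "h ** g"] bexI[of _ "g' ** h'"] conjI) (auto intro: Spin10_mult)
qed

lemma conj_commuting: "(\<And>d. d \<in> D \<Longrightarrow> d ** g = g ** d) \<Longrightarrow> g ** g' = mat 1 \<Longrightarrow> (\<lambda>d. g ** d ** g') ` D = D"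
proof -
  assume a: "\<And>d. d \<in> D \<Longrightarrow> d ** g = g ** d" "g ** g' = mat 1"
  have "g ** d ** g' = d" if "d \<in> D" for d
    using a(1)[OF that, symmetric] a(2) by (simp add: matrix_mul_assoc[symmetric])
  then show ?thesis by auto
qed

lemma reduces_commuting:
  assumes g: "g \<in> Spin10" and c: "\<And>d. d \<in> D \<Longrightarrow> d ** g = g ** d" and red: "reduces D (g *v x) P"
  shows "reduces D x P"
proof -
  obtain g' where g': "g' \<in> Spin10" "g ** g' = mat 1" "g' ** g = mat 1" using Spin10_inverse[OF g] by blast
  show ?thesis by (rule reduces_step[OF g g']) (use red conj_commuting[OF c g'(2)] in simp)
qed

lemma eigen_commuting:
  assumes "eigen D x" "\<And>d. d \<in> D \<Longrightarrow> d ** g = g ** d"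
  shows "eigen D (g *v x)"
  unfolding eigen_def
proof
  fix d assume d: "d \<in> D"
  then obtain k where k: "d *v x = k *s x" using assms unfolding eigen_def by blast
  have "d *v (g *v x) = g *v (d *v x)" using assms(2)[OF d] by (simp add: matrix_vector_mul_assoc)
  then show "\<exists>k. d *v (g *v x) = k *s (g *v x)" using k by (intro exI[of _ k]) (simp add: vector_scalar_commute)
qed

text \<open>Coordinates that occur in a common eigenvector have equal weights under
  \<open>D\<close>. The root vector leading from one of them to another therefore has trivial
  weight, and this is why the unipotent elements that clear coordinates commute with
  \<open>D\<close>.\<close>

lemma eigen_Diag_eq:
  assumes "eigen D x" "d \<in> D" "d = dg l m" "l \<noteq> 0" "x $ I \<noteq> 0" "x $ J \<noteq> 0"
  shows "prod m I = prod m J"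
proof -
  obtain k where k: "d *v x = k *s x" using assms(1,2) unfolding eigen_def by blast
  have "l * prod m K = k" if "x $ K \<noteq> 0" for K
    using arg_cong[OF k, of "\<lambda>z. z $ K"] that by (simp add: assms(3) dg_mv)
  then show ?thesis using assms(4-6) by (metis mult_cancel_left)
qed

text \<open>Toggling two elements at a time moves a nonzero coordinate to \<open>{}\<close>. The
  flips normalize the diagonal elements but may change \<open>D\<close>, so \<open>base\<close> has
  to be available for every \<open>D\<close>.\<close>

lemma reduces_flip:
  assumes D: "D \<subseteq> Diag" "eigen D x" and x: "x \<in> X" "x $ I \<noteq> 0" "even (card I)"
    and base: "\<And>D x. D \<subseteq> Diag \<Longrightarrow> eigen D x \<Longrightarrow> x \<in> X \<Longrightarrow> x $ {} \<noteq> 0 \<Longrightarrow> reduces D x P"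
  shows "reduces D x P"
  using D x
proof (induction "card I" arbitrary: D x I rule: less_induct)
  case less
  show ?case
  proof (cases "I = {}")
    case True then show ?thesis using less.prems base by blast
  next
    case False
    then obtain i where i: "i \<in> I" by blast
    have "card (I - {i}) \<noteq> 0" using less.prems(5) i False by (metis card_0_eq even_card_remove finite odd_card_imp_not_empty)
    then obtain j where j: "j \<in> I" "j \<noteq> i" by (metis card.empty Diff_iff ex_in_conv insertI1)
    let ?g = "flip j ** flip i" and ?g' = "flip i ** flip j"
    have gg: "?g ** ?g' = mat 1" "?g' ** ?g = mat 1"
    proof -
      have "?g ** ?g' = flip j ** (flip i ** flip i) ** flip j" "?g' ** ?g = flip i ** (flip j ** flip j) ** flip i"
        by (simp_all only: matrix_mul_assoc)
      then show "?g ** ?g' = mat 1" "?g' ** ?g = mat 1" by (simp_all add: flip_flip)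
    qed
    show ?thesis
    proof (rule reduces_step[OF flip_Spin10 flip_Spin10 gg])
      let ?J = "fl j (fl i I)"
      have "card ?J < card I" using i j by (simp add: fl_def card_gt_0_iff) (metis card_gt_0_iff diff_less empty_iff finite less_Suc_eq_0_disj less_imp_diff_less zero_less_one diff_Suc_1)
      moreover have "?g ** d ** ?g' = flip j ** (flip i ** d ** flip i) ** flip j" for d by (simp only: matrix_mul_assoc)
      then have "(\<lambda>d. ?g ** d ** ?g') ` D \<subseteq> Diag" using less.prems(1) flip_Diag by auto
      moreover have "eigen ((\<lambda>d. ?g ** d ** ?g') ` D) (?g *v x)" by (rule eigen_conj[OF less.prems(2) gg(2)])
      moreover have "?g *v x \<in> X" by (rule Spin10_X[OF flip_Spin10 less.prems(3)])
      moreover have "(?g *v x) $ ?J \<noteq> 0"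
        using less.prems(4) by (simp add: matrix_vector_mul_assoc[symmetric] flip_mv)
      moreover have "even (card ?J)" using less.prems(5) by (simp add: even_card_fl)
      ultimately show "reduces ((\<lambda>d. ?g ** d ** ?g') ` D) (?g *v x) P" by (rule less.hyps)
    qed
  qed
qed

text \<open>The coordinate at \<open>{}\<close> is used to clear those at the two-element sets one
  at a time. \<open>wedge i ** wedge j\<close> only affects sets containing both \<open>i\<close>
  and \<open>j\<close>, so coordinates cleared before stay zero. The predicate \<open>Q\<close>
  transports an invariant along; it will be the vanishing of the quadrics.\<close>

lemma reduces_pairs:
  assumes D: "D \<subseteq> Diag" "eigen D x" and x: "x \<in> X" "x $ {} \<noteq> 0"
    and Q: "Q x" "\<And>x i j t. Q x \<Longrightarrow> Q ((mat 1 + cmat t (wedge i ** wedge j)) *v x)"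
    and base: "\<And>x. eigen D x \<Longrightarrow> x \<in> X \<Longrightarrow> x $ {} \<noteq> 0 \<Longrightarrow> Q x \<Longrightarrow> (\<And>K. card K = 2 \<Longrightarrow> x $ K = 0) \<Longrightarrow> reduces D x P"
  shows "reduces D x P"
proof -
  have "reduces D x P" if "finite F" "{K. card K = 2 \<and> x $ K \<noteq> 0} \<subseteq> F" "eigen D x" "x \<in> X" "x $ {} \<noteq> 0" "Q x" for F x
    using that
  proof (induction F arbitrary: x rule: finite_induct)
    case empty then show ?case using base by blast
  next
    case (insert K F)
    show ?case
    proof (cases "card K = 2 \<and> x $ K \<noteq> 0")
      case False
      then show ?thesis using insert by (intro insert.IH) auto
    next
      case True
      then obtain i j where K: "K = {i, j}" "i \<noteq> j" by (auto simp: card_2_iff)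
      let ?e = "sg i {i, j} * sg j {j}"
      have e: "?e * ?e = 1" by (simp add: mult_ac)
      \<comment> \<open>Chosen so that the new coordinate at \<open>K\<close>,
        \<open>x $ K + t * ?e * x $ {}\<close>, vanishes; \<open>?e\<close> is its own
        inverse.\<close>
      define t where "t = - ?e * x $ K / x $ {}"
      define g where "g = mat 1 + cmat t (gamma (axis (Inr i) 1) ** gamma (axis (Inr j) 1))"
      have g: "g \<in> Spin10" unfolding g_def by (rule unipotent_axis_Spin10) simp
      have gx: "(g *v x) $ L = x $ L + t * (if i \<in> L then sg i L * (if j \<in> L - {i} then sg j (L - {i}) * x $ (L - {i} - {j}) else 0) else 0)" for L
        by (simp add: g_def matrix_vector_mult_add_rdistrib matrix_vector_mul_assoc[symmetric] gamma_axis wedge_mv)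
      have com: "d ** g = g ** d" if d: "d \<in> D" for d
      proof -
        obtain l m where lm: "d = dg l m" "l \<noteq> 0" "\<And>i. m i \<noteq> 0" using D(1) d unfolding Diag_def by blast
        have "prod m K = prod m {}" by (rule eigen_Diag_eq[OF insert.prems(2) d lm(1,2)]) (use True insert.prems in auto)
        then have "dwt m (Inr i) * dwt m (Inr j) = 1" using K by (simp add: dwt_def)
        then show ?thesis unfolding g_def lm(1) using lm(3) by (intro dg_unipotent_commute) auto
      qed
      show ?thesis
      proof (rule reduces_commuting[OF g com], assumption, rule insert.IH)
        show "eigen D (g *v x)" by (rule eigen_commuting[OF insert.prems(2) com])
        show "g *v x \<in> X" by (rule Spin10_X[OF g insert.prems(3)])
        show "Q (g *v x)" unfolding g_def gamma_axis by (rule Q(2)[OF insert.prems(5)])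
        show "(g *v x) $ {} \<noteq> 0" using insert.prems(4) by (simp add: gx)
        have K0: "(g *v x) $ K = 0"
        proof -
          have "K - {i} - {j} = {}" "K - {i} = {j}" using K by auto
          then have "(g *v x) $ K = x $ K + t * ?e * x $ {}" unfolding gx using K by simp
          also have "t * ?e * x $ {} = - (?e * ?e) * x $ K" unfolding t_def using insert.prems(4) by (simp add: mult_ac)
          finally show ?thesis unfolding e by simp
        qed
        have L: "(g *v x) $ L = x $ L" if "card L = 2" "L \<noteq> K" for L
        proof -
          have "\<not> (i \<in> L \<and> j \<in> L)"
          proof
            assume "i \<in> L \<and> j \<in> L"
            then have "K \<subseteq> L" using K by auto
            then have "K = L" using that(1) True by (metis card_subset_eq finite)
            then show False using that(2) by simp
          qed
          then show ?thesis unfolding gx by auto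
        qed
        show "{L. card L = 2 \<and> (g *v x) $ L \<noteq> 0} \<subseteq> F"
        proof
          fix L assume "L \<in> {L. card L = 2 \<and> (g *v x) $ L \<noteq> 0}"
          then have "card L = 2" "(g *v x) $ L \<noteq> 0" by auto
          moreover then have "L \<noteq> K" using K0 by auto
          ultimately show "L \<in> F" using L[of L] insert.prems(1) by auto
        qed
      qed
    qed
  qed
  then show ?thesis using x D(2) Q(1) finite subset_UNIV by blast
qed

text \<open>The operator \<open>wedge a\<close> after \<open>contr j\<close> replaces
  \<open>j\<close> by \<open>a\<close> in an index. It preserves sizes, leaves \<open>{}\<close>
  alone, has nothing to act on at size 2, and at size 4 only adds the coordinate at
  \<open>- {a}\<close> to the one at \<open>- {j}\<close>.\<close>

lemma compl_unipotent:
  assumes x: "x \<in> X" "x $ {} \<noteq> 0" "\<forall>K. card K = 2 \<longrightarrow> x $ K = 0" and aj: "a \<noteq> j"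
    and g_def: "g = mat 1 + cmat t (gamma (axis (Inr a) 1) ** gamma (axis (Inl j) 1))"
  shows "g \<in> Spin10" "g *v x \<in> X" "(g *v x) $ {} = x $ {}" "card K = 2 \<Longrightarrow> (g *v x) $ K = 0"
    "b \<noteq> j \<Longrightarrow> (g *v x) $ (- {b}) = x $ (- {b})"
    "(g *v x) $ (- {j}) = x $ (- {j}) + t * (sg a (- {j}) * sg j (- {j} - {a})) * x $ (- {a})"
proof -
  show g: "g \<in> Spin10" unfolding g_def using aj by (intro unipotent_axis_Spin10) simp
  show "g *v x \<in> X" by (rule Spin10_X[OF g x(1)])
  have gx: "(g *v x) $ L = x $ L + t * (if a \<in> L then sg a L * (if j \<notin> L - {a} then sg j (L - {a}) * x $ insert j (L - {a}) else 0) else 0)" for L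
    by (simp add: g_def matrix_vector_mult_add_rdistrib matrix_vector_mul_assoc[symmetric] gamma_axis wedge_mv contr_mv)
  show "(g *v x) $ {} = x $ {}" by (simp add: gx)
  show "(g *v x) $ K = 0" if K: "card K = 2" for K
  proof -
    have "a \<in> K \<Longrightarrow> j \<notin> K - {a} \<Longrightarrow> card (insert j (K - {a})) = 2" using K by simp
    then show ?thesis unfolding gx using x(3) K by auto
  qed
  show "(g *v x) $ (- {b}) = x $ (- {b})" if "b \<noteq> j" using that aj unfolding gx by auto
  have "insert j (- {j} - {a}) = - {a}" using aj by auto
  then show "(g *v x) $ (- {j}) = x $ (- {j}) + t * (sg a (- {j}) * sg j (- {j} - {a})) * x $ (- {a})"
    unfolding gx using aj by simp
qed

lemma reduces_compl:
  assumes D: "D \<subseteq> Diag" "eigen D x" and x: "x \<in> X" "x $ {} \<noteq> 0" "\<And>K. card K = 2 \<Longrightarrow> x $ K = 0" and a: "x $ (- {a}) \<noteq> 0"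
    and base: "\<And>x. eigen D x \<Longrightarrow> x \<in> X \<Longrightarrow> x $ {} \<noteq> 0 \<Longrightarrow> (\<And>K. card K = 2 \<Longrightarrow> x $ K = 0) \<Longrightarrow>
       x $ (- {a}) \<noteq> 0 \<Longrightarrow> (\<And>b. b \<noteq> a \<Longrightarrow> x $ (- {b}) = 0) \<Longrightarrow> reduces D x P"
  shows "reduces D x P"
proof -
  have "reduces D x P" if "finite F" "{j. j \<noteq> a \<and> x $ (- {j}) \<noteq> 0} \<subseteq> F" "eigen D x" "x \<in> X" "x $ {} \<noteq> 0"
     "\<And>K. card K = 2 \<Longrightarrow> x $ K = 0" "x $ (- {a}) \<noteq> 0" for F x
    using that
  proof (induction F arbitrary: x rule: finite_induct)
    case empty then show ?case using base[of x] by blast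
  next
    case (insert j F)
    show ?case
    proof (cases "j \<noteq> a \<and> x $ (- {j}) \<noteq> 0")
      case False
      then show ?thesis using insert by (intro insert.IH) auto
    next
      case True
      let ?e = "sg a (- {j}) * sg j (- {j} - {a})"
      have e: "?e * ?e = 1" by (simp add: mult_ac)
      define t where "t = - ?e * x $ (- {j}) / x $ (- {a})"
      define g where "g = mat 1 + cmat t (gamma (axis (Inr a) 1) ** gamma (axis (Inl j) 1))"
      have aj: "a \<noteq> j" using True by auto
      have z: "\<forall>K. card K = 2 \<longrightarrow> x $ K = 0" using insert.prems(5) by blast
      note cu = compl_unipotent[OF insert.prems(3,4) z aj g_def]
      have com: "d ** g = g ** d" if d: "d \<in> D" for d
      proof -
        obtain l m where lm: "d = dg l m" "l \<noteq> 0" "\<And>i. m i \<noteq> 0" using D(1) d unfolding Diag_def by blast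
        have p: "prod m (- {a}) = prod m (- {j})" by (rule eigen_Diag_eq[OF insert.prems(2) d lm(1,2)]) (use True insert.prems in auto)
        \<comment> \<open>Equality of the products over \<open>- {a}\<close> and
          \<open>- {j}\<close> is turned into \<open>m a = m j\<close>, the condition for the
          unipotent element to commute with \<open>dg l m\<close>.\<close>
        have "m b * prod m (- {b}) = prod m UNIV" for b :: 5 using prod.remove[of UNIV b m] by (simp add: Compl_eq_Diff_UNIV)
        then have "m a * prod m (- {a}) = m j * prod m (- {j})" by metis
        then have "m a = m j" using p lm(3) by (simp add: prod_zero_iff)
        then have "dwt m (Inr a) * dwt m (Inl j) = 1" using lm(3) by (simp add: dwt_def)
        then show ?thesis unfolding g_def lm(1) using lm(3) by (intro dg_unipotent_commute) auto
      qed
      show ?thesis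
      proof (rule reduces_commuting[OF cu(1) com], assumption, rule insert.IH)
        show "eigen D (g *v x)" by (rule eigen_commuting[OF insert.prems(2) com])
        show "g *v x \<in> X" "(g *v x) $ {} \<noteq> 0" "\<And>K. card K = 2 \<Longrightarrow> (g *v x) $ K = 0" "(g *v x) $ (- {a}) \<noteq> 0"
          using cu(2-4) cu(5)[OF aj] insert.prems by auto
        have "(g *v x) $ (- {j}) = 0"
        proof -
          have "t * ?e * x $ (- {a}) = - (?e * ?e) * x $ (- {j})" unfolding t_def using insert.prems(6) by (simp add: mult_ac)
          then show ?thesis unfolding cu(6) e by simp
        qed
        then show "{b. b \<noteq> a \<and> (g *v x) $ (- {b}) \<noteq> 0} \<subseteq> F" using cu(5) insert.prems(1) by (auto simp: subset_eq) metis
      qed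
    qed
  qed
  then show ?thesis using x a D(2) finite subset_UNIV by blast
qed

lemma card_compl_single: "card (- {a :: 5}) = 4"
  by (simp add: Compl_eq_Diff_UNIV card_Diff_singleton)

lemma card_5_cases: "even (card (I :: 5 set)) \<Longrightarrow> I = {} \<or> card I = 2 \<or> (\<exists>b. I = - {b})"
proof -
  assume I: "even (card I)"
  have c: "card I + card (- I) = 5" using card_Un_disjoint[of I "- I"] by (simp add: Compl_partition)
  then have "card I = 0 \<or> card I = 2 \<or> card (- I) = 1" using I by presburger
  moreover have "card (- I) = 1 \<Longrightarrow> \<exists>b. I = - {b}" by (metis card_1_singletonE double_complement)
  ultimately show ?thesis by auto
qed

definition normal_form :: "spinor \<Rightarrow> bool" where
  "normal_form x \<longleftrightarrow> (\<exists>k. k \<noteq> 0 \<and> x = k *s axis {} 1) \<or>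
     (\<exists>k l a. k \<noteq> 0 \<and> l \<noteq> 0 \<and> x = k *s axis {} 1 + l *s axis (- {a}) 1)"

lemma normal_formI1:
  assumes "x \<in> X" "x $ {} \<noteq> 0" "\<And>K. card K = 2 \<Longrightarrow> x $ K = 0" "\<And>b. x $ (- {b}) = 0"
  shows "x = x $ {} *s axis {} 1"
proof -
  have "x $ I = (x $ {} *s axis {} 1) $ I" for I
  proof (cases "even (card I)")
    case True
    then show ?thesis using card_5_cases[OF True] assms by (auto simp: axis_component)
  next
    case False
    then show ?thesis using assms(1) by (auto simp: X_def axis_component)
  qed
  then show ?thesis by (rule vec_eq_iff[THEN iffD2, OF allI])
qed

lemma normal_formI2:
  assumes "x \<in> X" "x $ {} \<noteq> 0" "\<And>K. card K = 2 \<Longrightarrow> x $ K = 0" "\<And>b. b \<noteq> a \<Longrightarrow> x $ (- {b}) = 0"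
  shows "x = x $ {} *s axis {} 1 + x $ (- {a}) *s axis (- {a}) 1"
proof -
  have ne: "- {b} \<noteq> {}" for b :: 5 using card_compl_single[of b] by (metis card.empty zero_neq_numeral)
  have "x $ I = (x $ {} *s axis {} 1 + x $ (- {a}) *s axis (- {a}) 1) $ I" for I
  proof -
    consider "odd (card I)" | "I = {}" | "card I = 2" | b where "I = - {b}" using card_5_cases by blast
    then show ?thesis
    proof cases
      case 1
      moreover have "odd (card I) \<Longrightarrow> I \<noteq> - {a}" by (auto simp: card_compl_single)
      ultimately show ?thesis using assms(1) by (auto simp: X_def axis_component)
    next
      case 2 then show ?thesis using ne[of a] by (simp add: axis_component)
    next
      case 3
      then have "I \<noteq> - {a}" "I \<noteq> {}" by (auto simp: card_compl_single)
      then show ?thesis using assms(3)[OF 3] by (simp add: axis_component)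
    next
      case 4
      show ?thesis using 4 ne[of b] assms(4)[of b] by (cases "a = b") (simp_all add: axis_component)
    qed
  qed
  then show ?thesis by (rule vec_eq_iff[THEN iffD2, OF allI])
qed

theorem reduces_normal_form:
  assumes "D \<subseteq> Diag" "eigen D x" "x \<in> X" "x \<noteq> 0"
  shows "reduces D x normal_form"
proof -
  obtain I where I: "x $ I \<noteq> 0" using assms(4) by (auto simp: vec_eq_iff)
  then have "even (card I)" using assms(3) unfolding X_def by blast
  show ?thesis
  proof (rule reduces_flip[OF assms(1-3) I \<open>even (card I)\<close>])
    fix D x assume D: "D \<subseteq> Diag" "eigen D x" and x: "x \<in> X" "x $ {} \<noteq> 0"
    show "reduces D x normal_form"
    proof (rule reduces_pairs[OF D x, where Q = "\<lambda>_. True", OF TrueI TrueI])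
      fix x assume ex: "eigen D x" and x: "x \<in> X" "x $ {} \<noteq> 0" "\<And>K. card K = 2 \<Longrightarrow> x $ K = 0"
      show "reduces D x normal_form"
      proof (cases "\<forall>b. x $ (- {b}) = 0")
        case True
        have "x = x $ {} *s axis {} 1" by (rule normal_formI1[OF x]) (use True in auto)
        then have "normal_form x" unfolding normal_form_def using x(2) by blast
        then show ?thesis by (rule reduces_refl[OF D(1)])
      next
        case False
        then obtain a where a: "x $ (- {a}) \<noteq> 0" by blast
        show ?thesis
        proof (rule reduces_compl[OF D(1) ex x a])
          fix x assume x: "eigen D x" "x \<in> X" "x $ {} \<noteq> 0" "\<And>K. card K = 2 \<Longrightarrow> x $ K = 0" "x $ (- {a}) \<noteq> 0" "\<And>b. b \<noteq> a \<Longrightarrow> x $ (- {b}) = 0"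
          have "x = x $ {} *s axis {} 1 + x $ (- {a}) *s axis (- {a}) 1" by (rule normal_formI2[OF x(2-4,6)])
          then have "normal_form x" unfolding normal_form_def using x(3,5) by blast
          then show "reduces D x normal_form" by (rule reduces_refl[OF D(1)])
        qed
      qed
    qed
  qed
qed

section \<open>Orbits and their representatives\<close>

lemma orbit_iff: "y \<in> orbit x \<longleftrightarrow> (\<exists>s\<in>Spin10. \<exists>c. c \<noteq> 0 \<and> y = c *s (s *v x))"
  unfolding orbit_def G0_def by force

lemma orbit_refl: "x \<in> orbit x"
  unfolding orbit_iff by (intro bexI[of _ "mat 1"] exI[of _ 1]) simp_all

lemma orbit_subset: "y \<in> orbit x \<Longrightarrow> orbit y \<subseteq> orbit x"
proof
  fix z assume "y \<in> orbit x" "z \<in> orbit y"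
  then obtain s c t d where "s \<in> Spin10" "c \<noteq> 0" "y = c *s (s *v x)" "t \<in> Spin10" "d \<noteq> 0" "z = d *s (t *v y)"
    unfolding orbit_iff by blast
  then show "z \<in> orbit x" unfolding orbit_iff
    by (intro bexI[of _ "t ** s"] exI[of _ "d * c"]) (auto simp: Spin10_mult vector_scalar_commute matrix_vector_mul_assoc)
qed

lemma orbit_sym: "y \<in> orbit x \<Longrightarrow> x \<in> orbit y"
proof -
  assume "y \<in> orbit x"
  then obtain s c where s: "s \<in> Spin10" "c \<noteq> 0" "y = c *s (s *v x)" unfolding orbit_iff by blast
  obtain s' where s': "s' \<in> Spin10" "s' ** s = mat 1" using Spin10_inverse[OF s(1)] by blast
  have "x = (1 / c) *s (s' *v y)" using s s' by (simp add: vector_scalar_commute matrix_vector_mul_assoc)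
  then show ?thesis unfolding orbit_iff using s s' by (intro bexI[of _ s'] exI[of _ "1 / c"]) simp_all
qed

lemma orbit_eq: "y \<in> orbit x \<Longrightarrow> orbit y = orbit x"
  using orbit_subset orbit_sym by blast

lemma orbit_X: "x \<in> X \<Longrightarrow> orbit x \<subseteq> X"
  unfolding orbit_iff subset_iff by (auto intro: X_scale Spin10_X)

lemma orbit_Spin: "s \<in> Spin10 \<Longrightarrow> s *v x \<in> orbit x"
  unfolding orbit_iff by (intro bexI[of _ s] exI[of _ 1]) simp_all

lemma orbit_scale: "c \<noteq> 0 \<Longrightarrow> c *s x \<in> orbit x"
  unfolding orbit_iff by (intro bexI[of _ "mat 1"] exI[of _ c]) simp_all

lemma reduces_orbit: "reduces D x P \<Longrightarrow> \<exists>y\<in>orbit x. P y"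
  unfolding reduces_def using orbit_Spin by blast

definition E1 :: spinor where "E1 = axis {} 1"
definition E2 :: spinor where "E2 = axis {} 1 + axis (- {0}) 1"

lemma E_X: "E1 \<in> X" "E2 \<in> X"
  unfolding E1_def E2_def by (auto intro!: X_add simp: X_axis card_compl_single)

lemma dg_axis: "dg l m *v axis I 1 = (l * prod m I) *s axis I 1"
  by (auto simp: vec_eq_iff dg_mv axis_def)

lemma pair_orbit_0:
  assumes "k \<noteq> 0" "l \<noteq> 0"
  shows "k *s axis {} 1 + l *s axis (- {0}) 1 \<in> orbit E2"
proof -
  \<comment> \<open>The torus element scales \<open>{}\<close> by \<open>1 / r\<close> and
    \<open>- {0}\<close> by \<open>r\<close>; the scalar \<open>k * r\<close> turns this into
    \<open>k\<close> and \<open>k * r^2 = l\<close>.\<close>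
  define r where "r = csqrt (l / k)"
  have r: "r * r = l / k" "r \<noteq> 0" using assms by (auto simp: r_def simp flip: power2_eq_square)
  let ?T = "dg (1 / r) (\<lambda>j. if j = 1 then r\<^sup>2 else 1)"
  have T: "?T \<in> Spin10" by (rule torus_Spin10_single[OF r(2)])
  have "(\<Prod>j\<in>- {0 :: 5}. if j = 1 then r\<^sup>2 else 1) = r\<^sup>2" for r :: complex by simp
  then have "(k * r) *s (?T *v E2) = k *s axis {} 1 + l *s axis (- {0}) 1"
    using r assms by (simp add: E2_def matrix_vector_right_distrib dg_axis vec.scale_right_distrib power2_eq_square mult.assoc)
  then show ?thesis unfolding orbit_iff using T r assms by (intro bexI[of _ ?T] exI[of _ "k * r"]) simp_all
qed

text \<open>A unipotent element first creates a nonzero coordinate at \<open>- {0}\<close>, which is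
  then used to clear all other coordinates of size 4, including the original one.\<close>

lemma pair_orbit:
  assumes "k \<noteq> 0" "l \<noteq> 0"
  shows "k *s axis {} 1 + l *s axis (- {a}) 1 \<in> orbit E2"
proof (cases "a = 0")
  case True then show ?thesis using pair_orbit_0 assms by simp
next
  case False
  let ?x = "k *s axis {} 1 + l *s axis (- {a}) 1"
  have ne: "- {b} \<noteq> {}" "{} \<noteq> - {b}" for b :: 5 using card_compl_single[of b] by (metis card.empty zero_neq_numeral)+
  have x: "?x \<in> X" "?x $ {} \<noteq> 0" by (auto simp: X_axis card_compl_single axis_component ne assms intro!: X_add X_scale)
  have x2: "\<forall>K. card K = 2 \<longrightarrow> ?x $ K = 0" by (auto simp: axis_component card_compl_single)
  define g where "g = mat 1 + cmat 1 (gamma (axis (Inr a) 1) ** gamma (axis (Inl 0) 1))"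
  note cu = compl_unipotent[OF x x2 False g_def]
  have "(g *v ?x) $ (- {0}) \<noteq> 0" unfolding cu(6) using False assms ne by (simp add: axis_component)
  then have "reduces {} (g *v ?x) (\<lambda>y. \<exists>k l. k \<noteq> 0 \<and> l \<noteq> 0 \<and> y = k *s axis {} 1 + l *s axis (- {0}) 1)"
  proof (rule reduces_compl[rotated 5])
    show "{} \<subseteq> Diag" "eigen {} (g *v ?x)" by (simp_all add: eigen_def)
    show "g *v ?x \<in> X" "(g *v ?x) $ {} \<noteq> 0" "\<And>K. card K = 2 \<Longrightarrow> (g *v ?x) $ K = 0" using cu x by auto
    fix y assume y: "y \<in> X" "y $ {} \<noteq> 0" "\<And>K. card K = 2 \<Longrightarrow> y $ K = 0" "y $ (- {0}) \<noteq> 0" "\<And>b. b \<noteq> 0 \<Longrightarrow> y $ (- {b}) = 0"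
    have "y = y $ {} *s axis {} 1 + y $ (- {0}) *s axis (- {0}) 1" by (rule normal_formI2[OF y(1-3,5)])
    then show "reduces {} y (\<lambda>y. \<exists>k l. k \<noteq> 0 \<and> l \<noteq> 0 \<and> y = k *s axis {} 1 + l *s axis (- {0}) 1)"
      using y(2,4) by (intro reduces_refl) blast+
  qed
  then obtain y where y: "y \<in> orbit (g *v ?x)" "\<exists>k l. k \<noteq> 0 \<and> l \<noteq> 0 \<and> y = k *s axis {} 1 + l *s axis (- {0}) 1"
    using reduces_orbit by blast
  then have "y \<in> orbit E2" using pair_orbit_0 by blast
  moreover have "orbit y = orbit ?x" using orbit_eq[OF y(1)] orbit_eq[OF orbit_Spin[OF cu(1)]] by simp
  ultimately show ?thesis using orbit_eq orbit_refl by blast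
qed

lemma X_orbits: "x \<in> X \<Longrightarrow> x \<noteq> 0 \<Longrightarrow> x \<in> orbit E1 \<or> x \<in> orbit E2"
proof -
  assume "x \<in> X" "x \<noteq> 0"
  then have "reduces {} x normal_form" by (intro reduces_normal_form) (auto simp: eigen_def)
  then obtain y where y: "y \<in> orbit x" "normal_form y" using reduces_orbit by blast
  have "y \<in> orbit E1 \<or> y \<in> orbit E2"
    using y(2) unfolding normal_form_def using orbit_scale[of _ E1] pair_orbit by (auto simp: E1_def)
  then show ?thesis using y(1) orbit_eq orbit_refl by metis
qed

subsection \<open>The invariant form and the quadrics through the closed orbit\<close>

text \<open>The matrix of the bilinear form \<open>pairing x (Wm *v y)\<close>, which is invariant
  because \<open>Wm\<close> carries \<open>gamma v\<close> to its transpose. As a product of an odd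
  number of flips it pairs \<open>X\<close> with \<open>XO\<close>, so a spinor can be paired with
  its image under a Clifford vector.\<close>

definition Wm :: spinor_mat where
  "Wm = flip 0 ** flip 1 ** flip 2 ** flip 3 ** flip 4"

lemma flip_gamma_axis:
  "flip i *v (gamma (axis p 1) *v x) = (if p = Inl i \<or> p = Inr i then gamma (axis (dual_index p) 1) *v (flip i *v x) else - (gamma (axis p 1) *v (flip i *v x)))"
proof -
  let ?u = "axis (Inl i) 1 + axis (Inr i) 1 :: complex ^ (5 + 5)"
  have "polar ?u (axis p 1) = (if p = Inl i \<or> p = Inr i then 1 else 0)"
    by (cases p) (auto simp: polar_simps polar_axis_axis)
  then have "flip i *v (gamma (axis p 1) *v x) = (if p = Inl i \<or> p = Inr i then x else 0) - gamma (axis p 1) *v (flip i *v x)"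
    unfolding flip_def by (simp add: gamma_swap[of ?u])
  moreover have "gamma (axis (dual_index p) 1) *v (flip i *v x) = x - gamma (axis p 1) *v (flip i *v x)" if "p = Inl i \<or> p = Inr i"
  proof -
    have "gamma (axis (dual_index p) 1) + gamma (axis p 1) = flip i"
      using that by (auto simp: flip_def gamma_linear add.commute)
    then have "gamma (axis (dual_index p) 1) *v y + gamma (axis p 1) *v y = flip i *v y" for y
      by (metis matrix_vector_mult_add_rdistrib)
    from this[of "flip i *v x"] show ?thesis by (simp add: matrix_vector_mul_assoc[of "flip i" "flip i"] flip_flip algebra_simps)
  qed
  ultimately show ?thesis by simp
qed

text \<open>Of the five flips, one replaces a basis vector by its dual and the other four
  anticommute with it; the four signs cancel.\<close>

lemma Wm_gamma: "Wm *v (gamma v *v x) = gamma (dualv v) *v (Wm *v x)"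
proof -
  have A: "Wm *v (gamma (axis p 1) *v x) = gamma (axis (dual_index p) 1) *v (Wm *v x)" for p x
    using exhaust_55[of p] unfolding Wm_def matrix_vector_mul_assoc[symmetric]
    by (elim insertE emptyE) (simp_all add: flip_gamma_axis mv_minus)
  have "Wm *v (gamma v *v x) = (\<Sum>p\<in>UNIV. v $ p *s (gamma (axis (dual_index p) 1) *v (Wm *v x)))"
    by (subst gamma_vector_expand) (simp add: sum_mv mv_sum vector_scalar_commute A)
  also have "\<dots> = (\<Sum>p\<in>UNIV. v $ dual_index p *s (gamma (axis p 1) *v (Wm *v x)))"
    using sum.reindex_bij_betw[OF bij_dual_index, of "\<lambda>p. v $ dual_index p *s (gamma (axis p 1) *v (Wm *v x))"] by simp
  also have "\<dots> = gamma (dualv v) *v (Wm *v x)" by (rule sum_gamma_axis_mv)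
  finally show ?thesis .
qed

lemma pprod_Wm: "\<forall>v\<in>set vs. quad v = 1 \<Longrightarrow> transpose (pprod vs) *v (Wm *v (pprod vs *v x)) = Wm *v x"
proof (induction vs arbitrary: x)
  case (Cons u vs)
  have "transpose (pprod (u # vs)) *v (Wm *v (pprod (u # vs) *v x)) = transpose (pprod vs) *v (gamma (dualv u) *v (Wm *v (gamma u *v (pprod vs *v x))))"
    by (simp add: matrix_transpose_mul transpose_gamma matrix_vector_mul_assoc[symmetric])
  also have "gamma (dualv u) *v (Wm *v (gamma u *v (pprod vs *v x))) = Wm *v (pprod vs *v x)"
    using Cons.prems by (simp add: Wm_gamma gamma_sq)
  finally show ?case using Cons by simp
qed (simp add: transpose_mat)

lemma Spin10_Wm: "s \<in> Spin10 \<Longrightarrow> pairing (s *v x) (Wm *v (s *v y)) = pairing x (Wm *v y)"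
proof -
  assume "s \<in> Spin10"
  then have "transpose s *v (Wm *v (s *v y)) = Wm *v y" unfolding Spin10_iff using pprod_Wm by blast
  then show ?thesis by (metis pairing_transpose pairing_commute)
qed

definition wsg :: "5 set \<Rightarrow> complex" where
  "wsg I = sg 0 I * (sg 1 (fl 0 I) * (sg 2 (fl 1 (fl 0 I)) * (sg 3 (fl 2 (fl 1 (fl 0 I))) * sg 4 (fl 3 (fl 2 (fl 1 (fl 0 I)))))))"

lemma wsg_nz [simp]: "wsg I \<noteq> 0" by (simp add: wsg_def)

lemma Wm_mv: "(Wm *v x) $ I = wsg I * x $ (- I)"
proof -
  have "i \<in> fl 4 (fl 3 (fl 2 (fl 1 (fl 0 I)))) \<longleftrightarrow> i \<notin> I" for i
    using exhaust_5[of i] by (elim disjE) (simp_all add: mem_fl)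
  then have "fl 4 (fl 3 (fl 2 (fl 1 (fl 0 I)))) = - I" by auto
  then show ?thesis by (simp add: Wm_def matrix_vector_mul_assoc[symmetric] flip_mv wsg_def mult.assoc)
qed

text \<open>The component along \<open>v\<close> of the quadratic covariant from \<open>X\<close> to
  the vector representation.\<close>

definition Fq :: "complex ^ (5 + 5) \<Rightarrow> spinor \<Rightarrow> complex" where
  "Fq v x = pairing x (Wm *v (gamma v *v x))"

lemma Fq_Spin:
  assumes "s \<in> Spin10" obtains w where "\<And>x. Fq v (s *v x) = Fq w x"
proof -
  obtain s' where s': "s' \<in> Spin10" "s' ** s = mat 1" "s ** s' = mat 1" using Spin10_inverse[OF assms] by blast
  obtain w where "s' ** gamma v = gamma w ** s'" using Spin10_gamma[OF s'(1)] by blast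
  then have "s ** (s' ** gamma v) ** s = s ** (gamma w ** s') ** s" by simp
  then have "(s ** s') ** gamma v ** s = s ** gamma w ** (s' ** s)" by (simp only: matrix_mul_assoc)
  then have "gamma v ** s = s ** gamma w" by (simp add: s')
  then have "gamma v *v (s *v x) = s *v (gamma w *v x)" for x by (simp add: matrix_vector_mul_assoc)
  then show thesis using that Spin10_Wm[OF assms] by (simp add: Fq_def)
qed

lemma Fq_scale: "Fq v (c *s x) = c\<^sup>2 * Fq v x"
  by (simp add: Fq_def vector_scalar_commute pairing_simps power2_eq_square)

text \<open>At \<open>E1\<close> the value is, up to a factor, the coordinate at \<open>UNIV\<close>
  of a Clifford vector applied to \<open>[{}]\<close>, and such a spinor lives on singletons. The
  spin group only changes the vector of the quadric.\<close>

lemma orbit_E1_Fq: "x \<in> orbit E1 \<Longrightarrow> Fq v x = 0"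
proof -
  assume "x \<in> orbit E1"
  then obtain s c where s: "s \<in> Spin10" "x = c *s (s *v E1)" unfolding orbit_iff by blast
  have F: "Fq w E1 = 0" for w
  proof -
    have "UNIV - {i} \<noteq> {}" for i :: 5 using card_compl_single[of i] by (metis Compl_eq_Diff_UNIV card.empty zero_neq_numeral)
    then have "(gamma w *v E1) $ UNIV = 0" unfolding gamma_component E1_def by (simp add: axis_component)
    then show ?thesis unfolding Fq_def E1_def pairing_axis Wm_mv by simp
  qed
  obtain w where "Fq v (s *v E1) = Fq w E1" using Fq_Spin[OF s(1)] by metis
  then show ?thesis using s F by (simp add: Fq_scale)
qed

text \<open>These five of the ten quadrics already cut out the smaller orbit where the coordinate at
  \<open>{}\<close> is nonzero, see \<open>orbit_E1_iff\<close>.\<close>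

definition Fa :: "5 \<Rightarrow> spinor \<Rightarrow> complex" where
  "Fa a = Fq (axis (Inr a) 1)"

definition Ba :: "5 \<Rightarrow> spinor \<Rightarrow> spinor \<Rightarrow> complex" where
  "Ba a x y = pairing x (Wm *v (wedge a *v y))"

lemma Fa_Ba: "Fa a x = Ba a x x"
  by (simp add: Fa_def Fq_def Ba_def gamma_axis)

lemma flip_anticomm: "i \<noteq> j \<Longrightarrow> flip i *v (flip j *v x) = - (flip j *v (flip i *v x))"
  unfolding flip_def by (subst gamma_swap) (simp add: polar_simps polar_axis_axis)

lemma transpose_Wm: "transpose Wm = Wm"
proof -
  have t: "transpose (flip i) = flip i" for i
  proof -
    have "dualv (v + w) = dualv v + dualv w" for v w by (simp add: dualv_def vec_eq_iff)
    then show ?thesis unfolding flip_def transpose_gamma by (simp add: add.commute)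
  qed
  have "transpose Wm *v x = Wm *v x" for x
  proof -
    have "transpose Wm *v x = flip 4 *v (flip 3 *v (flip 2 *v (flip 1 *v (flip 0 *v x))))"
      by (simp add: Wm_def matrix_transpose_mul t matrix_vector_mul_assoc matrix_mul_assoc)
    also have "\<dots> = flip 0 *v (flip 1 *v (flip 2 *v (flip 3 *v (flip 4 *v x))))"
      by (simp add: flip_anticomm[of 4] flip_anticomm[of 3 0] flip_anticomm[of 3 1] flip_anticomm[of 3 2]
          flip_anticomm[of 2 0] flip_anticomm[of 2 1] flip_anticomm[of 1 0] mv_minus)
    finally show ?thesis by (simp add: Wm_def matrix_vector_mul_assoc matrix_mul_assoc)
  qed
  then show ?thesis by (simp add: matrix_eq)
qed

lemma Ba_sym: "Ba a x y = Ba a y x"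
proof -
  have "Ba a x y = pairing (Wm *v x) (wedge a *v y)"
    unfolding Ba_def by (metis pairing_mv transpose_Wm)
  also have "\<dots> = pairing (contr a *v (Wm *v x)) y"
    by (simp add: pairing_mv contr_def)
  also have "contr a *v (Wm *v x) = Wm *v (wedge a *v x)"
    using Wm_gamma[of "axis (Inr a) 1" x] by (simp add: gamma_axis)
  finally show ?thesis by (simp add: Ba_def pairing_commute)
qed

definition kap :: "5 \<Rightarrow> complex" where "kap a = wsg {} * sg a UNIV"

lemma kap_nz [simp]: "kap a \<noteq> 0" by (simp add: kap_def)

lemma Ba_compl: "Ba a y (axis (- {b}) 1) = (if a = b then kap a * y $ {} else 0)"
proof (cases "a = b")
  case True
  have "UNIV - {a} = - {a}" by auto
  then have "wedge a *v axis (- {a}) 1 = sg a UNIV *s axis UNIV 1"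
    by (auto simp: vec_eq_iff wedge_mv axis_component)
  moreover have "Wm *v axis UNIV 1 = wsg {} *s axis {} 1"
    by (auto simp: vec_eq_iff Wm_mv axis_component)
  ultimately show ?thesis using True by (simp add: Ba_def vector_scalar_commute pairing_simps kap_def)
next
  case False
  then have "I - {a} \<noteq> - {b}" for I by auto
  then have "wedge a *v axis (- {b}) 1 = 0" by (simp add: vec_eq_iff wedge_mv axis_component)
  then show ?thesis using False by (simp add: Ba_def)
qed

lemma compl_neq_empty: "- {b :: 5} \<noteq> {}" "{} \<noteq> - {b :: 5}"
  using card_compl_single[of b] by (metis card.empty zero_neq_numeral)+

text \<open>\<open>vv\<close> collects the five coordinates at the four-element sets and
  \<open>zz\<close> keeps the remaining ones; the quadrics will be solved for the former.\<close>

definition vv :: "(5 \<Rightarrow> complex) \<Rightarrow> spinor" where "vv c = (\<Sum>a\<in>UNIV. c a *s axis (- {a}) 1)"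
definition zz :: "spinor \<Rightarrow> spinor" where "zz x = x - vv (\<lambda>a. x $ (- {a}))"

lemma vv_compl [simp]: "vv c $ (- {a}) = c a"
  by (simp add: vv_def sum_component axis_component if_distrib[of "\<lambda>z. _ * z"] cong: if_cong)
lemma vv_other: "(\<And>b. I \<noteq> - {b}) \<Longrightarrow> vv c $ I = 0"
  by (simp add: vv_def sum_component axis_component)
lemma vv_empty [simp]: "vv c $ {} = 0"
  by (rule vv_other) (simp add: compl_neq_empty)
lemma zz_compl [simp]: "zz x $ (- {a}) = 0"
  by (simp add: zz_def)
lemma zz_other: "(\<And>b. I \<noteq> - {b}) \<Longrightarrow> zz x $ I = x $ I"
  by (simp add: zz_def vv_other)
lemma zz_empty [simp]: "zz x $ {} = x $ {}"
  by (rule zz_other) (simp add: compl_neq_empty)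
lemma zz_vv: "zz (zz x + vv c) = zz x"
  by (simp add: zz_def)
lemma zz_plus: "x = zz x + vv (\<lambda>a. x $ (- {a}))"
  by (simp add: zz_def)
lemma vv_X: "vv c \<in> X"
  unfolding vv_def by (intro X_sum X_scale) (simp add: X_axis card_compl_single)
lemma zz_X: "x \<in> X \<Longrightarrow> zz x \<in> X"
  unfolding zz_def by (intro X_diff vv_X)

lemma Ba_add: "Ba a (x + y) z = Ba a x z + Ba a y z" "Ba a x (y + z) = Ba a x y + Ba a x z"
  by (simp_all add: Ba_def pairing_simps matrix_vector_right_distrib)

lemma Ba_vv: "Ba a y (vv c) = kap a * c a * y $ {}"
proof -
  have "Ba a y (vv c) = (\<Sum>b\<in>UNIV. c b * Ba a y (axis (- {b}) 1))"
    by (simp add: Ba_def vv_def mv_sum pairing_sum_right vector_scalar_commute pairing_simps)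
  also have "\<dots> = (\<Sum>b\<in>UNIV. if a = b then c b * (kap a * y $ {}) else 0)"
    unfolding Ba_compl by (intro sum.cong) auto
  finally show ?thesis by simp
qed

text \<open>There is no term quadratic in \<open>c\<close>: pairing with \<open>vv c\<close> only
  sees the coordinate at \<open>{}\<close>, which \<open>vv c\<close> lacks. So each quadric is
  affine in one coordinate of size 4.\<close>

lemma Fa_vv: "Fa a (z + vv c) = 2 * kap a * c a * z $ {} + Fa a z"
  unfolding Fa_Ba Ba_add Ba_vv by (simp add: Ba_sym[of a "vv c" z] Ba_vv)

lemma Fa_expand: "Fa a x = 2 * kap a * x $ (- {a}) * x $ {} + Fa a (zz x)"
  by (subst zz_plus[of x], subst Fa_vv) simp

lemma Fa_unipotent: "Fa a ((mat 1 + cmat t (wedge i ** wedge j)) *v x) = Fa a x"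
proof -
  let ?s = "mat 1 + cmat t (wedge i ** wedge j)"
  have s: "?s \<in> Spin10" using unipotent_axis_Spin10[of "Inr i" "Inr j" t] by (simp add: gamma_axis)
  have sw: "wedge a *v (wedge b *v x) = - (wedge b *v (wedge a *v x))" for a b x
    using wedge_anticomm[of a b x] by (simp add: add_eq_0_iff2)
  have "wedge a *v (wedge i *v (wedge j *v x)) = wedge i *v (wedge j *v (wedge a *v x))"
    by (simp add: sw[of a i] sw[of a j] mv_minus)
  then have "wedge a *v (?s *v x) = ?s *v (wedge a *v x)"
    by (simp add: matrix_vector_mult_add_rdistrib matrix_vector_mul_assoc[symmetric] matrix_vector_right_distrib vector_scalar_commute)
  then show ?thesis unfolding Fa_Ba Ba_def by (simp add: Spin10_Wm[OF s])
qed

text \<open>The unipotent elements that clear the two-element sets leave every \<open>Fa a\<close>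
  invariant. Afterwards \<open>zz y\<close> is a multiple of \<open>E1\<close>, on which the
  quadrics vanish, so \<open>Fa_expand\<close> forces the coordinates of size 4 to vanish as
  well.\<close>

lemma orbit_E1_iff:
  assumes x: "x \<in> X" "x $ {} \<noteq> 0"
  shows "x \<in> orbit E1 \<longleftrightarrow> (\<forall>a. Fa a x = 0)"
proof
  assume "x \<in> orbit E1" then show "\<forall>a. Fa a x = 0" by (simp add: Fa_def orbit_E1_Fq)
next
  assume F: "\<forall>a. Fa a x = 0"
  have "reduces {} x (\<lambda>y. \<exists>k. k \<noteq> 0 \<and> y = k *s E1)"
  proof (rule reduces_pairs[where Q = "\<lambda>x. \<forall>a. Fa a x = 0"])
    show "{} \<subseteq> Diag" "eigen {} x" by (simp_all add: eigen_def)
    fix y assume y: "y \<in> X" "y $ {} \<noteq> 0" "\<forall>a. Fa a y = 0" "\<And>K. card K = 2 \<Longrightarrow> y $ K = 0"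
    have "zz y = zz y $ {} *s axis {} 1"
    proof (rule normal_formI1)
      show "zz y $ K = 0" if "card K = 2" for K
      proof -
        have "K \<noteq> - {b}" for b using that by (auto simp: card_compl_single)
        then show ?thesis using y(4)[OF that] by (simp add: zz_other)
      qed
    qed (use y zz_X in simp_all)
    then have z: "zz y = y $ {} *s E1" by (simp add: E1_def)
    have "Fa a (zz y) = 0" for a unfolding z Fa_def Fq_scale using orbit_E1_Fq[OF orbit_refl] by simp
    then have "y $ (- {a}) = 0" for a using Fa_expand[of a y] y by simp
    then have "y = y $ {} *s axis {} 1"
      by (intro normal_formI1[OF y(1,2)]) (auto intro: y(4))
    then show "reduces {} y (\<lambda>y. \<exists>k. k \<noteq> 0 \<and> y = k *s E1)"
      using y(2) by (intro reduces_refl) (auto simp: E1_def)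
  qed (use x F Fa_unipotent in auto)
  then obtain y k where "y \<in> orbit x" "k \<noteq> 0" "y = k *s E1" using reduces_orbit by blast
  then show "x \<in> orbit E1" using orbit_scale[of k E1] orbit_eq orbit_refl by metis
qed

section \<open>The three orbits are distinct\<close>

lemma Fa_E2: "Fa 0 E2 \<noteq> 0"
proof -
  have e: "E2 = E1 + vv (\<lambda>a. if a = 0 then 1 else 0)"
    by (simp add: E1_def E2_def vv_def if_distrib[of "\<lambda>z. z *s _"] cong: if_cong)
  have "Fa 0 E1 = 0" unfolding Fa_def by (rule orbit_E1_Fq[OF orbit_refl])
  then show ?thesis unfolding e Fa_vv by (simp add: E1_def axis_component)
qed

lemma E2_not_E1: "E2 \<notin> orbit E1"
  using orbit_E1_Fq[of E2] Fa_E2 unfolding Fa_def by blast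

lemma orbits_disjoint: "x \<in> orbit E1 \<Longrightarrow> x \<notin> orbit E2"
  using E2_not_E1 orbit_eq orbit_refl by metis

lemma zero_orbit: "orbit 0 = {0}"
  using orbit_refl[of 0] by (auto simp: orbit_iff)

lemma E_nz: "E1 \<noteq> 0" "E2 \<noteq> 0"
proof -
  show "E1 \<noteq> 0" by (simp add: E1_def)
  have "E2 $ {} = 1" by (simp add: E2_def axis_component compl_neq_empty)
  then show "E2 \<noteq> 0" by (metis zero_index zero_neq_one)
qed

lemma zero_notin_orbit: "x \<noteq> 0 \<Longrightarrow> 0 \<notin> orbit x"
  using orbit_sym[of 0 x] zero_orbit by blast

lemma orbit_set: "{orbit x | x. x \<in> X} = {{0}, orbit E1, orbit E2}"
proof (intro set_eqI iffI)
  fix S assume "S \<in> {orbit x | x. x \<in> X}"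
  then obtain x where "x \<in> X" "S = orbit x" by blast
  then show "S \<in> {{0}, orbit E1, orbit E2}" using X_orbits[of x] zero_orbit orbit_eq by (cases "x = 0") auto
next
  fix S assume "S \<in> {{0}, orbit E1, orbit E2}"
  then consider "S = orbit 0" | "S = orbit E1" | "S = orbit E2" using zero_orbit by auto
  then show "S \<in> {orbit x | x. x \<in> X}" using E_X X_zero by cases blast+
qed

lemma orbit_card: "card {{0}, orbit E1, orbit E2} = 3"
proof -
  have "{0} \<noteq> orbit E1" "{0} \<noteq> orbit E2" using zero_notin_orbit E_nz by blast+
  moreover have "orbit E1 \<noteq> orbit E2" using E2_not_E1 orbit_refl by metis
  ultimately show ?thesis by simp
qed

lemma weight_vector_axis:
  assumes "weight_vector I x" obtains k where "k \<noteq> 0" "x = k *s axis I 1"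
proof -
  have w: "x \<noteq> 0" "\<And>i. spin_cartan i *v x = sgn_in I i *s x"
    using assms unfolding weight_vector_def sgn_in_def by auto
  have "x $ J = 0" if ne: "J \<noteq> I" for J
  proof -
    obtain i where i: "(i \<in> J) \<noteq> (i \<in> I)" using ne by blast
    have "sgn_in J i * x $ J = sgn_in I i * x $ J"
      using arg_cong[OF w(2)[of i], of "\<lambda>z. z $ J"] by (simp add: spin_cartan_component)
    then show ?thesis using i sgn_in_eq_iff by auto
  qed
  then have e: "x = x $ I *s axis I 1" by (auto simp: vec_eq_iff axis_component)
  then have "x $ I \<noteq> 0" using w(1) by (metis vec.scale_zero_left)
  then show thesis using e that by blast
qed

subsection \<open>Dimensions\<close>

definition cderiv :: "(complex ^ 'n \<Rightarrow> complex ^ 'm) \<Rightarrow> complex ^ 'n \<Rightarrow> bool" where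
  "cderiv f x \<longleftrightarrow> (\<exists>D. (f has_derivative D) (at x) \<and> (\<forall>k v. D (k *s v) = k *s D v))"
definition cderiv1 :: "(complex ^ 'n \<Rightarrow> complex) \<Rightarrow> complex ^ 'n \<Rightarrow> bool" where
  "cderiv1 f x \<longleftrightarrow> (\<exists>D. (f has_derivative D) (at x) \<and> (\<forall>k v. D (k *s v) = k * D v))"

lemma scaleR_vec_complex: "r *\<^sub>R (x :: complex ^ 'n) = of_real r *s x"
  by (simp add: vec_eq_iff scaleR_conv_of_real[symmetric])

lemma bounded_linear_mv: "bounded_linear (\<lambda>x :: complex ^ 'n. (A :: complex ^ 'n ^ 'm) *v x)"
  by (simp add: linear_conv_bounded_linear[symmetric] linear_iff matrix_vector_right_distrib scaleR_vec_complex vector_scalar_commute)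

lemma bounded_linear_scale_vec: "bounded_linear (\<lambda>c :: complex. c *s (v :: complex ^ 'n))"
  by (simp add: linear_conv_bounded_linear[symmetric] linear_iff scaleR_vec_complex vec.scale_left_distrib scaleR_conv_of_real)

lemma cderiv_mv: "cderiv ((*v) A) x"
  unfolding cderiv_def using bounded_linear.has_derivative[OF bounded_linear_mv[of A] has_derivative_ident]
  by (intro exI[of _ "(*v) A"]) (auto simp: vector_scalar_commute)

lemma cderiv_ident: "cderiv (\<lambda>x. x) x"
  unfolding cderiv_def by (intro exI[of _ "\<lambda>x. x"]) simp

lemma cderiv_compose: "cderiv f x \<Longrightarrow> cderiv g (f x) \<Longrightarrow> cderiv (\<lambda>x. g (f x)) x"
proof -
  assume "cderiv f x" "cderiv g (f x)"
  then obtain D E where "(f has_derivative D) (at x)" "\<And>k v. D (k *s v) = k *s D v"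
    "(g has_derivative E) (at (f x))" "\<And>k v. E (k *s v) = k *s E v" unfolding cderiv_def by blast
  then show ?thesis unfolding cderiv_def
    by (intro exI[of _ "E \<circ> D"]) (auto intro: diff_chain_at simp: o_def dest: diff_chain_at)
qed

lemma cderiv_add: "cderiv f x \<Longrightarrow> cderiv g x \<Longrightarrow> cderiv (\<lambda>x. f x + g x) x"
  unfolding cderiv_def by (elim exE conjE, rule exI, rule conjI, erule (1) has_derivative_add) (simp add: vec.scale_right_distrib)
lemma cderiv_diff: "cderiv f x \<Longrightarrow> cderiv g x \<Longrightarrow> cderiv (\<lambda>x. f x - g x) x"
  unfolding cderiv_def by (elim exE conjE, rule exI, rule conjI, erule (1) has_derivative_diff) (simp add: vec.scale_right_diff_distrib)
lemma cderiv_const: "cderiv (\<lambda>_. c) x"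
  unfolding cderiv_def by (rule exI[of _ "\<lambda>_. 0"]) simp
lemma cderiv_sum: "(\<And>i. i \<in> S \<Longrightarrow> cderiv (f i) x) \<Longrightarrow> cderiv (\<lambda>x. \<Sum>i\<in>S. f i x) x"
  by (induction S rule: infinite_finite_induct) (simp_all add: cderiv_const cderiv_add)
lemma cderiv_scale: "cderiv1 c x \<Longrightarrow> cderiv (\<lambda>x. c x *s v) x"
  unfolding cderiv_def cderiv1_def
  by (elim exE conjE, rule exI, rule conjI, erule bounded_linear.has_derivative[OF bounded_linear_scale_vec]) simp

lemma cderiv1_component: "cderiv f x \<Longrightarrow> cderiv1 (\<lambda>x. f x $ i) x"
  unfolding cderiv_def cderiv1_def
  by (elim exE conjE, rule exI, rule conjI, erule bounded_linear.has_derivative[OF bounded_linear_vec_nth]) simp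
lemma cderiv1_add: "cderiv1 f x \<Longrightarrow> cderiv1 g x \<Longrightarrow> cderiv1 (\<lambda>x. f x + g x) x"
  unfolding cderiv1_def by (elim exE conjE, rule exI, rule conjI, erule (1) has_derivative_add) (simp add: distrib_left)
lemma cderiv1_diff: "cderiv1 f x \<Longrightarrow> cderiv1 g x \<Longrightarrow> cderiv1 (\<lambda>x. f x - g x) x"
  unfolding cderiv1_def by (elim exE conjE, rule exI, rule conjI, erule (1) has_derivative_diff) (simp add: right_diff_distrib)
lemma cderiv1_const: "cderiv1 (\<lambda>_. c) x"
  unfolding cderiv1_def by (rule exI[of _ "\<lambda>_. 0"]) simp
lemma cderiv1_mult: "cderiv1 f x \<Longrightarrow> cderiv1 g x \<Longrightarrow> cderiv1 (\<lambda>x. f x * g x) x"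
  unfolding cderiv1_def by (elim exE conjE, rule exI, rule conjI, erule (1) has_derivative_mult) (simp add: algebra_simps)
lemma cderiv1_inverse: "cderiv1 f x \<Longrightarrow> f x \<noteq> 0 \<Longrightarrow> cderiv1 (\<lambda>x. inverse (f x)) x"
  unfolding cderiv1_def by (elim exE conjE, rule exI, rule conjI, rule Deriv.has_derivative_inverse) (auto simp: algebra_simps)
lemma cderiv1_sum: "(\<And>i. i \<in> S \<Longrightarrow> cderiv1 (f i) x) \<Longrightarrow> cderiv1 (\<lambda>x. \<Sum>i\<in>S. f i x) x"
  by (induction S rule: infinite_finite_induct) (simp_all add: cderiv1_const cderiv1_add)

lemma holomorphic_iff: "holomorphic_map_on f U \<longleftrightarrow> (\<forall>x\<in>U. cderiv f x)"
  unfolding holomorphic_map_on_def cderiv_def ..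

lemma cderiv1_Fa: "cderiv f x \<Longrightarrow> cderiv1 (\<lambda>x. Fa a (f x)) x"
proof -
  assume f: "cderiv f x"
  have "cderiv (\<lambda>x. Wm *v (wedge a *v f x)) x"
    by (rule cderiv_compose[OF cderiv_compose[OF f cderiv_mv] cderiv_mv])
  then show ?thesis unfolding Fa_Ba Ba_def pairing_def
    by (intro cderiv1_sum cderiv1_mult cderiv1_component f)
qed

lemma cderiv_zz: "cderiv zz x"
  unfolding zz_def vv_def by (intro cderiv_diff cderiv_sum cderiv_scale cderiv1_component cderiv_ident)

definition submanifold_chart :: "nat \<Rightarrow> (complex ^ 'n) set \<Rightarrow> complex ^ 'n \<Rightarrow> bool" where
  "submanifold_chart d M p \<longleftrightarrow> (\<exists>U f g K. open U \<and> p \<in> U \<and> open (f ` U) \<and>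
        holomorphic_map_on f U \<and> holomorphic_map_on g (f ` U) \<and> (\<forall>x\<in>U. g (f x) = x) \<and>
        vec.subspace K \<and> vec.dim K = d \<and> f ` (M \<inter> U) = f ` U \<inter> K)"

lemma submanifold_chart_linear:
  assumes ch: "submanifold_chart d M p" and A: "A ** B = mat 1" "B ** A = mat 1" and M: "(*v) A ` M = M"
  shows "submanifold_chart d M (A *v p)"
proof -
  obtain U f g K where c: "open U" "p \<in> U" "open (f ` U)" "holomorphic_map_on f U" "holomorphic_map_on g (f ` U)"
     "\<forall>x\<in>U. g (f x) = x" "vec.subspace K" "vec.dim K = d" "f ` (M \<inter> U) = f ` U \<inter> K"
    using ch unfolding submanifold_chart_def by blast
  have AB: "A *v (B *v x) = x" "B *v (A *v x) = x" for x by (simp_all add: matrix_vector_mul_assoc A)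
  have U: "(*v) A ` U = (*v) B -` U" by (auto simp: AB) (metis AB(1) imageI)
  have fU: "(\<lambda>x. f (B *v x)) ` ((*v) A ` U) = f ` U" by (simp add: image_image AB)
  have "A *v y \<in> M \<longleftrightarrow> y \<in> M" for y using M AB(2) by (metis imageE imageI)
  then have "(*v) A ` U \<inter> M = (*v) A ` (M \<inter> U)" by blast
  then have fM: "(\<lambda>x. f (B *v x)) ` (M \<inter> (*v) A ` U) = f ` (M \<inter> U)" by (simp add: image_image AB Int_commute)
  have "open ((*v) A ` U)" unfolding U
    by (rule open_vimage[OF c(1)]) (rule linear_continuous_on[OF bounded_linear_mv])
  moreover have "holomorphic_map_on (\<lambda>x. f (B *v x)) ((*v) A ` U)"
    unfolding holomorphic_iff using c(4) by (auto simp: AB holomorphic_iff intro!: cderiv_compose[OF cderiv_mv])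
  moreover have "holomorphic_map_on (\<lambda>x. A *v g x) (f ` U)"
    unfolding holomorphic_iff using c(5) by (auto simp: holomorphic_iff intro!: cderiv_compose[OF _ cderiv_mv])
  ultimately show ?thesis unfolding submanifold_chart_def
    using c(2,3,6,7,8,9)
    by (intro exI[of _ "(*v) A ` U"] exI[of _ "\<lambda>x. f (B *v x)"] exI[of _ "\<lambda>x. A *v g x"] exI[of _ K])
       (simp add: fU fM AB)
qed

text \<open>Group elements act by invertible linear maps preserving the orbit, so a chart at one
  point can be carried to all others.\<close>

lemma orbit_submanifold:
  assumes "submanifold_chart d (orbit x) x"
  shows "complex_submanifold_of_dim d (orbit x)"
  unfolding complex_submanifold_of_dim_def submanifold_chart_def[symmetric]
proof
  fix p assume "p \<in> orbit x"
  then obtain s c where s: "s \<in> Spin10" "c \<noteq> 0" "p = c *s (s *v x)" unfolding orbit_iff by blast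
  obtain s' where s': "s' \<in> Spin10" "s ** s' = mat 1" "s' ** s = mat 1" using Spin10_inverse[OF s(1)] by blast
  let ?A = "cmat c s" and ?B = "cmat (1 / c) s'"
  have AB: "?A ** ?B = mat 1" "?B ** ?A = mat 1" using s s' by simp_all
  have M: "?A *v y \<in> orbit x" "?B *v y \<in> orbit x" if "y \<in> orbit x" for y
  proof -
    have "?A *v y \<in> orbit y" unfolding orbit_iff cmat_mv using s by blast
    moreover have "?B *v y \<in> orbit y" unfolding orbit_iff cmat_mv
      using s s' by (intro bexI[of _ s'] exI[of _ "1 / c"]) simp_all
    ultimately show "?A *v y \<in> orbit x" "?B *v y \<in> orbit x" using orbit_eq[OF that] by auto
  qed
  have "(*v) ?A ` orbit x = orbit x"
  proof
    show "(*v) ?A ` orbit x \<subseteq> orbit x" using M by blast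
    show "orbit x \<subseteq> (*v) ?A ` orbit x"
    proof
      fix y assume "y \<in> orbit x"
      then have "?B *v y \<in> orbit x" by (rule M)
      moreover have "y = ?A *v (?B *v y)" by (simp only: matrix_vector_mul_assoc AB matrix_vector_mul_lid)
      ultimately show "y \<in> (*v) ?A ` orbit x" by blast
    qed
  qed
  from submanifold_chart_linear[OF assms AB this] show "submanifold_chart d (orbit x) p" using s by simp
qed

text \<open>The chart replaces the five coordinates of size 4 by the values of the quadrics, and the
  orbit becomes the vanishing of these. \<open>gch\<close> solves the affine equations of
  \<open>Fa_expand\<close>, which needs the coordinate at \<open>{}\<close> to be nonzero.\<close>

definition fch :: "spinor \<Rightarrow> spinor" where "fch x = zz x + vv (\<lambda>a. Fa a x)"
definition gch :: "spinor \<Rightarrow> spinor" where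
  "gch y = zz y + vv (\<lambda>a. (y $ (- {a}) - Fa a (zz y)) * inverse (2 * kap a * y $ {}))"

lemma gch_fch: "x $ {} \<noteq> 0 \<Longrightarrow> gch (fch x) = x"
proof -
  assume x: "x $ {} \<noteq> 0"
  have "(Fa a x - Fa a (zz x)) * inverse (2 * kap a * x $ {}) = x $ (- {a})" for a
    using x by (subst Fa_expand) (simp add: field_simps)
  then show ?thesis using zz_plus[of x] by (simp add: gch_def fch_def zz_vv)
qed

lemma fch_gch: "y $ {} \<noteq> 0 \<Longrightarrow> fch (gch y) = y"
proof -
  assume y: "y $ {} \<noteq> 0"
  have "Fa a (gch y) = y $ (- {a})" for a
    unfolding gch_def Fa_vv using y by (simp add: field_simps)
  then show ?thesis using zz_plus[of y] by (simp add: fch_def) (simp add: gch_def zz_vv)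
qed

lemma card_pairs_5: "card {I :: 5 set. card I = 2} = 10"
  using n_subsets[of "UNIV :: 5 set" 2] by (simp add: choose_two)

lemma chart_E1: "submanifold_chart 11 (orbit E1) E1"
proof -
  let ?U = "{x :: spinor. x $ {} \<noteq> 0}"
  \<comment> \<open>The coordinates that stay free on the orbit: \<open>{}\<close> and the ten
    two-element sets. The odd coordinates vanish on \<open>X\<close>, those of size 4 through the
    quadrics.\<close>
  define d where "d = insert {} {I :: 5 set. card I = 2}"
  let ?K = "{x :: spinor. \<forall>I. I \<notin> d \<longrightarrow> x $ I = 0}"
  have d: "I \<in> d \<longleftrightarrow> even (card I) \<and> (\<forall>b. I \<noteq> - {b})" for I
    unfolding d_def using card_5_cases[of I] by (auto simp: card_compl_single compl_neq_empty)
  have fU: "fch ` ?U = ?U"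
  proof
    show "fch ` ?U \<subseteq> ?U" by (auto simp: fch_def)
    show "?U \<subseteq> fch ` ?U"
    proof
      fix y assume "y \<in> ?U"
      moreover then have "gch y \<in> ?U" by (simp add: gch_def)
      ultimately show "y \<in> fch ` ?U" by (intro image_eqI[of _ _ "gch y"]) (simp_all add: fch_gch)
    qed
  qed
  have op: "open ?U" by (intro open_Collect_neq continuous_intros)
  have "vec.dim ?K = card d" by (rule dim_substandard_cart)
  also have "card d = 11" unfolding d_def by (subst card_insert_disjoint) (auto simp: card_pairs_5)
  finally have dim: "vec.dim ?K = 11" .
  have sub: "vec.subspace ?K" by (auto simp: vec.subspace_def)
  have hf: "holomorphic_map_on fch ?U"
    unfolding holomorphic_iff fch_def vv_def
    by (intro ballI cderiv_add cderiv_zz cderiv_sum cderiv_scale cderiv1_Fa cderiv_ident)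
  have hg: "holomorphic_map_on gch ?U"
    unfolding holomorphic_iff gch_def vv_def
    by (intro ballI cderiv_add cderiv_zz cderiv_sum cderiv_scale cderiv1_Fa cderiv_ident cderiv1_mult cderiv1_diff
        cderiv1_component cderiv1_inverse cderiv1_const) simp
  have img: "fch ` (orbit E1 \<inter> ?U) = ?U \<inter> ?K"
  proof
    show "fch ` (orbit E1 \<inter> ?U) \<subseteq> ?U \<inter> ?K"
    proof
      fix y assume "y \<in> fch ` (orbit E1 \<inter> ?U)"
      then obtain x where x: "y = fch x" "x \<in> orbit E1" "x $ {} \<noteq> 0" by blast
      have xX: "x \<in> X" using x(2) orbit_X[OF E_X(1)] by blast
      have "Fa a x = 0" for a using x(2) by (simp add: Fa_def orbit_E1_Fq)
      then have "y = zz x" by (simp add: x(1) fch_def vv_def)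
      moreover have "zz x $ I = 0" if "I \<notin> d" for I
      proof (cases "\<exists>b. I = - {b}")
        case False
        then have "odd (card I)" using that d by blast
        then show ?thesis using zz_X[OF xX] by (simp add: X_def)
      qed auto
      ultimately show "y \<in> ?U \<inter> ?K" using x by simp
    qed
    show "?U \<inter> ?K \<subseteq> fch ` (orbit E1 \<inter> ?U)"
    proof
      fix y assume y: "y \<in> ?U \<inter> ?K"
      have yX: "y \<in> X" unfolding X_def using y d by auto
      have y4: "y $ (- {a}) = 0" for a using y d by auto
      have gX: "gch y \<in> X" unfolding gch_def by (intro X_add zz_X vv_X yX)
      have g0: "gch y $ {} \<noteq> 0" using y by (simp add: gch_def)
      have fg: "fch (gch y) = y" using y by (intro fch_gch) simp
      have "Fa a (gch y) = fch (gch y) $ (- {a})" for a by (simp add: fch_def)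
      then have "gch y \<in> orbit E1" using orbit_E1_iff[OF gX g0] by (simp add: fg y4)
      then show "y \<in> fch ` (orbit E1 \<inter> ?U)" using fg g0 by (intro image_eqI[of _ _ "gch y"]) simp_all
    qed
  qed
  show ?thesis unfolding submanifold_chart_def
    by (intro exI[of _ ?U] exI[of _ fch] exI[of _ gch] exI[of _ ?K])
       (use op fU hf hg gch_fch sub dim img in \<open>auto simp: E1_def axis_component\<close>)
qed

lemma card_even_5: "card {I :: 5 set. even (card I)} = 16"
proof -
  have e: "{I :: 5 set. even (card I)} = insert {} {I. card I = 2} \<union> (\<lambda>b. - {b}) ` UNIV"
    using card_5_cases by (auto simp: card_compl_single)
  have i: "inj (\<lambda>b :: 5. - {b})" by (rule injI) auto
  have "card (insert {} {I :: 5 set. card I = 2}) = 11" by (subst card_insert_disjoint) (auto simp: card_pairs_5)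
  moreover have "card ((\<lambda>b :: 5. - {b}) ` UNIV) = 5" using card_image[OF i] by simp
  moreover have "insert {} {I :: 5 set. card I = 2} \<inter> (\<lambda>b. - {b}) ` UNIV = {}"
    using compl_neq_empty card_compl_single by auto
  ultimately show ?thesis unfolding e by (subst card_Un_disjoint) auto
qed

lemma X_dim: "vec.subspace X" "vec.dim X = 16"
proof -
  have e: "X = {x :: spinor. \<forall>I. I \<notin> {I. even (card I)} \<longrightarrow> x $ I = 0}" by (auto simp: X_def)
  show "vec.dim X = 16" unfolding e dim_substandard_cart by (rule card_even_5)
  show "vec.subspace X" by (auto simp: vec.subspace_def X_def)
qed

lemma continuous_on_Fa: "continuous_on S (Fa a)"
proof -
  have "isCont (Fa a) x" for x
    using cderiv1_Fa[OF cderiv_ident, of a x] unfolding cderiv1_def by (auto intro: has_derivative_continuous)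
  then show ?thesis by (simp add: continuous_at_imp_continuous_on)
qed

lemma chart_E2: "submanifold_chart 16 (orbit E2) E2"
proof -
  let ?U = "{x. Fa 0 x \<noteq> 0}"
  have op: "open ?U" by (intro open_Collect_neq continuous_on_Fa continuous_on_const)
  have "orbit E2 \<inter> ?U = ?U \<inter> X"
  proof
    show "orbit E2 \<inter> ?U \<subseteq> ?U \<inter> X" using orbit_X[OF E_X(2)] by blast
    show "?U \<inter> X \<subseteq> orbit E2 \<inter> ?U"
    proof
      fix x assume x: "x \<in> ?U \<inter> X"
      then have "x \<noteq> 0" by (auto simp: Fa_Ba Ba_def)
      moreover have "x \<notin> orbit E1" using x orbit_E1_Fq unfolding Fa_def by blast
      ultimately show "x \<in> orbit E2 \<inter> ?U" using X_orbits x by blast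
    qed
  qed
  then show ?thesis unfolding submanifold_chart_def
    by (intro exI[of _ ?U] exI[of _ "\<lambda>x. x"] exI[of _ "\<lambda>x. x"] exI[of _ X])
       (use op X_dim Fa_E2 in \<open>simp add: holomorphic_iff cderiv_ident\<close>)
qed

lemma chart_0: "complex_submanifold_of_dim 0 ({0} :: (complex ^ 'n) set)"
  unfolding complex_submanifold_of_dim_def
proof
  fix p :: "complex ^ 'n" assume "p \<in> {0}"
  moreover have "vec.dim ({0} :: (complex ^ 'n) set) = 0" by (simp add: vec.dim_eq_0)
  moreover have "vec.subspace ({0} :: (complex ^ 'n) set)" by (simp add: vec.subspace_def)
  ultimately show "\<exists>U f g K. open U \<and> p \<in> U \<and> open (f ` U) \<and>
        holomorphic_map_on f U \<and> holomorphic_map_on g (f ` U) \<and> (\<forall>x\<in>U. g (f x) = x) \<and>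
        vec.subspace K \<and> vec.dim K = 0 \<and> f ` ({0} \<inter> U) = f ` U \<inter> K"
    by (intro exI[of _ UNIV] exI[of _ "\<lambda>x. x"] exI[of _ "\<lambda>x. x"] exI[of _ "{0}"]) (simp add: holomorphic_iff cderiv_ident)
qed

subsection \<open>Orbit closures\<close>

lemma polynomial_fun_continuous: "polynomial_fun p \<Longrightarrow> continuous_on UNIV p"
  by (induction rule: polynomial_fun.induct) (auto intro!: continuous_intros)

lemma polynomial_fun_sum: "(\<And>i. i \<in> S \<Longrightarrow> polynomial_fun (f i)) \<Longrightarrow> polynomial_fun (\<lambda>x. \<Sum>i\<in>S. f i x)"
  by (induction S rule: infinite_finite_induct) (auto intro: polynomial_fun.intros)

lemma polynomial_fun_mv: "(\<And>j. polynomial_fun (\<lambda>x. f x $ j)) \<Longrightarrow> polynomial_fun (\<lambda>x. ((A :: complex ^ 'n ^ 'm) *v f x) $ i)"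
  unfolding matrix_vector_mult_def by (auto intro!: polynomial_fun_sum intro: polynomial_fun.intros)

lemma polynomial_Fa: "polynomial_fun (Fa a)"
proof -
  have "polynomial_fun (\<lambda>x. \<Sum>I\<in>UNIV. x $ I * (Wm *v (wedge a *v x)) $ I)"
    by (intro polynomial_fun_sum polynomial_fun.mult polynomial_fun_mv polynomial_fun.coord)
  moreover have "Fa a = (\<lambda>x. \<Sum>I\<in>UNIV. x $ I * (Wm *v (wedge a *v x)) $ I)"
    by (rule ext) (simp add: Fa_Ba Ba_def pairing_def)
  ultimately show ?thesis by simp
qed

lemma zariski_closure_subset: "S \<subseteq> zariski_closure S"
  by (auto simp: zariski_closure_def)

lemma zariski_closure_le:
  assumes "\<And>p x. polynomial_fun p \<Longrightarrow> (\<And>y. y \<in> T \<Longrightarrow> p y = 0) \<Longrightarrow> x \<in> S \<Longrightarrow> p x = 0"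
  shows "zariski_closure S \<subseteq> zariski_closure T"
  using assms by (auto simp: zariski_closure_def)

text \<open>Continuity along the line suffices; it is applied to one-parameter degenerations of
  orbit points as \<open>t\<close> tends to 0.\<close>

lemma polynomial_line_limit:
  assumes p: "polynomial_fun p" and z: "\<And>t. t \<noteq> 0 \<Longrightarrow> p (x + t *s y) = 0"
  shows "p (x :: complex ^ 'n) = 0"
proof -
  have "continuous_on UNIV (\<lambda>t. x + t *s y)"
    by (intro continuous_intros linear_continuous_on bounded_linear_scale_vec)
  then have "continuous_on UNIV (\<lambda>t. p (x + t *s y))"
    using continuous_on_compose2[OF polynomial_fun_continuous[OF p]] by auto
  then have "isCont (\<lambda>t. p (x + t *s y)) 0" by (simp add: continuous_on_eq_continuous_at)
  then have "((\<lambda>t. p (x + t *s y)) \<longlongrightarrow> p (x + 0 *s y)) (at 0)" by (rule isContD)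
  moreover have "((\<lambda>t. p (x + t *s y)) \<longlongrightarrow> 0) (at 0)"
    by (rule tendsto_eventually) (simp add: eventually_at_filter z)
  ultimately show ?thesis using tendsto_unique[of "at (0 :: complex)"] by fastforce
qed

lemma zariski_0: "zariski_closure {0} = ({0} :: spinor set)"
proof
  show "zariski_closure {0} \<subseteq> ({0} :: spinor set)"
  proof
    fix x :: spinor assume "x \<in> zariski_closure {0}"
    then have "x $ I = 0" for I using polynomial_fun.coord[of I] unfolding zariski_closure_def by auto
    then show "x \<in> {0}" by (simp add: vec_eq_iff)
  qed
qed (rule zariski_closure_subset)

lemma zariski_chain:
  "zariski_closure {0} \<subset> zariski_closure (orbit E1)"
  "zariski_closure (orbit E1) \<subset> zariski_closure (orbit E2)"
  "zariski_closure (orbit E2) = X"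
proof -
  have z0: "p 0 = 0" if "polynomial_fun p" "\<And>y. y \<in> orbit E1 \<Longrightarrow> p y = 0" for p
    by (rule polynomial_line_limit[OF that(1), of _ E1]) (use that(2) orbit_scale in simp)
  have z1: "p x = 0" if p: "polynomial_fun p" "\<And>y. y \<in> orbit E2 \<Longrightarrow> p y = 0" and x: "x \<in> orbit E1" for p x
  proof -
    obtain s c where s: "s \<in> Spin10" "c \<noteq> 0" "x = c *s (s *v E1)" using x unfolding orbit_iff by blast
    show ?thesis
    proof (rule polynomial_line_limit[OF p(1)])
      fix t :: complex assume "t \<noteq> 0"
      \<comment> \<open>For nonzero \<open>t\<close> this point lies in the open orbit, and it
        degenerates to \<open>E1\<close> as \<open>t\<close> tends to 0.\<close>
      let ?y = "E1 + t *s axis (- {0}) 1"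
      have "?y \<in> orbit E2" using pair_orbit_0[of 1 t] \<open>t \<noteq> 0\<close> by (simp add: E1_def)
      moreover have "c *s (s *v ?y) \<in> orbit ?y" unfolding orbit_iff using s by blast
      ultimately have "p (c *s (s *v ?y)) = 0" using p(2) orbit_eq by metis
      then show "p (x + t *s (c *s (s *v axis (- {0}) 1))) = 0"
        by (simp add: s(3) matrix_vector_right_distrib vector_scalar_commute vec.scale_right_distrib mult.commute)
    qed
  qed
  show "zariski_closure {0} \<subset> zariski_closure (orbit E1)"
  proof
    show "zariski_closure {0} \<subseteq> zariski_closure (orbit E1)" by (rule zariski_closure_le) (use z0 in auto)
    have "E1 \<in> zariski_closure (orbit E1)" using zariski_closure_subset orbit_refl by blast
    then show "zariski_closure {0} \<noteq> zariski_closure (orbit E1)" unfolding zariski_0 using E_nz by blast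
  qed
  show "zariski_closure (orbit E1) \<subset> zariski_closure (orbit E2)"
  proof
    show "zariski_closure (orbit E1) \<subseteq> zariski_closure (orbit E2)" by (rule zariski_closure_le) (rule z1)
    have "E2 \<in> zariski_closure (orbit E2)" using zariski_closure_subset orbit_refl by blast
    moreover have "E2 \<notin> zariski_closure (orbit E1)"
      unfolding zariski_closure_def using polynomial_Fa[of 0] orbit_E1_Fq Fa_E2 by (auto simp: Fa_def)
    ultimately show "zariski_closure (orbit E1) \<noteq> zariski_closure (orbit E2)" by blast
  qed
  show "zariski_closure (orbit E2) = X"
  proof
    show "zariski_closure (orbit E2) \<subseteq> X"
    proof
      fix x assume x: "x \<in> zariski_closure (orbit E2)"
      have "x $ I = 0" if "odd (card I)" for I
      proof -
        have "y $ I = 0" if "y \<in> orbit E2" for y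
          using orbit_X[OF E_X(2)] that \<open>odd (card I)\<close> unfolding X_def by blast
        then show ?thesis using x polynomial_fun.coord[of I] unfolding zariski_closure_def by blast
      qed
      then show "x \<in> X" by (simp add: X_def)
    qed
    show "X \<subseteq> zariski_closure (orbit E2)"
      unfolding zariski_closure_def using X_orbits z0 z1 by blast
  qed
qed

section \<open>Tori in the spin group\<close>

text \<open>The properties of an algebraic torus that are used: its elements are squares of elements, and
  it acts on the spinor space through finitely many characters, with projections \<open>A m\<close>.\<close>

definition toral :: "spinor_mat set \<Rightarrow> bool" where
  "toral H \<longleftrightarrow> H \<subseteq> Spin10 \<and> (\<forall>h\<in>H. \<exists>g\<in>H. h = g ** g) \<and>
     (\<exists>(M :: (nat \<Rightarrow> int) set) A \<theta>. finite M \<and> mat 1 = (\<Sum>m\<in>M. A m) \<and>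
        (\<forall>m\<in>M. A m \<noteq> 0 \<and> (\<forall>h\<in>H. h ** A m = cmat (\<theta> h m) (A m) \<and> A m ** h = cmat (\<theta> h m) (A m))))"

lemma mm_sum_right: "A ** (\<Sum>i\<in>S. B i) = (\<Sum>i\<in>S. A ** (B i :: complex ^ 'n ^ 'm))"
  by (induction S rule: infinite_finite_induct) (simp_all add: matrix_add_ldistrib)
lemma mm_sum_left: "(\<Sum>i\<in>S. B i) ** A = (\<Sum>i\<in>S. (B i :: complex ^ 'n ^ 'm) ** A)"
  by (induction S rule: infinite_finite_induct) (simp_all add: matrix_add_rdistrib')

definition tmon :: "nat \<Rightarrow> (nat \<Rightarrow> complex) \<Rightarrow> (nat \<Rightarrow> int) \<Rightarrow> complex" where
  "tmon r s m = (\<Prod>i<r. s i powi m i)"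

lemma tmon_mult: "tmon r (\<lambda>i. s i * t i) m = tmon r s m * tmon r t m"
  by (simp add: tmon_def power_int_mult_distrib prod.distrib)
lemma tmon_one: "tmon r (\<lambda>i. 1) m = 1"
  by (simp add: tmon_def)

lemma torus_mult: "s \<in> torus_points r \<Longrightarrow> t \<in> torus_points r \<Longrightarrow> (\<lambda>i. s i * t i) \<in> torus_points r"
  by (simp add: torus_points_def)
lemma torus_one: "(\<lambda>i. 1) \<in> torus_points r"
  by (simp add: torus_points_def)

text \<open>Translation of a vanishing sum by a torus element multiplies its coefficients by the
  values of the monomials, so interpolation isolates one coefficient. Exponents from
  \<open>r\<close> on are required to be zero in order that different exponents are different
  characters.\<close>

lemma monomials_independent:
  assumes M: "finite M" "\<And>m. m \<in> M \<Longrightarrow> \<forall>i\<ge>r. m i = 0" and z: "\<And>s. s \<in> torus_points r \<Longrightarrow> (\<Sum>m\<in>M. c m * tmon r s m) = 0"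
    and l: "l \<in> M"
  shows "c l = 0"
proof -
  let ?P = "\<lambda>c. \<forall>s\<in>torus_points r. (\<Sum>m\<in>M. c m * tmon r s m) = 0"
  have "\<exists>w. ?P (\<lambda>k. w k * c k) \<and> (\<forall>k. (\<forall>T\<in>torus_points r. tmon r T k = tmon r T l) \<longrightarrow> w k = 1)
     \<and> (\<forall>k\<in>M. \<not> (\<forall>T\<in>torus_points r. tmon r T k = tmon r T l) \<longrightarrow> w k = 0)"
  proof (rule weight_multiplier[where F = "torus_points r" and P = ?P and \<theta> = "tmon r"])
    fix T c assume T: "T \<in> torus_points r" and c: "?P c"
    show "?P (\<lambda>k. tmon r T k * c k)"
    proof
      fix s assume "s \<in> torus_points r"
      then have "(\<Sum>m\<in>M. c m * tmon r (\<lambda>i. s i * T i) m) = 0" using c T torus_mult by blast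
      then show "(\<Sum>m\<in>M. tmon r T m * c m * tmon r s m) = 0" by (simp add: tmon_mult mult_ac)
    qed
  qed (use M z in \<open>auto simp: distrib_right sum.distrib mult.assoc sum_distrib_left[symmetric]\<close>)
  then obtain w where w: "?P (\<lambda>k. w k * c k)" "w l = 1"
     "\<And>k. k \<in> M \<Longrightarrow> \<not> (\<forall>T\<in>torus_points r. tmon r T k = tmon r T l) \<Longrightarrow> w k = 0" by blast
  have "w k = 0" if k: "k \<in> M" "k \<noteq> l" for k
  proof (rule w(3)[OF k(1)])
    obtain i where i: "k i \<noteq> l i" using k(2) by blast
    then have ir: "i < r" using M(2)[OF k(1)] M(2)[OF l] by (metis not_le)
    \<comment> \<open>At this point a monomial takes the value 2 to the power of its
      \<open>i\<close>-th exponent, which distinguishes \<open>k\<close> from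
      \<open>l\<close>.\<close>
    let ?T = "\<lambda>j. if j = i then 2 else 1 :: complex"
    have T: "?T \<in> torus_points r" using ir by (simp add: torus_points_def)
    have "tmon r ?T m = 2 powi m i" for m
    proof -
      have "tmon r ?T m = (\<Prod>j<r. if j = i then 2 powi m i else 1)" unfolding tmon_def by (intro prod.cong) auto
      then show ?thesis using ir by simp
    qed
    moreover have "(2 :: complex) powi k i \<noteq> 2 powi l i"
    proof
      assume "(2 :: complex) powi k i = 2 powi l i"
      then have "norm ((2 :: complex) powi k i) = norm ((2 :: complex) powi l i)" by simp
      then have "(2 :: real) powi k i = 2 powi l i" by (simp add: norm_power_int)
      then show False using i power_int_strict_increasing[of "k i" "l i" "2 :: real"] power_int_strict_increasing[of "l i" "k i" "2 :: real"]
        by (metis less_irrefl linorder_neqE one_less_numeral_iff semiring_norm(76))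
    qed
    ultimately have "tmon r ?T k \<noteq> tmon r ?T l" by simp
    then show "\<not> (\<forall>T\<in>torus_points r. tmon r T k = tmon r T l)" using T by blast
  qed
  then have "(\<Sum>m\<in>M. w m * c m * tmon r (\<lambda>i. 1) m) = (\<Sum>m\<in>M. if m = l then c l else 0)"
    using w(2) by (intro sum.cong) (auto simp: tmon_one)
  then show ?thesis using w(1) torus_one[of r] M(1) l by simp
qed

lemma fst_G0_mult: "fst (G0_mult a b) = fst a ** fst b" and snd_G0_mult: "snd (G0_mult a b) = snd a * snd b"
  by (cases a; cases b; simp)+

text \<open>The parametrization is expanded into monomials with matrix coefficients
  \<open>B k\<close>. Multiplicativity and the independence of monomials make each
  \<open>B k\<close> an eigenvector for multiplication on either side, and the value at 1 writes the
  identity as their sum.\<close>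

lemma algebraic_torus_toral:
  assumes H: "algebraic_torus H" "H \<subseteq> G0"
  shows "toral (fst ` H)"
proof -
  obtain r \<rho> where rho: "bij_betw \<rho> (torus_points r) H"
    "\<And>s t. s \<in> torus_points r \<Longrightarrow> t \<in> torus_points r \<Longrightarrow> \<rho> (\<lambda>i. s i * t i) = G0_mult (\<rho> s) (\<rho> t)"
    "\<rho> (\<lambda>i. 1) = (mat 1, 1)" "\<And>I J. laurent_on_torus r (\<lambda>s. fst (\<rho> s) $ I $ J)"
    using H(1) unfolding algebraic_torus_def by blast
  have fm: "fst (\<rho> (\<lambda>i. s i * t i)) = fst (\<rho> s) ** fst (\<rho> t)" if "s \<in> torus_points r" "t \<in> torus_points r" for s t
    by (simp add: rho(2)[OF that] fst_G0_mult)
  have H_eq: "fst ` H = (\<lambda>s. fst (\<rho> s)) ` torus_points r"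
    using rho(1) by (auto simp: bij_betw_def image_image)
  have "\<forall>I J. \<exists>M a. finite M \<and> (\<forall>s\<in>torus_points r. fst (\<rho> s) $ I $ J = (\<Sum>m\<in>M. a m * tmon r s m))"
    using rho(4) unfolding laurent_on_torus_def tmon_def by blast
  then obtain M a where Ma: "\<And>I J. finite (M I J)"
    "\<And>I J s. s \<in> torus_points r \<Longrightarrow> fst (\<rho> s) $ I $ J = (\<Sum>m\<in>M I J. a I J m * tmon r s m)" by metis
  define N where "N = (\<Union>I. \<Union>J. M I J)"
  have N: "finite N" unfolding N_def using Ma(1) by simp
  define A where "A m = (\<chi> I J. if m \<in> M I J then a I J m else 0)" for m
  have rA: "fst (\<rho> s) = (\<Sum>m\<in>N. cmat (tmon r s m) (A m))" if "s \<in> torus_points r" for s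
  proof -
    have "fst (\<rho> s) $ I $ J = (\<Sum>m\<in>N. cmat (tmon r s m) (A m)) $ I $ J" for I J
    proof -
      have "(\<Sum>m\<in>N. cmat (tmon r s m) (A m)) $ I $ J = (\<Sum>m\<in>N. if m \<in> M I J then a I J m * tmon r s m else 0)"
        unfolding sum_component by (intro sum.cong) (auto simp: A_def)
      also have "\<dots> = (\<Sum>m\<in>M I J. a I J m * tmon r s m)"
        using N by (subst sum.inter_restrict[symmetric]) (auto simp: N_def intro!: sum.cong)
      finally show ?thesis using Ma(2)[OF that] by simp
    qed
    then show ?thesis by (simp add: vec_eq_iff)
  qed
  \<comment> \<open>Exponents that differ only from position \<open>r\<close> on give the same
    function; they are merged before independence is used.\<close>
  define rr where "rr m = (\<lambda>i. if i < r then m i else (0 :: int))" for m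
  have trr: "tmon r s (rr m) = tmon r s m" for s m unfolding tmon_def rr_def by (intro prod.cong) auto
  define B where "B k = (\<Sum>m | m \<in> N \<and> rr m = k. A m)" for k
  define L where "L = {k \<in> rr ` N. B k \<noteq> 0}"
  have L: "finite L" "\<And>k. k \<in> L \<Longrightarrow> \<forall>i\<ge>r. k i = 0" using N by (auto simp: L_def rr_def)
  have rB: "fst (\<rho> s) = (\<Sum>k\<in>L. cmat (tmon r s k) (B k))" if "s \<in> torus_points r" for s
  proof -
    have "fst (\<rho> s) = (\<Sum>k\<in>rr ` N. \<Sum>m | m \<in> N \<and> rr m = k. cmat (tmon r s m) (A m))"
      unfolding rA[OF that] by (rule sum.image_gen[OF N])
    also have "\<dots> = (\<Sum>k\<in>rr ` N. cmat (tmon r s k) (B k))"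
    proof (intro sum.cong refl)
      fix k
      have "(\<Sum>m | m \<in> N \<and> rr m = k. cmat (tmon r s m) (A m)) = (\<Sum>m | m \<in> N \<and> rr m = k. cmat (tmon r s k) (A m))"
        by (intro sum.cong refl) (auto simp: trr)
      then show "(\<Sum>m | m \<in> N \<and> rr m = k. cmat (tmon r s m) (A m)) = cmat (tmon r s k) (B k)"
        by (simp add: B_def mat.scale_sum_right)
    qed
    also have "\<dots> = (\<Sum>k\<in>L. cmat (tmon r s k) (B k))"
      by (rule sum.mono_neutral_right) (use N in \<open>auto simp: L_def\<close>)
    finally show ?thesis .
  qed
  have eigenB: "fst (\<rho> t) ** B k = cmat (tmon r t k) (B k)" "B k ** fst (\<rho> t) = cmat (tmon r t k) (B k)"
    if t: "t \<in> torus_points r" and k: "k \<in> L" for t k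
  proof -
    have "(fst (\<rho> t) ** B k) $ I $ J - tmon r t k * B k $ I $ J = 0" for I J
    proof (rule monomials_independent[OF L _ k, of "\<lambda>k. (fst (\<rho> t) ** B k) $ I $ J - tmon r t k * B k $ I $ J"])
      fix s assume s: "s \<in> torus_points r"
      have "(\<Sum>k\<in>L. cmat (tmon r s k) (fst (\<rho> t) ** B k)) = (\<Sum>k\<in>L. cmat (tmon r s k) (cmat (tmon r t k) (B k)))"
        using fm[OF t s] rB[OF s] rB[OF torus_mult[OF t s]] by (simp add: mm_sum_right tmon_mult mult.commute)
      from arg_cong[OF this, of "\<lambda>A. A $ I $ J"]
      show "(\<Sum>k\<in>L. ((fst (\<rho> t) ** B k) $ I $ J - tmon r t k * B k $ I $ J) * tmon r s k) = 0"
        by (simp add: sum_component sum_subtractf algebra_simps)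
    qed
    then show "fst (\<rho> t) ** B k = cmat (tmon r t k) (B k)" by (simp add: vec_eq_iff)
    have "(B k ** fst (\<rho> t)) $ I $ J - tmon r t k * B k $ I $ J = 0" for I J
    proof (rule monomials_independent[OF L _ k, of "\<lambda>k. (B k ** fst (\<rho> t)) $ I $ J - tmon r t k * B k $ I $ J"])
      fix s assume s: "s \<in> torus_points r"
      have "(\<Sum>k\<in>L. cmat (tmon r s k) (B k ** fst (\<rho> t))) = (\<Sum>k\<in>L. cmat (tmon r s k) (cmat (tmon r t k) (B k)))"
        using fm[OF s t] rB[OF s] rB[OF torus_mult[OF s t]] by (simp add: mm_sum_left tmon_mult)
      from arg_cong[OF this, of "\<lambda>A. A $ I $ J"]
      show "(\<Sum>k\<in>L. ((B k ** fst (\<rho> t)) $ I $ J - tmon r t k * B k $ I $ J) * tmon r s k) = 0"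
        by (simp add: sum_component sum_subtractf algebra_simps)
    qed
    then show "B k ** fst (\<rho> t) = cmat (tmon r t k) (B k)" by (simp add: vec_eq_iff)
  qed
  \<comment> \<open>The projection to the matrix part need not be injective on \<open>H\<close>, so
    a parameter is chosen for each matrix.\<close>
  define ch where "ch h = (SOME t. t \<in> torus_points r \<and> h = fst (\<rho> t))" for h
  have ch: "ch h \<in> torus_points r \<and> h = fst (\<rho> (ch h))" if "h \<in> fst ` H" for h
  proof -
    have "\<exists>t. t \<in> torus_points r \<and> h = fst (\<rho> t)" using that H_eq by blast
    then show ?thesis unfolding ch_def by (rule someI_ex)
  qed
  show ?thesis unfolding toral_def
  proof (intro conjI ballI)
    show "fst ` H \<subseteq> Spin10" using H(2) by (auto simp: G0_def)
    show "\<exists>g\<in>fst ` H. h = g ** g" if "h \<in> fst ` H" for h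
    proof -
      \<comment> \<open>Square roots of the coordinates give a square root inside the torus.\<close>
      let ?t = "\<lambda>i. if i < r then csqrt (ch h i) else 1"
      have t: "?t \<in> torus_points r" using ch[OF that] by (auto simp: torus_points_def)
      have "(\<lambda>i. ?t i * ?t i) = ch h" using ch[OF that] by (auto simp: torus_points_def simp flip: power2_eq_square)
      then have "h = fst (\<rho> ?t) ** fst (\<rho> ?t)" using fm[OF t t] ch[OF that] by simp
      then show ?thesis using t H_eq by blast
    qed
    have "mat 1 = (\<Sum>k\<in>L. B k)" using rB[OF torus_one] rho(3) by (simp add: tmon_one)
    then show "\<exists>(M :: (nat \<Rightarrow> int) set) A \<theta>. finite M \<and> mat 1 = (\<Sum>m\<in>M. A m) \<and>
        (\<forall>m\<in>M. A m \<noteq> 0 \<and> (\<forall>h\<in>fst ` H. h ** A m = cmat (\<theta> h m) (A m) \<and> A m ** h = cmat (\<theta> h m) (A m)))"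
    proof (intro exI[of _ L] exI[of _ B] exI[of _ "\<lambda>h m. tmon r (ch h) m"] conjI ballI L(1))
      fix m h assume m: "m \<in> L" and h: "h \<in> fst ` H"
      have hc: "h = fst (\<rho> (ch h))" using ch[OF h] by blast
      show "h ** B m = cmat (tmon r (ch h) m) (B m)" "B m ** h = cmat (tmon r (ch h) m) (B m)"
        using eigenB[OF _ m, of "ch h"] ch[OF h] hc by simp_all
    qed (simp_all add: L_def)
  qed
qed

lemma conj_mult:
  assumes "g' ** g = mat (1 :: complex)"
  shows "(g ** A ** g') ** (g ** B ** g') = g ** (A ** B) ** g'"
proof -
  have "(g ** A ** g') ** (g ** B ** g') = g ** A ** (g' ** g) ** B ** g'" by (simp only: matrix_mul_assoc)
  then show ?thesis by (simp add: assms matrix_mul_assoc)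
qed

lemma toral_conj:
  assumes H: "toral H" and g: "g \<in> Spin10" "g' \<in> Spin10" "g ** g' = mat 1" "g' ** g = mat 1"
  shows "toral ((\<lambda>h. g ** h ** g') ` H)"
proof -
  obtain M :: "(nat \<Rightarrow> int) set" and A \<theta> where M: "finite M" "mat 1 = (\<Sum>m\<in>M. A m)" "\<And>m. m \<in> M \<Longrightarrow> A m \<noteq> 0"
     "\<And>m h. m \<in> M \<Longrightarrow> h \<in> H \<Longrightarrow> h ** A m = cmat (\<theta> h m) (A m) \<and> A m ** h = cmat (\<theta> h m) (A m)"
    using H unfolding toral_def by blast
  have bck: "g' ** (g ** h ** g') ** g = h" for h
  proof -
    have "g' ** (g ** h ** g') ** g = (g' ** g) ** h ** (g' ** g)" by (simp only: matrix_mul_assoc)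
    then show ?thesis by (simp add: g(4))
  qed
  show ?thesis unfolding toral_def
  proof (intro conjI)
    show "(\<lambda>h. g ** h ** g') ` H \<subseteq> Spin10" using H g unfolding toral_def by (auto intro: Spin10_mult)
    show "\<forall>h\<in>(\<lambda>h. g ** h ** g') ` H. \<exists>k\<in>(\<lambda>h. g ** h ** g') ` H. h = k ** k"
    proof safe
      fix h assume "h \<in> H"
      then obtain k where k: "k \<in> H" "h = k ** k" using H unfolding toral_def by blast
      have "(g ** k ** g') ** (g ** k ** g') = g ** h ** g'" unfolding k(2) by (rule conj_mult[OF g(4)])
      then show "\<exists>m\<in>(\<lambda>h. g ** h ** g') ` H. g ** h ** g' = m ** m" using k by (intro bexI[of _ "g ** k ** g'"]) auto
    qed
    let ?A = "\<lambda>m. g ** A m ** g'" and ?\<theta> = "\<lambda>h. \<theta> (g' ** h ** g)"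
    have "(\<Sum>m\<in>M. ?A m) = g ** (\<Sum>m\<in>M. A m) ** g'" by (simp add: mm_sum_left mm_sum_right)
    then have "mat 1 = (\<Sum>m\<in>M. ?A m)" using M(2) g(3) by (metis matrix_mul_rid)
    moreover have "?A m \<noteq> 0" if "m \<in> M" for m
    proof
      assume "?A m = 0"
      then have "g' ** ?A m ** g = 0" by simp
      then show False using bck M(3)[OF that] by simp
    qed
    moreover have "h ** ?A m = cmat (?\<theta> h m) (?A m) \<and> ?A m ** h = cmat (?\<theta> h m) (?A m)"
      if m: "m \<in> M" and h: "h \<in> (\<lambda>h. g ** h ** g') ` H" for m h
    proof -
      obtain k where k: "k \<in> H" "h = g ** k ** g'" using h by blast
      have 1: "h ** ?A m = g ** (k ** A m) ** g'" "?A m ** h = g ** (A m ** k) ** g'"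
        unfolding k(2) by (rule conj_mult[OF g(4)])+
      show ?thesis unfolding 1 using M(4)[OF m k(1)] bck by (simp add: k(2))
    qed
    ultimately show "\<exists>(M :: (nat \<Rightarrow> int) set) A \<theta>. finite M \<and> mat 1 = (\<Sum>m\<in>M. A m) \<and>
        (\<forall>m\<in>M. A m \<noteq> 0 \<and> (\<forall>h\<in>(\<lambda>h. g ** h ** g') ` H. h ** A m = cmat (\<theta> h m) (A m) \<and> A m ** h = cmat (\<theta> h m) (A m)))"
      using M(1) by (intro exI[of _ M] exI[of _ ?A] exI[of _ ?\<theta>]) blast
  qed
qed

subsection \<open>Weight vectors in the vector representation\<close>

text \<open>\<open>u\<close> is a weight vector of character \<open>c\<close> for conjugation on
  Clifford vectors, written without inverses.\<close>

definition wtv :: "spinor_mat set \<Rightarrow> complex ^ (5 + 5) \<Rightarrow> (spinor_mat \<Rightarrow> complex) \<Rightarrow> bool" where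
  "wtv H u c \<longleftrightarrow> (\<forall>h\<in>H. h ** gamma u = cmat (c h) (gamma u ** h))"

lemma Spin10_cancel:
  assumes "h \<in> Spin10" shows "A ** h = B ** h \<Longrightarrow> A = B" "h ** A = h ** B \<Longrightarrow> A = B"
proof -
  obtain h' where "h ** h' = mat 1" "h' ** h = mat 1" using Spin10_inverse[OF assms] by blast
  then show "A ** h = B ** h \<Longrightarrow> A = B" "h ** A = h ** B \<Longrightarrow> A = B"
    by (metis matrix_mul_assoc matrix_mul_rid matrix_mul_lid)+
qed

text \<open>Through \<open>gamma\<close> the vector representation sits inside the matrices, where
  the projections \<open>A m\<close> on both sides split \<open>gamma v\<close> into pieces of
  weight \<open>\<theta> h m / \<theta> h n\<close>. Pieces of equal weight are collected, and
  interpolation shows that each collection is again a Clifford vector from \<open>W\<close>.\<close>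

lemma weight_decomposition:
  assumes H: "toral H" and W: "vec.subspace W" "\<And>h v. h \<in> H \<Longrightarrow> v \<in> W \<Longrightarrow> \<exists>w\<in>W. h ** gamma v = gamma w ** h"
    and v: "v \<in> W"
  obtains Y :: "(spinor_mat \<Rightarrow> complex) set" and u where "finite Y" "v = (\<Sum>y\<in>Y. u y)" "\<And>y. y \<in> Y \<Longrightarrow> u y \<in> W \<and> wtv H (u y) y"
proof -
  obtain M :: "(nat \<Rightarrow> int) set" and A \<theta> where M: "finite M" "mat 1 = (\<Sum>m\<in>M. A m)" "\<And>m. m \<in> M \<Longrightarrow> A m \<noteq> 0"
     "\<And>m h. m \<in> M \<Longrightarrow> h \<in> H \<Longrightarrow> h ** A m = cmat (\<theta> h m) (A m) \<and> A m ** h = cmat (\<theta> h m) (A m)"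
    using H unfolding toral_def by blast
  have HS: "H \<subseteq> Spin10" using H unfolding toral_def by blast
  have nz: "\<theta> h m \<noteq> 0" if "m \<in> M" "h \<in> H" for h m
  proof
    assume "\<theta> h m = 0"
    then have "h ** A m = h ** 0" using M(4)[OF that] by simp
    then show False using Spin10_cancel(2) HS that M(3) by blast
  qed
  let ?K = "M \<times> M"
  define z where "z = (\<lambda>(m, n). A m ** gamma v ** A n)"
  define th where "th h = (\<lambda>(m, n). \<theta> h m / \<theta> h n)" for h
  have zs: "gamma v = (\<Sum>k\<in>?K. z k)"
  proof -
    have "gamma v = (\<Sum>m\<in>M. A m) ** gamma v ** (\<Sum>n\<in>M. A n)" unfolding M(2)[symmetric] by simp
    also have "\<dots> = (\<Sum>m\<in>M. \<Sum>n\<in>M. A m ** gamma v ** A n)" by (simp add: mm_sum_left mm_sum_right) (rule sum.swap)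
    finally show ?thesis by (simp add: z_def sum.cartesian_product)
  qed
  have hz: "h ** z k = cmat (th h k) (z k ** h)" if hH: "h \<in> H" and kK: "k \<in> ?K" for h k
  proof -
    obtain m n where k: "k = (m, n)" "m \<in> M" "n \<in> M" using kK by blast
    have "h ** z k = (h ** A m) ** gamma v ** A n" by (simp add: z_def k matrix_mul_assoc)
    moreover have "z k ** h = A m ** gamma v ** (A n ** h)" by (simp add: z_def k matrix_mul_assoc)
    ultimately show ?thesis using M(4)[OF k(2) hH] M(4)[OF k(3) hH] nz[OF k(3) hH] by (simp add: th_def k)
  qed
  let ?J = "gamma ` W"
  have J: "mat.subspace ?J" unfolding mat.subspace_def
  proof (intro conjI ballI allI)
    show "0 \<in> ?J" using vec.subspace_0[OF W(1)] by (intro image_eqI[of _ _ 0]) simp_all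
  next
    fix x y assume "x \<in> ?J" "y \<in> ?J"
    then obtain a b where "x = gamma a" "y = gamma b" "a \<in> W" "b \<in> W" by blast
    then show "x + y \<in> ?J" using vec.subspace_add[OF W(1)] by (intro image_eqI[of _ _ "a + b"]) (simp_all add: gamma_add)
  next
    fix c x assume "x \<in> ?J"
    then obtain a where "x = gamma a" "a \<in> W" by blast
    then show "cmat c x \<in> ?J" using vec.subspace_scale[OF W(1)] by (intro image_eqI[of _ _ "c *s a"]) (simp_all add: gamma_scale)
  qed
  have cls: "(\<Sum>k | k \<in> ?K \<and> (\<forall>h\<in>H. th h k = th h l). z k) \<in> ?J" for l
  proof (rule weight_component_mem[OF mat.vector_space_axioms J])
    show "finite ?K" using M(1) by simp
    show "sum z ?K \<in> ?J" unfolding zs[symmetric] using v by (rule imageI)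
    fix h c assume h: "h \<in> H" and c: "(\<Sum>k\<in>?K. cmat (c k) (z k)) \<in> ?J"
    then obtain a where a: "a \<in> W" "(\<Sum>k\<in>?K. cmat (c k) (z k)) = gamma a" by auto
    obtain b where b: "b \<in> W" "h ** gamma a = gamma b ** h" using W(2)[OF h a(1)] by blast
    have "h ** (\<Sum>k\<in>?K. cmat (c k) (z k)) = (\<Sum>k\<in>?K. cmat (th h k * c k) (z k)) ** h"
      unfolding mm_sum_left mm_sum_right using hz[OF h] by (intro sum.cong) (auto simp: mult.commute)
    then have "gamma b ** h = (\<Sum>k\<in>?K. cmat (th h k * c k) (z k)) ** h" using a b by simp
    then have "gamma b = (\<Sum>k\<in>?K. cmat (th h k * c k) (z k))" using Spin10_cancel(1) HS h by blast
    then show "(\<Sum>k\<in>?K. cmat (th h k * c k) (z k)) \<in> ?J" using b(1) by (metis imageI)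
  qed
  \<comment> \<open>The value 0 outside \<open>H\<close> makes weights that agree on
    \<open>H\<close> equal as functions, so that they can index the components.\<close>
  define ka where "ka k = (\<lambda>h. if h \<in> H then th h k else 0)" for k
  have kcls: "{k \<in> ?K. ka k = ka l} = {k. k \<in> ?K \<and> (\<forall>h\<in>H. th h k = th h l)}" for l
    by (auto simp: ka_def fun_eq_iff)
  have "\<exists>u. u \<in> W \<and> gamma u = (\<Sum>k | k \<in> ?K \<and> ka k = y. z k)" if y: "y \<in> ka ` ?K" for y
  proof -
    obtain l where "y = ka l" using y by blast
    then have "(\<Sum>k | k \<in> ?K \<and> ka k = y. z k) \<in> ?J" using cls[of l] kcls[of l] by simp
    then show ?thesis by auto
  qed
  then have "\<exists>u. \<forall>y\<in>ka ` ?K. u y \<in> W \<and> gamma (u y) = (\<Sum>k | k \<in> ?K \<and> ka k = y. z k)"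
    by (intro bchoice) blast
  then obtain u where "\<forall>y\<in>ka ` ?K. u y \<in> W \<and> gamma (u y) = (\<Sum>k | k \<in> ?K \<and> ka k = y. z k)" ..
  then have u: "\<And>y. y \<in> ka ` ?K \<Longrightarrow> u y \<in> W" "\<And>y. y \<in> ka ` ?K \<Longrightarrow> gamma (u y) = (\<Sum>k | k \<in> ?K \<and> ka k = y. z k)"
    by blast+
  have "gamma v = (\<Sum>y\<in>ka ` ?K. \<Sum>k | k \<in> ?K \<and> ka k = y. z k)"
    unfolding zs by (rule sum.image_gen) (use M(1) in simp)
  also have "\<dots> = gamma (\<Sum>y\<in>ka ` ?K. u y)"
    unfolding gamma_sum by (intro sum.cong refl) (rule u(2)[symmetric])
  finally have "gamma v = gamma (\<Sum>y\<in>ka ` ?K. u y)" .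
  then have v_eq: "v = (\<Sum>y\<in>ka ` ?K. u y)" by simp
  have "wtv H (u y) y" if y: "y \<in> ka ` ?K" for y
    unfolding wtv_def
  proof
    fix h assume h: "h \<in> H"
    show "h ** gamma (u y) = cmat (y h) (gamma (u y) ** h)"
      unfolding u(2)[OF y] mm_sum_left mm_sum_right mat.scale_sum_right
      using hz[OF h] h by (intro sum.cong) (auto simp: ka_def)
  qed
  then show thesis using that[of "ka ` ?K" u] M(1) v_eq u(1) by simp
qed

text \<open>Conjugation by \<open>g\<close> carries the line of \<open>u\<close> to the line of
  \<open>w\<close>. A scalar is allowed since only lines matter, and \<open>g\<close> may also be a
  single reflection.\<close>

definition lmap :: "spinor_mat \<Rightarrow> complex ^ (5 + 5) \<Rightarrow> complex ^ (5 + 5) \<Rightarrow> bool" where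
  "lmap g u w \<longleftrightarrow> (\<exists>c. c \<noteq> 0 \<and> g ** gamma u = cmat c (gamma w ** g))"

lemma lmap_mv: "lmap g u w \<longleftrightarrow> (\<exists>c. c \<noteq> 0 \<and> (\<forall>z. g *v (gamma u *v z) = c *s (gamma w *v (g *v z))))"
  by (simp add: lmap_def matrix_eq matrix_vector_mul_assoc[symmetric])

lemma lmap_comp: "lmap g u v \<Longrightarrow> lmap h v w \<Longrightarrow> lmap (h ** g) u w"
proof -
  assume "lmap g u v" "lmap h v w"
  then obtain c d where "c \<noteq> 0" "\<And>z. g *v (gamma u *v z) = c *s (gamma v *v (g *v z))"
    "d \<noteq> 0" "\<And>z. h *v (gamma v *v z) = d *s (gamma w *v (h *v z))" unfolding lmap_mv by blast
  then show ?thesis unfolding lmap_mv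
    by (intro exI[of _ "c * d"]) (simp add: matrix_vector_mul_assoc[symmetric] vector_scalar_commute)
qed

lemma lmap_scale: "lmap g u w \<Longrightarrow> a \<noteq> 0 \<Longrightarrow> lmap g (a *s u) w"
proof -
  assume "lmap g u w" "a \<noteq> 0"
  then obtain c where "c \<noteq> 0" "\<And>z. g *v (gamma u *v z) = c *s (gamma w *v (g *v z))" unfolding lmap_mv by blast
  then show ?thesis using \<open>a \<noteq> 0\<close> unfolding lmap_mv
    by (intro exI[of _ "a * c"]) (simp add: gamma_linear vector_scalar_commute)
qed

lemma lmap_polar:
  assumes g: "g \<in> Spin10" "g ** gamma v = cmat a (gamma v' ** g)" "g ** gamma w = cmat b (gamma w' ** g)"
  shows "polar v w = a * b * polar v' w'"
proof -
  have 1: "g *v (gamma v *v z) = a *s (gamma v' *v (g *v z))" "g *v (gamma w *v z) = b *s (gamma w' *v (g *v z))" for z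
    using arg_cong[OF g(2), of "\<lambda>A. A *v z"] arg_cong[OF g(3), of "\<lambda>A. A *v z"] by (simp_all add: matrix_vector_mul_assoc[symmetric])
  have "polar v w *s (g *v z) = (a * b * polar v' w') *s (g *v z)" for z
  proof -
    have "polar v w *s (g *v z) = g *v (gamma v *v (gamma w *v z) + gamma w *v (gamma v *v z))"
      by (simp add: gamma_anticomm vector_scalar_commute)
    also have "\<dots> = (a * b) *s (gamma v' *v (gamma w' *v (g *v z)) + gamma w' *v (gamma v' *v (g *v z)))"
      by (simp add: matrix_vector_right_distrib 1 vector_scalar_commute vec.scale_right_distrib mult.commute)
    finally show ?thesis by (simp add: gamma_anticomm)
  qed
  moreover obtain g' where "g ** g' = mat 1" using Spin10_inverse[OF g(1)] by blast
  then have "g *v (g' *v axis {} 1) = axis {} 1" by (simp add: matrix_vector_mul_assoc)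
  ultimately have "polar v w *s axis {} 1 = (a * b * polar v' w') *s (axis {} 1 :: spinor)" by metis
  from arg_cong[OF this, of "\<lambda>z. z $ {}"] show ?thesis by (simp add: axis_component)
qed

lemma wtv_mv:
  assumes "wtv H u c" "h \<in> H" shows "h *v (gamma u *v z) = c h *s (gamma u *v (h *v z))"
proof -
  have "h ** gamma u = cmat (c h) (gamma u ** h)" using assms unfolding wtv_def by blast
  from arg_cong[OF this, of "\<lambda>A. A *v z"] show ?thesis by (simp add: matrix_vector_mul_assoc[symmetric])
qed

lemma wtv_polar:
  assumes "wtv H u c" "wtv H w d" "polar u w \<noteq> 0" "h \<in> H" "H \<subseteq> Spin10"
  shows "c h * d h = 1"
proof -
  have "polar u w = c h * d h * polar u w"
    by (rule lmap_polar[of h]) (use assms in \<open>auto simp: wtv_def\<close>)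
  then show ?thesis using assms(3) by simp
qed

definition Wk :: "5 set \<Rightarrow> (complex ^ (5 + 5)) set" where
  "Wk K = {v. \<forall>i. i \<notin> K \<longrightarrow> v $ Inl i = 0 \<and> v $ Inr i = 0}"

text \<open>Such elements fix the coordinate lines outside \<open>K\<close>, hence preserve the
  orthogonal complement \<open>Wk K\<close>; this is what keeps vectors already split off in
  place.\<close>

definition outside :: "5 set \<Rightarrow> spinor_mat \<Rightarrow> bool" where
  "outside K g \<longleftrightarrow> (\<forall>i. i \<notin> K \<longrightarrow> lmap g (axis (Inl i) 1) (axis (Inl i) 1) \<and> lmap g (axis (Inr i) 1) (axis (Inr i) 1))"

lemma Wk_subspace: "vec.subspace (Wk K)"
  by (auto simp: Wk_def vec.subspace_def)

lemma Wk_axis: "i \<in> K \<Longrightarrow> axis (Inl i) 1 \<in> Wk K" "i \<in> K \<Longrightarrow> axis (Inr i) 1 \<in> Wk K"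
  by (auto simp: Wk_def axis_def)

lemma Wk_axis_dual: "u \<in> Wk K \<Longrightarrow> u $ p \<noteq> 0 \<Longrightarrow> axis (dual_index p) 1 \<in> Wk K"
proof (cases p)
  case (Inl i)
  assume "u \<in> Wk K" "u $ p \<noteq> 0"
  then have "i \<in> K" using Inl unfolding Wk_def by blast
  then show ?thesis using Wk_axis(2) Inl by simp
next
  case (Inr i)
  assume "u \<in> Wk K" "u $ p \<noteq> 0"
  then have "i \<in> K" using Inr unfolding Wk_def by blast
  then show ?thesis using Wk_axis(1) Inr by simp
qed

lemma Wk_polar: "v \<in> Wk K \<longleftrightarrow> (\<forall>i. i \<notin> K \<longrightarrow> polar v (axis (Inl i) 1) = 0 \<and> polar v (axis (Inr i) 1) = 0)"
  by (auto simp: Wk_def polar_axis)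

lemma outside_comp: "outside K g \<Longrightarrow> outside K h \<Longrightarrow> outside K (h ** g)"
  unfolding outside_def using lmap_comp by blast

lemma outside_stable:
  assumes g: "g \<in> Spin10" "outside K g" and v: "v \<in> Wk K"
  shows "\<exists>w\<in>Wk K. g ** gamma v = gamma w ** g"
proof -
  obtain w where w: "g ** gamma v = gamma w ** g" using Spin10_gamma[OF g(1)] by blast
  have "polar w a = 0" if l: "lmap g a a" and a: "polar v a = 0" for a
  proof -
    obtain c where c: "c \<noteq> 0" "g ** gamma a = cmat c (gamma a ** g)" using l unfolding lmap_def by blast
    have "polar v a = 1 * c * polar w a" by (rule lmap_polar[OF g(1) _ c(2)]) (simp add: w)
    then show ?thesis using a c(1) by simp
  qed
  then have "w \<in> Wk K" using v g(2) unfolding Wk_polar outside_def by blast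
  then show ?thesis using w by blast
qed

lemma outside_gamma: "r \<in> Wk K \<Longrightarrow> outside K (gamma r)"
proof -
  assume r: "r \<in> Wk K"
  have "lmap (gamma r) a a" if "polar r a = 0" for a
    unfolding lmap_mv using that by (intro exI[of _ "-1"]) (simp add: gamma_swap[of r a])
  then show ?thesis using r unfolding outside_def Wk_polar by blast
qed

text \<open>The vector \<open>u + (1 / polar u w) w\<close> is a unit vector of the hyperbolic plane
  of \<open>u\<close> and \<open>w\<close>, and its reflection maps the line of \<open>u\<close> to
  that of \<open>w\<close>.\<close>

lemma reflection_lmap:
  assumes uw: "u \<in> Wk K" "w \<in> Wk K" "quad u = 0" "quad w = 0" "polar u w \<noteq> 0"
  obtains r where "quad r = 1" "lmap (gamma r) u w" "outside K (gamma r)"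
proof -
  define r where "r = u + (1 / polar u w) *s w"
  have q: "quad r = 1" using uw by (simp add: r_def quad_add quad_scale polar_simps)
  have "r \<in> Wk K" using uw(1,2) by (simp add: r_def Wk_def)
  then have o: "outside K (gamma r)" by (rule outside_gamma)
  have pr: "polar r u = 1" using uw by (simp add: r_def polar_simps polar_self polar_commute[of w u])
  have "gamma r *v (gamma u *v z) = (1 / polar u w) *s (gamma w *v (gamma r *v z))" for z
  proof -
    have "gamma r *v (gamma u *v (gamma r *v y)) = gamma r *v y - gamma u *v y" for y
      by (simp add: gamma_swap[of r u] pr gamma_sq q)
    from this[of "gamma r *v z"] have "gamma r *v (gamma u *v z) = gamma (r - u) *v (gamma r *v z)"
      by (simp add: gamma_sq q gamma_linear matrix_vector_mult_diff_rdistrib)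
    then show ?thesis by (simp add: r_def gamma_linear)
  qed
  then have "lmap (gamma r) u w" unfolding lmap_mv using uw(5) by (intro exI[of _ "1 / polar u w"]) simp
  then show thesis using that q o by blast
qed

lemma flip_lmap: "p = Inl k \<or> p = Inr k \<Longrightarrow> lmap (flip k) (axis p 1) (axis (dual_index p) 1)"
  unfolding lmap_mv by (intro exI[of _ 1]) (simp add: flip_gamma_axis)

lemma outside_flip: "k \<in> K \<Longrightarrow> outside K (flip k)"
  unfolding flip_def by (rule outside_gamma) (simp add: Wk_def axis_def)

text \<open>An even number of reflections is needed. If one reflection already moves
  \<open>u\<close> to an axis of the pair \<open>k\<close>, a flip is added, so the target may be
  either of the two axes; otherwise an intermediate isotropic vector is used.\<close>

lemma move_vector:
  assumes u: "u \<in> Wk K" "quad u = 0" "u \<noteq> 0" and k: "k \<in> K"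
  obtains g p where "g \<in> Spin10" "p = Inl k \<or> p = Inr k" "lmap g u (axis p 1)" "outside K g"
proof -
  note res = that
  have one: thesis if p: "p = Inl k \<or> p = Inr k" and ne: "polar u (axis p 1) \<noteq> 0" for p
  proof -
    have "axis p 1 \<in> Wk K" using p k Wk_axis by blast
    then obtain r where r: "quad r = 1" "lmap (gamma r) u (axis p 1)" "outside K (gamma r)"
      using reflection_lmap[OF u(1) _ u(2) quad_axis ne] by blast
    show thesis
    proof (rule res[of "flip k ** gamma r" "dual_index p"])
      show "flip k ** gamma r \<in> Spin10" unfolding flip_def by (rule Spin10_pair[OF quad_flip r(1)])
      show "dual_index p = Inl k \<or> dual_index p = Inr k" using p by auto
      show "lmap (flip k ** gamma r) u (axis (dual_index p) 1)" by (rule lmap_comp[OF r(2) flip_lmap[OF p]])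
      show "outside K (flip k ** gamma r)" by (rule outside_comp[OF r(3) outside_flip[OF k]])
    qed
  qed
  show thesis
  proof (cases "u $ Inl k = 0 \<and> u $ Inr k = 0")
    case False
    then show thesis using one[of "Inl k"] one[of "Inr k"] by (auto simp: polar_axis)
  next
    case True
    obtain q where q: "u $ q \<noteq> 0" using u(3) by (auto simp: vec_eq_iff)
    \<comment> \<open>An isotropic vector that is orthogonal neither to \<open>u\<close>, through
      the second summand, nor to \<open>axis (Inl k) 1\<close>, through the first.\<close>
    define z where "z = axis (Inr k) 1 + (axis (dual_index q) 1 :: complex ^ (5 + 5))"
    have qk: "q \<noteq> Inl k" "q \<noteq> Inr k" using q True by auto
    have "axis (dual_index q) 1 \<in> Wk K" by (rule Wk_axis_dual[OF u(1) q])
    then have zW: "z \<in> Wk K" using Wk_axis(2)[OF k] by (auto simp: z_def Wk_def)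
    have dk: "dual_index q \<noteq> Inl k" "dual_index q \<noteq> Inr k" using qk by (cases q; simp)+
    have qz: "quad z = 0" using dk by (simp add: z_def quad_add polar_axis_axis)
    have uz: "polar u z \<noteq> 0" using q True by (simp add: z_def polar_simps polar_axis)
    have zk: "polar z (axis (Inl k) 1) \<noteq> 0"
      unfolding polar_axis using dk by (simp add: z_def axis_def)
    obtain r where r: "quad r = 1" "lmap (gamma r) u z" "outside K (gamma r)"
      using reflection_lmap[OF u(1) zW u(2) qz uz] by blast
    obtain t where t: "quad t = 1" "lmap (gamma t) z (axis (Inl k) 1)" "outside K (gamma t)"
      using reflection_lmap[OF zW Wk_axis(1)[OF k] qz quad_axis zk] by blast
    show thesis
      by (rule res[of "gamma t ** gamma r" "Inl k"])
         (auto intro: Spin10_pair r t lmap_comp[OF r(2) t(2)] outside_comp[OF r(3) t(3)])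
  qed
qed

text \<open>The Eichler transformation attached to the isotropic axis and the vector
  \<open>a\<close>. It fixes the axis and everything orthogonal to the axis and \<open>a\<close>;
  \<open>y\<close> is the general isotropic vector that pairs to 1 with the axis.\<close>

lemma unipotent_lmap:
  assumes a: "polar a (axis p 1) = 0" "polar a (axis (dual_index p) 1) = 0"
  defines "g \<equiv> mat 1 + gamma (- a) ** gamma (axis p 1)" and "y \<equiv> axis (dual_index p) 1 + a + (- quad a) *s axis p 1"
  shows "g \<in> Spin10" "lmap g y (axis (dual_index p) 1)" "lmap g (axis p 1) (axis p 1)"
    "polar a b = 0 \<Longrightarrow> polar (axis p 1) b = 0 \<Longrightarrow> lmap g b b"
proof -
  let ?p = "axis p 1 :: complex ^ (5 + 5)" and ?d = "axis (dual_index p) 1 :: complex ^ (5 + 5)"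
  show "g \<in> Spin10" unfolding g_def by (rule unipotent_Spin10) (simp add: polar_simps a)
  have gz: "g *v z = z - gamma a *v (gamma ?p *v z)" for z
    by (simp add: g_def matrix_vector_mult_add_rdistrib matrix_vector_mul_assoc[symmetric] gamma_linear mv_minus)
  have pd: "polar ?p ?d = 1" by (simp add: polar_axis_axis)
  have pp: "gamma ?p *v (gamma ?p *v z) = 0" for z by (simp add: gamma_sq)
  have pa: "gamma ?p *v (gamma a *v z) = - (gamma a *v (gamma ?p *v z))" for z
    by (subst gamma_swap) (simp add: polar_commute[of ?p] a)
  have da: "gamma ?d *v (gamma a *v z) = - (gamma a *v (gamma ?d *v z))" for z
    by (subst gamma_swap) (simp add: polar_commute[of ?d] a)
  have pd': "gamma ?p *v (gamma ?d *v z) = z - gamma ?d *v (gamma ?p *v z)" for z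
    by (subst gamma_swap) (simp add: pd)
  have "g *v (gamma y *v z) = gamma ?d *v (g *v z)" for z
    unfolding gz y_def
    by (simp add: gamma_linear matrix_vector_mult_add_rdistrib matrix_vector_mult_diff_rdistrib matrix_vector_right_distrib
        matrix_vector_mult_diff_distrib vector_scalar_commute pp pa da pd' mv_minus gamma_sq)
  then show "lmap g y ?d" unfolding lmap_mv by (intro exI[of _ 1]) simp
  have "g *v (gamma ?p *v z) = gamma ?p *v (g *v z)" for z
    unfolding gz by (simp add: matrix_vector_mult_diff_distrib pp pa mv_minus)
  then show "lmap g ?p ?p" unfolding lmap_mv by (intro exI[of _ 1]) simp
  assume b: "polar a b = 0" "polar ?p b = 0"
  have "g *v (gamma b *v z) = gamma b *v (g *v z)" for z
    unfolding gz by (simp add: matrix_vector_mult_diff_distrib gamma_swap[of ?p b] gamma_swap[of a b] b mv_minus)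
  then show "lmap g b b" unfolding lmap_mv by (intro exI[of _ 1]) simp
qed

text \<open>First \<open>u\<close> is moved to an axis. The image of \<open>w\<close>, scaled to
  pair to 1 with that axis, is isotropic and so has the form required by
  \<open>unipotent_lmap\<close>, which moves it to the dual axis without disturbing the first
  one.\<close>

lemma move_pair:
  assumes uw: "u \<in> Wk K" "w \<in> Wk K" "quad u = 0" "quad w = 0" "polar u w \<noteq> 0" and k: "k \<in> K"
  obtains g p where "g \<in> Spin10" "p = Inl k \<or> p = Inr k" "lmap g u (axis p 1)" "lmap g w (axis (dual_index p) 1)" "outside K g"
proof -
  have "u \<noteq> 0" using uw(5) by auto
  then obtain g p where g: "g \<in> Spin10" "p = Inl k \<or> p = Inr k" "lmap g u (axis p 1)" "outside K g"
    using move_vector[OF uw(1,3) _ k] by blast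
  obtain c where c: "c \<noteq> 0" "g ** gamma u = cmat c (gamma (axis p 1) ** g)" using g(3) unfolding lmap_def by blast
  obtain w1 where w1: "w1 \<in> Wk K" "g ** gamma w = gamma w1 ** g" using outside_stable[OF g(1,4) uw(2)] by blast
  have w1': "g ** gamma w = cmat 1 (gamma w1 ** g)" using w1 by simp
  have "polar u w = c * 1 * polar (axis p 1) w1" by (rule lmap_polar[OF g(1) c(2) w1'])
  then have P0: "polar (axis p 1) w1 \<noteq> 0" using uw(5) by auto
  have "polar w w = 1 * 1 * polar w1 w1" by (rule lmap_polar[OF g(1) w1' w1'])
  then have q1: "quad w1 = 0" using uw(4) by (simp add: polar_self)
  let ?p = "axis p 1 :: complex ^ (5 + 5)" and ?d = "axis (dual_index p) 1 :: complex ^ (5 + 5)"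
  define P where "P = polar ?p w1"
  define y where "y = (1 / P) *s w1"
  \<comment> \<open>The component of \<open>y\<close> orthogonal to the hyperbolic pair; isotropy of
    \<open>y\<close> then makes its coefficient at \<open>?p\<close> equal to
    \<open>- quad a\<close>.\<close>
  define a where "a = y - ?d - polar ?d y *s ?p"
  have dp: "polar ?d ?p = 1" "polar ?p ?d = 1" "polar ?p ?p = 0" "polar ?d ?d = 0" by (simp_all add: polar_axis_axis dual_index_neq[symmetric])
  have py: "polar ?p y = 1" using P0 by (simp add: y_def polar_simps P_def)
  have ap: "polar a ?p = 0" "polar a ?d = 0"
    using py by (simp_all add: a_def polar_simps dp polar_commute[of y])
  have y0: "y = ?d + a + polar ?d y *s ?p" by (simp add: a_def)
  have "quad y = 0" by (simp add: y_def quad_scale q1)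
  moreover have "quad y = quad a + polar ?d y"
    using ap by (subst y0) (simp add: quad_add quad_scale polar_simps dp polar_commute[of ?d a])
  ultimately have y: "y = ?d + a + (- quad a) *s ?p" using y0 by (simp add: add_eq_0_iff2)
  have aK: "a \<in> Wk K"
  proof -
    have "?p \<in> Wk K" "?d \<in> Wk K" using g(2) Wk_axis k by auto
    then show ?thesis using w1(1) by (simp add: a_def y_def Wk_def)
  qed
  define h where "h = mat 1 + gamma (- a) ** gamma ?p"
  note un = unipotent_lmap[OF ap, folded h_def y]
  have oh: "outside K h" unfolding outside_def
  proof (intro allI impI)
    fix i assume i: "i \<notin> K"
    have pK: "?p \<in> Wk K" using g(2) Wk_axis k by auto
    show "lmap h (axis (Inl i) 1) (axis (Inl i) 1) \<and> lmap h (axis (Inr i) 1) (axis (Inr i) 1)"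
      using i aK pK unfolding Wk_polar by (intro conjI un(4)) blast+
  qed
  have "lmap g w w1" unfolding lmap_def using w1' by (intro exI[of _ 1]) simp
  moreover have "w1 = P *s y" using P0 by (simp add: y_def P_def)
  then have "lmap h w1 ?d" using lmap_scale[OF un(2), of P] P0 by (simp add: P_def)
  ultimately have "lmap (h ** g) w ?d" by (rule lmap_comp)
  then show thesis
    by (intro that[of "h ** g" p] Spin10_mult un(1) g(1,2) lmap_comp[OF g(3) un(3)] outside_comp[OF g(4) oh])
qed

lemma wtv_lmap:
  assumes "wtv H u c" "lmap g u w" "g ** g' = mat 1" "g' ** g = mat 1"
  shows "wtv ((\<lambda>h. g ** h ** g') ` H) w (\<lambda>k. c (g' ** k ** g))"
  unfolding wtv_def
proof
  fix k assume "k \<in> (\<lambda>h. g ** h ** g') ` H"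
  then obtain h where h: "h \<in> H" "k = g ** h ** g'" by blast
  obtain d where d: "d \<noteq> 0" "g ** gamma u = cmat d (gamma w ** g)" using assms(2) unfolding lmap_def by blast
  have gg: "g *v (g' *v z) = z" "g' *v (g *v z) = z" for z by (simp_all add: matrix_vector_mul_assoc assms)
  have dz: "g *v (gamma u *v z) = d *s (gamma w *v (g *v z))" for z
    using arg_cong[OF d(2), of "\<lambda>A. A *v z"] by (simp add: matrix_vector_mul_assoc[symmetric])
  have hz: "h *v (gamma u *v z) = c h *s (gamma u *v (h *v z))" for z
    by (rule wtv_mv[OF assms(1) h(1)])
  have "g' ** (g ** h ** g') ** g = h"
  proof -
    have "(g' ** (g ** h ** g') ** g) *v z = h *v z" for z by (simp add: matrix_vector_mul_assoc[symmetric] gg)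
    then show ?thesis by (simp add: matrix_eq)
  qed
  then have ck: "c (g' ** k ** g) = c h" using h by simp
  have wz: "gamma w *v z = (1 / d) *s (g *v (gamma u *v (g' *v z)))" for z
    using d(1) by (simp add: dz gg)
  have "k *v (gamma w *v z) = c h *s (gamma w *v (k *v z))" for z
    unfolding wz h(2) by (simp add: matrix_vector_mul_assoc[symmetric] gg vector_scalar_commute hz mult.commute)
  then show "k ** gamma w = cmat (c (g' ** k ** g)) (gamma w ** k)"
    unfolding ck by (simp add: matrix_eq matrix_vector_mul_assoc[symmetric])
qed

lemma wtv_nonzero: "wtv H u c \<Longrightarrow> u \<noteq> 0 \<Longrightarrow> h \<in> H \<Longrightarrow> H \<subseteq> Spin10 \<Longrightarrow> c h \<noteq> 0"
proof
  assume a: "wtv H u c" "u \<noteq> 0" "h \<in> H" "H \<subseteq> Spin10" "c h = 0"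
  then have "h ** gamma u = h ** 0" unfolding wtv_def by simp
  then have "gamma u = gamma 0" using Spin10_cancel(2)[of h] a by auto
  then show False using a(2) by (simp del: gamma_zero)
qed

lemma wtv_lmap_self: "wtv H u c \<Longrightarrow> u \<noteq> 0 \<Longrightarrow> h \<in> H \<Longrightarrow> H \<subseteq> Spin10 \<Longrightarrow> lmap h u u"
  using wtv_nonzero unfolding lmap_def wtv_def by blast

text \<open>Invariance of the quadratic form gives \<open>c g = 1\<close> or \<open>c g = -1\<close>
  for every \<open>g\<close> in \<open>H\<close>. As each \<open>h\<close> is a square in
  \<open>H\<close>, its character value is the square of such a sign.\<close>

lemma wtv_anisotropic:
  assumes H: "toral H" and u: "wtv H u c" "quad u \<noteq> 0" and h: "h \<in> H"
  shows "c h = 1"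
proof -
  have HS: "H \<subseteq> Spin10" using H unfolding toral_def by blast
  obtain g where g: "g \<in> H" "h = g ** g" using H h unfolding toral_def by blast
  have "u \<noteq> 0" using u(2) by (auto simp: quad_def)
  have "c g * c g = 1" using wtv_polar[OF u(1) u(1) _ g(1) HS] u(2) by (simp add: polar_self)
  moreover have "h ** gamma u = cmat (c g * c g) (gamma u ** h)"
  proof -
    have gz: "g *v (gamma u *v z) = c g *s (gamma u *v (g *v z))" for z
      by (rule wtv_mv[OF u(1) g(1)])
    have "(h ** gamma u) *v z = cmat (c g * c g) (gamma u ** h) *v z" for z
      by (simp add: g(2) matrix_vector_mul_assoc[symmetric] gz vector_scalar_commute)
    then show ?thesis by (simp add: matrix_eq)
  qed
  moreover have "h ** gamma u = cmat (c h) (gamma u ** h)" using u(1) h unfolding wtv_def by blast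
  ultimately have "cmat (c h - 1) (gamma u) ** h = 0 ** h" by (simp add: mat.scale_left_diff_distrib matrix_diff_distrib)
  then have "cmat (c h - 1) (gamma u) = 0" using Spin10_cancel(1) HS h by blast
  then have "gamma ((c h - 1) *s u) = gamma 0" unfolding gamma_scale gamma_zero .
  then have "(c h - 1) *s u = 0" by (simp only: gamma_eq_iff)
  then show ?thesis using \<open>u \<noteq> 0\<close> by (simp only: vec.scale_eq_0_iff) simp
qed

lemma wtv_add: "wtv H u c \<Longrightarrow> wtv H w d \<Longrightarrow> (\<And>h. h \<in> H \<Longrightarrow> c h = d h) \<Longrightarrow> wtv H (u + a *s w) c"
  unfolding wtv_def by (simp add: gamma_linear matrix_add_ldistrib matrix_add_rdistrib' mat.scale_right_distrib mult.commute)

text \<open>If every nonzero weight component of an isotropic axis vector is anisotropic, then all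
  these components have trivial weight, so the axis vector is itself a weight vector.\<close>

lemma isotropic_weight:
  assumes H: "toral H" "\<And>h. h \<in> H \<Longrightarrow> outside K h" and k: "k \<in> K"
  obtains u c where "u \<in> Wk K" "u \<noteq> 0" "quad u = 0" "wtv H u c"
proof -
  have HS: "H \<subseteq> Spin10" using H(1) unfolding toral_def by blast
  have st: "\<exists>w\<in>Wk K. h ** gamma v = gamma w ** h" if "h \<in> H" "v \<in> Wk K" for h v
    using outside_stable[OF _ H(2)] that HS by blast
  let ?e = "axis (Inl k) 1 :: complex ^ (5 + 5)"
  obtain Y u where Y: "finite Y" "?e = (\<Sum>y\<in>Y. u y)" "\<And>y. y \<in> Y \<Longrightarrow> u y \<in> Wk K \<and> wtv H (u y) y"
    using weight_decomposition[OF H(1) Wk_subspace st Wk_axis(1)[OF k]] by metis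
  show thesis
  proof (cases "\<exists>y\<in>Y. u y \<noteq> 0 \<and> quad (u y) = 0")
    case True then show thesis using Y(3) that by blast
  next
    case False
    have "h ** gamma (u y) = gamma (u y) ** h" if "y \<in> Y" "h \<in> H" for y h
    proof (cases "u y = 0")
      case False
      then have "y h = 1" using wtv_anisotropic[OF H(1)] Y(3)[OF that(1)] that \<open>\<not> (\<exists>y\<in>Y. u y \<noteq> 0 \<and> quad (u y) = 0)\<close> by blast
      then show ?thesis using Y(3)[OF that(1)] that(2) unfolding wtv_def by simp
    qed simp
    then have "wtv H ?e (\<lambda>_. 1)"
      unfolding wtv_def Y(2) gamma_sum mm_sum_left mm_sum_right by (simp cong: sum.cong)
    then show thesis using that[of ?e] Wk_axis(1)[OF k] by simp
  qed
qed

text \<open>Some weight component of an axis vector is not orthogonal to the isotropic weight vector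
  \<open>u\<close>; it is then made isotropic by a multiple of \<open>u\<close>.\<close>

lemma hyperbolic_weight_pair:
  assumes H: "toral H" "\<And>h. h \<in> H \<Longrightarrow> outside K h" and k: "k \<in> K"
  obtains u w c d where "u \<in> Wk K" "w \<in> Wk K" "quad u = 0" "quad w = 0" "polar u w \<noteq> 0" "wtv H u c" "wtv H w d"
proof -
  have HS: "H \<subseteq> Spin10" using H(1) unfolding toral_def by blast
  have st: "\<exists>w\<in>Wk K. h ** gamma v = gamma w ** h" if "h \<in> H" "v \<in> Wk K" for h v
    using outside_stable[OF _ H(2)] that HS by blast
  obtain u c where u: "u \<in> Wk K" "u \<noteq> 0" "quad u = 0" "wtv H u c" using isotropic_weight[OF H k] by blast
  obtain p where p: "u $ p \<noteq> 0" using u(2) by (auto simp: vec_eq_iff)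
  let ?e = "axis (dual_index p) 1 :: complex ^ (5 + 5)"
  have eK: "?e \<in> Wk K" by (rule Wk_axis_dual[OF u(1) p])
  obtain Y v where Y: "finite Y" "?e = (\<Sum>y\<in>Y. v y)" "\<And>y. y \<in> Y \<Longrightarrow> v y \<in> Wk K \<and> wtv H (v y) y"
    using weight_decomposition[OF H(1) Wk_subspace st eK] by metis
  have "polar u (\<Sum>y\<in>S. v y) = (\<Sum>y\<in>S. polar u (v y))" for S
    by (induction S rule: infinite_finite_induct) (simp_all add: polar_simps)
  then have "(\<Sum>y\<in>Y. polar u (v y)) \<noteq> 0" using p Y(2) polar_axis[of u "dual_index p"] by simp
  then obtain y where y: "y \<in> Y" "polar u (v y) \<noteq> 0" by (metis sum.neutral)
  \<comment> \<open>The correction keeps the pairing with \<open>u\<close>. It is nonzero only if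
    \<open>v y\<close> is anisotropic; then the characters of both \<open>v y\<close> and
    \<open>u\<close> are trivial and the sum is still a weight vector.\<close>
  let ?w = "v y + (- quad (v y) / polar u (v y)) *s u"
  have "quad ?w = 0" using y u(3) by (simp add: quad_diff quad_scale polar_simps polar_commute[of "v y" u])
  moreover have "polar u ?w \<noteq> 0" using y u(3) by (simp add: polar_simps polar_self)
  moreover have "?w \<in> Wk K" using Y(3)[OF y(1)] u(1) by (simp add: Wk_def)
  moreover have "wtv H ?w y"
  proof (cases "quad (v y) = 0")
    case True then show ?thesis using Y(3)[OF y(1)] by simp
  next
    case False
    show ?thesis
    proof (rule wtv_add)
      show "wtv H (v y) y" "wtv H u c" using Y(3)[OF y(1)] u(4) by auto
      fix h assume h: "h \<in> H"
      have "y h = 1" using wtv_anisotropic[OF H(1) _ False h] Y(3)[OF y(1)] by blast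
      moreover have "c h * y h = 1" using wtv_polar[OF u(4) _ y(2) h HS] Y(3)[OF y(1)] by blast
      ultimately show "y h = c h" by simp
    qed
  qed
  ultimately show thesis using that u by blast
qed

text \<open>The spinor \<open>[{}]\<close> is characterised up to a scalar by being killed by all
  \<open>contr i\<close>, so its line is preserved. Every other basis spinor arises from it by the
  operators \<open>wedge i\<close>, each of which only contributes a scalar.\<close>

lemma axis_weights_Diag:
  assumes H: "H \<subseteq> Spin10" and w: "\<And>p. \<exists>c. wtv H (axis p 1) c"
  shows "H \<subseteq> Diag"
proof
  fix h assume h: "h \<in> H"
  obtain c where c: "\<And>p. wtv H (axis p 1) (c p)" using w by metis
  have hz: "h *v (gamma (axis p 1) *v z) = c p h *s (gamma (axis p 1) *v (h *v z))" for p z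
    by (rule wtv_mv[OF c h])
  have cn: "c p h \<noteq> 0" for p
    by (rule wtv_nonzero[OF c _ h H]) simp
  define y where "y = h *v axis {} 1"
  have c0: "contr i *v y = 0" for i
  proof -
    have "contr i *v axis {} 1 = 0" by (simp add: contr_mv vec_eq_iff axis_component)
    then have "c (Inl i) h *s (contr i *v y) = 0" using hz[of "Inl i" "axis {} 1"] by (simp add: gamma_axis y_def)
    then show ?thesis using cn by simp
  qed
  have y: "y $ I = 0" if "i \<in> I" for i I
  proof -
    have "(contr i *v y) $ (I - {i}) = 0" using c0[of i] by simp
    then show ?thesis using that by (simp add: contr_mv insert_absorb)
  qed
  define l where "l = y $ {}"
  have "y $ I = (l *s axis {} 1) $ I" for I
    using y by (cases "I = {}") (auto simp: l_def axis_component)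
  then have yl: "h *v axis {} 1 = l *s axis {} 1" by (simp add: vec_eq_iff y_def[symmetric])
  have hI: "h *v axis I 1 = (l * (\<Prod>i\<in>I. c (Inr i) h)) *s axis I 1" for I
    using finite[of I]
  proof (induction I rule: finite_induct)
    case empty then show ?case using yl by simp
  next
    case (insert i I)
    have e: "axis (insert i I) 1 = sg i (insert i I) *s (wedge i *v axis I 1)"
    proof -
      have "J - {i} = I \<longleftrightarrow> J = insert i I" if "i \<in> J" for J using that insert.hyps by auto
      then have "axis (insert i I) 1 $ J = (sg i (insert i I) *s (wedge i *v axis I 1)) $ J" for J
        by (cases "i \<in> J") (auto simp: wedge_mv axis_component)
      then show ?thesis by (simp only: vec_eq_iff) blast
    qed
    show ?case unfolding e using insert hz[of "Inr i" "axis I 1"]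
      by (simp add: vector_scalar_commute gamma_axis mult_ac)
  qed
  have "h = dg l (\<lambda>i. c (Inr i) h)"
  proof -
    have "h $ I $ J = dg l (\<lambda>i. c (Inr i) h) $ I $ J" for I J
      unfolding mv_axis[symmetric] hI dg_axis ..
    then show ?thesis by (simp add: vec_eq_iff)
  qed
  moreover have "l \<noteq> 0"
  proof
    assume "l = 0"
    then have "h *v axis {} 1 = h *v 0" using yl by simp
    moreover obtain h' where "h' ** h = mat 1" using Spin10_inverse[of h] H h by blast
    ultimately have "axis {} 1 = (0 :: spinor)" by (metis matrix_vector_mul_assoc matrix_vector_mul_lid)
    then show False by simp
  qed
  ultimately show "h \<in> Diag" unfolding Diag_def using cn by blast
qed

text \<open>In the induction, \<open>K\<close> is the set of indices whose standard hyperbolic pair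
  does not yet consist of weight vectors. The conjugating elements fix the lines of the pairs
  outside \<open>K\<close>, so these remain weight vectors.\<close>

theorem toral_diagonal:
  assumes "toral H"
  obtains g g' where "g \<in> Spin10" "g' \<in> Spin10" "g ** g' = mat 1" "g' ** g = mat 1" "(\<lambda>h. g ** h ** g') ` H \<subseteq> Diag"
proof -
  have "\<exists>g\<in>Spin10. \<exists>g'\<in>Spin10. g ** g' = mat 1 \<and> g' ** g = mat 1 \<and> (\<lambda>h. g ** h ** g') ` H \<subseteq> Diag"
    if "toral H" "\<And>i. i \<notin> K \<Longrightarrow> (\<exists>c. wtv H (axis (Inl i) 1) c) \<and> (\<exists>c. wtv H (axis (Inr i) 1) c)" for H K
    using finite[of K] that
  proof (induction K arbitrary: H rule: finite_induct)
    case empty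
    have "H \<subseteq> Diag"
    proof (rule axis_weights_Diag)
      show "H \<subseteq> Spin10" using empty(1) unfolding toral_def by blast
      show "\<exists>c. wtv H (axis p 1) c" for p using empty(2) by (cases p) auto
    qed
    then show ?case by (intro bexI[of _ "mat 1"]) auto
  next
    case (insert k K)
    let ?K = "insert k K"
    have HS: "H \<subseteq> Spin10" using insert.prems(1) unfolding toral_def by blast
    have out: "outside ?K h" if "h \<in> H" for h
      unfolding outside_def using insert.prems(2) wtv_lmap_self[OF _ _ that HS] by (metis axis_eq_0_iff zero_neq_one)
    obtain u w c d where uw: "u \<in> Wk ?K" "w \<in> Wk ?K" "quad u = 0" "quad w = 0" "polar u w \<noteq> 0" "wtv H u c" "wtv H w d"
      using hyperbolic_weight_pair[OF insert.prems(1) out insertI1] by blast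
    obtain g p where g: "g \<in> Spin10" "p = Inl k \<or> p = Inr k" "lmap g u (axis p 1)" "lmap g w (axis (dual_index p) 1)" "outside ?K g"
      using move_pair[OF uw(1-5) insertI1] by blast
    obtain g' where g': "g' \<in> Spin10" "g ** g' = mat 1" "g' ** g = mat 1" using Spin10_inverse[OF g(1)] by blast
    let ?H = "(\<lambda>h. g ** h ** g') ` H"
    have "(\<exists>c. wtv ?H (axis (Inl i) 1) c) \<and> (\<exists>c. wtv ?H (axis (Inr i) 1) c)" if i: "i \<notin> K" for i
    proof (cases "i = k")
      case True
      have "\<exists>c. wtv ?H (axis p 1) c" "\<exists>c. wtv ?H (axis (dual_index p) 1) c"
        using wtv_lmap[OF uw(6) g(3) g'(2,3)] wtv_lmap[OF uw(7) g(4) g'(2,3)] by blast+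
      then show ?thesis using g(2) True by auto
    next
      case False
      then have "i \<notin> ?K" using i by simp
      then show ?thesis using insert.prems(2)[of i] g(5) wtv_lmap[OF _ _ g'(2,3)] unfolding outside_def by meson
    qed
    then obtain h h' where h: "h \<in> Spin10" "h' \<in> Spin10" "h ** h' = mat 1" "h' ** h = mat 1" "(\<lambda>k. h ** k ** h') ` ?H \<subseteq> Diag"
      using insert.IH[OF toral_conj[OF insert.prems(1) g(1) g'(1,2,3)]] by blast
    have "h ** g ** (g' ** h') = h ** (g ** g') ** h'" "g' ** h' ** (h ** g) = g' ** (h' ** h) ** g"
      by (simp_all only: matrix_mul_assoc)
    then have "h ** g ** (g' ** h') = mat 1" "g' ** h' ** (h ** g) = mat 1" using h g' by simp_all
    moreover have "h ** g ** k ** (g' ** h') = h ** (g ** k ** g') ** h'" for k by (simp only: matrix_mul_assoc)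
    then have "(\<lambda>k. h ** g ** k ** (g' ** h')) ` H \<subseteq> Diag" using h(5) by (simp add: image_image)
    ultimately show ?case using g g' h by (intro bexI[of _ "h ** g"] bexI[of _ "g' ** h'"] conjI Spin10_mult)
  qed
  from this[OF assms, of UNIV] show thesis using that by blast
qed

subsection \<open>Laurent polynomials and conjugation\<close>

lemma laurent_iff: "laurent_on_torus r f \<longleftrightarrow> (\<exists>M a. finite M \<and> (\<forall>s\<in>torus_points r. f s = (\<Sum>m\<in>M. a m * tmon r s m)))"
  by (simp add: laurent_on_torus_def tmon_def)

lemma laurent_add:
  assumes "laurent_on_torus r f" "laurent_on_torus r g" shows "laurent_on_torus r (\<lambda>s. f s + g s)"
proof -
  obtain M a N b where h: "finite M" "\<And>s. s \<in> torus_points r \<Longrightarrow> f s = (\<Sum>m\<in>M. a m * tmon r s m)"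
    "finite N" "\<And>s. s \<in> torus_points r \<Longrightarrow> g s = (\<Sum>m\<in>N. b m * tmon r s m)"
    using assms unfolding laurent_iff by metis
  define A where "A m = (if m \<in> M then a m else 0)" for m
  define B where "B m = (if m \<in> N then b m else 0)" for m
  have "f s + g s = (\<Sum>m\<in>M \<union> N. (A m + B m) * tmon r s m)" if "s \<in> torus_points r" for s
  proof -
    have "(\<Sum>m\<in>M. a m * tmon r s m) = (\<Sum>m\<in>M \<union> N. A m * tmon r s m)"
      using h(1,3) by (intro sum.mono_neutral_cong_left) (auto simp: A_def)
    moreover have "(\<Sum>m\<in>N. b m * tmon r s m) = (\<Sum>m\<in>M \<union> N. B m * tmon r s m)"
      using h(1,3) by (intro sum.mono_neutral_cong_left) (auto simp: B_def)
    ultimately show ?thesis using h(2,4)[OF that] by (simp add: distrib_right sum.distrib)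
  qed
  then show ?thesis unfolding laurent_iff using h(1,3) by (intro exI[of _ "M \<union> N"] exI[of _ "\<lambda>m. A m + B m"]) simp
qed

lemma laurent_scale:
  assumes "laurent_on_torus r f" shows "laurent_on_torus r (\<lambda>s. k * f s)"
proof -
  obtain M a where h: "finite M" "\<And>s. s \<in> torus_points r \<Longrightarrow> f s = (\<Sum>m\<in>M. a m * tmon r s m)"
    using assms unfolding laurent_iff by metis
  then show ?thesis unfolding laurent_iff
    by (intro exI[of _ M] exI[of _ "\<lambda>m. k * a m"]) (simp add: sum_distrib_left mult.assoc)
qed

lemma laurent_monomial: "laurent_on_torus r (\<lambda>s. tmon r s m)"
  unfolding laurent_iff by (intro exI[of _ "{m}"] exI[of _ "\<lambda>_. 1"]) simp

lemma laurent_sum: "finite S \<Longrightarrow> (\<And>i. i \<in> S \<Longrightarrow> laurent_on_torus r (f i)) \<Longrightarrow> laurent_on_torus r (\<lambda>s. \<Sum>i\<in>S. f i s)"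
proof (induction S rule: finite_induct)
  case empty
  show ?case using laurent_scale[OF laurent_monomial, of r 0 "\<lambda>_. 0"] by simp
qed (simp add: laurent_add)

definition cj :: "spinor_mat \<Rightarrow> spinor_mat \<Rightarrow> spinor_mat \<times> complex \<Rightarrow> spinor_mat \<times> complex" where
  "cj g g' u = (g ** fst u ** g', snd u)"

lemma cj_simps [simp]: "fst (cj g g' u) = g ** fst u ** g'" "snd (cj g g' u) = snd u"
  by (simp_all add: cj_def)

lemma cj_cj: "g' ** g = mat 1 \<Longrightarrow> cj g' g (cj g g' u) = u"
proof -
  assume g: "g' ** g = mat 1"
  have "g' ** (g ** fst u ** g') ** g = (g' ** g) ** fst u ** (g' ** g)" by (simp only: matrix_mul_assoc)
  then show ?thesis by (simp add: prod_eq_iff g)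
qed

lemma cj_mult: "g' ** g = mat 1 \<Longrightarrow> cj g g' (G0_mult a b) = G0_mult (cj g g' a) (cj g g' b)"
  by (simp add: prod_eq_iff fst_G0_mult snd_G0_mult conj_mult)

lemma algebraic_torus_conj:
  assumes H: "algebraic_torus H" and g: "g ** g' = mat 1" "g' ** g = mat 1"
  shows "algebraic_torus (cj g g' ` H)"
proof -
  obtain r \<rho> where rho: "bij_betw \<rho> (torus_points r) H"
    "\<And>s t. s \<in> torus_points r \<Longrightarrow> t \<in> torus_points r \<Longrightarrow> \<rho> (\<lambda>i. s i * t i) = G0_mult (\<rho> s) (\<rho> t)"
    "\<rho> (\<lambda>i. 1) = (mat 1, 1)" "\<And>I J. laurent_on_torus r (\<lambda>s. fst (\<rho> s) $ I $ J)" "laurent_on_torus r (\<lambda>s. snd (\<rho> s))"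
    using H unfolding algebraic_torus_def by blast
  show ?thesis unfolding algebraic_torus_def
  proof (intro exI[of _ r] exI[of _ "\<lambda>s. cj g g' (\<rho> s)"] conjI ballI allI)
    have "inj_on (cj g g') H" by (rule inj_on_inverseI[of _ "cj g' g"]) (simp add: cj_cj g(2))
    then show "bij_betw (\<lambda>s. cj g g' (\<rho> s)) (torus_points r) (cj g g' ` H)"
      using bij_betw_trans[OF rho(1) bij_betw_imageI[OF _ refl]] by (simp add: comp_def)
    show "cj g g' (\<rho> (\<lambda>i. s i * t i)) = G0_mult (cj g g' (\<rho> s)) (cj g g' (\<rho> t))"
      if "s \<in> torus_points r" "t \<in> torus_points r" for s t
      by (simp add: rho(2)[OF that] cj_mult g(2))
    show "cj g g' (\<rho> (\<lambda>i. 1)) = (mat 1, 1)" by (simp add: rho(3) prod_eq_iff g(1))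
    show "laurent_on_torus r (\<lambda>s. snd (cj g g' (\<rho> s)))" using rho(5) by simp
    fix I J
    have "(\<lambda>s. fst (cj g g' (\<rho> s)) $ I $ J) = (\<lambda>s. \<Sum>L\<in>UNIV. \<Sum>K\<in>UNIV. g' $ L $ J * (g $ I $ K * fst (\<rho> s) $ K $ L))"
      by (rule ext) (simp add: matrix_matrix_mult_def sum_distrib_left mult.commute)
    then show "laurent_on_torus r (\<lambda>s. fst (cj g g' (\<rho> s)) $ I $ J)"
      by (simp only:) (intro laurent_sum laurent_scale rho(4) finite)
  qed
qed

lemma cj_image_inverse: "g' ** g = mat 1 \<Longrightarrow> cj g' g ` cj g g' ` H = H"
  by (simp add: image_image cj_cj)

lemma maximal_torus_conj:
  assumes H: "maximal_torus_in H N" and g: "g ** g' = mat 1" "g' ** g = mat 1"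
  shows "maximal_torus_in (cj g g' ` H) (cj g g' ` N)"
  unfolding maximal_torus_in_def
proof (intro conjI allI impI)
  show "algebraic_torus (cj g g' ` H)" "cj g g' ` H \<subseteq> cj g g' ` N"
    using H algebraic_torus_conj[OF _ g] unfolding maximal_torus_in_def by auto
  fix H' assume H': "algebraic_torus H' \<and> cj g g' ` H \<subseteq> H' \<and> H' \<subseteq> cj g g' ` N"
  then have "algebraic_torus (cj g' g ` H')" using algebraic_torus_conj[OF _ g(2,1)] by blast
  moreover have "H \<subseteq> cj g' g ` H'" using H' image_mono[of "cj g g' ` H" H' "cj g' g"] cj_image_inverse[OF g(2)] by metis
  moreover have "cj g' g ` H' \<subseteq> N" using H' image_mono[of H' "cj g g' ` N" "cj g' g"] cj_image_inverse[OF g(2)] by metis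
  ultimately have "cj g' g ` H' = H" using H unfolding maximal_torus_in_def by blast
  then show "H' = cj g g' ` H" using cj_image_inverse[OF g(1), of H'] by simp
qed

lemma line_normalizer_iff:
  assumes "e \<noteq> 0"
  shows "u \<in> line_normalizer e \<longleftrightarrow> fst u \<in> Spin10 \<and> snd u \<noteq> 0 \<and> (\<exists>k. fst u *v e = k *s e)"
proof -
  obtain s c where u: "u = (s, c)" by (cases u)
  have "G0_act (s, c) ` range (\<lambda>k. k *s e) = range (\<lambda>k. k *s e) \<longleftrightarrow> (\<exists>k. s *v e = k *s e)"
    if s: "s \<in> Spin10" and c: "c \<noteq> 0"
  proof
    assume eq: "G0_act (s, c) ` range (\<lambda>k. k *s e) = range (\<lambda>k. k *s e)"
    have "G0_act (s, c) (1 *s e) \<in> range (\<lambda>k. k *s e)" using eq by blast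
    then obtain k where "c *s (s *v e) = k *s e" by auto
    then have "(1 / c) *s (c *s (s *v e)) = (1 / c) *s (k *s e)" by (rule arg_cong)
    then have "s *v e = (1 / c * k) *s e" using c by simp
    then show "\<exists>k. s *v e = k *s e" ..
  next
    assume "\<exists>k. s *v e = k *s e"
    then obtain k where k: "s *v e = k *s e" ..
    have k0: "k \<noteq> 0"
    proof
      assume "k = 0"
      obtain s' where "s' ** s = mat 1" using Spin10_inverse[OF s] by blast
      then have "e = s' *v (s *v e)" by (simp add: matrix_vector_mul_assoc)
      then show False using k \<open>k = 0\<close> assms by simp
    qed
    have act: "G0_act (s, c) (l *s e) = (c * (l * k)) *s e" for l by (simp add: vector_scalar_commute k)
    have "l *s e = G0_act (s, c) ((l / (c * k)) *s e)" for l using c k0 by (simp only: act) simp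
    then show "G0_act (s, c) ` range (\<lambda>k. k *s e) = range (\<lambda>k. k *s e)"
      unfolding image_image act by (intro subset_antisym) (auto simp only: act)
  qed
  then show ?thesis unfolding line_normalizer_def u G0_def by auto
qed

lemma line_normalizer_conj:
  assumes g: "g \<in> Spin10" "g' \<in> Spin10" "g ** g' = mat 1" "g' ** g = mat 1" and e: "e \<noteq> 0"
  shows "cj g g' ` line_normalizer e = line_normalizer (g *v e)"
proof -
  have sub: "cj g g' ` line_normalizer e \<subseteq> line_normalizer (g *v e)"
    if g: "g \<in> Spin10" "g' \<in> Spin10" "g ** g' = mat 1" "g' ** g = mat 1" and e: "e \<noteq> 0" for g g' e
  proof
    fix v assume "v \<in> cj g g' ` line_normalizer e"
    then obtain u where u: "u \<in> line_normalizer e" "v = cj g g' u" by blast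
    have "e = g' *v (g *v e)" by (simp add: matrix_vector_mul_assoc g)
    then have ge: "g *v e \<noteq> 0" using e by auto
    obtain k where k: "fst u *v e = k *s e" using u(1) line_normalizer_iff[OF e] by blast
    have "fst v *v (g *v e) = g *v (fst u *v ((g' ** g) *v e))" by (simp add: u(2) matrix_vector_mul_assoc matrix_mul_assoc)
    then have "fst v *v (g *v e) = k *s (g *v e)" by (simp add: g k vector_scalar_commute)
    then show "v \<in> line_normalizer (g *v e)"
      using u line_normalizer_iff[OF e, of u] line_normalizer_iff[OF ge, of v] g by (auto intro: Spin10_mult)
  qed
  have ee: "e = g' *v (g *v e)" by (simp add: matrix_vector_mul_assoc g)
  then have ge: "g *v e \<noteq> 0" using e by auto
  have "cj g' g ` line_normalizer (g *v e) \<subseteq> line_normalizer e" using sub[OF g(2,1,4,3) ge] ee by simp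
  then have "cj g g' ` cj g' g ` line_normalizer (g *v e) \<subseteq> cj g g' ` line_normalizer e" by (rule image_mono)
  then show ?thesis using sub[OF g e] cj_image_inverse[OF g(3)] by auto
qed

subsection \<open>Standard tori\<close>

text \<open>\<open>Tst S\<close> is the diagonal torus if \<open>S\<close> is empty; for \<open>S = {-{a}}\<close> it is the part on which
  the weight vectors with indices \<open>{}\<close> and \<open>-{a}\<close> have the same weight.\<close>

definition Tst :: "5 set set \<Rightarrow> (spinor_mat \<times> complex) set" where
  "Tst S = {(dg l m, c) | l m c. l\<^sup>2 * prod m UNIV = 1 \<and> c \<noteq> 0 \<and> (\<forall>I\<in>S. prod m I = 1)}"

definition std :: "5 set set \<Rightarrow> bool" where
  "std S \<longleftrightarrow> S = {} \<or> (\<exists>a. S = {- {a}})"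

lemma dg_component: "dg l m $ I $ J = (if I = J then l * prod m I else 0)"
  by (simp add: dg_def)

lemma dg_eqD: "dg l m = dg l' m' \<Longrightarrow> l \<noteq> 0 \<Longrightarrow> l = l' \<and> m = m'"
proof -
  assume e: "dg l m = dg l' m'" "l \<noteq> 0"
  have "l = l'" using arg_cong[OF e(1), of "\<lambda>A. A $ {} $ {}"] by (simp add: dg_component)
  moreover have "l * m i = l' * m' i" for i using arg_cong[OF e(1), of "\<lambda>A. A $ {i} $ {i}"] by (simp add: dg_component)
  ultimately show ?thesis using e(2) by (auto simp: fun_eq_iff)
qed

lemma tmon_nonzero: "s \<in> torus_points r \<Longrightarrow> tmon r s m \<noteq> 0"
  by (simp add: tmon_def torus_points_def)

lemma tmon_add: "s \<in> torus_points r \<Longrightarrow> tmon r s (\<lambda>i. m i + n i) = tmon r s m * tmon r s n"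
  unfolding tmon_def prod.distrib[symmetric] by (intro prod.cong) (simp_all add: torus_points_def power_int_add)

lemma tmon_sum: "s \<in> torus_points r \<Longrightarrow> (\<Prod>i\<in>I. tmon r s (e i)) = tmon r s (\<lambda>j. \<Sum>i\<in>I. e i j)"
  by (induction I rule: infinite_finite_induct) (simp_all add: tmon_add, simp_all add: tmon_def)

lemma monomial_torus:
  fixes e :: "5 \<Rightarrow> nat \<Rightarrow> int" and e0 ec :: "nat \<Rightarrow> int" and r :: nat
  defines "\<rho> \<equiv> \<lambda>s. (dg (tmon r s e0) (\<lambda>i. tmon r s (e i)), tmon r s ec)"
  assumes inj: "\<And>s t. s \<in> torus_points r \<Longrightarrow> t \<in> torus_points r \<Longrightarrow> tmon r s e0 = tmon r t e0 \<Longrightarrow>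
     (\<And>i. tmon r s (e i) = tmon r t (e i)) \<Longrightarrow> tmon r s ec = tmon r t ec \<Longrightarrow> s = t"
  shows "algebraic_torus (\<rho> ` torus_points r)"
  unfolding algebraic_torus_def
proof (intro exI[of _ r] exI[of _ \<rho>] conjI ballI allI)
  have "inj_on \<rho> (torus_points r)"
  proof (rule inj_onI)
    fix s t assume st: "s \<in> torus_points r" "t \<in> torus_points r" "\<rho> s = \<rho> t"
    then have "tmon r s e0 = tmon r t e0 \<and> (\<lambda>i. tmon r s (e i)) = (\<lambda>i. tmon r t (e i))"
      unfolding \<rho>_def by (intro dg_eqD tmon_nonzero) simp_all
    moreover have "tmon r s ec = tmon r t ec" using st(3) by (simp add: \<rho>_def)
    ultimately show "s = t" using inj[OF st(1,2)] by (simp add: fun_eq_iff)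
  qed
  then show "bij_betw \<rho> (torus_points r) (\<rho> ` torus_points r)" by (rule bij_betw_imageI) simp
  show "\<rho> (\<lambda>i. s i * t i) = G0_mult (\<rho> s) (\<rho> t)" for s t
    by (simp add: \<rho>_def tmon_mult dg_mult)
  show "\<rho> (\<lambda>i. 1) = (mat 1, 1)" by (simp add: \<rho>_def tmon_one dg_one)
  show "laurent_on_torus r (\<lambda>s. snd (\<rho> s))" by (simp add: \<rho>_def laurent_monomial)
  fix I J
  have "laurent_on_torus r (\<lambda>s. (if I = J then 1 else 0) * tmon r s (\<lambda>j. e0 j + (\<Sum>i\<in>I. e i j)))"
    by (intro laurent_scale laurent_monomial)
  moreover have "fst (\<rho> s) $ I $ J = (if I = J then 1 else 0) * tmon r s (\<lambda>j. e0 j + (\<Sum>i\<in>I. e i j))" if "s \<in> torus_points r" for s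
    using that by (simp add: \<rho>_def dg_component tmon_add tmon_sum)
  ultimately show "laurent_on_torus r (\<lambda>s. fst (\<rho> s) $ I $ J)"
    unfolding laurent_on_torus_def by simp
qed

abbreviation dl :: "nat \<Rightarrow> nat \<Rightarrow> int" where "dl j \<equiv> (\<lambda>i. if i = j then 1 else 0)"

lemma tmon_dl: "j < r \<Longrightarrow> tmon r s (dl j) = s j"
proof -
  assume "j < r"
  have "tmon r s (dl j) = (\<Prod>i<r. if i = j then s i else 1)" unfolding tmon_def by (intro prod.cong) auto
  then show ?thesis using \<open>j < r\<close> by simp
qed

lemma torus_points_eqI: "s \<in> torus_points r \<Longrightarrow> t \<in> torus_points r \<Longrightarrow> (\<And>i. i < r \<Longrightarrow> s i = t i) \<Longrightarrow> s = t"
  by (rule ext) (metis (mono_tags, lifting) mem_Collect_eq not_le torus_points_def)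

lemma less_6: "i < 6 \<longleftrightarrow> i \<in> {0, 1, 2, 3, 4, 5 :: nat}" by auto
lemma less_5: "i < 5 \<longleftrightarrow> i \<in> {0, 1, 2, 3, 4 :: nat}" by auto

lemma tmon_6: "tmon 6 s m = s 0 powi m 0 * s 1 powi m 1 * s 2 powi m 2 * s 3 powi m 3 * s 4 powi m 4 * s 5 powi m 5"
  by (simp add: tmon_def eval_nat_numeral)
lemma tmon_5: "tmon 5 s m = s 0 powi m 0 * s 1 powi m 1 * s 2 powi m 2 * s 3 powi m 3 * s 4 powi m 4"
  by (simp add: tmon_def eval_nat_numeral)

lemma torus_Tst_empty: "algebraic_torus (Tst {})"
proof -
  \<comment> \<open>The parameters are \<open>l\<close>, \<open>m 1\<close>, ..., \<open>m 4\<close>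
    and the scalar; \<open>m 0\<close> is the inverse of \<open>l^2 * m 1 * m 2 * m 3 * m 4\<close>,
    as membership in the spin group requires.\<close>
  define e :: "5 \<Rightarrow> nat \<Rightarrow> int" where "e i = (if i = 1 then dl 1 else if i = 2 then dl 2 else if i = 3 then dl 3
     else if i = 4 then dl 4 else (\<lambda>j. if j = 0 then -2 else if j = 5 then 0 else -1))" for i
  let ?r = "\<lambda>s. (dg (tmon 6 s (dl 0)) (\<lambda>i. tmon 6 s (e i)), tmon 6 s (dl 5))"
  have ev: "tmon 6 s (e 1) = s 1" "tmon 6 s (e 2) = s 2" "tmon 6 s (e 3) = s 3" "tmon 6 s (e 4) = s 4"
    "tmon 6 s (e 0) = 1 / ((s 0)\<^sup>2 * s 1 * s 2 * s 3 * s 4)" "tmon 6 s (dl 0) = s 0" "tmon 6 s (dl 5) = s 5" for s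
    by (simp_all add: e_def tmon_dl, simp add: tmon_6 power_int_minus field_simps)
  have "algebraic_torus (?r ` torus_points 6)"
  proof (rule monomial_torus)
    fix s t assume st: "s \<in> torus_points 6" "t \<in> torus_points 6" "tmon 6 s (dl 0) = tmon 6 t (dl 0)"
      "\<And>i. tmon 6 s (e i) = tmon 6 t (e i)" "tmon 6 s (dl 5) = tmon 6 t (dl 5)"
    show "s = t"
      by (rule torus_points_eqI[OF st(1,2)])
         (use st(3,5) st(4)[of 1] st(4)[of 2] st(4)[of 3] st(4)[of 4] in \<open>auto simp: ev less_6\<close>)
  qed
  moreover have "?r ` torus_points 6 = Tst {}"
  proof
    show "?r ` torus_points 6 \<subseteq> Tst {}"
    proof
      fix u assume "u \<in> ?r ` torus_points 6"
      then obtain s where s: "s \<in> torus_points 6" "u = ?r s" by blast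
      then have "s 0 \<noteq> 0" "s 1 \<noteq> 0" "s 2 \<noteq> 0" "s 3 \<noteq> 0" "s 4 \<noteq> 0" "s 5 \<noteq> 0" by (simp_all add: torus_points_def)
      then have "(tmon 6 s (dl 0))\<^sup>2 * (\<Prod>i\<in>UNIV. tmon 6 s (e i)) = 1" "tmon 6 s (dl 5) \<noteq> 0"
        unfolding prod_5 ev by simp_all
      then show "u \<in> Tst {}" unfolding Tst_def s(2) by blast
    qed
    show "Tst {} \<subseteq> ?r ` torus_points 6"
    proof
      fix u assume "u \<in> Tst {}"
      then obtain l m c where u: "u = (dg l m, c)" "l\<^sup>2 * prod m UNIV = 1" "c \<noteq> 0" unfolding Tst_def by blast
      define s where "s j = (if j = 0 then l else if j = 1 then m 1 else if j = 2 then m 2 else if j = 3 then m 3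
          else if j = 4 then m 4 else if j = 5 then c else 1)" for j :: nat
      have nz: "l \<noteq> 0" "m 0 \<noteq> 0" "m 1 \<noteq> 0" "m 2 \<noteq> 0" "m 3 \<noteq> 0" "m 4 \<noteq> 0" using u(2) unfolding prod_5 by auto
      have s: "s \<in> torus_points 6" using nz u(3) by (auto simp: torus_points_def s_def)
      have sv: "s 0 = l" "s 1 = m 1" "s 2 = m 2" "s 3 = m 3" "s 4 = m 4" "s 5 = c" by (simp_all add: s_def)
      have "m 0 = 1 / (l\<^sup>2 * m 1 * m 2 * m 3 * m 4)" using u(2) nz unfolding prod_5 by (simp add: field_simps)
      then have "tmon 6 s (e i) = m i" for i using exhaust_5[of i] by (elim disjE) (simp_all add: ev sv del: One_nat_def)
      then have "u = ?r s" by (simp add: u(1) ev(6,7) sv del: One_nat_def)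
      then show "u \<in> ?r ` torus_points 6" using s by blast
    qed
  qed
  ultimately show ?thesis by simp
qed

text \<open>The transposition of \<open>a\<close> and 0, which reduces the stabilizer of
  \<open>- {a}\<close> to the case \<open>a = 0\<close>.\<close>

definition sw :: "5 \<Rightarrow> 5 \<Rightarrow> 5" where "sw a i = (if i = a then 0 else if i = 0 then a else i)"

lemma sw_sw [simp]: "sw a (sw a i) = i" by (auto simp: sw_def)
lemma sw_a [simp]: "sw a a = 0" "sw a 0 = a" by (auto simp: sw_def)
lemma bij_sw: "bij (sw a)" by (rule involuntory_imp_bij) simp
lemma prod_sw: "prod (\<lambda>i. f (sw a i)) UNIV = prod f UNIV"
  using prod.reindex_bij_betw[OF bij_sw, of f a] by simp

lemma prod_compl: "m a * prod m (- {a}) = prod m (UNIV :: 5 set)"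
  using prod.remove[of UNIV a m] by (simp add: Compl_eq_Diff_UNIV)

lemma torus_Tst_single: "algebraic_torus (Tst {- {a}})"
proof -
  \<comment> \<open>After the transposition the two conditions read \<open>l^2 * n 0 = 1\<close> and
    \<open>n 1 * n 2 * n 3 * n 4 = 1\<close>. So the parameters are \<open>l\<close>,
    \<open>n 1\<close>, \<open>n 2\<close>, \<open>n 3\<close> and the scalar.\<close>
  define e :: "5 \<Rightarrow> nat \<Rightarrow> int" where "e i = (if i = 1 then dl 1 else if i = 2 then dl 2 else if i = 3 then dl 3
     else if i = 4 then (\<lambda>j. if j = 0 \<or> j = 4 then 0 else -1) else (\<lambda>j. if j = 0 then -2 else 0))" for i
  let ?r = "\<lambda>s. (dg (tmon 5 s (dl 0)) (\<lambda>i. tmon 5 s (e (sw a i))), tmon 5 s (dl 4))"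
  have ev: "tmon 5 s (e 1) = s 1" "tmon 5 s (e 2) = s 2" "tmon 5 s (e 3) = s 3" "tmon 5 s (e 4) = 1 / (s 1 * s 2 * s 3)"
    "tmon 5 s (e 0) = 1 / (s 0)\<^sup>2" "tmon 5 s (dl 0) = s 0" "tmon 5 s (dl 4) = s 4" for s
    by (simp_all add: e_def tmon_dl, simp_all add: tmon_5 power_int_minus field_simps)
  have "algebraic_torus (?r ` torus_points 5)"
  proof (rule monomial_torus)
    fix s t assume st: "s \<in> torus_points 5" "t \<in> torus_points 5" "tmon 5 s (dl 0) = tmon 5 t (dl 0)"
      "\<And>i. tmon 5 s (e (sw a i)) = tmon 5 t (e (sw a i))" "tmon 5 s (dl 4) = tmon 5 t (dl 4)"
    have "tmon 5 s (e i) = tmon 5 t (e i)" for i using st(4)[of "sw a i"] by simp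
    from st(3,5) this[of 1] this[of 2] this[of 3] show "s = t"
      by (intro torus_points_eqI[OF st(1,2)]) (auto simp: ev less_5)
  qed
  moreover have "?r ` torus_points 5 = Tst {- {a}}"
  proof
    show "?r ` torus_points 5 \<subseteq> Tst {- {a}}"
    proof
      fix u assume "u \<in> ?r ` torus_points 5"
      then obtain s where s: "s \<in> torus_points 5" "u = ?r s" by blast
      then have nz: "s 0 \<noteq> 0" "s 1 \<noteq> 0" "s 2 \<noteq> 0" "s 3 \<noteq> 0" "s 4 \<noteq> 0" by (simp_all add: torus_points_def)
      let ?m = "\<lambda>i. tmon 5 s (e (sw a i))"
      have P: "(tmon 5 s (dl 0))\<^sup>2 * prod ?m UNIV = 1" "tmon 5 s (dl 4) \<noteq> 0"
        unfolding prod_sw[of "\<lambda>i. tmon 5 s (e i)"] prod_5 ev using nz by simp_all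
      moreover have "prod ?m (- {a}) = 1"
        using P(1) prod_compl[of ?m a] nz by (simp add: ev field_simps)
      ultimately show "u \<in> Tst {- {a}}" unfolding Tst_def s(2) by blast
    qed
    show "Tst {- {a}} \<subseteq> ?r ` torus_points 5"
    proof
      fix u assume "u \<in> Tst {- {a}}"
      then obtain l m c where u: "u = (dg l m, c)" "l\<^sup>2 * prod m UNIV = 1" "c \<noteq> 0" "prod m (- {a}) = 1" unfolding Tst_def by blast
      define n where "n i = m (sw a i)" for i
      have n0: "l\<^sup>2 * n 0 = 1" using u(2,4) prod_compl[of m a] by (simp add: n_def)
      moreover have "l\<^sup>2 * prod n UNIV = 1" using u(2) prod_sw[of m a] by (simp add: n_def)
      ultimately have n4: "n 1 * n 2 * n 3 * n 4 = 1" unfolding prod_5 by (simp add: mult.assoc[symmetric])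
      define s where "s j = (if j = 0 then l else if j = 1 then n 1 else if j = 2 then n 2 else if j = 3 then n 3
          else if j = 4 then c else 1)" for j :: nat
      have nz: "l \<noteq> 0" "n 0 \<noteq> 0" "n 1 \<noteq> 0" "n 2 \<noteq> 0" "n 3 \<noteq> 0" "n 4 \<noteq> 0" using n0 n4 by auto
      have s: "s \<in> torus_points 5" using nz u(3) by (auto simp: torus_points_def s_def)
      have sv: "s 0 = l" "s 1 = n 1" "s 2 = n 2" "s 3 = n 3" "s 4 = c" by (simp_all add: s_def)
      have "n 0 = 1 / l\<^sup>2" "n 4 = 1 / (n 1 * n 2 * n 3)" using n0 n4 nz by (simp_all add: field_simps)
      then have "tmon 5 s (e i) = n i" for i using exhaust_5[of i] by (elim disjE) (simp_all add: ev sv del: One_nat_def)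
      then have "u = ?r s" by (simp add: u(1) ev(6,7) sv n_def del: One_nat_def)
      then show "u \<in> ?r ` torus_points 5" using s by blast
    qed
  qed
  ultimately show ?thesis by simp
qed

lemma torus_Tst: "std S \<Longrightarrow> algebraic_torus (Tst S)"
  unfolding std_def using torus_Tst_empty torus_Tst_single by blast

text \<open>The invariant form pairs the basis spinors at \<open>UNIV\<close> and \<open>{}\<close>,
  whose eigenvalues under \<open>dg l m\<close> are \<open>l * prod m UNIV\<close> and
  \<open>l\<close>; their product has to be 1.\<close>

lemma Spin10_Diag: "dg l m \<in> Spin10 \<longleftrightarrow> l\<^sup>2 * prod m UNIV = 1"
proof
  assume "dg l m \<in> Spin10"
  from Spin10_Wm[OF this, of "axis UNIV 1" "axis {} 1"]
  have "(l * prod m UNIV) * l * (Wm *v axis {} 1) $ UNIV = (Wm *v axis {} 1) $ UNIV"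
    by (simp add: dg_axis vector_scalar_commute pairing_simps mult.assoc mult.left_commute)
  then show "l\<^sup>2 * prod m UNIV = 1" by (simp add: Wm_mv axis_component power2_eq_square mult_ac)
qed (rule torus_Spin10)

lemma Tst_G0: "u \<in> Tst S \<Longrightarrow> fst u \<in> Spin10 \<and> snd u \<noteq> 0"
  unfolding Tst_def using torus_Spin10 by auto

lemma generic_weights:
  obtains l m where "(dg l m, 1) \<in> Tst {- {a}}" "\<And>i. m i \<noteq> 0" "\<And>p q. dwt m p = dwt m q \<Longrightarrow> p = q"
proof -
  \<comment> \<open>Four numbers with product 1, so that \<open>{}\<close> and \<open>- {a}\<close>
    get the same weight, and 7 at the remaining place. These five numbers and their inverses are ten
    different values.\<close>
  define n :: "5 \<Rightarrow> complex" where "n i = (if i = 1 then 2 else if i = 2 then 3 else if i = 3 then 5 else if i = 4 then 1/30 else 7)" for i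
  define m where "m i = n (sw a i)" for i
  define l where "l = csqrt (1/7)"
  have l: "l\<^sup>2 = 1/7" unfolding l_def by (rule power2_csqrt)
  have "m = (\<lambda>i. n (sw a i))" by (rule ext) (simp add: m_def)
  then have "prod m UNIV = prod n UNIV" using prod_sw[of n a] by simp
  also have "prod n UNIV = 7" unfolding prod_5 by (simp add: n_def)
  finally have P: "prod m UNIV = 7" .
  have "m a = 7" by (simp add: m_def n_def)
  then have "prod m (- {a}) = 1" using prod_compl[of m a] P by simp
  moreover have "l\<^sup>2 * prod m UNIV = 1" using l P by simp
  ultimately have T: "(dg l m, 1) \<in> Tst {- {a}}" unfolding Tst_def by fastforce
  have nz: "m i \<noteq> 0" for i by (simp add: m_def n_def)
  have dn: "p = q" if "dwt n p = dwt n q" for p q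
    using that exhaust_55[of p] exhaust_55[of q] by (elim insertE emptyE; simp add: dwt_def n_def)
  define sp where "sp p = (case p of Inl i \<Rightarrow> Inl (sw a i) | Inr i \<Rightarrow> Inr (sw a i))" for p
  have "dwt m p = dwt n (sp p)" for p by (cases p) (simp_all add: dwt_def m_def sp_def)
  moreover have "sp (sp p) = p" for p by (cases p) (simp_all add: sp_def)
  ultimately have "p = q" if "dwt m p = dwt m q" for p q using dn that by metis
  then show thesis using that T nz by blast
qed

text \<open>An element commuting with a diagonal one preserves its eigenspaces on the vector
  representation. The ten weights being different, these are the coordinate lines.\<close>

lemma centralizer_Diag:
  assumes s: "s \<in> Spin10" and m: "\<And>i. m i \<noteq> 0" "\<And>p q. dwt m p = dwt m q \<Longrightarrow> p = q" "l \<noteq> 0"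
    and comm: "s ** dg l m = dg l m ** s"
  shows "s \<in> Diag"
proof -
  obtain s' where s': "s' \<in> Spin10" "s ** s' = mat 1" "s' ** s = mat 1" using Spin10_inverse[OF s] by blast
  have "\<exists>c. wtv {s} (axis p 1) c" for p
  proof -
    obtain v where v: "s ** gamma (axis p 1) = gamma v ** s" using Spin10_gamma[OF s] by blast
    have vz: "s *v (gamma (axis p 1) *v z) = gamma v *v (s *v z)" for z
      using arg_cong[OF v, of "\<lambda>A. A *v z"] by (simp add: matrix_vector_mul_assoc[symmetric])
    have cz: "dg l m *v (s *v z) = s *v (dg l m *v z)" for z
      using comm by (simp add: matrix_vector_mul_assoc)
    have sz: "s *v (s' *v z) = z" for z by (simp add: matrix_vector_mul_assoc s')
    define w where "w = (\<chi> q. dwt m q * v $ q)"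
    have "gamma w *v (dg l m *v y) = gamma (dwt m p *s v) *v (dg l m *v y)" for y
    proof -
      have "gamma w *v (dg l m *v y) = dg l m *v (gamma v *v y)"
        by (subst (1 2) gamma_vector_expand) (simp add: sum_mv mv_sum vector_scalar_commute dg_gamma_axis[of m, OF m(1)] w_def mult_ac)
      also have "gamma v *v y = s *v (gamma (axis p 1) *v (s' *v y))" by (simp add: vz sz)
      also have "dg l m *v \<dots> = dwt m p *s (gamma v *v (dg l m *v (s *v (s' *v y))))"
        by (simp add: cz dg_gamma_axis[of m, OF m(1)] vector_scalar_commute vz[symmetric])
      finally show ?thesis by (simp add: gamma_linear sz)
    qed
    moreover have "\<exists>y. z = dg l m *v y" for z
    proof
      show "z = dg l m *v (dg (1 / l) (\<lambda>i. 1 / m i) *v z)"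
        using m(1,3) by (simp add: matrix_vector_mul_assoc dg_mult dg_one)
    qed
    ultimately have "gamma w *v z = gamma (dwt m p *s v) *v z" for z by metis
    then have "gamma w = gamma (dwt m p *s v)" by (simp add: matrix_eq)
    then have "w = dwt m p *s v" by simp
    then have "dwt m q * v $ q = dwt m p * v $ q" for q by (simp add: w_def vec_eq_iff)
    then have "v $ q = 0" if "q \<noteq> p" for q using m(2) that by (metis mult_cancel_right)
    then have "v = v $ p *s axis p 1" by (auto simp: vec_eq_iff axis_def)
    then have "s ** gamma (axis p 1) = cmat (v $ p) (gamma (axis p 1) ** s)" using v by (metis cmat_mm(1) gamma_scale)
    then show ?thesis unfolding wtv_def by (intro exI[of _ "\<lambda>_. v $ p"]) simp
  qed
  then show ?thesis using axis_weights_Diag[of "{s}"] s by blast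
qed

section \<open>Maximality and conjugacy of the standard tori\<close>

definition adapted :: "5 set set \<Rightarrow> spinor \<Rightarrow> bool" where
  "adapted S x \<longleftrightarrow> (\<forall>I. x $ I \<noteq> 0 \<longleftrightarrow> I \<in> insert {} S)"

lemma adapted_nz: "adapted S x \<Longrightarrow> x $ {} \<noteq> 0 \<and> x \<noteq> 0"
  unfolding adapted_def by (metis insertI1 zero_index)

lemma Diag_in_Tst:
  assumes x: "adapted S x" and u: "fst u \<in> Diag" "fst u \<in> Spin10" "snd u \<noteq> 0" "fst u *v x = k *s x"
  shows "u \<in> Tst S"
proof -
  obtain l m where lm: "fst u = dg l m" "l \<noteq> 0" using u(1) unfolding Diag_def by blast
  have "eigen {fst u} x" using u(4) by (auto simp: eigen_def)
  then have "prod m I = prod m {}" if "I \<in> S" for I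
    using eigen_Diag_eq[OF _ _ lm, of "{fst u}" x I "{}"] x that unfolding adapted_def by auto
  then have "\<forall>I\<in>S. prod m I = 1" by simp
  moreover have "l\<^sup>2 * prod m UNIV = 1" using u(2) lm(1) Spin10_Diag by simp
  moreover have "u = (dg l m, snd u)" using lm(1) by (simp add: prod_eq_iff)
  ultimately show ?thesis unfolding Tst_def using u(3) by blast
qed

lemma Tst_normalizer:
  assumes "adapted S x" shows "Tst S \<subseteq> line_normalizer x"
proof
  fix u assume u: "u \<in> Tst S"
  then obtain l m c where lm: "u = (dg l m, c)" "\<forall>I\<in>S. prod m I = 1" unfolding Tst_def by blast
  have "(dg l m *v x) $ I = (l *s x) $ I" for I
    using assms lm(2) by (cases "x $ I = 0") (auto simp: dg_mv adapted_def)
  then have "dg l m *v x = l *s x" by (simp add: vec_eq_iff)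
  then show "u \<in> line_normalizer x"
    using Tst_G0[OF u] line_normalizer_iff[of x u] adapted_nz[OF assms] lm(1) by auto
qed

lemma Tst_mono: "std S \<Longrightarrow> \<exists>a. Tst {- {a}} \<subseteq> Tst S"
  unfolding std_def
proof (elim disjE exE)
  assume "S = {}"
  then have "Tst {- {0}} \<subseteq> Tst S" unfolding Tst_def by blast
  then show ?thesis ..
qed blast

text \<open>A larger torus is commutative, so it centralizes the element with ten distinct weights
  and consists of diagonal elements; a diagonal element normalizing the line lies in
  \<open>Tst S\<close>.\<close>

lemma Tst_maximal:
  assumes S: "std S" and x: "adapted S x"
  shows "maximal_torus_in (Tst S) (line_normalizer x)"
  unfolding maximal_torus_in_def
proof (intro conjI allI impI)
  show "algebraic_torus (Tst S)" by (rule torus_Tst[OF S])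
  show "Tst S \<subseteq> line_normalizer x" by (rule Tst_normalizer[OF x])
  fix H assume H: "algebraic_torus H \<and> Tst S \<subseteq> H \<and> H \<subseteq> line_normalizer x"
  obtain r \<rho> where rho: "bij_betw \<rho> (torus_points r) H"
    "\<And>s t. s \<in> torus_points r \<Longrightarrow> t \<in> torus_points r \<Longrightarrow> \<rho> (\<lambda>i. s i * t i) = G0_mult (\<rho> s) (\<rho> t)"
    using H unfolding algebraic_torus_def by blast
  have comm: "fst u ** fst v = fst v ** fst u" if "u \<in> H" "v \<in> H" for u v
  proof -
    obtain s t where st: "s \<in> torus_points r" "t \<in> torus_points r" "u = \<rho> s" "v = \<rho> t"
      using rho(1) \<open>u \<in> H\<close> \<open>v \<in> H\<close> unfolding bij_betw_def by blast
    have "G0_mult u v = G0_mult v u" using rho(2)[OF st(1,2)] rho(2)[OF st(2,1)] st by (simp add: mult.commute)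
    then show ?thesis by (metis fst_G0_mult)
  qed
  obtain a where a: "Tst {- {a}} \<subseteq> Tst S" using Tst_mono[OF S] by blast
  obtain l m where lm: "(dg l m, 1) \<in> Tst {- {a}}" "\<And>i. m i \<noteq> 0" "\<And>p q. dwt m p = dwt m q \<Longrightarrow> p = q"
    using generic_weights by blast
  have l0: "l \<noteq> 0" using Tst_G0[OF lm(1)] Spin10_Diag[of l m] by auto
  have "u \<in> Tst S" if u: "u \<in> H" for u
  proof -
    have n: "fst u \<in> Spin10" "snd u \<noteq> 0" "\<exists>k. fst u *v x = k *s x"
      using H u line_normalizer_iff[of x u] adapted_nz[OF x] by auto
    have c: "fst u ** dg l m = dg l m ** fst u" using comm[OF u, of "(dg l m, 1)"] H a lm(1) by auto
    have "fst u \<in> Diag" by (rule centralizer_Diag[OF n(1) _ _ l0 c]) (use lm(2,3) in blast)+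
    then show ?thesis using Diag_in_Tst[OF x] n by blast
  qed
  then show "H = Tst S" using H by blast
qed

lemma normal_form_adapted:
  assumes "normal_form x" obtains S where "std S" "adapted S x" "S = {} \<Longrightarrow> x \<in> orbit E1" "S \<noteq> {} \<Longrightarrow> x \<in> orbit E2"
proof -
  from assms consider k where "k \<noteq> 0" "x = k *s axis {} 1"
    | k l a where "k \<noteq> 0" "l \<noteq> 0" "x = k *s axis {} 1 + l *s axis (- {a}) 1" unfolding normal_form_def by blast
  then show thesis
  proof cases
    case 1
    then show thesis using orbit_scale[of k E1]
      by (intro that[of "{}"]) (auto simp: std_def adapted_def axis_component E1_def)
  next
    case 2
    have "adapted {- {a}} x" using 2(1,2) unfolding adapted_def 2(3)
      by (auto simp: axis_component compl_neq_empty)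
    then show thesis using pair_orbit[OF 2(1,2), of a] 2(3)
      by (intro that[of "{- {a}}"]) (auto simp: std_def)
  qed
qed

text \<open>The torus is diagonalised before the spinor is touched; the spinor is a common
  eigenvector, so the reduction to normal form keeps the torus diagonal. The conjugate is then
  contained in \<open>Tst S\<close>, a torus in the same normalizer, and maximality gives
  equality.\<close>

lemma maximal_torus_conjugate:
  assumes e: "e \<in> X" "e \<noteq> 0" and H: "maximal_torus_in H (line_normalizer e)"
  obtains g g' S where "g \<in> Spin10" "g' \<in> Spin10" "g ** g' = mat 1" "g' ** g = mat 1" "std S" "adapted S (g *v e)"
    "cj g g' ` H = Tst S" "S = {} \<Longrightarrow> e \<in> orbit E1" "S \<noteq> {} \<Longrightarrow> e \<in> orbit E2"
proof -
  have HN: "H \<subseteq> line_normalizer e" "algebraic_torus H" using H unfolding maximal_torus_in_def by auto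
  then have HG: "H \<subseteq> G0" unfolding line_normalizer_def by blast
  obtain g g' where g: "g \<in> Spin10" "g' \<in> Spin10" "g ** g' = mat 1" "g' ** g = mat 1" "(\<lambda>h. g ** h ** g') ` (fst ` H) \<subseteq> Diag"
    using toral_diagonal[OF algebraic_torus_toral[OF HN(2) HG]] by blast
  let ?D = "(\<lambda>h. g ** h ** g') ` (fst ` H)"
  have "eigen (fst ` H) e" using HN(1) line_normalizer_iff[OF e(2)] by (auto simp: eigen_def)
  then have eg: "eigen ?D (g *v e)" by (rule eigen_conj[OF _ g(4)])
  have "e = g' *v (g *v e)" by (simp add: matrix_vector_mul_assoc g)
  then have "g *v e \<noteq> 0" using e(2) by auto
  then have "reduces ?D (g *v e) normal_form"
    by (rule reduces_normal_form[OF g(5) eg Spin10_X[OF g(1) e(1)]])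
  then obtain h h' where h: "h \<in> Spin10" "h' \<in> Spin10" "h ** h' = mat 1" "h' ** h = mat 1"
     "(\<lambda>d. h ** d ** h') ` ?D \<subseteq> Diag" "normal_form (h *v (g *v e))" unfolding reduces_def by blast
  let ?k = "h ** g" and ?k' = "g' ** h'"
  have "?k ** ?k' = h ** (g ** g') ** h'" "?k' ** ?k = g' ** (h' ** h) ** g" by (simp_all only: matrix_mul_assoc)
  then have k: "?k \<in> Spin10" "?k' \<in> Spin10" "?k ** ?k' = mat 1" "?k' ** ?k = mat 1" using g h by (auto intro: Spin10_mult)
  have nf: "normal_form (?k *v e)" using h(6) by (simp add: matrix_vector_mul_assoc)
  obtain S where S: "std S" "adapted S (?k *v e)" "S = {} \<Longrightarrow> ?k *v e \<in> orbit E1" "S \<noteq> {} \<Longrightarrow> ?k *v e \<in> orbit E2"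
    using normal_form_adapted[OF nf] by blast
  let ?H = "cj ?k ?k' ` H"
  have mx: "maximal_torus_in ?H (line_normalizer (?k *v e))"
    using maximal_torus_conj[OF H k(3,4)] line_normalizer_conj[OF k e(2)] by simp
  have "?H \<subseteq> Tst S"
  proof
    fix u assume u: "u \<in> ?H"
    then obtain v where v: "v \<in> H" "u = cj ?k ?k' v" by blast
    have "fst u = h ** (g ** fst v ** g') ** h'" unfolding v(2) by (simp add: matrix_mul_assoc)
    then have d: "fst u \<in> Diag" using h(5) v(1) by blast
    have "u \<in> line_normalizer (?k *v e)" using mx u unfolding maximal_torus_in_def by blast
    then show "u \<in> Tst S" using Diag_in_Tst[OF S(2) d] line_normalizer_iff[of "?k *v e" u] adapted_nz[OF S(2)] by blast
  qed
  then have "Tst S = ?H"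
    using mx Tst_normalizer[OF S(2)] torus_Tst[OF S(1)] unfolding maximal_torus_in_def by blast
  moreover have "e \<in> orbit (?k *v e)" using orbit_sym[OF orbit_Spin[OF k(1)]] .
  ultimately show thesis using that[OF k S(1,2)] S(3,4) orbit_eq by blast
qed

section \<open>Sums of commuting copies of sl(2)\<close>

lemma e6_br_sum_left: "e6_br (\<Sum>i\<in>I. f i) b = (\<Sum>i\<in>I. e6_br (f i) b)"
  by (induction I rule: infinite_finite_induct) (simp_all add: e6_br_add_left)

lemma e6_br_span:
  assumes gen: "\<And>a b. a \<in> A \<Longrightarrow> b \<in> B \<Longrightarrow> e6_br a b \<in> V" and V: "e6.subspace V"
    and a: "a \<in> e6.span A" and b: "b \<in> e6.span B"
  shows "e6_br a b \<in> V"
  using a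
proof (induction rule: e6.span_induct_alt)
  case base show ?case using V by (simp add: e6.subspace_0)
next
  case (step c s y)
  have "e6_br s b \<in> V" using b
  proof (induction rule: e6.span_induct_alt)
    case base show ?case using V by (simp add: e6.subspace_0)
  next
    case (step d t z)
    then show ?case using gen[OF \<open>s \<in> A\<close>] V
      by (simp add: e6_br_add_right e6_br_scale_right e6.subspace_add e6.subspace_scale)
  qed
  then show ?case using step V
    by (simp add: e6_br_add_left e6_br_scale_left e6.subspace_add e6.subspace_scale)
qed

definition sl2_family :: "nat \<Rightarrow> (nat \<Rightarrow> e6_vec) \<Rightarrow> (nat \<Rightarrow> e6_vec) \<Rightarrow> bool" where
  "sl2_family n x y \<longleftrightarrow>
     (\<forall>i\<in>{1..n}. x i \<in> e6 \<and> y i \<in> e6 \<and> x i \<noteq> 0) \<and>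
     (\<forall>i\<in>{1..n}. \<forall>j\<in>{1..n}. e6_br (x i) (x j) = 0 \<and> e6_br (y i) (y j) = 0 \<and> (i \<noteq> j \<longrightarrow> e6_br (x i) (y j) = 0) \<and>
        e6_br (e6_br (x i) (y i)) (x j) = e6_scale (if i = j then 2 else 0) (x j) \<and>
        e6_br (e6_br (x i) (y i)) (y j) = e6_scale (if i = j then -2 else 0) (y j))"

definition sl2_span :: "nat \<Rightarrow> (nat \<Rightarrow> e6_vec) \<Rightarrow> (nat \<Rightarrow> e6_vec) \<Rightarrow> e6_vec set" where
  "sl2_span n x y = e6.span (\<Union>i\<in>{1..n}. {x i, y i, e6_br (x i) (y i)})"

lemma sl2_family_type:
  assumes fam: "sl2_family n x y"
  shows "lie_algebra e6_scale (sl2_span n x y) e6_br" (is "lie_algebra _ ?L _")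
    and "lie_algebra.dynkin_type e6_scale (sl2_span n x y) e6_br n {}"
proof -
  define h where "h i = e6_br (x i) (y i)" for i
  let ?G = "\<Union>i\<in>{1..n}. {x i, y i, h i}"
  have mem: "x i \<in> e6" "y i \<in> e6" "x i \<noteq> 0" "h i \<in> e6" if "i \<in> {1..n}" for i
    using fam that unfolding sl2_family_def h_def by (blast intro: e6_br_closed)+
  have br: "e6_br (x i) (x j) = 0" "e6_br (y i) (y j) = 0" "i \<noteq> j \<Longrightarrow> e6_br (x i) (y j) = 0"
    "e6_br (h i) (x j) = e6_scale (if i = j then 2 else 0) (x j)"
    "e6_br (h i) (y j) = e6_scale (if i = j then -2 else 0) (y j)" if "i \<in> {1..n}" "j \<in> {1..n}" for i j
    using fam that unfolding sl2_family_def h_def by blast+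
  \<comment> \<open>\<open>br (h i)\<close> is a derivation, and its eigenvalues on
    \<open>x j\<close> and \<open>y j\<close> cancel.\<close>
  have hh0: "e6_br (h i) (h j) = 0" if ij: "i \<in> {1..n}" "j \<in> {1..n}" for i j
  proof -
    have "e6_br (h i) (h j) = e6_br (e6_br (h i) (x j)) (y j) + e6_br (x j) (e6_br (h i) (y j))"
      unfolding h_def[of j] using mem ij by (intro e6.br_br)
    also have "\<dots> = e6_scale (if i = j then 2 else 0) (h j) + e6_scale (if i = j then -2 else 0) (h j)"
      unfolding br[OF ij] e6_br_scale_left e6_br_scale_right by (simp only: h_def)
    finally show ?thesis by (simp add: e6.scale_left_distrib[symmetric] split: if_splits)
  qed
  have y0: "y i \<noteq> 0" if i: "i \<in> {1..n}" for i
  proof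
    assume "y i = 0"
    then have "e6_scale 2 (x i) = 0" using br(4)[OF i i] by (simp add: h_def)
    then show False using mem(3)[OF i] by simp
  qed
  have L: "?L = e6.span ?G" unfolding sl2_span_def h_def ..
  have GL: "?G \<subseteq> ?L" unfolding L by (rule e6.span_superset)
  have gL: "x i \<in> ?L" "y i \<in> ?L" "h i \<in> ?L" if "i \<in> {1..n}" for i
    using GL that by blast+
  have subL: "e6.subspace ?L" unfolding L by (rule e6.subspace_span)
  have brG: "e6_br a b \<in> ?L" if ab: "a \<in> ?G" "b \<in> ?G" for a b
  proof -
    obtain i j where ij: "i \<in> {1..n}" "j \<in> {1..n}" "a \<in> {x i, y i, h i}" "b \<in> {x j, y j, h j}" using ab by blast
    have z: "0 \<in> ?L" using subL by (rule e6.subspace_0)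
    have sc: "e6_scale k v \<in> ?L" if "v \<in> ?L" for k v using subL that by (rule e6.subspace_scale)
    have xy: "e6_br (x i) (y j) \<in> ?L" if "i \<in> {1..n}" "j \<in> {1..n}" for i j
      using br(3)[OF that] z gL(3)[OF that(1)] by (cases "i = j") (simp_all add: h_def)
    have hx: "e6_br (h i) (x j) \<in> ?L" and hy: "e6_br (h i) (y j) \<in> ?L" if "i \<in> {1..n}" "j \<in> {1..n}" for i j
      unfolding br[OF that] using sc gL that by blast+
    have neg: "e6_br v w \<in> ?L" if "e6_br w v \<in> ?L" for v w
      using e6.subspace_neg[OF subL that] e6_br_antisym[of v w] by simp
    from ij(3,4) show ?thesis
      using br(1,2)[OF ij(1,2)] hh0[OF ij(1,2)] z xy[OF ij(1,2)] neg[OF xy[OF ij(2,1)]]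
        hx[OF ij(1,2)] hy[OF ij(1,2)] neg[OF hx[OF ij(2,1)]] neg[OF hy[OF ij(2,1)]]
      by (elim insertE emptyE) (simp_all only:)
  qed
  have Le6: "?L \<subseteq> e6" unfolding L by (rule e6.span_minimal[OF _ e6.subspace_L]) (use mem in blast)
  show lie: "lie_algebra e6_scale ?L e6_br"
  proof
    show "e6_br a b \<in> ?L" if "a \<in> ?L" "b \<in> ?L" for a b
      by (rule e6_br_span[OF brG subL]) (use that L in auto)
  qed (use subL Le6 in \<open>auto simp: e6_br_add_left e6_br_add_right e6_br_scale_left e6_br_scale_right e6.br_self zero_prod_def[symmetric] intro: e6.jacobi\<close>)
  define hh where "hh = e6.span (h ` {1..n})"
  define K where "K = {1..n} \<times> (UNIV :: bool set)"
  define e where "e k = (if snd k then x (fst k) else y (fst k))" for k :: "nat \<times> bool"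
  define pm where "pm k = (if snd k then 1 else -1 :: complex)" for k :: "nat \<times> bool"
  \<comment> \<open>The weight is read off from the action on \<open>x\<close> alone; the roots of
    the \<open>y\<close> get the opposite sign through \<open>pm\<close>.\<close>
  define wt where "wt k z = (if z \<in> hh then pm k * (THE c. e6_br z (x (fst k)) = e6_scale c (x (fst k))) else 0)"
    for k z
  have hz: "\<exists>c. z = (\<Sum>j\<in>{1..n}. e6_scale (c j) (h j))" if "z \<in> hh" for z
    using that unfolding hh_def
  proof (induction rule: e6.span_induct_alt)
    case base show ?case by (intro exI[of _ "\<lambda>_. 0"]) simp
  next
    case (step a s z)
    then obtain c i where c: "z = (\<Sum>j\<in>{1..n}. e6_scale (c j) (h j))" "i \<in> {1..n}" "s = h i" by blast
    have "(\<Sum>j\<in>{1..n}. e6_scale (c j + (if j = i then a else 0)) (h j)) = z + (\<Sum>j\<in>{1..n}. if j = i then e6_scale a (h j) else 0)"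
      unfolding c(1) sum.distrib[symmetric] by (intro sum.cong) (auto simp: e6.scale_left_distrib)
    also have "\<dots> = e6_scale a s + z" using c(2,3) by simp
    finally show ?case by (intro exI[of _ "\<lambda>j. c j + (if j = i then a else 0)"]) (rule sym)
  qed
  have hmem: "(\<Sum>j\<in>{1..n}. e6_scale (c j) (h j)) \<in> hh" for c
    unfolding hh_def by (intro e6.span_sum e6.span_scale e6.span_base imageI)
  have brx: "e6_br (\<Sum>j\<in>{1..n}. e6_scale (c j) (h j)) (e k) = e6_scale (pm k * (2 * c (fst k))) (e k)" if k: "k \<in> K" for c k
  proof -
    have i: "fst k \<in> {1..n}" using k by (auto simp: K_def)
    have "e6_br (h j) (e k) = e6_scale (if j = fst k then pm k * 2 else 0) (e k)" if "j \<in> {1..n}" for j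
      using br(4,5)[OF that i] by (auto simp: e_def pm_def)
    then have "e6_br (\<Sum>j\<in>{1..n}. e6_scale (c j) (h j)) (e k) = (\<Sum>j\<in>{1..n}. if j = fst k then e6_scale (pm k * (2 * c j)) (e k) else 0)"
      unfolding e6_br_sum_left e6_br_scale_left by (intro sum.cong) (auto simp: mult_ac)
    then show ?thesis using i by simp
  qed
  have wt: "wt k (\<Sum>j\<in>{1..n}. e6_scale (c j) (h j)) = pm k * (2 * c (fst k))" if k: "k \<in> K" for c k
  proof -
    have i: "fst k \<in> {1..n}" using k by (auto simp: K_def)
    have "e6_br (\<Sum>j\<in>{1..n}. e6_scale (c j) (h j)) (x (fst k)) = e6_scale (2 * c (fst k)) (x (fst k))"
      using brx[of "(fst k, True)" c] i by (simp add: K_def e_def pm_def)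
    then have "(THE d. e6_br (\<Sum>j\<in>{1..n}. e6_scale (c j) (h j)) (x (fst k)) = e6_scale d (x (fst k))) = 2 * c (fst k)"
      using mem(3)[OF i] by (intro the_equality) simp_all
    then show ?thesis unfolding wt_def using hmem by simp
  qed
  have wth: "wt k (h j) = (if j = fst k then pm k * 2 else 0)" if k: "k \<in> K" "j \<in> {1..n}" for k j
  proof -
    have "h j = (\<Sum>i\<in>{1..n}. e6_scale (if i = j then 1 else 0) (h i))"
      using k(2) by (simp add: if_distrib[of "\<lambda>c. e6_scale c _"] cong: if_cong)
    then have "wt k (h j) = pm k * (2 * (if fst k = j then 1 else 0))" using wt[OF k(1), of "\<lambda>i. if i = j then 1 else 0"] by simp
    then show ?thesis by auto
  qed
  have hhh: "h j \<in> hh" if "j \<in> {1..n}" for j unfolding hh_def using that by (intro e6.span_base imageI)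
  have hhL: "hh \<subseteq> ?L" unfolding hh_def by (rule e6.span_minimal[OF _ subL]) (use gL in blast)
  interpret l: lie_algebra e6_scale ?L e6_br by (rule lie)
  interpret d: root_datum e6_scale ?L e6_br hh K wt e
  proof
    show "hh \<subseteq> ?L" by (rule hhL)
    show "e6.subspace hh" unfolding hh_def by (rule e6.subspace_span)
    show "finite K" unfolding K_def by simp
    show "?L \<subseteq> e6.span (hh \<union> e ` K)"
    proof -
      have "x i \<in> e ` K" "y i \<in> e ` K" if "i \<in> {1..n}" for i
        using that by (intro image_eqI[of _ _ "(i, True)"] image_eqI[of _ _ "(i, False)"]; simp add: e_def K_def)+
      then have "?G \<subseteq> hh \<union> e ` K" using hhh by blast
      then show ?thesis unfolding L by (rule e6.span_mono)
    qed
    show "inj_on wt K"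
    proof (rule inj_onI)
      fix k k' assume k: "k \<in> K" "k' \<in> K" "wt k = wt k'"
      have i: "fst k \<in> {1..n}" using k(1) by (auto simp: K_def)
      have "wt k (h (fst k)) = wt k' (h (fst k))" using k(3) by simp
      then have "pm k * 2 = (if fst k = fst k' then pm k' * 2 else 0)" using wth[OF k(1) i] wth[OF k(2) i] by simp
      then show "k = k'" by (auto simp: pm_def prod_eq_iff split: if_splits)
    qed
  next
    fix a b assume "a \<in> hh" "b \<in> hh"
    moreover have "e6_br v w \<in> {0}" if "v \<in> h ` {1..n}" "w \<in> h ` {1..n}" for v w using hh0 that by auto
    ultimately show "e6_br a b = 0" using e6_br_span[of "h ` {1..n}" "h ` {1..n}" "{0}"] unfolding hh_def by simp
  next
    fix k assume k: "k \<in> K"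
    then have i: "fst k \<in> {1..n}" by (auto simp: K_def)
    show "l.linear_form_on hh (wt k)" unfolding l.linear_form_on_def
    proof (intro conjI ballI allI impI)
      fix a b assume "a \<in> hh" "b \<in> hh"
      then obtain c d where cd: "a = (\<Sum>j\<in>{1..n}. e6_scale (c j) (h j))" "b = (\<Sum>j\<in>{1..n}. e6_scale (d j) (h j))" using hz by meson
      then have "a + b = (\<Sum>j\<in>{1..n}. e6_scale (c j + d j) (h j))" by (simp add: sum.distrib e6.scale_left_distrib)
      then show "wt k (a + b) = wt k a + wt k b" using wt[OF k] cd by (simp only: distrib_left)
    next
      fix l a assume "a \<in> hh"
      then obtain c where c: "a = (\<Sum>j\<in>{1..n}. e6_scale (c j) (h j))" using hz by meson
      then have "e6_scale l a = (\<Sum>j\<in>{1..n}. e6_scale (l * c j) (h j))" by (simp add: e6.scale_sum_right)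
      then show "wt k (e6_scale l a) = l * wt k a" using wt[OF k] c by (simp only: mult_ac)
    qed (simp add: wt_def)
    have "wt k (h (fst k)) \<noteq> 0" using wth[OF k i] by (simp add: pm_def)
    then show "wt k \<noteq> (\<lambda>x. 0)" by metis
    have "e k \<in> ?L" using gL[OF i] by (simp add: e_def)
    moreover have "e6_br z (e k) = e6_scale (wt k z) (e k)" if z: "z \<in> hh" for z
    proof -
      obtain c where c: "z = (\<Sum>j\<in>{1..n}. e6_scale (c j) (h j))" using hz[OF z] by blast
      show ?thesis unfolding c wt[OF k] by (rule brx[OF k])
    qed
    ultimately show "e k \<in> l.root_space hh (wt k)" unfolding l.root_space_def by blast
    show "e k \<noteq> 0" using mem(3)[OF i] y0[OF i] by (simp add: e_def)
  qed
  have iK: "(i, b) \<in> K" if "i \<in> {1..n}" for i b using that by (simp add: K_def)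
  have "l.dynkin_base hh n (\<lambda>i. wt (i, True)) {}"
  proof (rule d.dynkin_baseI)
    show "i \<in> {1..n} \<Longrightarrow> (i, True) \<in> K" for i by (rule iK)
  next
    fix c i assume c: "\<And>z. z \<in> hh \<Longrightarrow> (\<Sum>i=1..n. c i * wt (i, True) z) = 0" and i: "i \<in> {1..n}"
    have "(\<Sum>j=1..n. c j * wt (j, True) (h i)) = (\<Sum>j=1..n. if j = i then c j * 2 else 0)"
      by (intro sum.cong) (auto simp: wth[OF iK i] pm_def)
    then show "c i = 0" using c[OF hhh[OF i]] i by simp
  next
    fix k assume k: "k \<in> K"
    define m :: "nat \<Rightarrow> int" where "m i = (if i = fst k then if snd k then 1 else -1 else 0)" for i
    have i: "fst k \<in> {1..n}" using k by (auto simp: K_def)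
    have "wt k z = (\<Sum>j=1..n. of_int (m j) * wt (j, True) z)" for z
    proof -
      have "(\<Sum>j=1..n. of_int (m j) * wt (j, True) z) = (\<Sum>j=1..n. if j = fst k then pm k * wt (fst k, True) z else 0)"
        by (intro sum.cong) (auto simp: m_def pm_def)
      also have "\<dots> = pm k * wt (fst k, True) z" using i by simp
      also have "\<dots> = wt k z" by (simp add: wt_def pm_def)
      finally show ?thesis by simp
    qed
    moreover have "(\<forall>i\<in>{1..n}. m i \<ge> 0) \<or> (\<forall>i\<in>{1..n}. m i \<le> 0)" by (auto simp: m_def)
    ultimately show "\<exists>m. (\<forall>z\<in>hh. wt k z = (\<Sum>i=1..n. of_int (m i) * wt (i, True) z)) \<and>
        ((\<forall>i\<in>{1..n}. m i \<ge> 0) \<or> (\<forall>i\<in>{1..n}. m i \<le> 0))" by blast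
  next
    fix j assume j: "j \<in> {1..n}"
    have "e6_br z (y j) = e6_scale (- wt (j, True) z) (y j)" if "z \<in> hh" for z
      using d.br_e[OF iK[OF j, of False] that] by (simp add: e_def wt_def pm_def)
    then have "y j \<in> l.root_space hh (\<lambda>z. - wt (j, True) z)" unfolding l.root_space_def using gL(2)[OF j] by blast
    moreover have "e6_br (e (j, True)) (y j) = h j" by (simp add: e_def h_def)
    moreover have "wt (i, True) (h j) = (if i = j then 2 else if {i, j} \<in> {} then - 1 else 0)" if "i \<in> {1..n}" for i
      using wth[OF iK[OF that] j] by (auto simp: pm_def)
    ultimately show "\<exists>z\<in>l.root_space hh (\<lambda>z. - wt (j, True) z). e6_br (e (j, True)) z \<in> hh \<and>
        (\<forall>i\<in>{1..n}. wt (i, True) (e6_br (e (j, True)) z) = (if i = j then 2 else if {i, j} \<in> {} then - 1 else 0))"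
      using hhh[OF j] by (intro bexI[of _ "y j"]) simp_all
  qed
  moreover have "l.semisimple"
  proof (rule d.semisimple_root_datum)
    fix k assume k: "k \<in> K"
    then have i: "fst k \<in> {1..n}" by (auto simp: K_def)
    show "\<exists>z\<in>?L. e6_br (e6_br (e k) z) (e k) \<noteq> 0"
    proof (cases "snd k")
      case True
      then show ?thesis using br(4)[OF i i] mem(3)[OF i] gL(2)[OF i]
        by (intro bexI[of _ "y (fst k)"]) (simp_all add: e_def h_def[symmetric])
    next
      case False
      have "e6_br (y (fst k)) (x (fst k)) = e6_scale (-1) (h (fst k))"
        using e6_br_antisym[of "y (fst k)" "x (fst k)"] by (simp add: h_def)
      then have "e6_br (e6_br (y (fst k)) (x (fst k))) (y (fst k)) = e6_scale (-1) (e6_scale (if fst k = fst k then -2 else 0) (y (fst k)))"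
        by (simp only: e6_br_scale_left br(5)[OF i i])
      then show ?thesis using False y0[OF i] gL(1)[OF i]
        by (intro bexI[of _ "x (fst k)"]) (simp_all add: e_def)
    qed
  next
    fix z assume z: "z \<in> hh" and w: "\<And>k. k \<in> K \<Longrightarrow> wt k z = 0"
    obtain c where c: "z = (\<Sum>j\<in>{1..n}. e6_scale (c j) (h j))" using hz[OF z] by blast
    have "c j = 0" if "j \<in> {1..n}" for j
      using w[OF iK[OF that, of True]] wt[OF iK[OF that, of True], of c] by (simp add: c pm_def)
    then show "z = 0" unfolding c by (intro sum.neutral) simp
  qed
  ultimately show "l.dynkin_type n {}" unfolding l.dynkin_type_def by blast
qed

section \<open>Supports\<close>

subsection \<open>Lie algebras of the standard tori\<close>

text \<open>A linear equation valid on \<open>H\<close> holds along every curve in \<open>H\<close>,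
  so it passes to the derivative. This bounds the tangent space from above.\<close>

lemma lie_of_group_linear:
  fixes f :: "spinor_mat \<times> complex \<Rightarrow> complex"
  assumes f: "bounded_linear f" and H: "\<And>h. h \<in> H \<Longrightarrow> f h = 0" and u: "u \<in> lie_of_group H"
  shows "f u = 0"
proof -
  obtain c :: "real \<Rightarrow> spinor_mat \<times> complex" where c: "\<And>\<tau>. c \<tau> \<in> H" "(c has_vector_derivative u) (at 0)"
    using u unfolding lie_of_group_def by blast
  have "((\<lambda>\<tau>. f (c \<tau>)) has_vector_derivative f u) (at 0)" by (rule bounded_linear.has_vector_derivative[OF f c(2)])
  moreover have "(\<lambda>\<tau>. f (c \<tau>)) = (\<lambda>\<tau>. 0)" using c(1) H by blast
  moreover have "((\<lambda>\<tau>. 0 :: complex) has_vector_derivative 0) (at (0 :: real))" by (rule has_vector_derivative_const)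
  ultimately show ?thesis using vector_derivative_unique_at by metis
qed

lemma scaleR_spinor_mat: "r *\<^sub>R (A :: spinor_mat) = cmat (of_real r) A"
  by (simp add: vec_eq_iff) (simp add: scaleR_conv_of_real)

lemma bounded_linear_component: "bounded_linear (\<lambda>u :: spinor_mat \<times> complex. fst u $ I $ J)"
  by (intro bounded_linear_compose[OF bounded_linear_vec_nth] bounded_linear_fst)

lemma bounded_linear_cj: "bounded_linear (cj g g')"
  unfolding linear_conv_bounded_linear[symmetric]
  by (rule linearI) (simp_all add: cj_def scaleR_spinor_mat matrix_add_ldistrib matrix_add_rdistrib')

lemma lie_of_group_cj:
  assumes "g ** g' = mat 1" "u \<in> lie_of_group H" shows "cj g g' u \<in> lie_of_group (cj g g' ` H)"
proof -
  obtain c :: "real \<Rightarrow> spinor_mat \<times> complex" where c: "\<And>\<tau>. c \<tau> \<in> H" "c 0 = (mat 1, 1)" "(c has_vector_derivative u) (at 0)"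
    using assms(2) unfolding lie_of_group_def by blast
  have "((\<lambda>\<tau>. cj g g' (c \<tau>)) has_vector_derivative cj g g' u) (at 0)"
    by (rule bounded_linear.has_vector_derivative[OF bounded_linear_cj c(3)])
  moreover have "cj g g' (c 0) = (mat 1, 1)" by (simp add: c(2) cj_def assms(1))
  moreover have "\<forall>\<tau>. cj g g' (c \<tau>) \<in> cj g g' ` H" using c(1) by blast
  ultimately show ?thesis unfolding lie_of_group_def by (intro CollectI exI[of _ "\<lambda>\<tau>. cj g g' (c \<tau>)"]) blast
qed

text \<open>The derivative at the identity of the conditions \<open>prod m I = 1\<close> that define
  \<open>Tst S\<close>, for \<open>m i\<close> the exponential of \<open>- b i\<close>.\<close>

definition vanishing :: "5 set set \<Rightarrow> (5 \<Rightarrow> complex) \<Rightarrow> bool" where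
  "vanishing S b \<longleftrightarrow> (\<forall>I\<in>S. sum b I = 0)"

lemma sum_sgn_in: "(\<Sum>i\<in>UNIV. sgn_in I i * b i) = sum b UNIV / 2 - sum b I"
proof -
  have "(\<Sum>i\<in>UNIV. sgn_in I i * b i) = (\<Sum>i\<in>UNIV. b i / 2 - (if i \<in> I then b i else 0))"
    by (intro sum.cong) (auto simp: sgn_in_def)
  then show ?thesis by (simp add: sum_subtractf sum_divide_distrib sum.If_cases)
qed

lemma lie_Tst_component:
  assumes u: "u \<in> lie_of_group (Tst S)"
  shows "I \<noteq> J \<Longrightarrow> fst u $ I $ J = 0" "I \<in> S \<Longrightarrow> fst u $ I $ I = fst u $ {} $ {}"
proof -
  have entry: "I \<noteq> J \<Longrightarrow> fst h $ I $ J = 0" "I \<in> S \<Longrightarrow> fst h $ I $ I = fst h $ {} $ {}" if h: "h \<in> Tst S" for h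
  proof -
    obtain l m c where "h = (dg l m, c)" "\<forall>I\<in>S. prod m I = 1" using h unfolding Tst_def by blast
    then show "I \<noteq> J \<Longrightarrow> fst h $ I $ J = 0" "I \<in> S \<Longrightarrow> fst h $ I $ I = fst h $ {} $ {}"
      by (simp_all only: dg_component fst_conv if_False if_True) simp
  qed
  show "fst u $ I $ J = 0" if "I \<noteq> J"
    by (rule lie_of_group_linear[OF bounded_linear_component _ u]) (simp add: entry(1)[OF _ that])
  have "fst u $ I $ I - fst u $ {} $ {} = 0" if "I \<in> S"
    by (rule lie_of_group_linear[OF bounded_linear_sub[OF bounded_linear_component bounded_linear_component] _ u])
       (simp add: entry(2)[OF _ that])
  then show "I \<in> S \<Longrightarrow> fst u $ I $ I = fst u $ {} $ {}" by simp
qed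

text \<open>The tangent vector belongs to the one-parameter group with \<open>l\<close> the
  exponential of half the sum of the \<open>b i\<close> and \<open>m i\<close> the exponential of
  \<open>- b i\<close>, each multiplied by the time.\<close>

lemma lie_Tst_cart:
  assumes "vanishing S b" shows "(cart b, z) \<in> lie_of_group (Tst S)"
proof -
  define w where "w I = (\<Sum>i\<in>UNIV. sgn_in I i * b i)" for I :: "5 set"
  \<comment> \<open>The curve is written as a sum of linear images of scalar exponentials, one for
    each diagonal entry, so that it can be differentiated term by term.\<close>
  define F where "F I k = (cmat k (\<chi> J K. if J = I \<and> K = I then 1 else 0), 0 :: complex)" for I :: "5 set" and k
  define c where "c \<tau> = (\<Sum>I\<in>UNIV. F I (exp (\<tau> *\<^sub>R w I))) + (0, exp (\<tau> *\<^sub>R z))" for \<tau> :: real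
  have sumF: "(\<Sum>I\<in>UNIV. F I (k I)) = ((\<chi> J K. if J = K then k J else 0), 0)" for k
  proof -
    have "(\<Sum>I\<in>UNIV. fst (F I (k I)) $ J $ K) = (if J = K then k J else 0)" for J K
    proof -
      have "(\<Sum>I\<in>UNIV. fst (F I (k I)) $ J $ K) = (\<Sum>I\<in>UNIV. if I = J then if J = K then k J else 0 else 0)"
        by (intro sum.cong) (auto simp: F_def)
      then show ?thesis by simp
    qed
    moreover have "snd (F I (k I)) = 0" for I by (simp add: F_def)
    ultimately show ?thesis by (simp add: prod_eq_iff fst_sum snd_sum vec_eq_iff sum_component)
  qed
  have linF: "bounded_linear (F I)" for I
    unfolding linear_conv_bounded_linear[symmetric]
    by (rule linearI) (simp_all add: F_def scaleR_spinor_mat mat.scale_left_distrib scaleR_conv_of_real)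
  have linz: "bounded_linear (\<lambda>k :: complex. (0 :: spinor_mat, k))"
    by (rule bounded_linear_Pair[OF bounded_linear_zero bounded_linear_ident])
  have ex: "((\<lambda>\<tau>. exp (\<tau> *\<^sub>R k)) has_vector_derivative k) (at 0)" for k :: complex
    using exp_scaleR_has_vector_derivative_right[of k 0 UNIV] by simp
  have "(c has_vector_derivative ((\<Sum>I\<in>UNIV. F I (w I)) + (0, z))) (at 0)"
    unfolding c_def
    by (intro has_vector_derivative_add has_vector_derivative_sum bounded_linear.has_vector_derivative[OF linF]
        bounded_linear.has_vector_derivative[OF linz] ex)
  moreover have "(\<Sum>I\<in>UNIV. F I (w I)) + (0, z) = (cart b, z)"
    unfolding sumF by (simp add: prod_eq_iff vec_eq_iff cart_component w_def)
  moreover have ct: "c \<tau> = (dg (exp (\<tau> *\<^sub>R (sum b UNIV / 2))) (\<lambda>i. exp (\<tau> *\<^sub>R (- b i))), exp (\<tau> *\<^sub>R z))" for \<tau>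
  proof -
    have "exp (\<tau> *\<^sub>R w I) = exp (\<tau> *\<^sub>R (sum b UNIV / 2)) * (\<Prod>i\<in>I. exp (\<tau> *\<^sub>R (- b i)))" for I
      unfolding exp_sum[OF finite, symmetric] exp_add[symmetric] w_def sum_sgn_in scaleR_sum_right[symmetric]
      by (simp add: sum_negf scaleR_diff_right)
    then show ?thesis unfolding c_def sumF by (simp add: prod_eq_iff vec_eq_iff dg_component)
  qed
  have "c \<tau> \<in> Tst S" for \<tau>
  proof -
    have "(exp (\<tau> *\<^sub>R (sum b UNIV / 2)))\<^sup>2 * (\<Prod>i\<in>UNIV. exp (\<tau> *\<^sub>R (- b i))) = 1"
      unfolding exp_sum[OF finite, symmetric] power2_eq_square exp_add[symmetric] scaleR_sum_right[symmetric]
        scaleR_add_right[symmetric] by (simp add: sum_negf)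
    moreover have "(\<Prod>i\<in>I. exp (\<tau> *\<^sub>R (- b i))) = 1" if "I \<in> S" for I
      unfolding exp_sum[OF finite, symmetric] scaleR_sum_right[symmetric]
      using assms that by (simp add: sum_negf vanishing_def)
    ultimately show ?thesis unfolding ct Tst_def using exp_not_eq_zero by blast
  qed
  moreover have "c 0 = (mat 1, 1)" unfolding ct using dg_one by simp
  ultimately show ?thesis unfolding lie_of_group_def by auto
qed

subsection \<open>Centralizers of the standard tori\<close>

definition support_roots :: "5 set set \<Rightarrow> e6_root set" where
  "support_roots S = Pos ` insert {} S \<union> Neg ` insert {} S"

lemma std_even: "std S \<Longrightarrow> I \<in> insert {} S \<Longrightarrow> even (card I)"
  unfolding std_def by (auto simp: card_compl_single)

lemma support_roots_KE: "std S \<Longrightarrow> support_roots S \<subseteq> KE"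
  unfolding support_roots_def KE_def using std_even by blast

lemma sum_ind: "sum (ind j) I = (if j \<in> I then 1 else 0)"
  by (simp add: if_distrib cong: if_cong)

text \<open>Testing with \<open>ind a\<close> and with differences of two other unit vectors shows
  that \<open>J\<close> omits \<open>a\<close> and contains either all or none of the other
  elements.\<close>

lemma vanishing_subset:
  assumes S: "std S" and J: "\<And>b. vanishing S b \<Longrightarrow> sum b J = 0"
  shows "J \<in> insert {} S"
proof (cases "S = {}")
  case True
  then have z: "sum (ind j) J = 0" for j by (intro J) (simp add: vanishing_def)
  have "j \<notin> J" for j using z[of j] unfolding sum_ind by (simp split: if_splits)
  then show ?thesis by blast
next
  case False
  then obtain a where a: "S = {- {a}}" using S unfolding std_def by blast
  have "sum (ind a) J = 0" by (intro J) (simp add: a vanishing_def sum_ind)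
  then have aJ: "a \<notin> J" by (simp add: sum_ind split: if_splits)
  have same: "i \<in> J \<longleftrightarrow> j \<in> J" if "i \<noteq> a" "j \<noteq> a" for i j
  proof -
    have "sum (\<lambda>l. ind i l - ind j l) J = 0"
      by (intro J) (use that in \<open>simp add: a vanishing_def sum_subtractf sum_ind\<close>)
    then show ?thesis by (simp add: sum_subtractf sum_ind split: if_splits)
  qed
  show ?thesis
  proof (cases "J = {}")
    case False
    then obtain i where i: "i \<in> J" by blast
    then have "i \<noteq> a" using aJ by blast
    then have "j \<in> J \<longleftrightarrow> j \<in> - {a}" for j using same[of i j] i aJ by (cases "j = a") simp_all
    then have "J = - {a}" by (rule set_eqI)
    then show ?thesis using a by simp
  qed simp
qed

text \<open>If the root involves the coordinate \<open>a\<close>, then \<open>ind a\<close> serves.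
  Otherwise a unit vector at one of its two coordinates is corrected at an index different from
  \<open>a\<close> and both coordinates, which exists because there are five indices.\<close>

lemma vanishing_vec:
  assumes S: "std S" and P: "vec_pair P"
  obtains b where "vanishing S b" "lin (Vec P) b 0 \<noteq> 0"
proof (cases "S = {}")
  case True
  then show thesis using that lin_nz[of "Vec P"] P by (auto simp: KE_def vanishing_def)
next
  case False
  note res = that
  obtain a where a: "S = {- {a}}" using False S unfolding std_def by blast
  obtain p q where pq: "P = {p, q}" "p \<noteq> q" "q \<noteq> dual_index p" using P unfolding vec_pair_def by blast
  have L: "lin (Vec P) (ind j) 0 = (if Inl j \<in> P then 1 else if Inr j \<in> P then -1 else 0)" for j
    by (rule lin_Vec_ind[OF P])
  define ix :: "5 + 5 \<Rightarrow> 5" where "ix = case_sum (\<lambda>i. i) (\<lambda>i. i)"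
  have L0: "lin (Vec P) (ind j) 0 \<noteq> 0 \<longleftrightarrow> j \<in> {ix p, ix q}" for j
    unfolding L unfolding pq(1) by (cases p; cases q) (auto simp: ix_def simp del: lin.simps)
  show thesis
  proof (cases "a \<in> {ix p, ix q}")
    case True
    then show thesis using L0 by (intro res[of "ind a"]) (simp_all add: a vanishing_def sum_ind del: lin.simps)
  next
    case False
    have "card {a, ix p, ix q} \<le> 3" using card_length[of "[a, ix p, ix q]"] by simp
    then have "{a, ix p, ix q} \<noteq> UNIV" by (intro notI) simp
    then obtain l where l: "l \<notin> {a, ix p, ix q}" by blast
    have "lin (Vec P) (\<lambda>i. ind (ix p) i + (-1) * ind l i) (0 + (-1) * 0) = lin (Vec P) (ind (ix p)) 0 + (-1) * lin (Vec P) (ind l) 0"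
      unfolding lin_linear ..
    then have "lin (Vec P) (\<lambda>i. ind (ix p) i + (-1) * ind l i) 0 \<noteq> 0" using L0[of "ix p"] L0[of l] l by (simp del: lin.simps)
    moreover have "vanishing S (\<lambda>i. ind (ix p) i + (-1) * ind l i)"
      using l False by (auto simp: a vanishing_def sum_subtractf sum_ind)
    ultimately show thesis by (rule res[rotated])
  qed
qed

text \<open>The central direction shows that \<open>d\<close> is the degree of the root. In degree 1
  or -1 comparison with the weight of \<open>{}\<close> leaves the condition of
  \<open>vanishing_subset\<close>; degree 0 is excluded by \<open>vanishing_vec\<close>.\<close>

lemma support_roots_char:
  assumes S: "std S" and k: "k \<in> KE" and eq: "\<And>b z. vanishing S b \<Longrightarrow> lin k b z = d * lin (Pos {}) b z"
  shows "k \<in> support_roots S" "of_int (degE k) = d"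
proof -
  have "vanishing S (\<lambda>_. 0)" by (simp add: vanishing_def)
  from eq[OF this, of 1] show d: "of_int (degE k) = d" unfolding lin_degE by simp
  have P: "lin (Pos J) b z = sum b UNIV / 2 - sum b J + z" for J b z by (simp add: sum_sgn_in)
  have N: "lin (Neg J) b z = - lin (Pos J) b z" for J b z by simp
  show "k \<in> support_roots S"
  proof (cases k)
    case (Pos J)
    then have "d = 1" using d by simp
    then have "J \<in> insert {} S" using eq[of _ 0] by (intro vanishing_subset[OF S]) (simp add: Pos P del: lin.simps)
    then show ?thesis unfolding support_roots_def Pos by blast
  next
    case (Neg J)
    then have "d = -1" using d by simp
    then have "J \<in> insert {} S" using eq[of _ 0] by (intro vanishing_subset[OF S]) (simp add: Neg N P del: lin.simps)
    then show ?thesis unfolding support_roots_def Neg by blast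
  next
    case (Vec P)
    then have "vec_pair P" using k by (auto simp: KE_def)
    then obtain b where b: "vanishing S b" "lin (Vec P) b 0 \<noteq> 0" by (rule vanishing_vec[OF S])
    then show ?thesis using eq[OF b(1), of 0] d Vec by (simp del: lin.simps(3))
  qed
qed

lemma diagonal_mv:
  assumes "\<And>I J. I \<noteq> J \<Longrightarrow> A $ I $ J = 0" shows "(A *v x) $ I = A $ I $ I * (x :: spinor) $ I"
proof -
  have "(A *v x) $ I = (\<Sum>J\<in>UNIV. if J = I then A $ I $ I * x $ I else 0)"
    unfolding matrix_vector_mult_def vec_lambda_beta using assms by (intro sum.cong) auto
  then show ?thesis by simp
qed

lemma diagonal_cart_commute:
  assumes "\<And>I J. I \<noteq> J \<Longrightarrow> A $ I $ J = 0" shows "A ** cart b = cart b ** A"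
proof -
  have "A *v (cart b *v x) = cart b *v (A *v x)" for x
    by (rule vec_eq_iff[THEN iffD2, OF allI]) (simp add: diagonal_mv[OF assms] cart_mv mult.left_commute)
  then show ?thesis by (simp add: matrix_eq matrix_vector_mul_assoc)
qed

text \<open>An element of degree \<open>d\<close> is expanded in root vectors, which are
  eigenvectors of the Cartan elements tangent to the torus; a nonzero coefficient forces the root to
  be \<open>d\<close> times the weight of \<open>{}\<close> on all of these. For the other inclusion
  it is enough that tangent vectors are diagonal and have equal entries at the indices of the normal
  form.\<close>

lemma centralizer_Tst:
  assumes S: "std S" and \<phi>: "\<And>u. u \<in> lie_of_group (Tst S) \<Longrightarrow> \<phi> u = fst u $ {} $ {} + snd u"
  shows "e6_centralizer (lie_of_group (Tst S)) \<phi> = e6.span (hE \<union> eE ` support_roots S)"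
proof
  let ?t = "lie_of_group (Tst S)" and ?V = "e6.span (hE \<union> eE ` support_roots S)"
  have hel: "deg0 (cart b, z) = hel b z" for b z by (simp add: deg0_def hel_def)
  have phi_cart: "\<phi> (cart b, z) = lin (Pos {}) b z" if "vanishing S b" for b z
    using \<phi>[OF lie_Tst_cart[OF that]] by (simp add: cart_component)
  have "x \<in> ?V" if x: "x \<in> e6_centralizer_deg ?t \<phi> d" for x d
  proof -
    have xd: "x \<in> e6_deg d" "\<And>u. u \<in> ?t \<Longrightarrow> e6_br (deg0 u) x = e6_scale (of_int d * \<phi> u) x"
      using x unfolding e6_centralizer_deg_def by auto
    have "x \<in> e6" unfolding e6_def using xd(1) by (intro e6.span_base) blast
    then obtain h' c where hc: "h' \<in> hE" "x = h' + (\<Sum>k\<in>KE. e6_scale (c k) (eE k))" by (rule E6.decomp)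
    have "e6_scale (c k) (eE k) \<in> ?V" if k: "k \<in> KE" for k
    proof (cases "c k = 0")
      case False
      have "lin k b z = of_int d * lin (Pos {}) b z" if b: "vanishing S b" for b z
        using E6.eigen_decomp(2)[OF hc(1) hel_hE[of b z] _ k, of c "of_int d * \<phi> (cart b, z)"]
          xd(2)[OF lie_Tst_cart[OF b, of z]] False phi_cart[OF b] by (simp add: hel hc(2)[symmetric])
      then have "k \<in> support_roots S" by (rule support_roots_char(1)[OF S k])
      then show ?thesis by (intro e6.span_scale e6.span_base) blast
    qed (simp add: e6.span_zero)
    moreover have "h' \<in> ?V" using hc(1) by (intro e6.span_base) blast
    ultimately show ?thesis unfolding hc(2) by (intro e6.span_add e6.span_sum)
  qed
  then show "e6_centralizer ?t \<phi> \<subseteq> ?V"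
    unfolding e6_centralizer_def by (intro e6.span_minimal e6.subspace_span) blast
  have "x \<in> e6_centralizer_deg ?t \<phi> 0" if x: "x \<in> hE" for x
  proof -
    obtain b z where bz: "x = hel b z" using x unfolding hE_def by blast
    have br: "e6_br (deg0 u) x = 0" if u: "u \<in> ?t" for u
    proof -
      obtain A c where Ac: "u = (A, c)" by (cases u)
      have "A ** cart b = cart b ** A" using lie_Tst_component(1)[OF u] Ac by (intro diagonal_cart_commute) simp
      then show ?thesis by (simp add: bz hel_def deg0_def zero_prod_def Ac)
    qed
    have "x \<in> e6_deg 0" unfolding e6_deg_0 bz hel_def deg0_def using cart_soA by blast
    then show ?thesis unfolding e6_centralizer_deg_def using br by simp
  qed
  moreover have "eE (Pos I) \<in> e6_centralizer_deg ?t \<phi> 1 \<and> eE (Neg I) \<in> e6_centralizer_deg ?t \<phi> (-1)"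
    if I: "I \<in> insert {} S" for I
  proof -
    have XI: "axis I 1 \<in> X" using std_even[OF S I] by (simp add: X_axis)
    have br: "e6_br (deg0 u) (eE (Pos I)) = e6_scale (\<phi> u) (eE (Pos I)) \<and>
       e6_br (deg0 u) (eE (Neg I)) = e6_scale (- \<phi> u) (eE (Neg I))" if u: "u \<in> ?t" for u
    proof -
      obtain A c where Ac: "u = (A, c)" by (cases u)
      have A: "A $ I $ J = 0" if "I \<noteq> J" for I J using lie_Tst_component(1)[OF u that] Ac by simp
      have "A $ I $ I = A $ {} $ {}" using lie_Tst_component(2)[OF u, of I] I Ac by auto
      then have e: "A $ I $ I + c = \<phi> u" using \<phi>[OF u] Ac by simp
      have At: "transpose A $ I $ J = 0" if "I \<noteq> J" for I J using A[of J I] that by (simp add: transpose_def)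
      have "A *v axis I 1 = A $ I $ I *s axis I 1"
        by (rule vec_eq_iff[THEN iffD2, OF allI]) (simp add: diagonal_mv[OF A] axis_component)
      moreover have "transpose A *v axis I 1 = A $ I $ I *s axis I 1"
        by (rule vec_eq_iff[THEN iffD2, OF allI]) (simp add: diagonal_mv[OF At] axis_component, simp add: transpose_def)
      ultimately show ?thesis
        by (simp add: Ac deg0_def zero_prod_def e6_scale_pair e[unfolded Ac, symmetric] vec.scale_left_distrib)
    qed
    have "eE (Pos I) \<in> e6_deg 1" "eE (Neg I) \<in> e6_deg (-1)" unfolding e6_deg_1 e6_deg_m1 using XI by simp_all
    then show ?thesis unfolding e6_centralizer_deg_def using br by simp
  qed
  ultimately have "hE \<union> eE ` support_roots S \<subseteq> (\<Union>d. e6_centralizer_deg ?t \<phi> d)"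
    unfolding support_roots_def by blast
  then show "?V \<subseteq> e6_centralizer ?t \<phi>" unfolding e6_centralizer_def by (rule e6.span_mono)
qed

subsection \<open>The derived algebra of the centralizer\<close>

lemma ex_other_index: obtains l :: 5 where "l \<notin> {a, i, j}"
proof -
  have "card {a, i, j} \<le> 3" using card_length[of "[a, i, j]"] by simp
  then have "{a, i, j} \<noteq> UNIV" by (intro notI) simp
  then show thesis using that by blast
qed

text \<open>The two indices are \<open>{}\<close> and \<open>- {a}\<close>. They differ in four
  elements, too many for two toggles, and by \<open>sgn_in_product\<close> this makes the two roots
  orthogonal.\<close>

lemma std_far:
  assumes S: "std S" and IJ: "I \<in> insert {} S" "J \<in> insert {} S" "I \<noteq> J"
  shows "fl j (fl i J) \<noteq> I" "card {j. (j \<in> I) \<noteq> (j \<in> J)} = 4"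
proof -
  obtain a where a: "I = {} \<and> J = - {a} \<or> I = - {a} \<and> J = {}" using S IJ unfolding std_def by blast
  obtain l where l: "l \<notin> {a, i, j}" by (rule ex_other_index)
  have "l \<in> I \<longleftrightarrow> l \<notin> J" using a l by auto
  moreover have "l \<in> fl j (fl i J) \<longleftrightarrow> l \<in> J" using l by (simp add: mem_fl)
  ultimately show "fl j (fl i J) \<noteq> I" by blast
  have "{j. (j \<in> I) \<noteq> (j \<in> J)} = - {a}" using a by auto
  then show "card {j. (j \<in> I) \<noteq> (j \<in> J)} = 4" by (simp add: card_compl_single)
qed

lemma br_same_degree: "e6_br (eE (Pos I)) (eE (Pos J)) = 0" "e6_br (eE (Neg I)) (eE (Neg J)) = 0"
  by (simp_all add: zero_prod_def)

lemma br_opposite: "e6_br (eE (Pos I)) (eE (Neg I)) = hel (sgn_in I) (3/4)"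
  by (simp add: hel_def zero_prod_def moment_axis_same)

lemma br_far:
  assumes "std S" "I \<in> insert {} S" "J \<in> insert {} S" "I \<noteq> J"
  shows "e6_br (eE (Pos I)) (eE (Neg J)) = 0"
  using moment_axis_far[OF assms(4) std_far(1)[OF assms]] by (simp add: zero_prod_def)

lemma br_coroot:
  assumes "std S" "I \<in> insert {} S" "J \<in> insert {} S"
  shows "e6_br (hel (sgn_in I) (3/4)) (eE (Pos J)) = e6_scale (if I = J then 2 else 0) (eE (Pos J))"
    "e6_br (hel (sgn_in I) (3/4)) (eE (Neg J)) = e6_scale (if I = J then -2 else 0) (eE (Neg J))"
proof -
  have "Pos J \<in> KE" "Neg J \<in> KE" using std_even[OF assms(1,3)] by (auto simp: KE_def)
  moreover have "lin (Pos J) (sgn_in I) (3/4) = (if I = J then 2 else 0)" "lin (Neg J) (sgn_in I) (3/4) = (if I = J then -2 else 0)"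
    unfolding lin.simps sgn_in_product using std_far(2)[OF assms] by simp_all
  ultimately show "e6_br (hel (sgn_in I) (3/4)) (eE (Pos J)) = e6_scale (if I = J then 2 else 0) (eE (Pos J))"
    "e6_br (hel (sgn_in I) (3/4)) (eE (Neg J)) = e6_scale (if I = J then -2 else 0) (eE (Neg J))"
    by (simp_all only: br_hel_eE)
qed

lemma sl2_family_std:
  assumes S: "std S" and f: "bij_betw f {1..n} (insert {} S)"
  shows "sl2_family n (\<lambda>i. eE (Pos (f i))) (\<lambda>i. eE (Neg (f i)))"
proof -
  have fS: "f i \<in> insert {} S" if "i \<in> {1..n}" for i using f that unfolding bij_betw_def by blast
  have inj: "f i = f j \<longleftrightarrow> i = j" if "i \<in> {1..n}" "j \<in> {1..n}" for i j
    using f that unfolding bij_betw_def inj_on_def by blast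
  have mem: "Pos (f i) \<in> KE" "Neg (f i) \<in> KE" if "i \<in> {1..n}" for i
    using std_even[OF S fS[OF that]] by (simp_all add: KE_def)
  show ?thesis unfolding sl2_family_def br_opposite
  proof (intro conjI ballI impI)
    fix i j assume i: "i \<in> {1..n}" and j: "j \<in> {1..n}"
    show "e6_br (eE (Pos (f i))) (eE (Neg (f j))) = 0" if "i \<noteq> j"
      by (rule br_far[OF S fS[OF i] fS[OF j]]) (simp add: inj[OF i j] that)
    show "e6_br (hel (sgn_in (f i)) (3/4)) (eE (Pos (f j))) = e6_scale (if i = j then 2 else 0) (eE (Pos (f j)))"
      "e6_br (hel (sgn_in (f i)) (3/4)) (eE (Neg (f j))) = e6_scale (if i = j then - 2 else 0) (eE (Neg (f j)))"
      using br_coroot[OF S fS[OF i] fS[OF j]] by (simp_all only: inj[OF i j])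
  qed (simp_all only: br_same_degree mem eE_e6 E6.e_nz not_False_eq_True)
qed

text \<open>The Cartan subalgebra is abelian and scales the root vectors, so all brackets stay in
  the sum of the sl(2). Conversely the coroots are brackets of opposite root vectors, and bracketing
  with a coroot gives back 2 or -2 times the root vector.\<close>

lemma derived_centralizer:
  assumes S: "std S" and f: "bij_betw f {1..n} (insert {} S)"
  shows "e6.bracket_span (e6.span (hE \<union> eE ` support_roots S)) (e6.span (hE \<union> eE ` support_roots S))
     = sl2_span n (\<lambda>i. eE (Pos (f i))) (\<lambda>i. eE (Neg (f i)))" (is "e6.bracket_span ?C ?C = ?L")
proof -
  let ?g = "\<lambda>I. {eE (Pos I), eE (Neg I), hel (sgn_in I) (3/4)}"
  have L: "?L = e6.span (\<Union>I\<in>insert {} S. ?g I)"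
    using f unfolding sl2_span_def br_opposite bij_betw_def by (metis (no_types, lifting) SUP_cong UN_extend_simps(10))
  have subL: "e6.subspace ?L" unfolding sl2_span_def by (rule e6.subspace_span)
  have gL: "eE (Pos I) \<in> ?L" "eE (Neg I) \<in> ?L" "hel (sgn_in I) (3/4) \<in> ?L" if "I \<in> insert {} S" for I
    unfolding L using that by (intro e6.span_base; blast)+
  have rL: "eE k \<in> ?L" if "k \<in> support_roots S" for k
    using that gL unfolding support_roots_def by blast
  have zL: "0 \<in> ?L" using subL by (rule e6.subspace_0)
  have negL: "e6_br v w \<in> ?L" if "e6_br w v \<in> ?L" for v w
    using e6.subspace_neg[OF subL that] e6_br_antisym[of v w] by simp
  have hr: "e6_br h (eE k) \<in> ?L" if h: "h \<in> hE" and k: "k \<in> support_roots S" for h k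
  proof -
    have "e6_br h (eE k) = e6_scale (wtE k h) (eE k)" using E6.br_e h k support_roots_KE[OF S] by blast
    then show ?thesis using e6.subspace_scale[OF subL rL[OF k]] by simp
  qed
  have pn: "e6_br (eE (Pos I)) (eE (Neg J)) \<in> ?L" if "I \<in> insert {} S" "J \<in> insert {} S" for I J
    using br_far[OF S that] gL(3)[OF that(1)] zL br_opposite[of I] by (cases "I = J") simp_all
  have rr: "e6_br (eE k) (eE l) \<in> ?L" if "k \<in> support_roots S" "l \<in> support_roots S" for k l
    using that pn negL[OF pn] zL br_same_degree unfolding support_roots_def by auto
  have br: "e6_br a b \<in> ?L" if "a \<in> hE \<union> eE ` support_roots S" "b \<in> hE \<union> eE ` support_roots S" for a b
    using that
  proof (elim UnE imageE)
    show "a \<in> hE \<Longrightarrow> b \<in> hE \<Longrightarrow> ?thesis" using E6.hh_abelian[of a b] zL by simp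
    show "e6_br a b \<in> ?L" if "a \<in> hE" "b = eE l" "l \<in> support_roots S" for l unfolding that(2) by (rule hr[OF that(1,3)])
    show "e6_br a b \<in> ?L" if "a = eE k" "k \<in> support_roots S" "b \<in> hE" for k unfolding that(1) by (rule negL[OF hr[OF that(3,2)]])
    show "e6_br a b \<in> ?L" if "a = eE k" "k \<in> support_roots S" "b = eE l" "l \<in> support_roots S" for k l
      unfolding that(1,3) by (rule rr[OF that(2,4)])
  qed
  show ?thesis
  proof
    show "e6.bracket_span ?C ?C \<subseteq> ?L"
      unfolding e6.bracket_span_def
    proof (rule e6.span_minimal[OF _ subL])
      have "e6_br a b \<in> ?L" if "a \<in> ?C" "b \<in> ?C" for a b by (rule e6_br_span[OF br subL that])
      then show "{e6_br a b | a b. a \<in> ?C \<and> b \<in> ?C} \<subseteq> ?L" by blast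
    qed
    have brI: "e6_br a b \<in> e6.bracket_span ?C ?C" if "a \<in> ?C" "b \<in> ?C" for a b
      unfolding e6.bracket_span_def using that by (intro e6.span_base) blast
    have sub: "e6.subspace (e6.bracket_span ?C ?C)" unfolding e6.bracket_span_def by (rule e6.subspace_span)
    have unscale: "v \<in> e6.bracket_span ?C ?C" if "e6_scale c v \<in> e6.bracket_span ?C ?C" "c \<noteq> 0" for c v
      using e6.subspace_scale[OF sub that(1), of "1 / c"] that(2) by simp
    have "?g I \<subseteq> e6.bracket_span ?C ?C" if I: "I \<in> insert {} S" for I
    proof -
      have C: "eE (Pos I) \<in> ?C" "eE (Neg I) \<in> ?C" "hel (sgn_in I) (3/4) \<in> ?C"
        using I by (auto intro!: e6.span_base simp: support_roots_def simp del: eE.simps)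
      have PN: "e6_scale 2 (eE (Pos I)) \<in> e6.bracket_span ?C ?C" "e6_scale (-2) (eE (Neg I)) \<in> e6.bracket_span ?C ?C"
        using brI[OF C(3,1)] brI[OF C(3,2)] br_coroot[OF S I I] by simp_all
      have "eE (Pos I) \<in> e6.bracket_span ?C ?C" by (rule unscale[OF PN(1)]) simp
      moreover have "eE (Neg I) \<in> e6.bracket_span ?C ?C" by (rule unscale[OF PN(2)]) simp
      ultimately show ?thesis using brI[OF C(1,2)] unfolding br_opposite by blast
    qed
    then show "?L \<subseteq> e6.bracket_span ?C ?C"
      unfolding L by (intro e6.span_minimal[OF _ sub]) blast
  qed
qed

subsection \<open>Conjugation\<close>

definition spin_pair :: "spinor_mat \<Rightarrow> spinor_mat \<Rightarrow> bool" where
  "spin_pair g g' \<longleftrightarrow> g \<in> Spin10 \<and> g' \<in> Spin10 \<and> g ** g' = mat 1 \<and> g' ** g = mat 1"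

lemma transpose_pprod: "transpose (pprod vs) = pprod (map dualv (rev vs))"
  by (induction vs) (simp_all add: matrix_transpose_mul transpose_gamma pprod_append transpose_mat del: foldr_append)

text \<open>The piece of degree -1 is acted on by \<open>transpose g'\<close>, which therefore has
  to preserve \<open>X\<close> as well.\<close>

lemma Spin10_transpose: "s \<in> Spin10 \<Longrightarrow> transpose s \<in> Spin10"
proof -
  assume "s \<in> Spin10"
  then obtain vs where vs: "s = pprod vs" "even (length vs)" "\<forall>v\<in>set vs. quad v = 1" unfolding Spin10_iff by blast
  then show ?thesis unfolding Spin10_iff by (intro exI[of _ "map dualv (rev vs)"]) (simp add: transpose_pprod)
qed

abbreviation Ad :: "spinor_mat \<Rightarrow> spinor_mat \<Rightarrow> e6_vec \<Rightarrow> e6_vec" where "Ad g g' \<equiv> e6_Ad g g' 1"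

lemma Ad_zero: "Ad g g' 0 = 0"
  by (simp add: zero_prod_def)

lemma Ad_br: "spin_pair g g' \<Longrightarrow> e6_br (Ad g g' a) (Ad g g' b) = Ad g g' (e6_br a b)"
  unfolding spin_pair_def by (intro e6_Ad_br Spin10_Om) simp_all

lemma Ad_inverse: "spin_pair g g' \<Longrightarrow> Ad g' g (Ad g g' a) = a"
proof -
  assume g: "spin_pair g g'"
  then have "transpose g *v (transpose g' *v x) = x" "g' *v (g *v x) = x" for x
    by (simp_all add: matrix_vector_mul_assoc matrix_transpose_mul[symmetric] spin_pair_def transpose_mat)
  moreover have "g' ** (g ** A ** g') ** g = (g' ** g) ** A ** (g' ** g)" for A by (simp only: matrix_mul_assoc)
  ultimately show ?thesis using g by (simp add: e6_Ad_pair spin_pair_def)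
qed

lemma Ad_deg0: "Ad g g' (deg0 u) = deg0 (cj g g' u)"
  by (simp add: deg0_def e6_Ad_pair cj_def)

lemma Ad_deg1: "Ad g g' (deg1 x) = deg1 (g *v x)"
  by (simp add: deg1_def e6_Ad_pair zero_prod_def)

lemma Ad_deg: "spin_pair g g' \<Longrightarrow> x \<in> e6_deg i \<Longrightarrow> Ad g g' x \<in> e6_deg i"
proof -
  assume g: "spin_pair g g'" and x: "x \<in> e6_deg i"
  have s: "g \<in> Spin10" "transpose g' \<in> Spin10" using g Spin10_transpose by (auto simp: spin_pair_def)
  consider "i = -1" | "i = 0" | "i = 1" | "i \<noteq> -1" "i \<noteq> 0" "i \<noteq> 1" by blast
  then show ?thesis
  proof cases
    case 1
    then show ?thesis using x Spin10_X[OF s(2)] by (auto simp: e6_deg_m1 zero_prod_def)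
  next
    case 2
    then obtain A c where A: "x = deg0 (A, c)" "A \<in> soA" using x e6_deg_0 by blast
    have "g ** A ** g' \<in> soA" using g A(2) Spin10_conj_soA unfolding spin_pair_def by blast
    then show ?thesis unfolding 2 e6_deg_0 A(1) Ad_deg0 cj_def by auto
  next
    case 3
    then show ?thesis using x Spin10_X[OF s(1)] by (auto simp: e6_deg_1 zero_prod_def)
  next
    case 4
    then show ?thesis using x by (simp add: e6_deg_other Ad_zero)
  qed
qed

lemma Ad_span: "e6.span (Ad g g' ` A) = Ad g g' ` e6.span A"
proof -
  have "module_hom e6_scale e6_scale (Ad g g')"
    using e6.module_axioms by (simp add: module_hom_iff e6_Ad_add e6_Ad_scale)
  then show ?thesis by (rule module_hom.span_image)
qed

lemma Ad_centralizer_deg: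
  assumes g: "spin_pair g g'" and \<phi>: "\<forall>u\<in>t. \<psi> (cj g g' u) = \<phi> u" and x: "x \<in> e6_centralizer_deg t \<phi> i"
  shows "Ad g g' x \<in> e6_centralizer_deg (cj g g' ` t) \<psi> i"
proof -
  have "e6_br (deg0 (cj g g' u)) (Ad g g' x) = e6_scale (of_int i * \<psi> (cj g g' u)) (Ad g g' x)" if u: "u \<in> t" for u
  proof -
    have "e6_br (deg0 (cj g g' u)) (Ad g g' x) = Ad g g' (e6_br (deg0 u) x)" by (simp add: Ad_deg0[symmetric] Ad_br[OF g])
    also have "e6_br (deg0 u) x = e6_scale (of_int i * \<phi> u) x" using x u unfolding e6_centralizer_deg_def by blast
    finally show ?thesis using \<phi> u by (simp only: e6_Ad_scale)
  qed
  moreover have "Ad g g' x \<in> e6_deg i" using x Ad_deg[OF g] unfolding e6_centralizer_deg_def by blast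
  ultimately show ?thesis unfolding e6_centralizer_deg_def by blast
qed

lemma Ad_centralizer:
  assumes g: "spin_pair g g'" and \<phi>: "\<forall>u\<in>t. \<psi> (cj g g' u) = \<phi> u"
  shows "e6_centralizer (cj g g' ` t) \<psi> = Ad g g' ` e6_centralizer t \<phi>"
proof -
  have gg: "g' ** g = mat 1" "spin_pair g' g" using g by (auto simp: spin_pair_def)
  have "e6_centralizer_deg (cj g g' ` t) \<psi> i = Ad g g' ` e6_centralizer_deg t \<phi> i" for i
  proof
    show "Ad g g' ` e6_centralizer_deg t \<phi> i \<subseteq> e6_centralizer_deg (cj g g' ` t) \<psi> i"
      using Ad_centralizer_deg[OF g \<phi>] by blast
    show "e6_centralizer_deg (cj g g' ` t) \<psi> i \<subseteq> Ad g g' ` e6_centralizer_deg t \<phi> i"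
    proof
      fix x assume x: "x \<in> e6_centralizer_deg (cj g g' ` t) \<psi> i"
      have "\<forall>u\<in>cj g g' ` t. \<phi> (cj g' g u) = \<psi> u" using \<phi> cj_cj[OF gg(1)] by auto
      from Ad_centralizer_deg[OF gg(2) this x] have "Ad g' g x \<in> e6_centralizer_deg t \<phi> i"
        unfolding cj_image_inverse[OF gg(1)] .
      then show "x \<in> Ad g g' ` e6_centralizer_deg t \<phi> i" using Ad_inverse[OF gg(2)] by (metis imageI)
    qed
  qed
  then have "(\<Union>i. e6_centralizer_deg (cj g g' ` t) \<psi> i) = Ad g g' ` (\<Union>i. e6_centralizer_deg t \<phi> i)"
    by (simp add: image_UN)
  then show ?thesis unfolding e6_centralizer_def by (simp only: Ad_span)
qed

lemma Ad_bracket_span: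
  assumes g: "spin_pair g g'" shows "e6.bracket_span (Ad g g' ` A) (Ad g g' ` B) = Ad g g' ` e6.bracket_span A B"
proof -
  have "{e6_br x y | x y. x \<in> Ad g g' ` A \<and> y \<in> Ad g g' ` B} = Ad g g' ` {e6_br x y | x y. x \<in> A \<and> y \<in> B}"
  proof (intro set_eqI iffI)
    fix z assume "z \<in> {e6_br x y | x y. x \<in> Ad g g' ` A \<and> y \<in> Ad g g' ` B}"
    then obtain x y where "x \<in> A" "y \<in> B" "z = e6_br (Ad g g' x) (Ad g g' y)" by blast
    then show "z \<in> Ad g g' ` {e6_br x y | x y. x \<in> A \<and> y \<in> B}" unfolding Ad_br[OF g] by blast
  next
    fix z assume "z \<in> Ad g g' ` {e6_br x y | x y. x \<in> A \<and> y \<in> B}"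
    then obtain x y where "x \<in> A" "y \<in> B" "z = e6_br (Ad g g' x) (Ad g g' y)" unfolding Ad_br[OF g] by blast
    then show "z \<in> {e6_br x y | x y. x \<in> Ad g g' ` A \<and> y \<in> Ad g g' ` B}" by blast
  qed
  then show ?thesis unfolding e6.bracket_span_def by (simp only: Ad_span)
qed

lemma Ad_sl2_span: "spin_pair g g' \<Longrightarrow> Ad g g' ` sl2_span n x y = sl2_span n (\<lambda>i. Ad g g' (x i)) (\<lambda>i. Ad g g' (y i))"
  unfolding sl2_span_def Ad_span[symmetric] by (simp add: image_UN Ad_br)

lemma Ad_e6: "spin_pair g g' \<Longrightarrow> x \<in> e6 \<Longrightarrow> Ad g g' x \<in> e6"
proof -
  assume g: "spin_pair g g'" and x: "x \<in> e6"
  have "Ad g g' ` (\<Union>i. e6_deg i) \<subseteq> (\<Union>i. e6_deg i)" using Ad_deg[OF g] by blast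
  then have "Ad g g' ` e6 \<subseteq> e6" unfolding e6_def Ad_span[symmetric] by (rule e6.span_mono)
  then show ?thesis using x by blast
qed

lemma Ad_sl2_family:
  assumes g: "spin_pair g g'" and f: "sl2_family n x y"
  shows "sl2_family n (\<lambda>i. Ad g g' (x i)) (\<lambda>i. Ad g g' (y i))"
proof -
  have "Ad g g' a \<noteq> 0" if "a \<noteq> 0" for a using Ad_inverse[OF g, of a] Ad_zero that by metis
  then show ?thesis using f unfolding sl2_family_def Ad_br[OF g] e6_Ad_scale[symmetric]
    by (simp add: Ad_e6[OF g] Ad_zero)
qed

lemma lie_of_group_conj:
  assumes g: "spin_pair g g'" shows "lie_of_group (cj g g' ` H) = cj g g' ` lie_of_group H"
proof
  have gg: "g ** g' = mat 1" "g' ** g = mat 1" using g by (auto simp: spin_pair_def)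
  show "cj g g' ` lie_of_group H \<subseteq> lie_of_group (cj g g' ` H)" using lie_of_group_cj[OF gg(1)] by blast
  show "lie_of_group (cj g g' ` H) \<subseteq> cj g g' ` lie_of_group H"
  proof
    fix u assume "u \<in> lie_of_group (cj g g' ` H)"
    then have "cj g' g u \<in> lie_of_group H" using lie_of_group_cj[OF gg(2), of u "cj g g' ` H"] cj_image_inverse[OF gg(2)] by simp
    then show "u \<in> cj g g' ` lie_of_group H" using cj_cj[OF gg(1), of u] by (metis imageI)
  qed
qed

lemma br_deg0_deg1: "e6_br (deg0 u) (deg1 x) = deg1 (fst u *v x + snd u *s x)"
  by (cases u) (simp add: deg0_def deg1_def zero_prod_def)

lemma scale_deg1: "e6_scale k (deg1 x) = deg1 (k *s x)"
  by (simp add: deg1_def e6_scale_pair zero_prod_def)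

lemma derived_centralizer_conj:
  assumes S: "std S" and ad: "adapted S (g *v e)" and g: "spin_pair g g'" and H: "cj g g' ` H = Tst S"
    and \<phi>: "\<forall>u\<in>lie_of_group H. e6_br (deg0 u) (deg1 e) = e6_scale (\<phi> u) (deg1 e)"
    and f: "bij_betw f {1..n} (insert {} S)"
  shows "e6.bracket_span (e6_centralizer (lie_of_group H) \<phi>) (e6_centralizer (lie_of_group H) \<phi>)
     = sl2_span n (\<lambda>i. Ad g' g (eE (Pos (f i)))) (\<lambda>i. Ad g' g (eE (Neg (f i))))"
proof -
  let ?t = "lie_of_group (Tst S)"
  have g': "spin_pair g' g" and gg: "g' ** g = mat 1" "g ** g' = mat 1" using g by (auto simp: spin_pair_def)
  have lH: "lie_of_group H = cj g' g ` ?t"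
    unfolding lie_of_group_conj[OF g', symmetric] H[symmetric] cj_image_inverse[OF gg(1)] ..
  \<comment> \<open>The eigenvalue of a diagonal tangent vector on \<open>[{}]\<close>. Since
    \<open>g *v e\<close> has a nonzero coordinate at \<open>{}\<close>, comparing that coordinate
    identifies the transported \<open>\<phi>\<close> with it.\<close>
  define \<psi> where "\<psi> u = fst u $ {} $ {} + snd u" for u :: "spinor_mat \<times> complex"
  have "\<phi> (cj g' g u) = \<psi> u" if u: "u \<in> ?t" for u
  proof -
    let ?v = "cj g' g u"
    have "e6_br (deg0 ?v) (deg1 e) = e6_scale (\<phi> ?v) (deg1 e)" using \<phi> u lH by blast
    then have "Ad g g' (e6_br (deg0 ?v) (deg1 e)) = Ad g g' (e6_scale (\<phi> ?v) (deg1 e))" by (rule arg_cong)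
    then have "e6_br (deg0 u) (deg1 (g *v e)) = e6_scale (\<phi> ?v) (deg1 (g *v e))"
      by (simp only: Ad_br[OF g, symmetric] e6_Ad_scale Ad_deg0 Ad_deg1 cj_cj[OF gg(2)])
    then have "deg1 (fst u *v (g *v e) + snd u *s (g *v e)) = deg1 (\<phi> ?v *s (g *v e))"
      by (simp only: br_deg0_deg1 scale_deg1)
    then have "(fst u *v (g *v e) + snd u *s (g *v e)) $ {} = (\<phi> ?v *s (g *v e)) $ {}" by (simp add: deg1_def)
    moreover have "(fst u *v (g *v e)) $ {} = fst u $ {} $ {} * (g *v e) $ {}"
      by (rule diagonal_mv) (rule lie_Tst_component(1)[OF u])
    ultimately have "\<psi> u * (g *v e) $ {} = \<phi> ?v * (g *v e) $ {}" by (simp add: \<psi>_def distrib_right)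
    then show ?thesis using adapted_nz[OF ad] by simp
  qed
  then have "e6_centralizer (lie_of_group H) \<phi> = Ad g' g ` e6_centralizer ?t \<psi>"
    unfolding lH by (intro Ad_centralizer[OF g']) blast
  moreover have "e6_centralizer ?t \<psi> = e6.span (hE \<union> eE ` support_roots S)"
    by (rule centralizer_Tst[OF S]) (simp add: \<psi>_def)
  ultimately show ?thesis by (simp only: Ad_bracket_span[OF g'] derived_centralizer[OF S f] Ad_sl2_span[OF g'])
qed

text \<open>The number of copies of sl(2) is the number of weights in the normal form, which also
  decides the orbit. Both are recorded together; disjointness of the orbits later turns this into
  one type for each orbit.\<close>

lemma is_support_type:
  assumes e: "e \<in> X" "e \<noteq> 0" and T: "is_support e T"
  obtains n where "lie_algebra e6_scale T e6_br" "lie_algebra.dynkin_type e6_scale T e6_br n {}"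
    "n = 1 \<and> e \<in> orbit E1 \<or> n = 2 \<and> e \<in> orbit E2"
proof -
  note res = that
  obtain H \<phi> where H: "maximal_torus_in H (line_normalizer e)"
     "\<forall>u\<in>lie_of_group H. e6_br (deg0 u) (deg1 e) = e6_scale (\<phi> u) (deg1 e)"
     "T = e6.bracket_span (e6_centralizer (lie_of_group H) \<phi>) (e6_centralizer (lie_of_group H) \<phi>)"
    using T unfolding is_support_def by blast
  obtain g g' S where g: "g \<in> Spin10" "g' \<in> Spin10" "g ** g' = mat 1" "g' ** g = mat 1" and S: "std S" "adapted S (g *v e)"
    "cj g g' ` H = Tst S" "S = {} \<Longrightarrow> e \<in> orbit E1" "S \<noteq> {} \<Longrightarrow> e \<in> orbit E2"
    using maximal_torus_conjugate[OF e H(1)] by blast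
  have sp: "spin_pair g g'" "spin_pair g' g" using g by (simp_all add: spin_pair_def)
  have type: "lie_algebra e6_scale T e6_br \<and> lie_algebra.dynkin_type e6_scale T e6_br n {}"
    if f: "bij_betw f {1..n} (insert {} S)" for f n
    unfolding H(3) derived_centralizer_conj[OF S(1,2) sp(1) S(3) H(2) f]
    using sl2_family_type[OF Ad_sl2_family[OF sp(2) sl2_family_std[OF S(1) f]]] by blast
  show thesis
  proof (cases "S = {}")
    case True
    then have "bij_betw (\<lambda>_. {}) {1..1::nat} (insert {} S)" by (simp add: bij_betw_def)
    from type[OF this] show thesis using res S(4)[OF True] by blast
  next
    case False
    then obtain a where "S = {- {a}}" using S(1) unfolding std_def by blast
    then have "bij_betw (\<lambda>i. if i = 1 then {} else - {a}) {1..2::nat} (insert {} S)"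
      by (auto simp: bij_betw_def inj_on_def compl_neq_empty intro: image_eqI[of _ _ 1] image_eqI[of _ _ 2])
    from type[OF this] show thesis using res S(5)[OF False] by blast
  qed
qed

lemma support_exists:
  assumes S: "std S" and x: "adapted S x" and e: "e \<in> orbit x"
  shows "\<exists>T. is_support e T"
proof -
  obtain s c where s: "s \<in> Spin10" "c \<noteq> 0" "e = c *s (s *v x)" using e unfolding orbit_iff by blast
  obtain s' where s': "s' \<in> Spin10" "s ** s' = mat 1" "s' ** s = mat 1" using Spin10_inverse[OF s(1)] by blast
  have sp: "spin_pair s s'" using s(1) s' by (simp add: spin_pair_def)
  \<comment> \<open>The scalar of the group element is moved into the spinor; this keeps it adapted
    to \<open>S\<close>, and only the matrix part remains to be conjugated by.\<close>
  define y where "y = c *s x"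
  have y: "adapted S y" using x s(2) by (simp add: adapted_def y_def)
  have sy: "s *v y = e" by (simp add: y_def s(3) vector_scalar_commute)
  let ?H = "cj s s' ` Tst S"
  have "maximal_torus_in ?H (cj s s' ` line_normalizer y)"
    by (rule maximal_torus_conj[OF Tst_maximal[OF S y] s'(2,3)])
  moreover have "y \<noteq> 0" using adapted_nz[OF y] by blast
  ultimately have H: "maximal_torus_in ?H (line_normalizer e)"
    using line_normalizer_conj[OF s(1) s' \<open>y \<noteq> 0\<close>] by (simp only: sy)
  define \<phi> where "\<phi> u = fst (cj s' s u) $ {} $ {} + snd u" for u
  have "e6_br (deg0 u) (deg1 e) = e6_scale (\<phi> u) (deg1 e)" if u: "u \<in> lie_of_group ?H" for u
  proof -
    obtain v where v: "v \<in> lie_of_group (Tst S)" "u = cj s s' v" using u unfolding lie_of_group_conj[OF sp] by blast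
    have phi: "\<phi> u = fst v $ {} $ {} + snd v" unfolding \<phi>_def v(2) cj_cj[OF s'(3)] by simp
    have "(fst v *v y) $ I = fst v $ {} $ {} * y $ I" for I
    proof (cases "I \<in> insert {} S")
      case True
      then have "fst v $ I $ I = fst v $ {} $ {}" using lie_Tst_component(2)[OF v(1)] by auto
      then show ?thesis using lie_Tst_component(1)[OF v(1)] by (simp add: diagonal_mv)
    next
      case False
      then have "y $ I = 0" using y unfolding adapted_def by blast
      then show ?thesis using lie_Tst_component(1)[OF v(1)] by (simp add: diagonal_mv)
    qed
    then have "fst v *v y + snd v *s y = \<phi> u *s y"
      by (intro vec_eq_iff[THEN iffD2, OF allI]) (simp add: phi distrib_right)
    then have "e6_br (deg0 v) (deg1 y) = e6_scale (\<phi> u) (deg1 y)" by (simp only: br_deg0_deg1 scale_deg1)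
    then have "Ad s s' (e6_br (deg0 v) (deg1 y)) = Ad s s' (e6_scale (\<phi> u) (deg1 y))" by (rule arg_cong)
    then show ?thesis by (simp only: Ad_br[OF sp, symmetric] e6_Ad_scale Ad_deg0 Ad_deg1 v(2)[symmetric] sy)
  qed
  then show ?thesis unfolding is_support_def using H by blast
qed

lemma support_type_orbits:
  shows "e \<in> orbit E1 \<Longrightarrow> support_type e 1 {}" and "e \<in> orbit E2 \<Longrightarrow> support_type e 2 {}"
proof -
  have nz: "e \<in> X \<and> e \<noteq> 0" if "e \<in> orbit E1 \<or> e \<in> orbit E2"
    using that orbit_X E_X zero_notin_orbit E_nz by blast
  have "adapted {} E1" "adapted {- {0}} E2"
    by (auto simp: adapted_def E1_def E2_def axis_component compl_neq_empty)
  then have ex: "e \<in> orbit E1 \<or> e \<in> orbit E2 \<Longrightarrow> \<exists>T. is_support e T"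
    using support_exists[of "{}" E1 e] support_exists[of "{- {0}}" E2 e] unfolding std_def by blast
  have type: "lie_algebra e6_scale T e6_br \<and> lie_algebra.dynkin_type e6_scale T e6_br n {}"
    if T: "is_support e T" and n: "n = 1 \<and> e \<in> orbit E1 \<or> n = 2 \<and> e \<in> orbit E2" for T n
  proof -
    have "e \<in> X" "e \<noteq> 0" using nz n by blast+
    then obtain k where k: "lie_algebra e6_scale T e6_br" "lie_algebra.dynkin_type e6_scale T e6_br k {}"
      "k = 1 \<and> e \<in> orbit E1 \<or> k = 2 \<and> e \<in> orbit E2" using T by (rule is_support_type)
    then have "k = n" using n orbits_disjoint by blast
    then show ?thesis using k by blast
  qed
  show "e \<in> orbit E1 \<Longrightarrow> support_type e 1 {}" "e \<in> orbit E2 \<Longrightarrow> support_type e 2 {}"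
    unfolding support_type_def using ex type by blast+
qed

section \<open>The orbits\<close>

theorem proposition5p1:
  fixes b :: "5 set \<Rightarrow> spinor" and O0 O1 O2 :: "spinor set"
  assumes weights: "\<And>I. even (card I) \<Longrightarrow> weight_vector I (b I)"
    and O0: "O0 = {0}"
    and O1: "O1 = orbit (b {})"
    and O2: "O2 = orbit (b {} + b {1, 2, 3, 4})"
  shows "lie_algebra e6_scale e6 e6_br \<and>
         lie_algebra.semisimple e6_scale e6 e6_br \<and>
         (\<exists>\<hh> \<alpha>. lie_algebra.dynkin_base e6_scale e6 e6_br \<hh> 6 \<alpha> E6_edges \<and>
            (\<forall>i. e6_deg i = lie_algebra.simple_root_grading e6_scale e6 e6_br \<hh> 6 \<alpha> 1 i)) \<and>
         {orbit x | x. x \<in> X} = {O0, O1, O2} \<and> card {O0, O1, O2} = 3 \<and>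
         complex_submanifold_of_dim 0 O0 \<and>
         complex_submanifold_of_dim 11 O1 \<and>
         complex_submanifold_of_dim 16 O2 \<and>
         (\<forall>e\<in>O1. support_type e 1 A1_edges) \<and>
         (\<forall>e\<in>O2. support_type e 2 twoA1_edges) \<and>
         zariski_closure O0 \<subset> zariski_closure O1 \<and>
         zariski_closure O1 \<subset> zariski_closure O2 \<and>
         zariski_closure O2 = X"
proof -
  \<comment> \<open>In the index type the numeral 5 equals 0, so the set in the statement is the
    complement of a singleton.\<close>
  have c: "{1, 2, 3, 4} = - {0 :: 5}" using exhaust_5 by auto
  obtain k where k: "k \<noteq> 0" "b {} = k *s axis {} 1" using weight_vector_axis[OF weights[of "{}"]] by auto
  obtain l where l: "l \<noteq> 0" "b (- {0}) = l *s axis (- {0}) 1"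
    using weight_vector_axis[OF weights[of "- {0}"]] by (auto simp: card_compl_single)
  have 1: "O1 = orbit E1" unfolding O1 k(2) E1_def[symmetric] using k(1) by (intro orbit_eq orbit_scale)
  have 2: "O2 = orbit E2" unfolding O2 c k(2) l(2) using k(1) l(1) by (intro orbit_eq pair_orbit)
  show ?thesis unfolding O0 1 2 A1_edges_def twoA1_edges_def
  proof (intro conjI ballI)
    show "\<exists>\<hh> \<alpha>. e6.dynkin_base \<hh> 6 \<alpha> E6_edges \<and> (\<forall>i. e6_deg i = e6.simple_root_grading \<hh> 6 \<alpha> 1 i)"
      using E6_dynkin_base E6_grading by blast
    show "complex_submanifold_of_dim 11 (orbit E1)" by (rule orbit_submanifold[OF chart_E1])
    show "complex_submanifold_of_dim 16 (orbit E2)" by (rule orbit_submanifold[OF chart_E2])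
  qed (fact e6.lie_algebra_axioms E6_semisimple orbit_set orbit_card chart_0 zariski_chain | erule support_type_orbits)+
qed

end
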